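(* Let $\sigma>0$ and $\gamma\neq 2$ be real constants, let $f,g$ be functions of $x>0$, and suppose that $h(x)=x^{1-\gamma}f(x)$ is a solution of the Riccati equation $$\sigma x h'-\sigma h+\tfrac12 h^2+2\sigma x^{2-\gamma}g(x)=2\sigma A x^{2-\gamma}+B$$ for some constants $A,B$. Let $F$ be such that $F'(x)=f(x)/x^{\gamma}$. Then the PDE $$u_t=\sigma x^\gamma u_{xx}+f(x)u_x-g(x)u,\qquad x\ge 0, \tag{$*$}$$ has a symmetry of the form $$\overline U_\varepsilon(x,t)=\frac{1}{(1+4\varepsilon t)^{\frac{1-\gamma}{2-\gamma}}}\exp\left\{\frac{-4\varepsilon\left(x^{2-\gamma}+A\sigma(2-\gamma)^2t^2\right)}{\sigma(2-\gamma)^2(1+4\varepsilon t)}\right\}\exp\left\{\frac{1}{2\sigma}\left(F\left(\frac{x}{(1+4\varepsilon t)^{\frac{2}{2-\gamma}}}\right)-F(x)\right)\right\}u\left(\frac{x}{(1+4\varepsilon t)^{\frac{2}{2-\gamma}}},\frac{t}{1+4\varepsilon t}\right),$$ that is, $\overline U_\varepsilon$ is a solution of $( * )$ whenever $u$ is (for $\varepsilon$ with $1+4\varepsilon t>0$). Moreover, if $u(x,t)=u_0(x)$ with $u_0$ an analytic stationary solution of $( * )$, then there is a fundamental solution $p(t,x,y)$ of $( * )$ such that $$\int_0^\infty e^{-\lambda y^{2-\gamma}}u_0(y)p(t,x,y)\,dy=U_\lambda(x,t),$$ where $U_\lambda(x,t)=\overline U_{\frac14\sigma(2-\gamma)^2\lambda}(x,t)$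 is formed with $u=u_0$, and $\lambda\geq 0$ is the (generalized) Laplace transform variable.
   Context: A stationary solution is a time-independent solution $u_0(x)$, i.e. $\sigma x^\gamma u_0''+f u_0'-g u_0=0$. A fundamental solution of the PDE is a kernel $p(t,x,y)$, $t>0$, $x,y\ge 0$ (a function, or possibly a distribution in $y$, for example containing terms supported at $y=0$, in which case integrals against it are pairings) such that for suitable initial data $\varphi$ (e.g. continuous with compact support in $(0,\infty)$) the function $u(x,t)=\int_0^\infty\varphi(y)p(t,x,y)\,dy$ solves the PDE for $t>0$ and satisfies $u(x,0)=\varphi(x)$. Fundamental solutions need not be unique. *)

theory Defs
  imports "HOL-Analysis.Analysis"
begin

definition real_analytic_on :: "(real \<Rightarrow> real) \<Rightarrow> real set \<Rightarrow> bool" where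
  "real_analytic_on v S \<longleftrightarrow>
     (\<forall>a\<in>S. \<exists>r>0. \<exists>c. \<forall>x. \<bar>x - a\<bar> < r \<longrightarrow> (\<lambda>n. c n * (x - a) ^ n) sums v x)"

definition riccati_solution ::
  "real \<Rightarrow> real \<Rightarrow> real \<Rightarrow> real \<Rightarrow> (real \<Rightarrow> real) \<Rightarrow> (real \<Rightarrow> real) \<Rightarrow> bool" where
  "riccati_solution \<sigma> \<gamma> A B g h \<longleftrightarrow>
     (\<forall>x>0. h differentiable (at x) \<and>
        \<sigma> * x * deriv h x - \<sigma> * h x + 1/2 * (h x)\<^sup>2 + 2 * \<sigma> * x powr (2 - \<gamma>) * g x
          = 2 * \<sigma> * A * x powr (2 - \<gamma>) + B)"

text \<open>
  Classical solutions of \<open>u_t = \<sigma> x^\<gamma> u_xx + f u_x - g u\<close> on an open set \<open>S\<close> of points \<open>(x, t)\<close>.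
  The first derivatives are required to be continuous. Continuity of \<open>u_xx\<close> is not imposed: it
  follows from the equation wherever \<open>g\<close> is continuous, and nothing is assumed about \<open>g\<close>.
\<close>
definition solves_pde ::
  "real \<Rightarrow> real \<Rightarrow> (real \<Rightarrow> real) \<Rightarrow> (real \<Rightarrow> real) \<Rightarrow> (real \<times> real) set \<Rightarrow> (real \<Rightarrow> real \<Rightarrow> real) \<Rightarrow> bool"
where
  "solves_pde \<sigma> \<gamma> f g S u \<longleftrightarrow>
     (\<exists>u\<^sub>t u\<^sub>x u\<^sub>x\<^sub>x :: real \<Rightarrow> real \<Rightarrow> real.
        continuous_on S (\<lambda>(x, t). u\<^sub>t x t) \<and> continuous_on S (\<lambda>(x, t). u\<^sub>x x t) \<and>
        (\<forall>(x, t)\<in>S.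
           ((\<lambda>s. u x s) has_real_derivative u\<^sub>t x t) (at t) \<and>
           ((\<lambda>y. u y t) has_real_derivative u\<^sub>x x t) (at x) \<and>
           ((\<lambda>y. u\<^sub>x y t) has_real_derivative u\<^sub>x\<^sub>x x t) (at x) \<and>
           u\<^sub>t x t = \<sigma> * x powr \<gamma> * u\<^sub>x\<^sub>x x t + f x * u\<^sub>x x t - g x * u x t))"

definition stationary_solution ::
  "real \<Rightarrow> real \<Rightarrow> (real \<Rightarrow> real) \<Rightarrow> (real \<Rightarrow> real) \<Rightarrow> (real \<Rightarrow> real) \<Rightarrow> bool" where
  "stationary_solution \<sigma> \<gamma> f g u\<^sub>0 \<longleftrightarrow>
     (\<forall>x>0. u\<^sub>0 differentiable (at x) \<and> deriv u\<^sub>0 differentiable (at x) \<and>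
        \<sigma> * x powr \<gamma> * deriv (deriv u\<^sub>0) x + f x * deriv u\<^sub>0 x - g x * u\<^sub>0 x = 0)"

definition Ubar ::
  "real \<Rightarrow> real \<Rightarrow> real \<Rightarrow> (real \<Rightarrow> real) \<Rightarrow> real \<Rightarrow> (real \<Rightarrow> real \<Rightarrow> real) \<Rightarrow> real \<Rightarrow> real \<Rightarrow> real" where
  "Ubar \<sigma> \<gamma> A F \<epsilon> u x t =
     1 / (1 + 4 * \<epsilon> * t) powr ((1 - \<gamma>) / (2 - \<gamma>))
     * exp (- 4 * \<epsilon> * (x powr (2 - \<gamma>) + A * \<sigma> * (2 - \<gamma>)\<^sup>2 * t\<^sup>2)
            / (\<sigma> * (2 - \<gamma>)\<^sup>2 * (1 + 4 * \<epsilon> * t)))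
     * exp (1 / (2 * \<sigma>) * (F (x / (1 + 4 * \<epsilon> * t) powr (2 / (2 - \<gamma>))) - F x))
     * u (x / (1 + 4 * \<epsilon> * t) powr (2 / (2 - \<gamma>))) (t / (1 + 4 * \<epsilon> * t))"

text \<open>
  A kernel \<open>p(t, x, \<cdot>)\<close> that may be a distribution in \<open>y\<close> is represented by its pairing:
  \<open>p t x \<phi>\<close> stands for \<open>\<integral> \<phi>(y) p(t,x,y) dy\<close> over \<open>y > 0\<close>.
\<close>
type_synonym kernel = "real \<Rightarrow> real \<Rightarrow> (real \<Rightarrow> real) \<Rightarrow> real"

definition compact_data_in :: "nat \<Rightarrow> real set \<Rightarrow> (real \<Rightarrow> real) set" where
  "compact_data_in m K =
     {\<phi>. (\<forall>j<m. \<forall>y. (deriv ^^ j) \<phi> differentiable (at y)) \<and>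
         (\<forall>j\<le>m. continuous_on UNIV ((deriv ^^ j) \<phi>)) \<and>
         (\<forall>y. y \<notin> K \<longrightarrow> \<phi> y = 0)}"

text \<open>
  \<open>C\<^sup>m\<close> functions with compact support in \<open>(0, \<infinity>)\<close>; for \<open>m = 0\<close> these are the continuous ones.
\<close>
definition compact_data :: "nat \<Rightarrow> (real \<Rightarrow> real) set" where
  "compact_data m = (\<Union>K\<in>{K. compact K \<and> K \<subseteq> {0<..}}. compact_data_in m K)"

definition linear_functional_on :: "(real \<Rightarrow> real) set \<Rightarrow> ((real \<Rightarrow> real) \<Rightarrow> real) \<Rightarrow> bool" where
  "linear_functional_on V P \<longleftrightarrow>
     (\<forall>\<phi>\<in>V. \<forall>\<eta>\<in>V. \<forall>a b. P (\<lambda>y. a * \<phi> y + b * \<eta> y) = a * P \<phi> + b * P \<eta>)"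

text \<open>Distributions of order at most \<open>m\<close> on the open half-line \<open>(0, \<infinity>)\<close>.\<close>
definition distribution_of_order :: "nat \<Rightarrow> ((real \<Rightarrow> real) \<Rightarrow> real) \<Rightarrow> bool" where
  "distribution_of_order m P \<longleftrightarrow>
     linear_functional_on (compact_data m) P \<and>
     (\<forall>K. compact K \<and> K \<subseteq> {0<..} \<longrightarrow>
        (\<exists>C. \<forall>\<phi>\<in>compact_data_in m K. \<forall>M.
           (\<forall>j\<le>m. \<forall>y. \<bar>(deriv ^^ j) \<phi> y\<bar> \<le> M) \<longrightarrow> \<bar>P \<phi>\<bar> \<le> C * M))"

text \<open>
  The order \<open>m\<close> is the smoothness needed of the data for the pairing to make sense; an ordinary
  function kernel that is locally integrable in \<open>y\<close> has \<open>m = 0\<close>. The initial value is attained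
  in the sense that \<open>u\<close>, extended by \<open>\<phi>\<close>, is continuous up to \<open>t = 0\<close>.
\<close>
definition fundamental_solution ::
  "real \<Rightarrow> real \<Rightarrow> (real \<Rightarrow> real) \<Rightarrow> (real \<Rightarrow> real) \<Rightarrow> nat \<Rightarrow> kernel \<Rightarrow> bool" where
  "fundamental_solution \<sigma> \<gamma> f g m p \<longleftrightarrow>
     (\<forall>t>0. \<forall>x>0. distribution_of_order m (p t x)) \<and>
     (\<forall>\<phi>\<in>compact_data m.
        solves_pde \<sigma> \<gamma> f g ({0<..} \<times> {0<..}) (\<lambda>x t. p t x \<phi>) \<and>
        (\<forall>x>0. ((\<lambda>(x', t). p t x' \<phi>) \<longlongrightarrow> \<phi> x) (at (x, 0) within {0<..} \<times> {0<..})))"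

text \<open>
  Smooth functions with all derivatives bounded on \<open>[0, \<infinity>)\<close>. Every function smooth up to \<open>0\<close>
  extends smoothly to the real line, so requiring smoothness on the whole line is no restriction.
\<close>
definition bounded_smooth :: "(real \<Rightarrow> real) set" where
  "bounded_smooth =
     {\<psi>. \<forall>j. (\<forall>z. (deriv ^^ j) \<psi> differentiable (at z)) \<and> bounded ((deriv ^^ j) \<psi> ` {0..})}"

definition weighted_data :: "real \<Rightarrow> (real \<Rightarrow> real) \<Rightarrow> (real \<Rightarrow> real) set" where
  "weighted_data \<rho> w = (\<lambda>\<psi> y. \<psi> (y powr \<rho>) * w y) ` bounded_smooth"

text \<open>
  The functions \<open>exp (- \<lambda> * y powr \<rho>) * w y\<close> are not compactly supported in \<open>(0, \<infinity>)\<close>, so pairing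
  with them needs more than a distribution on the open half-line. The predicate says that \<open>w(y) P\<close>,
  in the variable \<open>z = y powr \<rho>\<close>, is an integrable distribution (in the sense of Schwartz) on the
  closed half-line \<open>z \<ge> 0\<close>, which may thus carry terms supported at \<open>z = 0\<close>. The factor \<open>1 + z\<close>
  in the estimate excludes contributions from \<open>z = \<infinity>\<close>. The joint linearity and the fact that
  \<open>P\<close> only sees values on \<open>y > 0\<close> tie this pairing to the one with compactly supported data:
  where both apply they agree.
\<close>
definition integrable_with_weight ::
  "nat \<Rightarrow> real \<Rightarrow> (real \<Rightarrow> real) \<Rightarrow> ((real \<Rightarrow> real) \<Rightarrow> real) \<Rightarrow> bool" where
  "integrable_with_weight m \<rho> w P \<longleftrightarrow>
     (\<forall>\<phi> \<eta>. (\<forall>y>0. \<phi> y = \<eta> y) \<longrightarrow> P \<phi> = P \<eta>) \<and>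
     linear_functional_on
       {\<lambda>y. \<phi> y + \<eta> y | \<phi> \<eta>. \<phi> \<in> compact_data m \<and> \<eta> \<in> weighted_data \<rho> w} P \<and>
     (\<exists>N C. \<forall>\<psi>\<in>bounded_smooth. \<forall>M.
        (\<forall>j\<le>N. \<forall>z\<ge>0. \<bar>(deriv ^^ j) \<psi> z\<bar> \<le> M * (1 + z)) \<longrightarrow>
        \<bar>P (\<lambda>y. \<psi> (y powr \<rho>) * w y)\<bar> \<le> C * M)"

end

theory Submission
  imports Defs "HOL-Complex_Analysis.Complex_Analysis" "HOL-Probability.Probability"
begin

text \<open>
  Put \<open>\<rho> = 2 - \<gamma>\<close>, \<open>z = x powr \<rho>\<close>, \<open>\<tau> = \<sigma> \<rho>\<^sup>2 t\<close>. By the Riccati equation the gauge factor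
  \<open>x powr (1/2) * exp (- F / (2 \<sigma>))\<close> turns the PDE into \<open>V\<^sub>\<tau> = z V\<^sub>z\<^sub>z + V\<^sub>z - (N / (4 z) + A) V\<close>, whose
  stationary solutions are spanned by modified or ordinary Bessel functions of \<open>2 \<surd>(\<bar>A\<bar> z)\<close> of order
  \<open>\<surd>N\<close>. For every solution \<open>e\<close> of the stationary equation with \<open>A = 1\<close> the function
  \<open>exp (- A \<tau> - (z + y) / \<tau>) / \<tau> * e (z y / \<tau>\<^sup>2)\<close> solves the PDE in \<open>(z, \<tau>)\<close>; the dominant \<open>e\<close>
  gives an approximate identity as \<open>\<tau> \<rightarrow> 0\<close>, the recessive one tends to \<open>0\<close>.

  Given a stationary \<open>V\<close>, one looks for a second stationary solution \<open>c\<close> such that the kernel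
  \<open>V(y) e\<^sub>1 + c(y) e\<^sub>2\<close> has the right Laplace transform. Its \<open>D\<close>-th iterated antiderivative in \<open>y\<close>,
  with constants fixed by the power series of Bessel products, has a convergent Laplace integral even where
  the kernel itself is not integrable at \<open>0\<close>; this is where the terms supported at \<open>0\<close> come from.
  The resulting pairing \<open>P\<^sub>w \<psi>\<close> with \<open>\<psi> V\<close> and the pairing \<open>\<integral> \<phi> e\<^sub>1 + (\<phi> / V) c e\<^sub>2\<close> with
  compactly supported \<open>\<phi>\<close> agree where both make sense. The zeros of \<open>V\<close> are simple, so \<open>\<phi> / V\<close> is
  regularised by subtracting the value of \<open>\<phi>\<close> at the nearest zero, which costs one derivative.
\<close>

section \<open>Changes of variables in linear parabolic equations\<close>

text \<open>The solution \<open>c\<close> is dictated by Weber's integral: the Laplace transform of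
  I_\<nu>(2 sqrt(a y)) I_\<nu>(2 sqrt(b y)) is exp((a + b) / s) / s times I_\<nu>(2 sqrt(a b) / s).
  It joins factors of the same order. So V = \<alpha> I_\<nu> + \<beta> I_(-\<nu>) has to be
  continued as \<alpha> I_\<nu> I_\<nu> + \<beta> I_(-\<nu>) I_(-\<nu>), and with I_\<nu> as the
  dominant solution this is V(y) I_\<nu> + \<beta> I_(-\<nu>)(y) (I_(-\<nu>) - I_\<nu>). The last
  factor is recessive, so the correction is invisible at time 0 and the initial values survive. For
  orders with real part at most -1 Weber's integral diverges at 0. Reciprocal Gamma factors make all
  series entire in the order; raising their arguments by D yields an antiderivative for which the
  formula persists with an extra s^(-D), and integration by parts moves the D derivatives to the
  test function. The obstacle at the end is consistency: compactly supported and weighted data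
  overlap, and a linear pairing on their sum exists only if the two prescriptions agree
  there.\<close>

definition linear_pde ::
  "(real \<Rightarrow> real) \<Rightarrow> (real \<Rightarrow> real) \<Rightarrow> (real \<Rightarrow> real) \<Rightarrow> (real \<times> real) set \<Rightarrow> (real \<Rightarrow> real \<Rightarrow> real) \<Rightarrow> bool"
where
  "linear_pde a b d S u \<longleftrightarrow>
     (\<exists>ut ux uxx :: real \<Rightarrow> real \<Rightarrow> real.
        continuous_on S (\<lambda>(x, t). ut x t) \<and> continuous_on S (\<lambda>(x, t). ux x t) \<and>
        (\<forall>(x, t)\<in>S.
           ((\<lambda>s. u x s) has_real_derivative ut x t) (at t) \<and>
           ((\<lambda>y. u y t) has_real_derivative ux x t) (at x) \<and>
           ((\<lambda>y. ux y t) has_real_derivative uxx x t) (at x) \<and>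
           ut x t = a x * uxx x t + b x * ux x t + d x * u x t))"

lemma solves_pde_eq_linear_pde:
  "solves_pde \<sigma> \<gamma> f g S u \<longleftrightarrow> linear_pde (%x. \<sigma> * x powr \<gamma>) f (%x. - g x) S u"
  unfolding solves_pde_def linear_pde_def by simp

text \<open>Continuity of one of the two partial derivatives suffices for joint differentiability.
  The total derivative is what the chain rule along moving points \<open>(Z x s, T s)\<close>
  requires.\<close>

lemma has_derivative_of_partials:
  fixes V :: "real => real => real"
  assumes "open S" "(z, \<tau>) \<in> S"
    and Vx: "((%y. V y \<tau>) has_real_derivative Vx) (at z)"
    and Vt: "\<And>x t. (x, t) \<in> S ==> ((%s. V x s) has_real_derivative Vt x t) (at t)"
    and cont: "continuous_on S (%(x, t). Vt x t)"
  shows "((%(x, t). V x t) has_derivative (%(h, k). Vx * h + Vt z \<tau> * k)) (at (z, \<tau>))"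
proof -
  obtain X Y where "open X" "open Y" "(z, \<tau>) \<in> X \<times> Y" "X \<times> Y \<subseteq> S"
    by (rule open_prod_elim[OF assms(1,2)])
  then have XY: "open X" "open Y" "z \<in> X" "\<tau> \<in> Y" "X \<times> Y \<subseteq> S" by auto
  obtain r where r: "r > 0" "ball \<tau> r \<subseteq> Y"
    using XY openE by blast
  have sub: "X \<times> ball \<tau> r \<subseteq> S" using XY r by blast
  have "((%(x, t). V x t) has_derivative (%(h, k). (%h. Vx * h) h + blinfun_mult_right (Vt z \<tau>) k))
      (at (z, \<tau>) within X \<times> ball \<tau> r)"
  proof (rule has_derivative_partialsI)
    show "((%x. V x \<tau>) has_derivative (*) Vx) (at z within X)"
      using Vx unfolding has_field_derivative_def by (rule has_derivative_at_withinI)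
    show "((%y. V x y) has_derivative blinfun_mult_right (Vt x y)) (at y within ball \<tau> r)"
      if "x \<in> X" "y \<in> ball \<tau> r" for x y
      unfolding has_field_derivative_eq_has_derivative_blinfun[symmetric]
      by (rule has_field_derivative_at_within[OF Vt]) (use that sub in blast)
    have "continuous_on (X \<times> ball \<tau> r) (%p. blinfun_mult_right (case p of (x, t) => Vt x t))"
      by (intro continuous_intros continuous_on_subset[OF cont sub])
    then show "continuous (at (z, \<tau>) within X \<times> ball \<tau> r) (%(x, y). blinfun_mult_right (Vt x y))"
      using XY r by (auto simp: continuous_on_eq_continuous_within case_prod_unfold)
  qed (use r in auto)
  moreover have "at (z, \<tau>) within X \<times> ball \<tau> r = at (z, \<tau>)"
    by (rule at_within_open) (use XY r in \<open>auto intro: open_Times\<close>)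
  ultimately show ?thesis by simp
qed

text \<open>The hypotheses \<open>c2\<close>, \<open>c1\<close>, \<open>c0\<close> compare the
  coefficients of the second derivative, the first derivative and the value of V after inserting
  \<open>m x t * V (Z x t) (T t)\<close> into the new equation. Both the reduction to the normal
  form and the symmetry are instances, so that each becomes a matter of algebra.\<close>

lemma linear_pde_transform:
  fixes V :: "real => real => real"
  assumes V: "linear_pde a b d S' V" and "open S'"
    and maps: "\<And>x t. (x, t) \<in> S ==> (Z x t, T t) \<in> S'"
    and mt: "\<And>x t. (x, t) \<in> S ==> ((%s. m x s) has_real_derivative mt x t) (at t)"
    and mx: "\<And>x t. (x, t) \<in> S ==> ((%y. m y t) has_real_derivative mx x t) (at x)"
    and mxx: "\<And>x t. (x, t) \<in> S ==> ((%y. mx y t) has_real_derivative mxx x t) (at x)"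
    and Zt: "\<And>x t. (x, t) \<in> S ==> ((%s. Z x s) has_real_derivative Zt x t) (at t)"
    and Zx: "\<And>x t. (x, t) \<in> S ==> ((%y. Z y t) has_real_derivative Zx x t) (at x)"
    and Zxx: "\<And>x t. (x, t) \<in> S ==> ((%y. Zx y t) has_real_derivative Zxx x t) (at x)"
    and Tt: "\<And>x t. (x, t) \<in> S ==> (T has_real_derivative Tt t) (at t)"
    and cont: "continuous_on S (%(x, t). m x t)" "continuous_on S (%(x, t). mt x t)"
       "continuous_on S (%(x, t). mx x t)" "continuous_on S (%(x, t). Z x t)"
       "continuous_on S (%(x, t). Zt x t)" "continuous_on S (%(x, t). Zx x t)"
       "continuous_on S (%(x, t). T t)" "continuous_on S (%(x, t). Tt t)"
    and c2: "\<And>x t. (x, t) \<in> S ==> Tt t * a (Z x t) = a' x * (Zx x t)\<^sup>2"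
    and c1: "\<And>x t. (x, t) \<in> S ==> m x t * Zt x t + m x t * Tt t * b (Z x t)
               = a' x * (2 * mx x t * Zx x t + m x t * Zxx x t) + b' x * m x t * Zx x t"
    and c0: "\<And>x t. (x, t) \<in> S ==> mt x t + m x t * Tt t * d (Z x t)
               = a' x * mxx x t + b' x * mx x t + d' x * m x t"
  shows "linear_pde a' b' d' S (%x t. m x t * V (Z x t) (T t))"
proof -
  from V obtain Vt Vx Vxx where
    cV: "continuous_on S' (%(x, t). Vt x t)" "continuous_on S' (%(x, t). Vx x t)"
    and Vt: "\<And>x t. (x, t) \<in> S' ==> ((%s. V x s) has_real_derivative Vt x t) (at t)"
    and Vx: "\<And>x t. (x, t) \<in> S' ==> ((%y. V y t) has_real_derivative Vx x t) (at x)"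
    and Vxx: "\<And>x t. (x, t) \<in> S' ==> ((%y. Vx y t) has_real_derivative Vxx x t) (at x)"
    and eq: "\<And>x t. (x, t) \<in> S' ==> Vt x t = a x * Vxx x t + b x * Vx x t + d x * V x t"
    unfolding linear_pde_def by blast
  have joint: "((%(x, t). V x t) has_derivative (%(h, k). Vx z \<tau> * h + Vt z \<tau> * k)) (at (z, \<tau>))"
    if "(z, \<tau>) \<in> S'" for z \<tau>
    by (rule has_derivative_of_partials[OF \<open>open S'\<close> that Vx[OF that] Vt cV(1)])
  have contV: "continuous_on S' (%(x, t). V x t)"
  proof (rule continuous_at_imp_continuous_on, rule ballI)
    fix p assume "p \<in> S'"
    then show "isCont (%(x, t). V x t) p"
      using has_derivative_continuous[OF joint[of "fst p" "snd p"]] by simp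
  qed
  have contZT: "continuous_on S (%(x, t). (Z x t, T t))"
    using cont(4,7) by (auto simp: case_prod_unfold intro!: continuous_intros)
  have ZTS: "(%(x, t). (Z x t, T t)) ` S \<subseteq> S'" using maps by auto
  note comp = continuous_on_compose2[OF _ contZT ZTS]
  have cc: "continuous_on S (%(x, t). V (Z x t) (T t))" "continuous_on S (%(x, t). Vt (Z x t) (T t))"
     "continuous_on S (%(x, t). Vx (Z x t) (T t))"
    using comp[OF contV] comp[OF cV(1)] comp[OF cV(2)] by (auto simp: case_prod_unfold)
  define ut where "ut x t = mt x t * V (Z x t) (T t) + m x t * (Vx (Z x t) (T t) * Zt x t + Vt (Z x t) (T t) * Tt t)" for x t
  define ux where "ux x t = mx x t * V (Z x t) (T t) + m x t * (Vx (Z x t) (T t) * Zx x t)" for x t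
  define uxx where "uxx x t = mxx x t * V (Z x t) (T t) + 2 * (mx x t * (Vx (Z x t) (T t) * Zx x t))
      + m x t * (Vxx (Z x t) (T t) * (Zx x t)\<^sup>2 + Vx (Z x t) (T t) * Zxx x t)" for x t
  show ?thesis
    unfolding linear_pde_def
  proof (intro exI conjI ballI)
    show "continuous_on S (%(x, t). ut x t)" "continuous_on S (%(x, t). ux x t)"
      unfolding ut_def ux_def using cont cc
      by (auto simp: case_prod_unfold intro!: continuous_intros)
  next
    fix p assume "p \<in> S"
    then obtain x t where p: "p = (x, t)" "(x, t) \<in> S" by (cases p) auto
    let ?z = "Z x t" and ?T = "T t"
    have in': "(?z, ?T) \<in> S'" using maps p by blast
    \<comment> \<open>In time both arguments of V move, hence the total derivative; in x only the
      first one does and the ordinary chain rule is enough.\<close>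
    have dt: "((%s. V (Z x s) (T s)) has_real_derivative Vx ?z ?T * Zt x t + Vt ?z ?T * Tt t) (at t)"
    proof -
      have "((%s. (Z x s, T s)) has_derivative (%h. (Zt x t * h, Tt t * h))) (at t)"
        using Zt[OF p(2)] Tt[OF p(2)] unfolding has_field_derivative_def
        by (intro has_derivative_Pair)
      from has_derivative_compose[OF this joint[OF in']]
      have "((%s. V (Z x s) (T s)) has_derivative (%h. Vx ?z ?T * (Zt x t * h) + Vt ?z ?T * (Tt t * h))) (at t)"
        by simp
      then show ?thesis unfolding has_field_derivative_def
        by (rule has_derivative_eq_rhs) (simp add: fun_eq_iff algebra_simps)
    qed
    have dx: "((%y. V (Z y t) ?T) has_real_derivative Vx ?z ?T * Zx x t) (at x)"
      by (rule DERIV_chain2[OF Vx[OF in'] Zx[OF p(2)]])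
    have dxx: "((%y. Vx (Z y t) ?T) has_real_derivative Vxx ?z ?T * Zx x t) (at x)"
      by (rule DERIV_chain2[OF Vxx[OF in'] Zx[OF p(2)]])
    have 1: "((%s. m x s * V (Z x s) (T s)) has_real_derivative ut x t) (at t)"
      unfolding ut_def by (rule derivative_eq_intros mt[OF p(2)] dt refl)+ (simp add: algebra_simps)
    have 2: "((%y. m y t * V (Z y t) ?T) has_real_derivative ux x t) (at x)"
      unfolding ux_def by (rule derivative_eq_intros mx[OF p(2)] dx refl)+ (simp add: algebra_simps)
    have 3: "((%y. ux y t) has_real_derivative uxx x t) (at x)"
      unfolding ux_def uxx_def
      by (rule derivative_eq_intros mx[OF p(2)] mxx[OF p(2)] Zx[OF p(2)] Zxx[OF p(2)] dx dxx refl)+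
         (simp add: algebra_simps power2_eq_square)
    have "ut x t = a' x * uxx x t + b' x * ux x t + d' x * (m x t * V ?z ?T)"
    proof -
      let ?V = "V ?z ?T" and ?Vx = "Vx ?z ?T" and ?Vxx = "Vxx ?z ?T"
      have "ut x t = (mt x t + m x t * Tt t * d ?z) * ?V
          + (m x t * Zt x t + m x t * Tt t * b ?z) * ?Vx + m x t * (Tt t * a ?z) * ?Vxx"
        unfolding ut_def eq[OF in'] by (simp add: algebra_simps)
      also have "\<dots> = a' x * uxx x t + b' x * ux x t + d' x * (m x t * ?V)"
        unfolding c0[OF p(2)] c1[OF p(2)] c2[OF p(2)] uxx_def ux_def by (simp add: algebra_simps)
      finally show ?thesis .
    qed
    with 1 2 3 show "case p of (x, t) =>
           ((%s. m x s * V (Z x s) (T s)) has_real_derivative ut x t) (at t) \<and>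
           ((%y. m y t * V (Z y t) (T t)) has_real_derivative ux x t) (at x) \<and>
           ((%y. ux y t) has_real_derivative uxx x t) (at x) \<and>
           ut x t = a' x * uxx x t + b' x * ux x t + d' x * (m x t * V (Z x t) (T t))"
      using p by simp
  qed
qed

section \<open>Bessel-Clifford functions\<close>

lemma norm_pochhammer_ge:
  fixes z :: complex
  assumes "Re z > 0"
  shows "pochhammer (Re z) n <= norm (pochhammer z n)"
proof -
  have "(\<Prod>i<n. Re z + of_nat i) <= (\<Prod>i<n. norm (z + of_nat i))"
  proof (rule prod_mono, safe)
    fix i show "0 <= Re z + of_nat i" using assms by simp
    show "Re z + of_nat i <= norm (z + of_nat i)"
      using complex_Re_le_cmod[of "z + of_nat i"] by simp
  qed
  then show ?thesis by (simp add: pochhammer_prod prod_norm atLeast0LessThan)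
qed

lemma fact_le_pochhammer:
  assumes "x >= (1::real)"
  shows "fact n <= pochhammer x n"
proof -
  have "(\<Prod>i<n. 1 + real i) <= (\<Prod>i<n. x + real i)"
    by (rule prod_mono) (use assms in auto)
  then show ?thesis by (simp add: pochhammer_fact pochhammer_prod atLeast0LessThan)
qed

text \<open>\<open>rGamma z = pochhammer z n * rGamma (z + of_nat n)\<close>, and for real part at
  least 1 the Pochhammer symbol has modulus at least \<open>fact n\<close>. The gain of a factorial
  is the source of the growth bound \<open>hser_sharp_bound\<close>.\<close>

lemma norm_rGamma_shift_le:
  fixes z :: complex
  assumes "Re z >= 1"
  shows "norm (rGamma (z + of_nat n)) <= norm (rGamma z) / fact n"
proof -
  have "fact n <= norm (pochhammer z n)"
    using fact_le_pochhammer[OF assms, of n] norm_pochhammer_ge[of z n] assms by simp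
  then have "fact n * norm (rGamma (z + of_nat n)) <= norm (pochhammer z n) * norm (rGamma (z + of_nat n))"
    by (rule mult_right_mono) simp
  also have "\<dots> = norm (rGamma z)"
    by (subst pochhammer_rGamma[of z n]) (simp add: norm_mult)
  finally show ?thesis by (simp add: field_simps)
qed

lemma continuous_on_rGamma_compose [continuous_intros]:
  fixes f :: "'a::topological_space => complex"
  assumes "continuous_on A f"
  shows "continuous_on A (%x. rGamma (f x))"
  by (rule continuous_on_compose2[OF continuous_on_rGamma[of UNIV] assms]) simp

text \<open>Beyond a shift exceeding the radius of \<open>K\<close> by 1 the real part is at least
  1, and further shifts do not increase the bound; the finitely many smaller shifts are handled by
  compactness. Uniformity in \<nu> is what later permits limits and integrals in the order.\<close>

lemma rGamma_uniformly_bounded: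
  fixes K :: "complex set"
  assumes "compact K"
  obtains B where "B > 0" "\<And>\<nu> m. \<nu> \<in> K ==> norm (rGamma (\<nu> + of_nat m)) <= B"
proof -
  obtain R where R: "\<And>\<nu>. \<nu> \<in> K ==> norm \<nu> <= R"
    using compact_imp_bounded[OF assms] bounded_iff by blast
  obtain M where M: "R + 1 <= real M" using real_arch_simple by blast
  have "\<exists>b. \<forall>\<nu>\<in>K. norm (rGamma (\<nu> + of_nat m)) <= b" for m
  proof -
    have "compact ((%\<nu>. rGamma (\<nu> + of_nat m)) ` K)"
      by (intro compact_continuous_image assms continuous_intros)
    then show ?thesis using compact_imp_bounded bounded_iff by (metis imageI)
  qed
  then obtain b where b: "\<And>m \<nu>. \<nu> \<in> K ==> norm (rGamma (\<nu> + of_nat m)) <= b m" by metis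
  define B where "B = 1 + (\<Sum>m\<le>M. \<bar>b m\<bar>)"
  have bB: "\<bar>b m\<bar> <= B" if "m <= M" for m
  proof -
    have "\<bar>b m\<bar> <= (\<Sum>m\<le>M. \<bar>b m\<bar>)" by (rule member_le_sum) (use that in auto)
    then show ?thesis by (simp add: B_def)
  qed
  show ?thesis
  proof (rule that[of B])
    show "B > 0" by (simp add: B_def add_pos_nonneg sum_nonneg)
    fix \<nu> m assume \<nu>: "\<nu> \<in> K"
    show "norm (rGamma (\<nu> + of_nat m)) <= B"
    proof (cases "m <= M")
      case True
      then show ?thesis using b[OF \<nu>, of m] bB[of m] by simp
    next
      case False
      then obtain n where n: "m = M + n" using le_Suc_ex nat_le_linear by blast
      have "Re (\<nu> + of_nat M) >= 1"
        using R[OF \<nu>] M abs_Re_le_cmod[of \<nu>] by simp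
      from norm_rGamma_shift_le[OF this, of n]
      have "norm (rGamma (\<nu> + of_nat m)) <= norm (rGamma (\<nu> + of_nat M)) / fact n"
        by (simp add: n add_ac)
      also have "\<dots> <= norm (rGamma (\<nu> + of_nat M))"
        by (simp add: divide_le_eq mult_le_cancel_left1 fact_ge_1)
      also have "\<dots> <= B" using b[OF \<nu>, of M] bB[of M] by simp
      finally show ?thesis .
    qed
  qed
qed

text \<open>The Bessel-Clifford function: \<open>I\<^sub>\<nu> (2 \<surd>x) = x powr (\<nu> / 2) * clif \<nu> x\<close>.\<close>
definition clif :: "complex => complex => complex" where
  "clif \<nu> x = (\<Sum>m. rGamma (\<nu> + 1 + of_nat m) / fact m * x ^ m)"

lemma summable_pow_fact: "summable (%m. B * (x::real) ^ m / fact m)"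
  using summable_mult[OF summable_exp[of x], of B] by (simp add: field_simps)

lemma summable_clif: "summable (%m. rGamma (\<nu> + 1 + of_nat m) / fact m * (x::complex) ^ m)"
proof -
  obtain B where B: "B > 0" "\<And>m. norm (rGamma (\<nu> + 1 + of_nat m)) <= B"
    by (rule rGamma_uniformly_bounded[of "{\<nu> + 1}"]) auto
  show ?thesis
  proof (rule summable_comparison_test'[OF summable_pow_fact[of B "norm x"]])
    fix m :: nat
    have "norm (rGamma (\<nu> + 1 + of_nat m)) * norm x ^ m / fact m <= B * norm x ^ m / fact m"
      by (intro divide_right_mono mult_right_mono B) auto
    then show "norm (rGamma (\<nu> + 1 + of_nat m) / fact m * x ^ m) <= B * norm x ^ m / fact m"
      by (simp add: norm_mult norm_divide norm_power)
  qed
qed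

lemma clif_sums: "(%m. rGamma (\<nu> + 1 + of_nat m) / fact m * x ^ m) sums clif \<nu> x"
  unfolding clif_def by (rule summable_sums[OF summable_clif])

lemma of_nat_Suc_mult_div_fact: "of_nat (Suc m) * (R / fact (Suc m)) = (R :: complex) / fact m"
  by (simp add: fact_Suc del: of_nat_Suc)

lemma has_field_derivative_clif:
  "(clif \<nu> has_field_derivative clif (\<nu> + 1) x) (at x)"
proof -
  have "((%x. \<Sum>m. rGamma (\<nu> + 1 + of_nat m) / fact m * x ^ m) has_field_derivative
     (\<Sum>m. diffs (%m. rGamma (\<nu> + 1 + of_nat m) / fact m) m * x ^ m)) (at x)"
    by (rule termdiffs_strong_converges_everywhere[OF summable_clif])
  moreover have "diffs (%m. rGamma (\<nu> + 1 + of_nat m) / fact m) = (%m. rGamma (\<nu> + 1 + 1 + of_nat m) / fact m)"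
  proof
    fix m
    have "\<nu> + 1 + of_nat (Suc m) = \<nu> + 1 + 1 + of_nat m" by simp
    then show "diffs (%m. rGamma (\<nu> + 1 + of_nat m) / fact m) m = rGamma (\<nu> + 1 + 1 + of_nat m) / fact m"
      unfolding diffs_def of_nat_Suc_mult_div_fact by (simp only:)
  qed
  ultimately show ?thesis unfolding clif_def[abs_def] by simp
qed

text \<open>Termwise this is the functional equation of Gamma, (\<nu> + 1 + m) / Gamma(\<nu> + 2 +
  m) = 1 / Gamma(\<nu> + 1 + m). Since differentiation raises the order by one, it is at the same
  time the Bessel equation.\<close>

lemma clif_recurrence: "clif \<nu> x = (\<nu> + 1) * clif (\<nu> + 1) x + x * clif (\<nu> + 2) x"
proof -
  have 1: "(%m. (\<nu> + 1) * (rGamma (\<nu> + 1 + 1 + of_nat m) / fact m * x ^ m)) sums ((\<nu> + 1) * clif (\<nu> + 1) x)"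
    by (intro sums_mult clif_sums)
  \<comment> \<open>The factor m kills the term of index 0, so the shifted series has the same sum;
    its terms are x times those of order \<nu> + 2.\<close>
  define t where "t m = of_nat m * (rGamma (\<nu> + 1 + 1 + of_nat m) / fact m * x ^ m)" for m
  have "(%m. t (Suc m)) = (%m. x * (rGamma (\<nu> + 2 + 1 + of_nat m) / fact m * x ^ m))"
  proof
    fix m
    have "\<nu> + 1 + 1 + of_nat (Suc m) = \<nu> + 2 + 1 + of_nat m" by simp
    then show "t (Suc m) = x * (rGamma (\<nu> + 2 + 1 + of_nat m) / fact m * x ^ m)"
      unfolding t_def mult.assoc[symmetric] of_nat_Suc_mult_div_fact by (simp only: power_Suc mult_ac)
  qed
  then have "(%m. t (Suc m)) sums (x * clif (\<nu> + 2) x)"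
    using sums_mult[OF clif_sums[of "\<nu> + 2" x], of x] by simp
  then have "t sums (x * clif (\<nu> + 2) x)" by (subst (asm) sums_Suc_iff) (simp add: t_def)
  from sums_add[OF 1 this]
  have "(%m. (\<nu> + 1) * (rGamma (\<nu> + 1 + 1 + of_nat m) / fact m * x ^ m) + t m) sums
      ((\<nu> + 1) * clif (\<nu> + 1) x + x * clif (\<nu> + 2) x)" .
  moreover have "(\<nu> + 1) * (rGamma (\<nu> + 1 + 1 + of_nat m) / fact m * x ^ m) + t m
      = rGamma (\<nu> + 1 + of_nat m) / fact m * x ^ m" for m
  proof -
    have "(\<nu> + 1 + of_nat m) * rGamma (\<nu> + 1 + 1 + of_nat m) = rGamma (\<nu> + 1 + of_nat m)"
      using rGamma_plus1[of "\<nu> + 1 + of_nat m"] by (simp add: add_ac)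
    then have "rGamma (\<nu> + 1 + of_nat m) / fact m * x ^ m
      = (\<nu> + 1 + of_nat m) * rGamma (\<nu> + 1 + 1 + of_nat m) / fact m * x ^ m" by (simp only:)
    then show ?thesis unfolding t_def by (simp only: distrib_right times_divide_eq_right mult.assoc times_divide_eq_left add_divide_distrib)
  qed
  ultimately have "(%m. rGamma (\<nu> + 1 + of_nat m) / fact m * x ^ m) sums
      ((\<nu> + 1) * clif (\<nu> + 1) x + x * clif (\<nu> + 2) x)" by simp
  with clif_sums[of \<nu> x] show ?thesis by (rule sums_unique2)
qed

text \<open>One Weierstrass estimate, uniform in the order and in the argument, serves both joint
  continuity and holomorphy in the order.\<close>

lemma clif_uniform_limit:
  assumes "compact K" "bounded X"
  shows "uniform_limit (K \<times> X) (%n (\<nu>, x). \<Sum>m<n. rGamma (\<nu> + 1 + of_nat m) / fact m * x ^ m)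
     (%(\<nu>, x). clif \<nu> x) sequentially"
proof -
  obtain R where R: "\<And>x. x \<in> X ==> norm x <= R" using assms(2) bounded_iff by blast
  obtain B where B: "B > 0" "\<And>\<nu> m. \<nu> \<in> (%\<nu>. \<nu> + 1) ` K ==> norm (rGamma (\<nu> + of_nat m)) <= B"
    by (rule rGamma_uniformly_bounded[of "(%\<nu>. \<nu> + 1) ` K"])
       (auto intro!: compact_continuous_image assms continuous_intros)
  have "uniform_limit (K \<times> X) (%n p. \<Sum>m<n. (case p of (\<nu>, x) => rGamma (\<nu> + 1 + of_nat m) / fact m * x ^ m))
     (%p. \<Sum>m. (case p of (\<nu>, x) => rGamma (\<nu> + 1 + of_nat m) / fact m * x ^ m)) sequentially"
  proof (rule Weierstrass_m_test)
    show "summable (%m. B * R ^ m / fact m)" by (rule summable_pow_fact)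
    fix m p assume "p \<in> K \<times> X"
    then obtain \<nu> x where p: "p = (\<nu>, x)" "\<nu> \<in> K" "x \<in> X" by auto
    have "norm (rGamma (\<nu> + 1 + of_nat m)) * norm x ^ m / fact m <= B * R ^ m / fact m"
      using p R[of x] B by (intro divide_right_mono mult_mono power_mono) auto
    then show "norm (case p of (\<nu>, x) => rGamma (\<nu> + 1 + of_nat m) / fact m * x ^ m) <= B * R ^ m / fact m"
      by (simp add: p norm_mult norm_divide norm_power)
  qed
  then show ?thesis by (simp add: case_prod_unfold clif_def)
qed

lemma continuous_on_clif [continuous_intros]:
  assumes "continuous_on A f" "continuous_on A g"
  shows "continuous_on A (%a. clif (f a) (g a))"
proof -
  have "isCont (%(\<nu>, x). clif \<nu> x) (\<nu>0, x0)" for \<nu>0 x0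
  proof -
    let ?S = "cball \<nu>0 1 \<times> cball x0 1"
    have "continuous_on ?S (%(\<nu>, x). clif \<nu> x)"
      by (rule uniform_limit_theorem[OF always_eventually clif_uniform_limit])
         (auto simp: case_prod_unfold intro!: continuous_intros)
    moreover have "(\<nu>0, x0) \<in> interior ?S" by (simp add: interior_Times)
    ultimately show ?thesis by (rule continuous_on_interior)
  qed
  then have "continuous_on UNIV (%(\<nu>, x). clif \<nu> x)" by (auto simp: continuous_on_eq_continuous_at)
  from continuous_on_compose2[OF this continuous_on_Pair[OF assms]]
  show ?thesis by simp
qed

text \<open>Holomorphy in the order makes Cauchy's formula available when the solutions for integer
  order are built.\<close>

lemma holomorphic_on_clif_param [holomorphic_intros]:
  assumes "f holomorphic_on A"
  shows "(%\<nu>. clif (f \<nu>) x) holomorphic_on A"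
proof -
  have "(%\<nu>. clif \<nu> x) holomorphic_on UNIV"
  proof (rule holomorphic_uniform_sequence[where f = "%n \<nu>. \<Sum>m<n. rGamma (\<nu> + 1 + of_nat m) / fact m * x ^ m"])
    show "(%\<nu>. \<Sum>m<n. rGamma (\<nu> + 1 + of_nat m) / fact m * x ^ m) holomorphic_on UNIV" for n
      by (intro holomorphic_intros) auto
    fix z :: complex
    have "uniform_limit (cball z 1 \<times> {x}) (%n (\<nu>, x). \<Sum>m<n. rGamma (\<nu> + 1 + of_nat m) / fact m * x ^ m)
     (%(\<nu>, x). clif \<nu> x) sequentially" by (rule clif_uniform_limit) auto
    then have "uniform_limit (cball z 1) (%n \<nu>. \<Sum>m<n. rGamma (\<nu> + 1 + of_nat m) / fact m * x ^ m)
     (%\<nu>. clif \<nu> x) sequentially" by (simp add: uniform_limit_iff)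
    then show "\<exists>d>0. cball z d \<subseteq> UNIV \<and> uniform_limit (cball z d) (%n \<nu>. \<Sum>m<n. rGamma (\<nu> + 1 + of_nat m) / fact m * x ^ m)
     (%\<nu>. clif \<nu> x) sequentially" by (intro exI[of _ 1]) auto
  qed auto
  from holomorphic_on_compose_gen[OF assms this] show ?thesis by (simp add: o_def)
qed

section \<open>Power series of products of two Bessel-Clifford functions\<close>

lemma sums_even_index:
  fixes f :: "nat => 'a::real_normed_vector"
  assumes "f sums s"
  shows "(%i. if even i then f (i div 2) else 0) sums s"
proof -
  have "(%n. (%i. if even i then f (i div 2) else 0) (2 * n)) sums s \<longleftrightarrow> (%i. if even i then f (i div 2) else 0) sums s"
    by (rule sums_mono_reindex) (auto simp: strict_mono_def elim!: evenE)
  with assms show ?thesis by simp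
qed

text \<open>
  The Taylor coefficients of \<open>exp ((a + b) y) * clif \<nu> (a b y\<^sup>2)\<close>; multiplying the \<open>k\<close>-th one by
  \<open>\<Gamma>(\<nu> + 1 + k)\<inverse>\<close>, which inverts the Laplace transform, gives those of \<open>clif \<nu> (a y) * clif \<nu> (b y)\<close>.
\<close>
definition ecoef :: "complex => complex => complex => nat => complex" where
  "ecoef a b \<nu> k = (\<Sum>i\<le>k. (if even i then (a * b) ^ (i div 2) * rGamma (\<nu> + 1 + of_nat (i div 2)) / fact (i div 2) else 0)
      * ((a + b) ^ (k - i) / fact (k - i)))"

text \<open>Majorant of \<open>ecoef\<close>, up to a bound for the reciprocal Gamma factors: these
  are dropped, and \<open>a\<close>, \<open>b\<close> will be moduli. Its generating function is
  elementary.\<close>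

definition emaj :: "real => real => nat => real" where
  "emaj a b k = (\<Sum>i\<le>k. (if even i then (a * b) ^ (i div 2) / fact (i div 2) else 0)
      * ((a + b) ^ (k - i) / fact (k - i)))"

lemma emaj_nonneg: "a >= 0 ==> b >= 0 ==> emaj a b k >= 0"
  unfolding emaj_def by (intro sum_nonneg) auto

lemma norm_ecoef_le:
  assumes "\<And>m. norm (rGamma (\<nu> + 1 + of_nat m)) <= B"
  shows "norm (ecoef a b \<nu> k) <= B * emaj (norm a) (norm b) k"
proof -
  have B0: "B >= 0" using assms[of 0] norm_ge_zero order_trans by blast
  show ?thesis
    unfolding ecoef_def emaj_def sum_distrib_left
  proof (rule sum_norm_le)
    fix i assume "i \<in> {..k}"
    have 1: "norm ((a + b) ^ (k - i) / fact (k - i)) <= (norm a + norm b) ^ (k - i) / fact (k - i)"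
      by (simp add: norm_divide norm_power divide_right_mono power_mono norm_triangle_ineq)
    have 2: "norm (if even i then (a * b) ^ (i div 2) * rGamma (\<nu> + 1 + of_nat (i div 2)) / fact (i div 2) else 0)
       <= B * (if even i then (norm a * norm b) ^ (i div 2) / fact (i div 2) else 0)"
    proof (cases "even i")
      case True
      have "(norm a * norm b) ^ (i div 2) * norm (rGamma (\<nu> + 1 + of_nat (i div 2))) / fact (i div 2)
         <= (norm a * norm b) ^ (i div 2) * B / fact (i div 2)"
        by (intro divide_right_mono mult_left_mono assms) auto
      with True show ?thesis by (simp add: norm_mult norm_divide norm_power mult_ac)
    qed simp
    show "norm ((if even i then (a * b) ^ (i div 2) * rGamma (\<nu> + 1 + of_nat (i div 2)) / fact (i div 2) else 0)
      * ((a + b) ^ (k - i) / fact (k - i))) <= B * ((if even i then (norm a * norm b) ^ (i div 2) / fact (i div 2) else 0)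
      * ((norm a + norm b) ^ (k - i) / fact (k - i)))"
      unfolding norm_mult mult.assoc[symmetric]
      by (rule mult_mono[OF 2 1]) (use B0 in auto)
  qed
qed

text \<open>The Cauchy product of a power series in u^2 with the exponential series. Both
  \<open>ecoef\<close> and \<open>emaj\<close> consist of coefficients of this shape.\<close>

lemma cauchy_exp_sums:
  fixes c :: "nat => 'a::{real_normed_field,banach}"
  assumes "summable (%i. norm (c i * (u\<^sup>2) ^ i))"
  shows "(%k. (\<Sum>i\<le>k. (if even i then c (i div 2) else 0) * (w ^ (k - i) / fact (k - i))) * u ^ k)
     sums ((\<Sum>i. c i * (u\<^sup>2) ^ i) * exp (w * u))"
proof -
  let ?a = "%i. if even i then c (i div 2) * (u\<^sup>2) ^ (i div 2) else 0"
  let ?b = "%i. (w * u) ^ i / fact i"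
  have "(%k. \<Sum>i\<le>k. ?a i * ?b (k - i)) sums ((\<Sum>k. ?a k) * (\<Sum>k. ?b k))"
  proof (rule Cauchy_product_sums)
    have "summable (%i. if even i then norm (c (i div 2) * (u\<^sup>2) ^ (i div 2)) else 0)"
      using sums_even_index[OF summable_sums[OF assms]] by (auto simp: summable_def)
    then show "summable (%k. norm (?a k))"
      by (rule back_subst[of summable]) auto
    show "summable (%k. norm (?b k))"
      using summable_norm_exp[of "w * u"] by (simp add: field_simps norm_divide norm_mult)
  qed
  moreover have "(\<Sum>k. ?a k) = (\<Sum>i. c i * (u\<^sup>2) ^ i)"
    using sums_even_index[OF summable_sums[OF summable_norm_cancel[OF assms]]] by (simp add: sums_iff)
  moreover have "(\<Sum>k. ?b k) = exp (w * u)"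
    using exp_converges[of "w * u"] by (simp add: sums_iff scaleR_conv_of_real field_simps)
  moreover have "(\<Sum>i\<le>k. ?a i * ?b (k - i)) =
     (\<Sum>i\<le>k. (if even i then c (i div 2) else 0) * (w ^ (k - i) / fact (k - i))) * u ^ k" for k
    unfolding sum_distrib_right
  proof (rule sum.cong[OF refl])
    fix i assume "i \<in> {..k}"
    then have "u ^ k = u ^ i * u ^ (k - i)" by (simp flip: power_add)
    then show "?a i * ?b (k - i) = (if even i then c (i div 2) else 0) * (w ^ (k - i) / fact (k - i)) * u ^ k"
      by (auto elim!: evenE simp: power_mult power_mult_distrib)
  qed
  ultimately show ?thesis by simp
qed

text \<open>The generating function is entire, so the coefficients decay faster than any geometric
  sequence; at u = 4 this supplies the factor 4^(-k) in \<open>hser_sharp_bound\<close>.\<close>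

lemma emaj_sums:
  assumes "a >= 0" "b >= 0"
  shows "(%k. emaj a b k * u ^ k) sums (exp (a * b * u\<^sup>2) * exp ((a + b) * u))"
proof -
  have s: "(%i. (a * b) ^ i / fact i * (u\<^sup>2) ^ i) sums exp (a * b * u\<^sup>2)"
    using exp_converges[of "a * b * u\<^sup>2"] by (simp add: power_mult_distrib field_simps)
  have "(%k. emaj a b k * u ^ k) sums ((\<Sum>i. (a * b) ^ i / fact i * (u\<^sup>2) ^ i) * exp ((a + b) * u))"
    unfolding emaj_def
    by (rule cauchy_exp_sums) (use s assms in \<open>simp add: sums_iff abs_mult\<close>)
  with s show ?thesis by (simp add: sums_iff)
qed

lemma ecoef_sums:
  "(%k. ecoef a b \<nu> k * u ^ k) sums (clif \<nu> (a * b * u\<^sup>2) * exp ((a + b) * u))"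
proof -
  obtain B where B: "B > 0" "\<And>m. norm (rGamma (\<nu> + 1 + of_nat m)) <= B"
    by (rule rGamma_uniformly_bounded[of "{\<nu> + 1}"]) auto
  let ?c = "%i. (a * b) ^ i * rGamma (\<nu> + 1 + of_nat i) / fact i"
  have s: "(%i. ?c i * (u\<^sup>2) ^ i) sums clif \<nu> (a * b * u\<^sup>2)"
    using clif_sums[of \<nu> "a * b * u\<^sup>2"] by (simp add: power_mult_distrib mult_ac)
  have n: "summable (%i. norm (?c i * (u\<^sup>2) ^ i))"
  proof (rule summable_comparison_test'[OF summable_pow_fact[of B "norm (a * b * u\<^sup>2)"]])
    fix m :: nat
    have "norm (rGamma (\<nu> + 1 + of_nat m)) * norm (a * b * u\<^sup>2) ^ m / fact m <= B * norm (a * b * u\<^sup>2) ^ m / fact m"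
      by (intro divide_right_mono mult_right_mono B) auto
    then show "norm (norm (?c m * (u\<^sup>2) ^ m)) <= B * norm (a * b * u\<^sup>2) ^ m / fact m"
      by (simp add: norm_mult norm_divide norm_power power_mult_distrib mult_ac)
  qed
  have "(%k. ecoef a b \<nu> k * u ^ k) sums ((\<Sum>i. ?c i * (u\<^sup>2) ^ i) * exp ((a + b) * u))"
    unfolding ecoef_def by (rule cauchy_exp_sums[OF n])
  with s show ?thesis by (simp add: sums_iff)
qed

text \<open>Chu-Vandermonde for rising factorials, by Pascal's rule and induction on
  \<open>i\<close>. The falling factorial of \<open>l\<close> uses truncated subtraction: for
  \<open>j > l\<close> one of its factors is 0, so those terms drop out by themselves.\<close>

lemma vandermonde_pochhammer:
  fixes x :: "'a::comm_ring_1"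
  shows "(\<Sum>j\<le>i. of_nat (i choose j) * of_nat (\<Prod>m<j. l - m) * pochhammer (x + of_nat j) (i - j))
     = pochhammer (x + of_nat l) i"
proof (induction i arbitrary: l x)
  case 0
  show ?case by simp
next
  case (Suc i)
  define F :: "nat => nat => 'a" where "F l j = of_nat (\<Prod>m<j. l - m)" for l j
  have F0: "F l 0 = 1" for l by (simp add: F_def)
  note IH = Suc.IH[folded F_def]
  have "(\<Sum>j\<le>Suc i. of_nat (Suc i choose j) * F l j * pochhammer (x + of_nat j) (Suc i - j))
     = (\<Sum>j\<le>i. of_nat (i choose j) * F l j * pochhammer (x + of_nat j) (Suc i - j))
     + (\<Sum>j\<le>i. of_nat (i choose j) * F l (Suc j) * pochhammer (x + of_nat (Suc j)) (i - j))"
  proof -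
    let ?p = "%j. F l (Suc j) * pochhammer (x + of_nat (Suc j)) (i - j)"
    have 1: "(\<Sum>j\<le>Suc i. of_nat (Suc i choose j) * F l j * pochhammer (x + of_nat j) (Suc i - j))
      = pochhammer x (Suc i) + (\<Sum>j\<le>i. of_nat (Suc i choose Suc j) * ?p j)"
      by (subst sum.atMost_Suc_shift) (simp add: F0 mult.assoc)
    have 2: "(\<Sum>j\<le>i. of_nat (Suc i choose Suc j) * ?p j)
      = (\<Sum>j\<le>i. of_nat (i choose j) * ?p j) + (\<Sum>j\<le>i. of_nat (i choose Suc j) * ?p j)"
      unfolding sum.distrib[symmetric] by (intro sum.cong refl) (simp add: distrib_right)
    have "(\<Sum>j\<le>Suc i. of_nat (i choose j) * F l j * pochhammer (x + of_nat j) (Suc i - j))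
       = pochhammer x (Suc i) + (\<Sum>j\<le>i. of_nat (i choose Suc j) * ?p j)"
      by (subst sum.atMost_Suc_shift) (simp add: F0 mult.assoc)
    moreover have "(\<Sum>j\<le>Suc i. of_nat (i choose j) * F l j * pochhammer (x + of_nat j) (Suc i - j))
       = (\<Sum>j\<le>i. of_nat (i choose j) * F l j * pochhammer (x + of_nat j) (Suc i - j))"
      by (subst sum.atMost_Suc) (simp add: binomial_eq_0)
    ultimately have 3: "(\<Sum>j\<le>i. of_nat (i choose j) * F l j * pochhammer (x + of_nat j) (Suc i - j))
       = pochhammer x (Suc i) + (\<Sum>j\<le>i. of_nat (i choose Suc j) * ?p j)" by simp
    show ?thesis unfolding 1 2 3 by (simp only: mult.assoc add_ac)
  qed
  also have "(\<Sum>j\<le>i. of_nat (i choose j) * F l j * pochhammer (x + of_nat j) (Suc i - j))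
     = (x + of_nat i) * pochhammer (x + of_nat l) i"
    unfolding IH[of l x, symmetric] sum_distrib_left
  proof (intro sum.cong refl)
    fix j assume "j \<in> {..i}"
    then have "j <= i" by simp
    then have "pochhammer (x + of_nat j) (Suc i - j) = (x + of_nat i) * pochhammer (x + of_nat j) (i - j)"
      by (simp add: Suc_diff_le pochhammer_rec' of_nat_diff algebra_simps)
    then show "of_nat (i choose j) * F l j * pochhammer (x + of_nat j) (Suc i - j)
      = (x + of_nat i) * (of_nat (i choose j) * F l j * pochhammer (x + of_nat j) (i - j))"
      by (simp add: algebra_simps)
  qed
  also have "(\<Sum>j\<le>i. of_nat (i choose j) * F l (Suc j) * pochhammer (x + of_nat (Suc j)) (i - j))
     = of_nat l * pochhammer (x + of_nat l) i"
  proof (cases l)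
    case 0
    have "F 0 (Suc j) = 0" for j unfolding F_def by (subst prod.lessThan_Suc_shift) simp
    with 0 show ?thesis by simp
  next
    case (Suc l')
    \<comment> \<open>Splitting off the first factor of the falling factorial lowers
      \<open>l\<close> by one; the base point rises to x + 1 at the same time, so the sum x + l is
      unchanged.\<close>
    have f: "F l (Suc j) = of_nat l * F l' j" for j
      unfolding Suc F_def by (subst prod.lessThan_Suc_shift) (simp add: algebra_simps)
    have "pochhammer (x + of_nat l) i = pochhammer (x + 1 + of_nat l') i"
      by (simp add: Suc algebra_simps)
    also have "\<dots> = (\<Sum>j\<le>i. of_nat (i choose j) * F l' j * pochhammer (x + 1 + of_nat j) (i - j))"
      by (rule IH[symmetric])
    finally show ?thesis unfolding f by (simp add: sum_distrib_left algebra_simps)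
  qed
  also have "(x + of_nat i) * pochhammer (x + of_nat l) i + of_nat l * pochhammer (x + of_nat l) i
     = pochhammer (x + of_nat l) (Suc i)"
    by (simp add: pochhammer_rec' algebra_simps)
  finally show ?case unfolding F_def .
qed

text \<open>Linearises a product of two coefficients: apart from a factor depending on
  \<open>i + l\<close> alone, \<open>i\<close> and \<open>l\<close> enter only through 1 / (i - j)!
  and 1 / (l - j)!, which factorise. Since it comes from a polynomial identity, it holds for every
  complex \<nu>, also where Gamma has poles.\<close>

lemma rGamma_mult_rGamma:
  "rGamma (\<nu> + 1 + of_nat i) / fact i * (rGamma (\<nu> + 1 + of_nat l) / fact l) =
   rGamma (\<nu> + 1 + of_nat (i + l)) *
     (\<Sum>j | j <= i \<and> j <= l. rGamma (\<nu> + 1 + of_nat j) / (fact j * fact (i - j) * fact (l - j)) :: complex)"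
proof -
  let ?x = "\<nu> + 1"
  have 1: "rGamma (?x + of_nat l) = pochhammer (?x + of_nat l) i * rGamma (?x + of_nat (i + l))"
    using pochhammer_rGamma[of "?x + of_nat l" i] by (simp add: add_ac)
  have 2: "rGamma (?x + of_nat j) = pochhammer (?x + of_nat j) (i - j) * rGamma (?x + of_nat i)" if "j <= i" for j
  proof -
    have "?x + of_nat j + of_nat (i - j) = ?x + of_nat i" using that by (simp add: of_nat_diff)
    then show ?thesis using pochhammer_rGamma[of "?x + of_nat j" "i - j"] by (simp only:)
  qed
  have f0: "(\<Prod>m<j. l - m) = (0::nat)" if "j > l" for j
    using that by (auto simp: prod_zero_iff)
  have f1: "of_nat (\<Prod>m<j. l - m) = (fact l / fact (l - j) :: complex)" if "j <= l" for j
    using that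
  proof (induction j)
    case (Suc j)
    then have "l - j = Suc (l - Suc j)" by simp
    then have "(fact (l - j) :: complex) = of_nat (l - j) * fact (l - Suc j)"
      by (metis fact_Suc)
    with Suc show ?case by (simp add: field_simps)
  qed simp
  have "rGamma (?x + of_nat i) * rGamma (?x + of_nat l) = rGamma (?x + of_nat (i + l)) *
     (\<Sum>j\<le>i. of_nat (i choose j) * of_nat (\<Prod>m<j. l - m) * (pochhammer (?x + of_nat j) (i - j) * rGamma (?x + of_nat i)))"
    unfolding 1 vandermonde_pochhammer[where l=l and i=i and x="?x", symmetric] by (simp add: sum_distrib_left sum_distrib_right mult_ac)
  also have "(\<Sum>j\<le>i. of_nat (i choose j) * of_nat (\<Prod>m<j. l - m) * (pochhammer (?x + of_nat j) (i - j) * rGamma (?x + of_nat i)))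
    = (\<Sum>j\<le>i. of_nat (i choose j) * of_nat (\<Prod>m<j. l - m) * rGamma (?x + of_nat j))"
    by (intro sum.cong refl) (simp only: 2[symmetric] atMost_iff)
  also have "\<dots> = (\<Sum>j | j <= i \<and> j <= l. of_nat (i choose j) * of_nat (\<Prod>m<j. l - m) * rGamma (?x + of_nat j))"
    by (rule sum.mono_neutral_right) (use f0 in \<open>auto simp: not_le\<close>)
  also have "\<dots> = (\<Sum>j | j <= i \<and> j <= l. fact i * fact l * (rGamma (?x + of_nat j) / (fact j * fact (i - j) * fact (l - j))))"
    by (intro sum.cong refl) (use f1 in \<open>auto simp: binomial_fact\<close>)
  also have "\<dots> = fact i * fact l * (\<Sum>j | j <= i \<and> j <= l. rGamma (?x + of_nat j) / (fact j * fact (i - j) * fact (l - j)))"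
    by (simp only: sum_distrib_left)
  finally have h: "rGamma (?x + of_nat i) * rGamma (?x + of_nat l) = rGamma (?x + of_nat (i + l)) * \<dots>" .
  have "rGamma (?x + of_nat i) / fact i * (rGamma (?x + of_nat l) / fact l) =
     (rGamma (?x + of_nat i) * rGamma (?x + of_nat l)) / (fact i * fact l)" by simp
  then show ?thesis unfolding h by simp
qed

text \<open>After linearisation the pairs (i, j) are reindexed by n = 2 j and p = i - j. The sum
  over p is then the binomial expansion of (a + b)^(k - n), and the sum over even n is the one that
  defines \<open>ecoef\<close>.\<close>

lemma ecoef_mult_rGamma:
  "ecoef a b \<nu> k * rGamma (\<nu> + 1 + of_nat k) =
   (\<Sum>i\<le>k. (rGamma (\<nu> + 1 + of_nat i) / fact i * a ^ i) * (rGamma (\<nu> + 1 + of_nat (k - i)) / fact (k - i) * b ^ (k - i)))"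
proof -
  let ?R = "%j. rGamma (\<nu> + 1 + of_nat j)"
  let ?t = "%j i. ?R j / (fact j * fact (i - j) * fact (k - i - j)) * a ^ i * b ^ (k - i)"
  have "(\<Sum>i\<le>k. (?R i / fact i * a ^ i) * (?R (k - i) / fact (k - i) * b ^ (k - i)))
     = (\<Sum>i\<le>k. ?R k * (\<Sum>j | j <= i \<and> j <= k - i. ?t j i))"
  proof (intro sum.cong refl)
    fix i assume "i \<in> {..k}"
    then have k: "i + (k - i) = k" by simp
    have "(?R i / fact i * a ^ i) * (?R (k - i) / fact (k - i) * b ^ (k - i))
      = (?R i / fact i * (?R (k - i) / fact (k - i))) * (a ^ i * b ^ (k - i))" by simp
    also have "\<dots> = ?R k * (\<Sum>j | j <= i \<and> j <= k - i. ?R j / (fact j * fact (i - j) * fact (k - i - j))) * (a ^ i * b ^ (k - i))"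
      unfolding rGamma_mult_rGamma k by simp
    finally show "(?R i / fact i * a ^ i) * (?R (k - i) / fact (k - i) * b ^ (k - i))
      = ?R k * (\<Sum>j | j <= i \<and> j <= k - i. ?t j i)"
      by (simp add: sum_distrib_right mult.assoc)
  qed
  also have "\<dots> = ?R k * (\<Sum>(i, j) \<in> (SIGMA i:{..k}. {j. j <= i \<and> j <= k - i}). ?t j i)"
    by (subst sum.Sigma[symmetric]) (auto simp: sum_distrib_left)
  also have "(\<Sum>(i, j) \<in> (SIGMA i:{..k}. {j. j <= i \<and> j <= k - i}). ?t j i)
    = (\<Sum>(n, p) \<in> (SIGMA n:{n\<in>{..k}. even n}. {..k - n}). ?t (n div 2) (p + n div 2))"
    by (rule sum.reindex_bij_witness[of _ "%(n, p). (p + n div 2, n div 2)" "%(i, j). (2 * j, i - j)"])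
       (auto elim!: evenE)
  also have "\<dots> = (\<Sum>n\<in>{n\<in>{..k}. even n}. \<Sum>p\<le>k - n. ?t (n div 2) (p + n div 2))"
    by (subst sum.Sigma[symmetric]) auto
  also have "\<dots> = (\<Sum>n\<in>{n\<in>{..k}. even n}. ((a * b) ^ (n div 2) * ?R (n div 2) / fact (n div 2)) * ((a + b) ^ (k - n) / fact (k - n)))"
  proof (intro sum.cong refl)
    fix n assume n: "n \<in> {n\<in>{..k}. even n}"
    then obtain j where j: "n = 2 * j" "2 * j <= k" by (auto elim!: evenE)
    have bin: "(a + b) ^ (k - n) / fact (k - n) = (\<Sum>p\<le>k - n. a ^ p * b ^ (k - n - p) / (fact p * fact (k - n - p)))"
      unfolding binomial_ring sum_divide_distrib
      by (intro sum.cong refl) (simp add: binomial_fact)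
    show "(\<Sum>p\<le>k - n. ?t (n div 2) (p + n div 2)) =
       ((a * b) ^ (n div 2) * ?R (n div 2) / fact (n div 2)) * ((a + b) ^ (k - n) / fact (k - n))"
      unfolding bin sum_distrib_left
    proof (intro sum.cong refl)
      fix p assume "p \<in> {..k - n}"
      then have "k - (p + j) - j = k - n - p" "k - (p + j) = j + (k - n - p)" using j by auto
      then show "?t (n div 2) (p + n div 2) = ((a * b) ^ (n div 2) * ?R (n div 2) / fact (n div 2)) *
           (a ^ p * b ^ (k - n - p) / (fact p * fact (k - n - p)))"
        unfolding j by (simp add: power_add power_mult_distrib mult_ac)
    qed
  qed
  also have "\<dots> = ecoef a b \<nu> k"
    unfolding ecoef_def by (rule sum.mono_neutral_cong_left) auto
  finally show ?thesis by (simp add: mult.commute)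
qed

lemma clif_mult_clif_sums:
  "(%k. ecoef a b \<nu> k * rGamma (\<nu> + 1 + of_nat k) * y ^ k) sums (clif \<nu> (a * y) * clif \<nu> (b * y))"
proof -
  obtain B where B: "B > 0" "\<And>m. norm (rGamma (\<nu> + 1 + of_nat m)) <= B"
    by (rule rGamma_uniformly_bounded[of "{\<nu> + 1}"]) auto
  have n: "summable (%m. norm (rGamma (\<nu> + 1 + of_nat m) / fact m * x ^ m))" for x
  proof (rule summable_comparison_test'[OF summable_pow_fact[of B "norm x"]])
    fix m :: nat
    have "norm (rGamma (\<nu> + 1 + of_nat m)) * norm x ^ m / fact m <= B * norm x ^ m / fact m"
      by (intro divide_right_mono mult_right_mono B) auto
    then show "norm (norm (rGamma (\<nu> + 1 + of_nat m) / fact m * x ^ m)) <= B * norm x ^ m / fact m"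
      by (simp add: norm_mult norm_divide norm_power)
  qed
  from Cauchy_product_sums[OF n n, of "a * y" "b * y"]
  have "(%k. \<Sum>i\<le>k. (rGamma (\<nu> + 1 + of_nat i) / fact i * (a * y) ^ i) *
      (rGamma (\<nu> + 1 + of_nat (k - i)) / fact (k - i) * (b * y) ^ (k - i))) sums (clif \<nu> (a * y) * clif \<nu> (b * y))"
    unfolding clif_def .
  moreover have "(\<Sum>i\<le>k. (rGamma (\<nu> + 1 + of_nat i) / fact i * (a * y) ^ i) *
      (rGamma (\<nu> + 1 + of_nat (k - i)) / fact (k - i) * (b * y) ^ (k - i)))
      = ecoef a b \<nu> k * rGamma (\<nu> + 1 + of_nat k) * y ^ k" for k
    unfolding ecoef_mult_rGamma sum_distrib_right
  proof (intro sum.cong refl)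
    fix i assume "i \<in> {..k}"
    then have "y ^ k = y ^ i * y ^ (k - i)" by (simp flip: power_add)
    then show "(rGamma (\<nu> + 1 + of_nat i) / fact i * (a * y) ^ i) *
      (rGamma (\<nu> + 1 + of_nat (k - i)) / fact (k - i) * (b * y) ^ (k - i)) =
      (rGamma (\<nu> + 1 + of_nat i) / fact i * a ^ i) *
      (rGamma (\<nu> + 1 + of_nat (k - i)) / fact (k - i) * b ^ (k - i)) * y ^ k"
      by (simp add: power_mult_distrib)
  qed
  ultimately show ?thesis by simp
qed

section \<open>Laplace transforms of products of Bessel functions\<close>

text \<open>The power y^z of a positive real y by means of the real logarithm. This avoids the
  branch conditions of complex \<open>powr\<close>, and the laws for sums and negatives in the
  exponent hold without conditions on y.\<close>

definition rp :: "real => complex => complex" where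
  "rp y z = exp (z * of_real (ln y))"

lemma rp_add: "rp y (a + b) = rp y a * rp y b"
  by (simp add: rp_def exp_add algebra_simps)

lemma rp_mult: "x > 0 ==> y > 0 ==> rp (x * y) a = rp x a * rp y a"
  by (simp add: rp_def exp_add ln_mult algebra_simps)

lemma rp_of_nat: "y > 0 ==> rp y (of_nat n) = of_real (y ^ n)"
  by (simp add: rp_def exp_of_nat_mult exp_of_real)

lemma rp_zero [simp]: "rp y 0 = 1"
  by (simp add: rp_def)

lemma rp_one: "y > 0 ==> rp y 1 = of_real y"
  using rp_of_nat[of y 1] by simp

lemma rp_minus: "rp y (- z) = inverse (rp y z)"
  by (simp add: rp_def exp_minus)

lemma norm_rp: "y > 0 ==> norm (rp y z) = y powr Re z"
  by (simp add: rp_def powr_def)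

lemma has_vector_derivative_rp:
  assumes "y > 0"
  shows "((%y. rp y z) has_vector_derivative z * rp y z / of_real y) (at y)"
proof -
  have "((%y. z * of_real (ln y)) has_vector_derivative z * of_real (1 / y)) (at y)"
  proof -
    show ?thesis
      by (rule has_vector_derivative_mult_right[OF has_vector_derivative_of_real[OF DERIV_ln_divide[OF assms]]])
  qed
  from field_vector_diff_chain_at[OF this DERIV_exp]
  show ?thesis by (simp add: rp_def[abs_def] o_def mult_ac)
qed

lemma continuous_on_rp [continuous_intros]:
  assumes "continuous_on A f" "continuous_on A g" "\<And>a. a \<in> A ==> f a > 0"
  shows "continuous_on A (%a. rp (f a) (g a))"
proof -
  have "\<And>a. a \<in> A ==> f a \<noteq> 0" using assms(3) by fastforce
  then show ?thesis unfolding rp_def using assms by (intro continuous_intros) auto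
qed

lemma borel_measurable_rp [measurable]: "(%y. rp y z) \<in> borel_measurable borel"
  unfolding rp_def by measurable

lemma holomorphic_on_rp [holomorphic_intros]:
  assumes "f holomorphic_on A"
  shows "(%z. rp y (f z)) holomorphic_on A"
  unfolding rp_def by (intro holomorphic_intros assms)

text \<open>Euler's integral at s = 1, rescaled; the factor \<open>rp s (1 - z)\<close> compensates
  for the homogeneity of y^(z - 1).\<close>

lemma has_bochner_integral_Gamma:
  assumes z: "Re z > 0" and s: "s > 0"
  shows "has_bochner_integral lborel (%y. indicator {0<..} y *\<^sub>R (rp y (z - 1) * of_real (exp (- s * y)))) (Gamma z * rp s (- z))"
proof -
  let ?g = "%y. indicator {0<..} y *\<^sub>R (rp y (z - 1) * of_real (exp (- y)))"
  have eq: "?g = (%y. indicator {0<..} y *\<^sub>R (complex_of_real y powr (z - 1) / of_real (exp y)))"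
    by (rule ext) (auto simp: rp_def powr_def indicator_def exp_minus Ln_of_real field_simps)
  have m: "?g \<in> borel_measurable lborel" by measurable
  have "integrable lebesgue ?g"
    using absolutely_integrable_Gamma_integral'[OF z] unfolding set_integrable_def eq .
  then have I: "integrable lborel ?g" using integrable_completion[OF m] by simp
  have "set_integrable lborel {0<..} (%y. complex_of_real y powr (z - 1) / of_real (exp y))"
    using I unfolding eq set_integrable_def .
  from set_borel_integral_eq_integral(2)[OF this] Gamma_integral_complex'[OF z]
  have "integral\<^sup>L lborel ?g = Gamma z"
    unfolding eq set_lebesgue_integral_def by (simp add: integral_unique)
  with I have "has_bochner_integral lborel ?g (Gamma z)" by (simp add: has_bochner_integral_iff)
  then have "has_bochner_integral lborel (%y. ?g (0 + s * y)) (Gamma z /\<^sub>R \<bar>s\<bar>)"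
    using lborel_has_bochner_integral_real_affine_iff[of s ?g "Gamma z" 0] s by blast
  from has_bochner_integral_mult_right[OF this, where c = "rp s (1 - z)"]
  have "has_bochner_integral lborel (%y. rp s (1 - z) * ?g (0 + s * y)) (rp s (1 - z) * (Gamma z /\<^sub>R \<bar>s\<bar>))" by simp
  moreover have "rp s (1 - z) * ?g (0 + s * y) = indicator {0<..} y *\<^sub>R (rp y (z - 1) * of_real (exp (- s * y)))" for y
  proof (cases "y > 0")
    case True
    have "rp s (1 - z) * rp s (z - 1) = 1" using rp_add[of s "1 - z" "z - 1"] by simp
    then show ?thesis using True s by (simp add: rp_mult mult.assoc[symmetric])
  next
    case False
    then show ?thesis using s by (simp add: zero_less_mult_iff)
  qed
  moreover have "rp s (1 - z) * (Gamma z /\<^sub>R \<bar>s\<bar>) = Gamma z * rp s (- z)"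
  proof -
    have "rp s (1 - z) = of_real s * rp s (- z)" using rp_add[of s 1 "- z"] rp_one[OF s] by simp
    then show ?thesis using s by (simp add: scaleR_conv_of_real field_simps)
  qed
  ultimately show ?thesis by simp
qed

text \<open>For j = 0 a product of two Bessel-Clifford functions. In general
  \<open>rp y (\<nu> + of_nat j) * hser a b \<nu> j (of_real y)\<close> is a j-fold antiderivative
  of the expression for j = 0. Its constants are fixed by the shift of the Gamma argument alone, as
  in a Riemann-Liouville integral continued analytically in \<nu>.\<close>

definition hser :: "complex => complex => complex => nat => complex => complex" where
  "hser a b \<nu> j y = (\<Sum>k. ecoef a b \<nu> k * rGamma (\<nu> + 1 + of_nat (k + j)) * y ^ k)"

lemma hser_terms_bound:
  assumes "compact K"
  obtains B where "B > 0"
    "\<And>\<nu> k y. \<nu> \<in> K ==> norm (ecoef a b \<nu> k * rGamma (\<nu> + 1 + of_nat (k + j)) * y ^ k) <= B * (emaj (norm a) (norm b) k * norm y ^ k)"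
proof -
  obtain B where B: "B > 0" "\<And>\<nu> m. \<nu> \<in> (%\<nu>. \<nu> + 1) ` K ==> norm (rGamma (\<nu> + of_nat m)) <= B"
    by (rule rGamma_uniformly_bounded[of "(%\<nu>. \<nu> + 1) ` K"])
       (auto intro!: compact_continuous_image assms continuous_intros)
  show ?thesis
  proof (rule that[of "B * B"])
    show "B * B > 0" using B by simp
    fix \<nu> k and y :: complex assume \<nu>: "\<nu> \<in> K"
    have r: "norm (rGamma (\<nu> + 1 + of_nat (k + j))) <= B"
      by (rule B(2)) (use \<nu> in auto)
    have "norm (ecoef a b \<nu> k) <= B * emaj (norm a) (norm b) k"
      by (rule norm_ecoef_le) (use B(2) \<nu> in auto)
    then have "norm (ecoef a b \<nu> k) * norm (rGamma (\<nu> + 1 + of_nat (k + j))) * norm y ^ k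
      <= (B * emaj (norm a) (norm b) k) * B * norm y ^ k"
      using B(1) r emaj_nonneg[of "norm a" "norm b" k] by (intro mult_right_mono mult_mono) (auto simp del: of_nat_add)
    then show "norm (ecoef a b \<nu> k * rGamma (\<nu> + 1 + of_nat (k + j)) * y ^ k) <= B * B * (emaj (norm a) (norm b) k * norm y ^ k)"
      by (simp add: norm_mult norm_power mult_ac)
  qed
qed

lemma summable_hser_norm: "summable (%k. norm (ecoef a b \<nu> k * rGamma (\<nu> + 1 + of_nat (k + j)) * y ^ k))"
proof -
  obtain B where B: "\<And>k. norm (ecoef a b \<nu> k * rGamma (\<nu> + 1 + of_nat (k + j)) * y ^ k) <= B * (emaj (norm a) (norm b) k * norm y ^ k)"
    by (rule hser_terms_bound[of "{\<nu>}" a b j]) auto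
  have "summable (%k. B * (emaj (norm a) (norm b) k * norm y ^ k))"
    using emaj_sums[of "norm a" "norm b" "norm y"] by (intro summable_mult) (auto simp: sums_iff)
  then show ?thesis by (rule summable_comparison_test') (use B in simp)
qed

lemma hser_sums: "(%k. ecoef a b \<nu> k * rGamma (\<nu> + 1 + of_nat (k + j)) * y ^ k) sums hser a b \<nu> j y"
  unfolding hser_def by (rule summable_sums[OF summable_norm_cancel[OF summable_hser_norm]])

lemma hser_0: "hser a b \<nu> 0 y = clif \<nu> (a * y) * clif \<nu> (b * y)"
  using sums_unique2[OF hser_sums[of a b \<nu> 0 y]] clif_mult_clif_sums[of a b \<nu> y] by simp

text \<open>Up to a power of y the left-hand side is the derivative of y^(\<nu> + j + 1) times the
  series. It multiplies the k-th coefficient by \<nu> + 1 + k + j, which lowers the argument of the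
  reciprocal Gamma factor by one.\<close>

lemma hser_Suc_derivative:
  obtains D where "(hser a b \<nu> (Suc j) has_field_derivative D) (at y)"
    "(\<nu> + 1 + of_nat j) * hser a b \<nu> (Suc j) y + y * D = hser a b \<nu> j y"
proof -
  let ?c = "%k. ecoef a b \<nu> k * rGamma (\<nu> + 1 + of_nat (k + Suc j))"
  let ?D = "\<Sum>k. diffs ?c k * y ^ k"
  have s: "summable (%k. ?c k * x ^ k)" for x
    using hser_sums[of a b \<nu> "Suc j" x] by (simp add: sums_iff)
  have d: "(hser a b \<nu> (Suc j) has_field_derivative ?D) (at y)"
    unfolding hser_def[abs_def] by (rule termdiffs_strong_converges_everywhere[OF s])
  have "(%k. diffs ?c k * y ^ k) sums ?D"
    using termdiff_converges_all[OF s] by (rule summable_sums)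
  from diffs_equiv[OF sums_summable[OF this]]
  have "(%k. of_nat k * ?c k * y ^ (k - Suc 0)) sums ?D" .
  from sums_mult[OF this, of y] have "(%k. y * (of_nat k * ?c k * y ^ (k - Suc 0))) sums (y * ?D)" .
  moreover have "(%k. y * (of_nat k * ?c k * y ^ (k - Suc 0))) = (%k. of_nat k * (?c k * y ^ k))"
  proof
    fix k show "y * (of_nat k * ?c k * y ^ (k - Suc 0)) = of_nat k * (?c k * y ^ k)"
      by (cases k) simp_all
  qed
  ultimately have "(%k. of_nat k * (?c k * y ^ k)) sums (y * ?D)" by (simp only:)
  from sums_add[OF sums_mult[OF hser_sums[of a b \<nu> "Suc j" y], of "\<nu> + 1 + of_nat j"] this]
  have "(%k. (\<nu> + 1 + of_nat j) * (?c k * y ^ k) + of_nat k * (?c k * y ^ k)) sums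
     ((\<nu> + 1 + of_nat j) * hser a b \<nu> (Suc j) y + y * ?D)" .
  moreover have "(\<nu> + 1 + of_nat j) * (?c k * y ^ k) + of_nat k * (?c k * y ^ k)
     = ecoef a b \<nu> k * rGamma (\<nu> + 1 + of_nat (k + j)) * y ^ k" for k
  proof -
    let ?R = "rGamma (\<nu> + 1 + of_nat (k + Suc j))"
    have r: "rGamma (\<nu> + 1 + of_nat (k + j)) = (\<nu> + 1 + of_nat (k + j)) * ?R"
      using rGamma_plus1[of "\<nu> + 1 + of_nat (k + j)"] by (simp add: add_ac)
    have "(\<nu> + 1 + of_nat j) * (ecoef a b \<nu> k * R * y ^ k) + of_nat k * (ecoef a b \<nu> k * R * y ^ k)
      = ecoef a b \<nu> k * ((\<nu> + 1 + of_nat (k + j)) * R) * y ^ k" for R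
      by (simp add: algebra_simps)
    then show ?thesis unfolding r .
  qed
  ultimately have "(%k. ecoef a b \<nu> k * rGamma (\<nu> + 1 + of_nat (k + j)) * y ^ k) sums
      ((\<nu> + 1 + of_nat j) * hser a b \<nu> (Suc j) y + y * ?D)" by simp
  from sums_unique2[OF this hser_sums] that[OF d] show ?thesis by blast
qed

lemma continuous_on_ecoef [continuous_intros]:
  "continuous_on A f ==> continuous_on A (%x. ecoef a b (f x) k)"
  unfolding ecoef_def
proof (rule continuous_on_sum)
  fix i assume "continuous_on A f"
  then show "continuous_on A (%x. (if even i then (a * b) ^ (i div 2) * rGamma (f x + 1 + of_nat (i div 2)) / fact (i div 2) else 0)
      * ((a + b) ^ (k - i) / fact (k - i)))"
    by (cases "even i") (auto intro!: continuous_intros)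
qed

lemma hser_uniform_limit:
  assumes "compact K" "bounded X"
  shows "uniform_limit (K \<times> X) (%n (\<nu>, y). \<Sum>k<n. ecoef a b \<nu> k * rGamma (\<nu> + 1 + of_nat (k + j)) * y ^ k)
     (%(\<nu>, y). hser a b \<nu> j y) sequentially"
proof -
  obtain R where R: "\<And>x. x \<in> X ==> norm x <= R" using assms(2) bounded_iff by blast
  obtain B where B: "B > 0" "\<And>\<nu> k y. \<nu> \<in> K ==> norm (ecoef a b \<nu> k * rGamma (\<nu> + 1 + of_nat (k + j)) * y ^ k) <= B * (emaj (norm a) (norm b) k * norm y ^ k)"
    by (rule hser_terms_bound[OF assms(1), where a=a and b=b and j=j]) blast
  have "uniform_limit (K \<times> X) (%n p. \<Sum>k<n. (case p of (\<nu>, y) => ecoef a b \<nu> k * rGamma (\<nu> + 1 + of_nat (k + j)) * y ^ k))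
     (%p. \<Sum>k. (case p of (\<nu>, y) => ecoef a b \<nu> k * rGamma (\<nu> + 1 + of_nat (k + j)) * y ^ k)) sequentially"
  proof (rule Weierstrass_m_test)
    show "summable (%k. B * (emaj (norm a) (norm b) k * R ^ k))"
      using emaj_sums[of "norm a" "norm b" R] by (intro summable_mult) (auto simp: sums_iff)
    fix k p assume "p \<in> K \<times> X"
    then obtain \<nu> y where p: "p = (\<nu>, y)" "\<nu> \<in> K" "y \<in> X" by auto
    have "B * (emaj (norm a) (norm b) k * norm y ^ k) <= B * (emaj (norm a) (norm b) k * R ^ k)"
      using p R[of y] B(1) emaj_nonneg[of "norm a" "norm b" k] by (intro mult_left_mono power_mono) auto
    with B(2)[OF p(2), of k y]
    show "norm (case p of (\<nu>, y) => ecoef a b \<nu> k * rGamma (\<nu> + 1 + of_nat (k + j)) * y ^ k)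
       <= B * (emaj (norm a) (norm b) k * R ^ k)"
      by (simp add: p)
  qed
  then show ?thesis by (simp add: case_prod_unfold hser_def)
qed

lemma continuous_on_hser [continuous_intros]:
  assumes "continuous_on A f" "continuous_on A g"
  shows "continuous_on A (%x. hser a b (f x) j (g x))"
proof -
  have "isCont (%(\<nu>, x). hser a b \<nu> j x) (\<nu>0, x0)" for \<nu>0 x0
  proof -
    let ?S = "cball \<nu>0 1 \<times> cball x0 1"
    have "continuous_on ?S (%(\<nu>, x). hser a b \<nu> j x)"
      by (rule uniform_limit_theorem[OF always_eventually hser_uniform_limit])
         (auto simp: case_prod_unfold intro!: continuous_intros)
    moreover have "(\<nu>0, x0) \<in> interior ?S" by (simp add: interior_Times)
    ultimately show ?thesis by (rule continuous_on_interior)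
  qed
  then have "continuous_on UNIV (%(\<nu>, x). hser a b \<nu> j x)" by (auto simp: continuous_on_eq_continuous_at)
  from continuous_on_compose2[OF this continuous_on_Pair[OF assms]]
  show ?thesis by simp
qed

text \<open>Once Re \<nu> + D is nonnegative, the shifted reciprocal Gamma factor contributes 1 /
  k!, and the generating function of \<open>emaj\<close> at 4 contributes 4^(-k); together they sum
  to exp(y / 4). The rate 1/4 leaves room for a power of y and for the test function, a quarter
  each, in integrals against exp(- y).\<close>

lemma hser_sharp_bound:
  assumes "compact K" "\<And>\<nu>. \<nu> \<in> K ==> Re \<nu> + real D >= 0"
  obtains C where "C > 0"
    "\<And>\<nu> y n. \<nu> \<in> K ==> y >= 0 ==> (\<Sum>k<n. norm (ecoef a b \<nu> k * rGamma (\<nu> + 1 + of_nat (k + D)) * of_real y ^ k)) <= C * exp (y / 4)"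
    "\<And>\<nu> y. \<nu> \<in> K ==> y >= 0 ==> norm (hser a b \<nu> D (of_real y)) <= C * exp (y / 4)"
proof -
  obtain B where B: "B > 0" "\<And>\<nu> m. \<nu> \<in> (%\<nu>. \<nu> + 1) ` K ==> norm (rGamma (\<nu> + of_nat m)) <= B"
    by (rule rGamma_uniformly_bounded[of "(%\<nu>. \<nu> + 1) ` K"])
       (auto intro!: compact_continuous_image assms continuous_intros)
  \<comment> \<open>The value of the generating function at 4. As all terms are nonnegative, it
    bounds each \<open>emaj (norm a) (norm b) k * 4 ^ k\<close>.\<close>
  define E where "E = exp (norm a * norm b * 4\<^sup>2) * exp ((norm a + norm b) * 4)"
  have sm: "(%k. emaj (norm a) (norm b) k * 4 ^ k) sums E"
    unfolding E_def by (rule emaj_sums) auto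
  have E: "emaj (norm a) (norm b) k * 4 ^ k <= E" for k
  proof -
    have "(\<Sum>k\<in>{k}. emaj (norm a) (norm b) k * 4 ^ k) <= E"
      unfolding sums_unique[OF sm] by (rule sum_le_suminf) (use sm emaj_nonneg in \<open>auto simp: sums_iff\<close>)
    then show ?thesis by simp
  qed
  have E0: "E > 0" by (simp add: E_def)
  have 1: "(\<Sum>k<n. norm (ecoef a b \<nu> k * rGamma (\<nu> + 1 + of_nat (k + D)) * of_real y ^ k)) <= (B * B * E) * exp (y / 4)"
    if \<nu>: "\<nu> \<in> K" and y: "y >= 0" for \<nu> y n
  proof -
    have "(\<Sum>k<n. norm (ecoef a b \<nu> k * rGamma (\<nu> + 1 + of_nat (k + D)) * of_real y ^ k))
       <= (\<Sum>k<n. (B * B * E) * ((y / 4) ^ k / fact k))"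
    proof (rule sum_mono)
      fix k
      have a: "norm (ecoef a b \<nu> k) <= B * emaj (norm a) (norm b) k"
        by (rule norm_ecoef_le) (use B(2) \<nu> in auto)
      have "norm (rGamma (\<nu> + 1 + of_nat (k + D))) <= norm (rGamma (\<nu> + 1 + of_nat D)) / fact k"
        using norm_rGamma_shift_le[of "\<nu> + 1 + of_nat D" k] assms(2)[OF \<nu>] by (simp add: add_ac)
      also have "\<dots> <= B / fact k"
        using B(2)[of "\<nu> + 1" D] \<nu> by (intro divide_right_mono) auto
      finally have b: "norm (rGamma (\<nu> + 1 + of_nat (k + D))) <= B / fact k" .
      have "norm (ecoef a b \<nu> k * rGamma (\<nu> + 1 + of_nat (k + D)) * of_real y ^ k)
        <= (B * emaj (norm a) (norm b) k) * (B / fact k) * y ^ k"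
        unfolding norm_mult norm_power using a b y B emaj_nonneg[of "norm a" "norm b" k]
        by (intro mult_mono power_mono) auto
      also have "\<dots> = (B * B / fact k * (y / 4) ^ k) * (emaj (norm a) (norm b) k * 4 ^ k)"
        by (simp add: power_divide)
      also have "\<dots> <= (B * B / fact k * (y / 4) ^ k) * E"
        using B y by (intro mult_left_mono E) auto
      finally show "norm (ecoef a b \<nu> k * rGamma (\<nu> + 1 + of_nat (k + D)) * of_real y ^ k)
        <= (B * B * E) * ((y / 4) ^ k / fact k)" by (simp add: mult_ac)
    qed
    also have "\<dots> = (B * B * E) * (\<Sum>k<n. (y / 4) ^ k / fact k)" by (simp add: sum_distrib_left)
    also have "\<dots> <= (B * B * E) * exp (y / 4)"
    proof (rule mult_left_mono)
      have e: "(%k. (y / 4) ^ k / fact k) sums exp (y / 4)"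
        using exp_converges[of "y / 4"] by (simp add: field_simps)
      show "(\<Sum>k<n. (y / 4) ^ k / fact k) <= exp (y / 4)"
        unfolding sums_unique[OF e] by (rule sum_le_suminf) (use e y in \<open>auto simp: sums_iff\<close>)
    qed (use B E0 in auto)
    finally show ?thesis .
  qed
  show ?thesis
  proof (rule that[of "B * B * E"])
    show "B * B * E > 0" using B E0 by simp
    show "norm (hser a b \<nu> D (of_real y)) <= B * B * E * exp (y / 4)" if "\<nu> \<in> K" "y >= 0" for \<nu> y
    proof (rule Lim_bounded[OF tendsto_norm[OF hser_sums[unfolded sums_def]], of 0], safe)
      fix n
      show "norm (\<Sum>k<n. ecoef a b \<nu> k * rGamma (\<nu> + 1 + of_nat (k + D)) * of_real y ^ k) <= B * B * E * exp (y / 4)"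
        using norm_sum 1[OF that, of n] by (rule order_trans)
    qed
  qed (use 1 in auto)
qed

lemma pow_le_exp_quarter:
  fixes y :: real
  assumes "y >= 0"
  shows "y ^ n <= fact n * 4 ^ n * exp (y / 4)"
proof -
  have e: "(%k. (y / 4) ^ k / fact k) sums exp (y / 4)"
    using exp_converges[of "y / 4"] by (simp add: field_simps)
  have "(\<Sum>k\<in>{n}. (y / 4) ^ k / fact k) <= exp (y / 4)"
    unfolding sums_unique[OF e] by (rule sum_le_suminf) (use e assms in \<open>auto simp: sums_iff\<close>)
  then show ?thesis by (simp add: power_divide field_simps)
qed

text \<open>The constant must not depend on the exponent, because the real part of the order varies
  over a compact set.\<close>

lemma powr_le_exp_quarter:
  fixes P :: real
  assumes "P >= 0"
  obtains C where "C > 0" "\<And>y p. y > 0 ==> 0 <= p ==> p <= P ==> y powr p <= C * exp (y / 4)"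
proof -
  obtain n :: nat where n: "P <= real n" using real_arch_simple by blast
  show ?thesis
  proof (rule that[of "1 + fact n * 4 ^ n"])
    show "(0::real) < 1 + fact n * 4 ^ n" by (simp add: add_pos_pos)
    fix y p :: real assume y: "y > 0" and p: "0 <= p" "p <= P"
    have e1: "exp (y / 4) >= 1" using y by simp
    show "y powr p <= (1 + fact n * 4 ^ n) * exp (y / 4)"
    proof (cases "y >= 1")
      case True
      have "y powr p <= y powr real n" using True p n by (intro powr_mono) auto
      also have "\<dots> = y ^ n" using y by (simp add: powr_realpow)
      also have "\<dots> <= fact n * 4 ^ n * exp (y / 4)" using y by (intro pow_le_exp_quarter) simp
      also have "\<dots> <= (1 + fact n * 4 ^ n) * exp (y / 4)" by simp
      finally show ?thesis .
    next
      case False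
      have "y powr p <= 1" using False y p by (intro powr_le1) auto
      also have "1 <= 1 * exp (y / 4)" using e1 by simp
      also have "\<dots> <= (1 + fact n * 4 ^ n) * exp (y / 4)" by (intro mult_right_mono) auto
      finally show ?thesis .
    qed
  qed
qed

lemma borel_measurable_indicator_continuous:
  fixes f :: "'a::topological_space => 'b::real_normed_vector"
  assumes "continuous_on A f" "A \<in> sets borel"
  shows "(%x. indicator A x *\<^sub>R f x) \<in> borel_measurable borel"
  using borel_measurable_continuous_on_indicator[OF assms(2,1)] .

lemma integrable_exp_indicator:
  assumes "(c::real) > 0"
  shows "integrable lborel (%y. indicator {0<..} y * exp (- c * y))"
proof -
  have "has_bochner_integral lborel (%y. indicator {0<..} y *\<^sub>R (rp y (1 - 1) * of_real (exp (- c * y)))) (Gamma 1 * rp c (- 1))"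
    by (rule has_bochner_integral_Gamma) (use assms in auto)
  then have "integrable lborel (%y. indicator {0<..} y *\<^sub>R (complex_of_real (exp (- c * y))))"
    by (simp add: has_bochner_integral_iff)
  from integrable_norm[OF this] show ?thesis
    by (rule back_subst[of "integrable lborel"]) (auto simp: indicator_def)
qed

text \<open>I_\<nu>(2 sqrt(A y)) without the factor A^(\<nu> / 2), hence meaningful for every real
  A. Up to constants it is an ordinary Bessel function for A < 0 and a power for A = 0, so the sign
  of A needs no case distinction.\<close>

definition ifun :: "real => complex => real => complex" where
  "ifun A \<nu> y = rp y (\<nu> / 2) * clif \<nu> (of_real (A * y))"

text \<open>The j-fold antiderivative in \<open>y\<close> of
  \<open>ifun A \<nu> (t * y) * ifun 1 \<nu> (b * y)\<close>, with the constants of integration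
  chosen as in \<open>hser\<close>.\<close>

definition Hc :: "real => real => real => complex => nat => real => complex" where
  "Hc A t b \<nu> j y = rp (t * b) (\<nu> / 2) * rp y (\<nu> + of_nat j) * hser (of_real (A * t)) (of_real b) \<nu> j (of_real y)"

lemma continuous_on_ifun [continuous_intros]:
  assumes "continuous_on S f" "continuous_on S g" "\<And>a. a \<in> S ==> g a > 0"
  shows "continuous_on S (%a. ifun A (f a) (g a))"
  unfolding ifun_def by (intro continuous_intros assms) auto

lemma continuous_on_Hc [continuous_intros]:
  assumes "continuous_on S f" "continuous_on S g" "\<And>a. a \<in> S ==> g a > 0" "t > 0" "b > 0"
  shows "continuous_on S (%a. Hc A t b (f a) j (g a))"
  unfolding Hc_def by (intro continuous_intros assms) (use assms in auto)

lemma Hc_0: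
  assumes "t > 0" "b > 0" "y > 0"
  shows "Hc A t b \<nu> 0 y = ifun A \<nu> (t * y) * ifun 1 \<nu> (b * y)"
proof -
  have "rp y \<nu> = rp y (\<nu> / 2) * rp y (\<nu> / 2)" by (simp flip: rp_add)
  then show ?thesis
    using assms by (simp add: Hc_def ifun_def hser_0 rp_mult mult_ac)
qed

lemma has_vector_derivative_Hc:
  assumes "y > 0"
  shows "(Hc A t b \<nu> (Suc j) has_vector_derivative Hc A t b \<nu> j y) (at y)"
proof -
  let ?a = "complex_of_real (A * t)" and ?b = "complex_of_real b"
  obtain D where D: "(hser ?a ?b \<nu> (Suc j) has_field_derivative D) (at (of_real y))"
    "(\<nu> + 1 + of_nat j) * hser ?a ?b \<nu> (Suc j) (of_real y) + of_real y * D = hser ?a ?b \<nu> j (of_real y)"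
    by (rule hser_Suc_derivative)
  have "((%y. hser ?a ?b \<nu> (Suc j) (of_real y)) has_vector_derivative D) (at y)"
    using has_vector_derivative_real_field[OF D(1)] by simp
  from has_vector_derivative_mult[OF has_vector_derivative_rp[OF assms, of "\<nu> + of_nat (Suc j)"] this]
  have "((%y. rp y (\<nu> + of_nat (Suc j)) * hser ?a ?b \<nu> (Suc j) (of_real y)) has_vector_derivative
     rp y (\<nu> + of_nat (Suc j)) * D + (\<nu> + of_nat (Suc j)) * rp y (\<nu> + of_nat (Suc j)) / of_real y * hser ?a ?b \<nu> (Suc j) (of_real y)) (at y)" .
  moreover have "rp y (\<nu> + of_nat (Suc j)) * D + (\<nu> + of_nat (Suc j)) * rp y (\<nu> + of_nat (Suc j)) / of_real y * h
      = rp y (\<nu> + of_nat j) * ((\<nu> + 1 + of_nat j) * h + of_real y * D)" for h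
  proof -
    have r: "rp y (\<nu> + of_nat (Suc j)) = rp y (\<nu> + of_nat j) * of_real y"
      using rp_add[of y "\<nu> + of_nat j" 1] rp_one[OF assms] by (simp add: add_ac)
    have "R * of_real y * D + (\<nu> + of_nat (Suc j)) * (R * of_real y) / of_real y * h
       = R * ((\<nu> + 1 + of_nat j) * h + of_real y * D)" for R
      using assms by (simp add: field_simps)
    then show ?thesis unfolding r .
  qed
  ultimately have "((%y. rp y (\<nu> + of_nat (Suc j)) * hser ?a ?b \<nu> (Suc j) (of_real y)) has_vector_derivative
     rp y (\<nu> + of_nat j) * ((\<nu> + 1 + of_nat j) * hser ?a ?b \<nu> (Suc j) (of_real y) + of_real y * D)) (at y)"
    by (simp only:)
  from has_vector_derivative_mult_right[OF this[unfolded D(2)], of "rp (t * b) (\<nu> / 2)"]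
  show ?thesis unfolding Hc_def[abs_def] by (simp add: mult.assoc)
qed

text \<open>The bound for the partial sums dominates the termwise Laplace integral; the bound for
  the limit dominates integrals over a curve of orders.\<close>

lemma Hc_bound:
  assumes "compact K" "\<And>\<nu>. \<nu> \<in> K ==> Re \<nu> + real D >= 0" "t > 0" "b > 0"
  obtains C where "C > 0"
    "\<And>\<nu> y n. \<nu> \<in> K ==> y > 0 ==> norm (rp (t * b) (\<nu> / 2) * rp y (\<nu> + of_nat D) *
       (\<Sum>k<n. ecoef (of_real (A * t)) (of_real b) \<nu> k * rGamma (\<nu> + 1 + of_nat (k + D)) * of_real y ^ k)) <= C * exp (y / 2)"
    "\<And>\<nu> y. \<nu> \<in> K ==> y > 0 ==> norm (Hc A t b \<nu> D y) <= C * exp (y / 2)"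
proof -
  let ?a = "complex_of_real (A * t)" and ?b = "complex_of_real b"
  obtain R where R: "\<And>\<nu>. \<nu> \<in> K ==> norm \<nu> <= R" using compact_imp_bounded[OF assms(1)] bounded_iff by blast
  obtain C1 where C1: "C1 > 0"
    "\<And>\<nu> y n. \<nu> \<in> K ==> y >= 0 ==> (\<Sum>k<n. norm (ecoef ?a ?b \<nu> k * rGamma (\<nu> + 1 + of_nat (k + D)) * of_real y ^ k)) <= C1 * exp (y / 4)"
    "\<And>\<nu> y. \<nu> \<in> K ==> y >= 0 ==> norm (hser ?a ?b \<nu> D (of_real y)) <= C1 * exp (y / 4)"
    using hser_sharp_bound[OF assms(1,2), where a="?a" and b="?b"] by blast
  obtain C2 where C2: "C2 > 0" "\<And>y p. y > 0 ==> 0 <= p ==> p <= \<bar>R\<bar> + real D ==> y powr p <= C2 * exp (y / 4)"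
    by (rule powr_le_exp_quarter[of "\<bar>R\<bar> + real D"]) auto
  have "compact ((%\<nu>. rp (t * b) (\<nu> / 2)) ` K)"
    using assms by (intro compact_continuous_image continuous_intros) auto
  from compact_imp_bounded[OF this]
  obtain C3 where C3: "\<And>\<nu>. \<nu> \<in> K ==> norm (rp (t * b) (\<nu> / 2)) <= C3"
    by (auto simp: bounded_iff)
  have pre: "norm (rp (t * b) (\<nu> / 2) * rp y (\<nu> + of_nat D) * z) <= (\<bar>C3\<bar> * C2 * C1 + 1) * exp (y / 2)"
    if \<nu>: "\<nu> \<in> K" and y: "y > 0" and z: "norm z <= C1 * exp (y / 4)" for \<nu> y z
  proof -
    have "norm (rp y (\<nu> + of_nat D)) <= C2 * exp (y / 4)"
      using C2(2)[of y "Re \<nu> + real D"] assms(2)[OF \<nu>] y R[OF \<nu>] abs_Re_le_cmod[of \<nu>] by (simp add: norm_rp)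
    then have "norm (rp (t * b) (\<nu> / 2) * rp y (\<nu> + of_nat D) * z) <= \<bar>C3\<bar> * (C2 * exp (y / 4)) * (C1 * exp (y / 4))"
      unfolding norm_mult using C3[OF \<nu>] C2(1) z by (intro mult_mono) auto
    also have "\<dots> = \<bar>C3\<bar> * C2 * C1 * exp (y / 2)" by (simp add: mult_ac flip: exp_add)
    also have "\<dots> <= (\<bar>C3\<bar> * C2 * C1 + 1) * exp (y / 2)" by (simp add: distrib_right)
    finally show ?thesis .
  qed
  show ?thesis
  proof (rule that[of "\<bar>C3\<bar> * C2 * C1 + 1"])
    show "0 < \<bar>C3\<bar> * C2 * C1 + 1" using C1 C2 by (simp add: add_nonneg_pos)
  next
    fix \<nu> and y :: real and n assume "\<nu> \<in> K" "y > 0"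
    then show "norm (rp (t * b) (\<nu> / 2) * rp y (\<nu> + of_nat D) *
       (\<Sum>k<n. ecoef ?a ?b \<nu> k * rGamma (\<nu> + 1 + of_nat (k + D)) * of_real y ^ k)) <= (\<bar>C3\<bar> * C2 * C1 + 1) * exp (y / 2)"
      using C1(2)[of \<nu> y n] by (intro pre order_trans[OF norm_sum]) auto
  next
    fix \<nu> and y :: real assume "\<nu> \<in> K" "y > 0"
    then show "norm (Hc A t b \<nu> D y) <= (\<bar>C3\<bar> * C2 * C1 + 1) * exp (y / 2)"
      unfolding Hc_def using C1(3)[of \<nu> y] by (intro pre) auto
  qed
qed

text \<open>The elementary factor in Weber's integral with a = A t. One power of 1 / s belongs to
  the integral itself, the other D come from the D-fold antiderivative.\<close>

definition laplace_ifun :: "real => real => real => nat => real => real" where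
  "laplace_ifun A t b D s = exp ((A * t + b) / s) / s ^ Suc D"

text \<open>Weber's second exponential integral, integrated term by term: Euler's integral cancels
  the shifted reciprocal Gamma factor, and what is left is the generating series
  \<open>ecoef_sums\<close> at u = 1 / s. The shift by D makes every term integrable at 0.\<close>

lemma laplace_Hc:
  assumes "Re \<nu> + real D >= 0" "t > 0" "b > 0" "s >= 1"
  shows "has_bochner_integral lborel (%y. indicator {0<..} y *\<^sub>R (of_real (exp (- s * y)) * Hc A t b \<nu> D y))
     (of_real (laplace_ifun A t b D s) * ifun A \<nu> (t * b / s\<^sup>2))"
proof -
  let ?a = "complex_of_real (A * t)" and ?b = "complex_of_real b" and ?P = "rp (t * b) (\<nu> / 2)"
  let ?e = "ecoef ?a ?b \<nu>" and ?r = "%k. rGamma (\<nu> + 1 + of_nat (k + D))"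
  have s: "s > 0" using assms by simp
  obtain C where C: "C > 0"
    "\<And>y n. y > 0 ==> norm (?P * rp y (\<nu> + of_nat D) * (\<Sum>k<n. ?e k * ?r k * of_real y ^ k)) <= C * exp (y / 2)"
    by (rule Hc_bound[of "{\<nu>}" D t b A]) (use assms in auto)
  let ?f = "%k y. indicator {0<..} y *\<^sub>R (of_real (exp (- s * y)) * (?P * rp y (\<nu> + of_nat D) * (?e k * ?r k * of_real y ^ k)))"
  let ?F = "%y. indicator {0<..} y *\<^sub>R (of_real (exp (- s * y)) * Hc A t b \<nu> D y)"
  have term_int: "has_bochner_integral lborel (?f k) (?P * ?e k * rp s (- (\<nu> + of_nat D + 1)) * of_real (1 / s) ^ k)" for k
  proof -
    let ?z = "\<nu> + 1 + of_nat (k + D)"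
    have z: "Re ?z > 0" using assms by simp
    have nz: "Gamma ?z * rGamma ?z = 1"
    proof -
      have "?z \<notin> \<int>\<^sub>\<le>\<^sub>0"
      proof
        assume "?z \<in> \<int>\<^sub>\<le>\<^sub>0"
        then obtain n where n: "?z = of_int n" "n <= 0" by (auto elim!: nonpos_Ints_cases)
        have "Re ?z = of_int n" unfolding n(1) by simp
        with z n(2) show False by linarith
      qed
      then show ?thesis by (simp add: rGamma_inverse_Gamma Gamma_eq_zero_iff)
    qed
    have "has_bochner_integral lborel (%y. (?P * ?e k * ?r k) * (indicator {0<..} y *\<^sub>R (rp y (?z - 1) * of_real (exp (- s * y)))))
       ((?P * ?e k * ?r k) * (Gamma ?z * rp s (- ?z)))"
      by (intro has_bochner_integral_mult_right has_bochner_integral_Gamma z s)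
    moreover have "(%y. (?P * ?e k * ?r k) * (indicator {0<..} y *\<^sub>R (rp y (?z - 1) * of_real (exp (- s * y))))) = ?f k"
    proof
      fix y :: real
      show "(?P * ?e k * ?r k) * (indicator {0<..} y *\<^sub>R (rp y (?z - 1) * of_real (exp (- s * y)))) = ?f k y"
      proof (cases "y > 0")
        case True
        have "rp y (?z - 1) = rp y (\<nu> + of_nat D) * of_real y ^ k"
          using rp_add[of y "\<nu> + of_nat D" "of_nat k"] rp_of_nat[OF True, of k] by (simp add: add_ac)
        then show ?thesis using True by (simp add: mult_ac)
      qed simp
    qed
    moreover have "(?P * ?e k * ?r k) * (Gamma ?z * rp s (- ?z)) = ?P * ?e k * rp s (- (\<nu> + of_nat D + 1)) * of_real (1 / s) ^ k"
    proof -
      have "rp s (- ?z) = rp s (- (\<nu> + of_nat D + 1)) * of_real (1 / s) ^ k"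
        using rp_add[of s "- (\<nu> + of_nat D + 1)" "- of_nat k"] rp_of_nat[OF s, of k]
        by (simp add: rp_minus algebra_simps power_divide divide_inverse power_inverse)
      then have "(?P * ?e k * ?r k) * (Gamma ?z * rp s (- ?z))
         = (?P * ?e k) * (Gamma ?z * ?r k) * (rp s (- (\<nu> + of_nat D + 1)) * of_real (1 / s) ^ k)" by simp
      then show ?thesis unfolding nz by simp
    qed
    ultimately show ?thesis by (simp only:)
  qed
  have part: "has_bochner_integral lborel (%y. \<Sum>k<n. ?f k y)
     (\<Sum>k<n. ?P * ?e k * rp s (- (\<nu> + of_nat D + 1)) * of_real (1 / s) ^ k)" for n
    by (intro has_bochner_integral_sum term_int)
  have sumf: "(\<Sum>k<n. ?f k y) = indicator {0<..} y *\<^sub>R (of_real (exp (- s * y)) *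
      (?P * rp y (\<nu> + of_nat D) * (\<Sum>k<n. ?e k * ?r k * of_real y ^ k)))" for n y
    by (simp add: sum_distrib_left scaleR_sum_right)
  \<comment> \<open>The growth exp(y / 2) from \<open>Hc_bound\<close> against exp(- s y) with s at
    least 1 leaves exp(- y / 2).\<close>
  let ?w = "%y. C * (indicator {0<..} y * exp (- (1/2) * y))"
  have w: "integrable lborel ?w" by (intro integrable_mult_right integrable_exp_indicator) simp
  have bnd: "norm (\<Sum>k<n. ?f k y) <= ?w y" for n y
  proof (cases "y > 0")
    case True
    have "norm (\<Sum>k<n. ?f k y) <= exp (- s * y) * (C * exp (y / 2))"
      unfolding sumf using C(2)[OF True, of n] True by (simp add: norm_mult)
    also have "\<dots> = C * exp (- s * y + y / 2)" by (simp flip: exp_add)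
    also have "\<dots> <= C * exp (- (1/2) * y)" using True assms(4) C(1) by simp
    finally show ?thesis using True by simp
  qed simp
  have lim: "(%n. \<Sum>k<n. ?f k y) \<longlonglongrightarrow> ?F y" for y
    unfolding sumf Hc_def
    by (intro tendsto_intros hser_sums[unfolded sums_def])
  have Fm: "?F \<in> borel_measurable lborel"
  proof -
    have "continuous_on {0<..} (%y. of_real (exp (- s * y)) * Hc A t b \<nu> D y)"
      using assms by (intro continuous_intros) auto
    from borel_measurable_indicator_continuous[OF this] show ?thesis by simp
  qed
  have fm: "(%y. \<Sum>k<n. ?f k y) \<in> borel_measurable lborel" for n
    using part[of n] has_bochner_integral_iff borel_measurable_integrable by blast
  have I: "integrable lborel ?F"
    by (rule integrable_dominated_convergence[OF Fm fm w AE_I2[OF lim] AE_I2[OF bnd]])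
  have L: "(%n. integral\<^sup>L lborel (%y. \<Sum>k<n. ?f k y)) \<longlonglongrightarrow> integral\<^sup>L lborel ?F"
    by (rule integral_dominated_convergence[OF Fm fm w AE_I2[OF lim] AE_I2[OF bnd]])
  have "(%k. ?P * ?e k * rp s (- (\<nu> + of_nat D + 1)) * of_real (1 / s) ^ k) sums integral\<^sup>L lborel ?F"
    using L unfolding sums_def has_bochner_integral_integral_eq[OF part] .
  moreover have "(%k. ?P * rp s (- (\<nu> + of_nat D + 1)) * (?e k * of_real (1 / s) ^ k)) sums
     (?P * rp s (- (\<nu> + of_nat D + 1)) * (clif \<nu> (?a * ?b * (of_real (1 / s))\<^sup>2) * exp ((?a + ?b) * of_real (1 / s))))"
    by (intro sums_mult ecoef_sums)
  ultimately have "integral\<^sup>L lborel ?F =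
     ?P * rp s (- (\<nu> + of_nat D + 1)) * (clif \<nu> (?a * ?b * (of_real (1 / s))\<^sup>2) * exp ((?a + ?b) * of_real (1 / s)))"
    by (simp add: mult_ac sums_unique2)
  also have "\<dots> = of_real (laplace_ifun A t b D s) * ifun A \<nu> (t * b / s\<^sup>2)"
  proof -
    have 1: "rp s (- (\<nu> + of_nat D + 1)) = rp s (- \<nu>) * of_real (1 / s ^ Suc D)"
    proof -
      have e: "- (\<nu> + of_nat D + 1) = - \<nu> + - of_nat (Suc D)" by simp
      show ?thesis unfolding e rp_add rp_minus[of s "of_nat (Suc D)"] rp_of_nat[OF s]
        by (simp add: divide_inverse)
    qed
    have 2: "rp (t * b / s\<^sup>2) (\<nu> / 2) = ?P * rp s (- \<nu>)"
    proof -
      have "ln (t * b / s\<^sup>2) = ln (t * b) - 2 * ln s"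
        using assms s by (simp add: ln_div ln_realpow)
      moreover have "\<nu> / 2 * of_real (l1 - 2 * l2) = \<nu> / 2 * of_real l1 + - \<nu> * of_real l2" for l1 l2
        by (simp add: field_simps)
      ultimately show ?thesis by (simp only: rp_def exp_add)
    qed
    have 3: "?a * ?b * (of_real (1 / s))\<^sup>2 = of_real (A * (t * b / s\<^sup>2))"
      by (simp add: power_divide)
    have 4: "exp ((?a + ?b) * of_real (1 / s)) = of_real (exp ((A * t + b) / s))"
      by (simp flip: exp_of_real)
    show ?thesis unfolding 1 3 4 ifun_def 2 laplace_ifun_def by simp
  qed
  finally show ?thesis using I by (simp add: has_bochner_integral_iff)
qed

text \<open>A kernel M(y, x) reproduces the weight v when some D-fold antiderivative of M(\<tau> y,
  b y) has the Laplace transform that Weber's integral predicts. For products of equal order this is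
  \<open>laplace_Hc\<close>. All clauses are linear in the pair (v, M), so the property passes to
  combinations, superpositions and real parts.\<close>

definition cgood_rep :: "real => nat => (real => complex) => (real => real => complex) =>
    (real => real => nat => real => complex) => bool" where
  "cgood_rep A D v M H \<longleftrightarrow> (\<forall>\<tau>>0. \<forall>b>0.
      (\<forall>y>0. H \<tau> b 0 y = M (\<tau> * y) (b * y)) \<and>
      (\<forall>j<D. \<forall>y>0. (H \<tau> b (Suc j) has_vector_derivative H \<tau> b j y) (at y)) \<and>
      continuous_on {0<..} (H \<tau> b D) \<and>
      (\<exists>C. \<forall>y>0. norm (H \<tau> b D y) <= C * exp (y / 2)) \<and>
      (\<forall>s\<ge>1. has_bochner_integral lborel (%y. indicator {0<..} y *\<^sub>R (of_real (exp (- s * y)) * H \<tau> b D y))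
         (of_real (laplace_ifun A \<tau> b D s) * v (\<tau> * b / s\<^sup>2))))"

definition cgood :: "real => nat => (real => complex) => (real => real => complex) => bool" where
  "cgood A D v M \<longleftrightarrow> (\<exists>H. cgood_rep A D v M H)"

lemma cgood_lincomb:
  assumes "cgood A D v M" "cgood A D v' M'"
  shows "cgood A D (%y. \<alpha> * v y + \<beta> * v' y) (%y x. \<alpha> * M y x + \<beta> * M' y x)"
proof -
  obtain H H' where H: "cgood_rep A D v M H" and H': "cgood_rep A D v' M' H'"
    using assms unfolding cgood_def by blast
  define G where "G \<tau> b j y = \<alpha> * H \<tau> b j y + \<beta> * H' \<tau> b j y" for \<tau> b j y
  show ?thesis
    unfolding cgood_def cgood_rep_def
  proof (intro exI[of _ G] allI impI conjI)
    fix \<tau> b :: real assume p: "\<tau> > 0" "b > 0"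
    note H = H[unfolded cgood_rep_def, rule_format, OF p] and H' = H'[unfolded cgood_rep_def, rule_format, OF p]
    show "G \<tau> b 0 y = \<alpha> * M (\<tau> * y) (b * y) + \<beta> * M' (\<tau> * y) (b * y)" if "y > 0" for y
      using H H' that by (simp add: G_def)
    show "(G \<tau> b (Suc j) has_vector_derivative G \<tau> b j y) (at y)" if "j < D" "y > 0" for j y
      unfolding G_def using H H' that by (intro has_vector_derivative_add has_vector_derivative_mult_right) blast+
    show "continuous_on {0<..} (G \<tau> b D)"
      unfolding G_def using H H' by (intro continuous_intros) blast+
    obtain C C' where C: "\<forall>y>0. norm (H \<tau> b D y) <= C * exp (y / 2)" "\<forall>y>0. norm (H' \<tau> b D y) <= C' * exp (y / 2)"
      using H H' by blast
    show "\<exists>C. \<forall>y>0. norm (G \<tau> b D y) <= C * exp (y / 2)"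
    proof (intro exI[of _ "norm \<alpha> * C + norm \<beta> * C'"] allI impI)
      fix y :: real assume y: "y > 0"
      have "norm (G \<tau> b D y) <= norm \<alpha> * norm (H \<tau> b D y) + norm \<beta> * norm (H' \<tau> b D y)"
        unfolding G_def by (metis norm_mult norm_triangle_ineq)
      also have "\<dots> <= norm \<alpha> * (C * exp (y / 2)) + norm \<beta> * (C' * exp (y / 2))"
        using C y by (intro add_mono mult_left_mono) auto
      finally show "norm (G \<tau> b D y) <= (norm \<alpha> * C + norm \<beta> * C') * exp (y / 2)" by (simp add: algebra_simps)
    qed
    fix s :: real assume s: "s >= 1"
    have "has_bochner_integral lborel (%y. \<alpha> * (indicator {0<..} y *\<^sub>R (of_real (exp (- s * y)) * H \<tau> b D y))
         + \<beta> * (indicator {0<..} y *\<^sub>R (of_real (exp (- s * y)) * H' \<tau> b D y)))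
         (\<alpha> * (of_real (laplace_ifun A \<tau> b D s) * v (\<tau> * b / s\<^sup>2)) + \<beta> * (of_real (laplace_ifun A \<tau> b D s) * v' (\<tau> * b / s\<^sup>2)))"
      using H H' s by (intro has_bochner_integral_add has_bochner_integral_mult_right) blast+
    then show "has_bochner_integral lborel (%y. indicator {0<..} y *\<^sub>R (of_real (exp (- s * y)) * G \<tau> b D y))
         (of_real (laplace_ifun A \<tau> b D s) * (\<alpha> * v (\<tau> * b / s\<^sup>2) + \<beta> * v' (\<tau> * b / s\<^sup>2)))"
      by (simp add: G_def algebra_simps)
  qed
qed

text \<open>
  Superpositions over a curve in the \<open>\<nu>\<close>-plane; differentiation in \<open>\<nu>\<close>, needed for the
  logarithmic solutions, is such a superposition by Cauchy's formula.
\<close>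
lemma cgood_superposition:
  fixes \<nu> w :: "real => complex"
  assumes cont: "continuous_on {0..1} \<nu>" "continuous_on {0..1} w"
    and Re: "\<And>t. t \<in> {0..1} ==> Re (\<nu> t) + real D >= 0"
  shows "cgood A D (%y. integral {0..1} (%t. w t * ifun A (\<nu> t) y))
      (%y x. integral {0..1} (%t. w t * (ifun A (\<nu> t) y * ifun 1 (\<nu> t) x)))"
proof -
  define H where "H \<tau> b j y = integral {0..1} (%t. w t * Hc A \<tau> b (\<nu> t) j y)" for \<tau> b j y
  have cmp: "compact (\<nu> ` {0..1})" by (intro compact_continuous_image cont) auto
  obtain W where W: "\<And>t. t \<in> {0..1} ==> norm (w t) <= W"
  proof -
    have "compact (w ` {0..1})" by (intro compact_continuous_image cont) auto
    from compact_imp_bounded[OF this] obtain a where "\<forall>z\<in>w ` {0..1}. norm z <= a" unfolding bounded_iff by blast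
    then show ?thesis by (intro that[of a]) auto
  qed
  have W0: "W >= 0" using order_trans[OF norm_ge_zero W[of 0]] by simp
  show ?thesis
    unfolding cgood_def cgood_rep_def
  proof (intro exI[of _ H] allI impI conjI)
    fix \<tau> b :: real assume p: "\<tau> > 0" "b > 0"
    have cc: "continuous_on ({0<..} \<times> {0..1}) (%(y, t). w t * Hc A \<tau> b (\<nu> t) j y)" for j
    proof -
      have "continuous_on ({0<..} \<times> {0..1}) (%p. w (snd p))" "continuous_on ({0<..} \<times> {0..1}) (%p. \<nu> (snd p))"
        by (rule continuous_on_compose2[OF cont(2)] continuous_on_compose2[OF cont(1)]; auto intro!: continuous_intros)+
      then show ?thesis using p by (auto simp: case_prod_unfold intro!: continuous_intros)
    qed
    have ct: "continuous_on {0..1} (%t. w t * Hc A \<tau> b (\<nu> t) j y)" if "y > 0" for j y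
      using that p by (intro continuous_intros cont) auto
    show "H \<tau> b 0 y = integral {0..1} (%t. w t * (ifun A (\<nu> t) (\<tau> * y) * ifun 1 (\<nu> t) (b * y)))" if "y > 0" for y
      unfolding H_def using Hc_0[OF p that] by simp
    show "(H \<tau> b (Suc j) has_vector_derivative H \<tau> b j y) (at y)" if "j < D" "y > 0" for j y
    proof -
      have "((%y. integral (cbox 0 1) (%t. w t * Hc A \<tau> b (\<nu> t) (Suc j) y)) has_vector_derivative
         integral (cbox 0 1) (%t. w t * Hc A \<tau> b (\<nu> t) j y)) (at y within {0<..})"
      proof (rule leibniz_rule_vector_derivative)
        fix x t :: real assume "x \<in> {0<..}" "t \<in> cbox 0 1"
        then show "((%x. w t * Hc A \<tau> b (\<nu> t) (Suc j) x) has_vector_derivative w t * Hc A \<tau> b (\<nu> t) j x) (at x within {0<..})"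
          by (intro has_vector_derivative_mult_right has_vector_derivative_at_within[OF has_vector_derivative_Hc]) auto
      next
        fix x :: real assume "x \<in> {0<..}"
        then show "(%t. w t * Hc A \<tau> b (\<nu> t) (Suc j) x) integrable_on cbox 0 1"
          using ct[of x "Suc j"] by (intro integrable_continuous) (simp add: cbox_interval)
      next
        show "continuous_on ({0<..} \<times> cbox 0 1) (%(x, t). w t * Hc A \<tau> b (\<nu> t) j x)"
          using cc[of j] by (simp add: cbox_interval)
      qed (use that in auto)
      then show ?thesis unfolding H_def[abs_def] using that
        by (simp add: at_within_open[of y "{0<..}"])
    qed
    obtain C where C: "C > 0" "\<And>t y. t \<in> {0..1} ==> y > 0 ==> norm (Hc A \<tau> b (\<nu> t) D y) <= C * exp (y / 2)"
      by (rule Hc_bound[of "\<nu> ` {0..1}" D \<tau> b A]) (use cmp p Re in auto)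
    have wH: "norm (w t * Hc A \<tau> b (\<nu> t) D y) <= W * C * exp (y / 2)" if "t \<in> {0..1}" "y > 0" for t y
    proof -
      have "norm (w t * Hc A \<tau> b (\<nu> t) D y) <= W * (C * exp (y / 2))"
        unfolding norm_mult using W[OF that(1)] C(2)[OF that] W0 by (intro mult_mono) auto
      then show ?thesis by (simp add: mult_ac)
    qed
    show "continuous_on {0<..} (H \<tau> b D)"
    proof (rule continuous_at_imp_continuous_on, safe)
      fix y :: real assume y: "y > 0"
      have "continuous_on {y/2..2*y} (%y. integral (cbox 0 1) (%t. w t * Hc A \<tau> b (\<nu> t) D y))"
        by (rule integral_continuous_on_param, rule continuous_on_subset[OF cc[of D]]) (use y in \<open>auto simp: cbox_interval\<close>)
      then have "continuous_on {y/2..2*y} (H \<tau> b D)" unfolding H_def[abs_def] by (simp add: cbox_interval)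
      moreover have "y \<in> interior {y/2..2*y}" using y by (simp add: interior_atLeastAtMost_real)
      ultimately show "isCont (H \<tau> b D) y" by (rule continuous_on_interior)
    qed
    show "\<exists>C. \<forall>y>0. norm (H \<tau> b D y) <= C * exp (y / 2)"
    proof (intro exI[of _ "W * C"] allI impI)
      fix y :: real assume y: "y > 0"
      have "norm (integral {0..1} (%t. w t * Hc A \<tau> b (\<nu> t) D y)) <= W * C * exp (y / 2) * (1 - 0)"
        by (rule integral_bound[OF _ ct[OF y]]) (use wH y in auto)
      then show "norm (H \<tau> b D y) <= W * C * exp (y / 2)" by (simp add: H_def)
    qed
    fix s :: real assume s: "s >= 1"
    let ?L = "of_real (laplace_ifun A \<tau> b D s) :: complex"
    let ?f = "%t y. indicator {0..1} t *\<^sub>R (w t * (indicator {0<..} y *\<^sub>R (of_real (exp (- s * y)) * Hc A \<tau> b (\<nu> t) D y)))"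
    have m: "(%(t, y). ?f t y) \<in> borel_measurable (lborel \<Otimes>\<^sub>M lborel)"
    proof -
      have "continuous_on ({0..1} \<times> {0<..}) (%(t, y). of_real (exp (- s * y)) * (w t * Hc A \<tau> b (\<nu> t) D y))"
      proof -
        have "continuous_on ({0..1} \<times> {0<..}) (%q. (%(y, t). w t * Hc A \<tau> b (\<nu> t) D y) (snd q, fst q))"
          by (rule continuous_on_compose2[OF cc[of D]]) (auto intro!: continuous_intros)
        then show ?thesis by (auto simp: case_prod_unfold intro!: continuous_intros)
      qed
      moreover have "({0..1} \<times> {0<..} :: (real \<times> real) set) \<in> sets borel"
        by (intro borel_Times) auto
      ultimately have "(%q. indicator ({0..1} \<times> {0<..}) q *\<^sub>R (%(t, y). of_real (exp (- s * y)) * (w t * Hc A \<tau> b (\<nu> t) D y)) q)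
          \<in> borel_measurable borel"
        by (rule borel_measurable_indicator_continuous)
      moreover have "(%q. indicator ({0..1} \<times> {0<..}) q *\<^sub>R (%(t, y). of_real (exp (- s * y)) * (w t * Hc A \<tau> b (\<nu> t) D y)) q)
          = (%(t, y). ?f t y)"
        by (rule ext) (auto simp: indicator_def)
      ultimately show ?thesis by (simp add: lborel_prod)
    qed
    \<comment> \<open>A product bound, integrable in both variables, which justifies exchanging the
      integral over the curve with the Laplace integral.\<close>
    have nf: "norm (?f t y) <= indicator {0..1} t * (W * C * (indicator {0<..} y * exp (- (1/2) * y)))" for t y
    proof (cases "t \<in> {0..1} \<and> y > 0")
      case True
      have "norm (?f t y) = exp (- s * y) * norm (w t * Hc A \<tau> b (\<nu> t) D y)" using True by (simp add: norm_mult)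
      also have "\<dots> <= exp (- s * y) * (W * C * exp (y / 2))" using wH True by (intro mult_left_mono) auto
      also have "\<dots> = W * C * exp (- s * y + y / 2)" by (simp flip: exp_add)
      also have "\<dots> <= W * C * exp (- (1/2) * y)"
        using True s C(1) W0 by (intro mult_left_mono) auto
      finally show ?thesis using True by simp
    qed (auto simp: indicator_def)
    have int_y: "integrable lborel (%y. ?f t y)" for t
    proof (cases "t \<in> {0..1}")
      case True
      have "integrable lborel (%y. w t * (indicator {0<..} y *\<^sub>R (of_real (exp (- s * y)) * Hc A \<tau> b (\<nu> t) D y)))"
        using laplace_Hc[OF Re[OF True] p s] by (intro integrable_mult_right) (simp add: has_bochner_integral_iff)
      then show ?thesis by (rule integrable_scaleR_right)
    qed simp
    have I: "integrable (lborel \<Otimes>\<^sub>M lborel) (%(t, y). ?f t y)"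
    proof (rule lborel_pair.Fubini_integrable[OF m])
      let ?c = "W * C * integral\<^sup>L lborel (%y. indicator {0<..} y * exp (- (1/2) * y))"
      have ie: "integrable lborel (%y. W * C * (indicator {0<..} y * exp (- (1/2) * y)))"
        by (intro integrable_mult_right integrable_exp_indicator) simp
      have "integrable lborel (%t. indicator {0..1::real} t * ?c)"
        by (intro integrable_mult_left integrable_real_indicator) auto
      then show "integrable lborel (%t. \<integral>y. norm ((%(t, y). ?f t y) (t, y)) \<partial>lborel)"
      proof (rule Bochner_Integration.integrable_bound)
        show "(%t. \<integral>y. norm ((%(t, y). ?f t y) (t, y)) \<partial>lborel) \<in> borel_measurable lborel"
        proof -
          have "(%(t, y). norm (?f t y)) \<in> borel_measurable (lborel \<Otimes>\<^sub>M lborel)"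
            using measurable_compose[OF m borel_measurable_norm] by (simp only: case_prod_unfold)
          from lborel.borel_measurable_lebesgue_integral[OF this] show ?thesis by (simp only: prod.case)
        qed
        show "AE t in lborel. norm (\<integral>y. norm ((%(t, y). ?f t y) (t, y)) \<partial>lborel) <= norm (indicator {0..1} t * ?c)"
        proof (rule AE_I2)
          fix t :: real
          have "(\<integral>y. norm (?f t y) \<partial>lborel) <= (\<integral>y. indicator {0..1} t * (W * C * (indicator {0<..} y * exp (- (1/2) * y))) \<partial>lborel)"
            by (intro integral_mono integrable_norm int_y integrable_mult_right[OF ie] nf)
          also have "\<dots> = indicator {0..1} t * ?c" by simp
          finally show "norm (\<integral>y. norm ((%(t, y). ?f t y) (t, y)) \<partial>lborel) <= norm (indicator {0..1} t * ?c)"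
            by simp
        qed
      qed
      show "AE t in lborel. integrable lborel (%y. (%(t, y). ?f t y) (t, y))"
        using int_y by simp
    qed
    have inner_t: "(\<integral>t. ?f t y \<partial>lborel) = indicator {0<..} y *\<^sub>R (of_real (exp (- s * y)) * H \<tau> b D y)" for y
    proof (cases "y > 0")
      case True
      have "set_integrable lborel {0..1} (%t. w t * Hc A \<tau> b (\<nu> t) D y)"
        by (rule borel_integrable_atLeastAtMost'[OF ct[OF True]])
      from set_borel_integral_eq_integral(2)[OF this]
      have "(\<integral>t. indicator {0..1} t *\<^sub>R (w t * Hc A \<tau> b (\<nu> t) D y) \<partial>lborel) = H \<tau> b D y"
        unfolding H_def set_lebesgue_integral_def .
      moreover have "(\<integral>t. ?f t y \<partial>lborel) =
          (\<integral>t. of_real (exp (- s * y)) * (indicator {0..1} t *\<^sub>R (w t * Hc A \<tau> b (\<nu> t) D y)) \<partial>lborel)"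
        using True by (intro Bochner_Integration.integral_cong) (simp_all add: mult_ac)
      ultimately show ?thesis using True by (simp only: integral_mult_right_zero) simp
    qed simp
    have inner_y: "(\<integral>y. ?f t y \<partial>lborel) = indicator {0..1} t *\<^sub>R (?L * (w t * ifun A (\<nu> t) (\<tau> * b / s\<^sup>2)))" for t
    proof (cases "t \<in> {0..1}")
      case True
      have "(\<integral>y. w t * (indicator {0<..} y *\<^sub>R (of_real (exp (- s * y)) * Hc A \<tau> b (\<nu> t) D y)) \<partial>lborel)
          = w t * (?L * ifun A (\<nu> t) (\<tau> * b / s\<^sup>2))"
        using has_bochner_integral_mult_right[OF laplace_Hc[OF Re[OF True] p s], of "w t"]
        by (simp only: has_bochner_integral_integral_eq)
      with True show ?thesis by (simp add: mult_ac)
    qed simp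
    have "integrable lborel (%y. \<integral>t. ?f t y \<partial>lborel)"
      using lborel_pair.integrable_snd[of ?f] I by simp
    then have A1: "integrable lborel (%y. indicator {0<..} y *\<^sub>R (of_real (exp (- s * y)) * H \<tau> b D y))"
      unfolding inner_t .
    have "(\<integral>y. (\<integral>t. ?f t y \<partial>lborel) \<partial>lborel) = (\<integral>t. (\<integral>y. ?f t y \<partial>lborel) \<partial>lborel)"
      by (rule lborel_pair.Fubini_integral[OF I])
    then have "(\<integral>y. indicator {0<..} y *\<^sub>R (of_real (exp (- s * y)) * H \<tau> b D y) \<partial>lborel)
       = (\<integral>t. indicator {0..1} t *\<^sub>R (?L * (w t * ifun A (\<nu> t) (\<tau> * b / s\<^sup>2))) \<partial>lborel)"
      unfolding inner_t inner_y .
    also have "\<dots> = integral {0..1} (%t. ?L * (w t * ifun A (\<nu> t) (\<tau> * b / s\<^sup>2)))"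
    proof -
      have "continuous_on {0..1} (%t. ?L * (w t * ifun A (\<nu> t) (\<tau> * b / s\<^sup>2)))"
        using p s by (intro continuous_intros cont) auto
      from set_borel_integral_eq_integral(2)[OF borel_integrable_atLeastAtMost'[OF this]]
      show ?thesis unfolding set_lebesgue_integral_def .
    qed
    finally show "has_bochner_integral lborel (%y. indicator {0<..} y *\<^sub>R (of_real (exp (- s * y)) * H \<tau> b D y))
       (?L * integral {0..1} (%t. w t * ifun A (\<nu> t) (\<tau> * b / s\<^sup>2)))"
      using A1 by (simp add: has_bochner_integral_iff)
  qed
qed

text \<open>A superposition over a constant curve with weight 1.\<close>

lemma cgood_ifun:
  assumes "Re \<nu> + real D >= 0"
  shows "cgood A D (ifun A \<nu>) (%y x. ifun A \<nu> y * ifun 1 \<nu> x)"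
  using cgood_superposition[of "%_. \<nu>" "%_. 1" D A] assms by simp

section \<open>Asymptotics at infinity\<close>

text \<open>I_\<nu>(2 sqrt x) divided by its leading asymptotics exp(2 sqrt x) / sqrt(4 pi sqrt x),
  written with \<open>clif\<close>.\<close>

definition asy :: "complex => real => complex" where
  "asy \<nu> x = of_real (sqrt (4 * pi) * exp (- 2 * sqrt x)) * rp x (\<nu> / 2 + 1 / 4) * clif \<nu> (of_real x)"

section \<open>Sonine's integral and the asymptotics for large order\<close>

lemma has_bochner_integral_rp_unit:
  assumes "Re z >= 1"
  shows "has_bochner_integral lborel (%t. indicator {0<..<1} t *\<^sub>R rp t (z - 1)) (1 / z)"
proof -
  have z0: "z \<noteq> 0" using assms by auto
  \<comment> \<open>The value 0 at t = 0 makes the antiderivative continuous on the closed interval,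
    as the fundamental theorem requires.\<close>
  define F where "F t = (if t = 0 then 0 else rp t z / z)" for t
  have "continuous_on {0..1} F"
  proof (rule continuous_on_eq_continuous_within[THEN iffD2], safe)
    fix t :: real assume t: "t \<in> {0..1}"
    show "continuous (at t within {0..1}) F"
    proof (cases "t = 0")
      case True
      have "(F \<longlongrightarrow> 0) (at 0 within {0..1})"
      proof (rule Lim_null_comparison[where g = "%t. t / norm z"])
        show "eventually (%t. norm (F t) <= t / norm z) (at 0 within {0..1})"
        proof (rule eventually_at_topological[THEN iffD2], intro exI[of _ UNIV] conjI ballI impI)
          fix s :: real assume "s \<in> UNIV" "s \<noteq> 0" "s \<in> {0..1}"
          then have s: "0 < s" "s <= 1" by auto
          have "s powr Re z <= s powr 1" using s assms by (intro powr_mono') auto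
          then show "norm (F s) <= s / norm z"
            using s by (auto simp: F_def norm_divide norm_rp intro!: divide_right_mono)
        qed auto
        show "((%t. t / norm z) \<longlongrightarrow> 0) (at 0 within {0..1})"
          by (rule tendsto_eq_intros refl | simp add: z0)+
      qed
      then show ?thesis using True by (simp add: continuous_within F_def)
    next
      case False
      then have tp: "t > 0" using t by simp
      have "continuous_on {0<..} (%t. rp t z / z)" by (intro continuous_intros) (auto simp: z0)
      then have "continuous_on {0<..} F" by (rule continuous_on_eq) (auto simp: F_def)
      then have "isCont F t" using tp by (simp add: continuous_on_eq_continuous_at)
      then show ?thesis by (rule continuous_at_imp_continuous_at_within)
    qed
  qed
  then have FTC: "((%t. rp t (z - 1)) has_integral F 1 - F 0) {0..1}"
  proof (rule fundamental_theorem_of_calculus_interior[rotated])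
    fix t :: real assume t: "t \<in> {0<..<1}"
    then have tp: "t > 0" by simp
    have "((%t. rp t z / z) has_vector_derivative (z * rp t z / of_real t) / z) (at t)"
      by (rule has_vector_derivative_divide[OF has_vector_derivative_rp[OF tp]])
    moreover have "(z * rp t z / of_real t) / z = rp t (z - 1)"
      using rp_add[of t "z - 1" 1] rp_one[OF tp] tp z0 by simp
    ultimately have "((%t. rp t z / z) has_vector_derivative rp t (z - 1)) (at t)" by simp
    then show "(F has_vector_derivative rp t (z - 1)) (at t)"
      by (rule has_vector_derivative_transform_within_open[where S = "{0<..}"]) (use tp in \<open>auto simp: F_def\<close>)
  qed auto
  have I: "integrable lborel (%t. indicator {0<..<1} t *\<^sub>R rp t (z - 1))"
  proof (rule Bochner_Integration.integrable_bound[where f = "indicator {0<..<1::real} :: real => real"])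
    show "AE t in lborel. norm (indicator {0<..<1} t *\<^sub>R rp t (z - 1)) <= norm (indicator {0<..<1::real} t :: real)"
    proof (rule AE_I2)
      fix t :: real
      have "0 < t ==> t < 1 ==> t powr (Re z - 1) <= 1" using assms by (intro powr_le1) auto
      then show "norm (indicator {0<..<1} t *\<^sub>R rp t (z - 1)) <= norm (indicator {0<..<1::real} t :: real)"
        by (auto simp: indicator_def norm_rp)
    qed
  qed (auto intro!: integrable_real_indicator)
  have "set_integrable lborel {0<..<1} (%t. rp t (z - 1))"
    using I unfolding set_integrable_def .
  from set_borel_integral_eq_integral(2)[OF this]
  have "integral\<^sup>L lborel (%t. indicator {0<..<1} t *\<^sub>R rp t (z - 1)) = integral {0<..<1} (%t. rp t (z - 1))"
    unfolding set_lebesgue_integral_def .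
  also have "\<dots> = F 1 - F 0"
    using FTC by (intro integral_unique) (simp add: has_integral_Icc_iff_Ioo)
  also have "\<dots> = 1 / z" by (simp add: F_def rp_def)
  finally show ?thesis using I by (simp add: has_bochner_integral_iff)
qed

text \<open>From (1 - t)^(n + 1) = (1 - t)^n - t (1 - t)^n, which relates the integrals for z and z
  + 1. Real part at least 1 keeps t^(z - 1) bounded.\<close>

lemma has_bochner_integral_beta_nat:
  assumes "Re z >= 1"
  shows "has_bochner_integral lborel (%t. indicator {0<..<1} t *\<^sub>R (of_real ((1 - t) ^ n) * rp t (z - 1))) (fact n / pochhammer z (Suc n))"
  using assms
proof (induction n arbitrary: z)
  case 0
  then show ?case using has_bochner_integral_rp_unit[of z] by simp
next
  case (Suc n)
  have z0: "z \<noteq> 0" "z + of_nat (Suc n) \<noteq> 0"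
  proof -
    show "z \<noteq> 0" using Suc.prems by auto
    have "Re (z + of_nat (Suc n)) > 0" using Suc.prems by simp
    then show "z + of_nat (Suc n) \<noteq> 0" by (metis less_irrefl zero_complex.sel(1))
  qed
  have pn: "pochhammer (z + 1) n \<noteq> 0"
    using norm_pochhammer_ge[of "z + 1" n] pochhammer_pos[of "Re (z + 1)" n] Suc.prems by auto
  from has_bochner_integral_diff[OF Suc.IH[OF Suc.prems] Suc.IH[of "z + 1"]] Suc.prems
  have "has_bochner_integral lborel (%t. indicator {0<..<1} t *\<^sub>R (of_real ((1 - t) ^ n) * rp t (z - 1))
       - indicator {0<..<1} t *\<^sub>R (of_real ((1 - t) ^ n) * rp t (z + 1 - 1)))
      (fact n / pochhammer z (Suc n) - fact n / pochhammer (z + 1) (Suc n))" by simp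
  moreover have "(%t. indicator {0<..<1} t *\<^sub>R (of_real ((1 - t) ^ n) * rp t (z - 1))
       - indicator {0<..<1} t *\<^sub>R (of_real ((1 - t) ^ n) * rp t (z + 1 - 1)))
      = (%t. indicator {0<..<1} t *\<^sub>R (of_real ((1 - t) ^ Suc n) * rp t (z - 1)))"
  proof
    fix t :: real
    show "indicator {0<..<1} t *\<^sub>R (of_real ((1 - t) ^ n) * rp t (z - 1))
       - indicator {0<..<1} t *\<^sub>R (of_real ((1 - t) ^ n) * rp t (z + 1 - 1))
       = indicator {0<..<1} t *\<^sub>R (of_real ((1 - t) ^ Suc n) * rp t (z - 1))"
    proof (cases "t \<in> {0<..<1}")
      case True
      then have "rp t (z + 1 - 1) = rp t (z - 1) * of_real t"
        using rp_add[of t "z - 1" 1] rp_one[of t] by simp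
      with True show ?thesis by (simp add: algebra_simps)
    qed simp
  qed
  moreover have "fact n / pochhammer z (Suc n) - fact n / pochhammer (z + 1) (Suc n) = fact (Suc n) / pochhammer z (Suc (Suc n))"
  proof -
    have a: "pochhammer z (Suc n) = z * pochhammer (z + 1) n" by (rule pochhammer_rec)
    have b: "pochhammer (z + 1) (Suc n) = (z + of_nat (Suc n)) * pochhammer (z + 1) n" by (simp add: pochhammer_rec' add_ac)
    have c: "pochhammer z (Suc (Suc n)) = z * ((z + of_nat (Suc n)) * pochhammer (z + 1) n)"
      by (subst pochhammer_rec) (simp only: b)
    have d: "f / (z * P) - f / (w * P) = ((w - z) * f) / (z * (w * P))" if "w \<noteq> 0" "P \<noteq> 0" for f w P :: complex
      using that z0(1) by (simp add: field_simps)
    show ?thesis unfolding a b c d[OF z0(2) pn] by (simp add: fact_Suc del: of_nat_Suc)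
  qed
  ultimately show ?case by (simp only:)
qed

lemma summable_clif_norm: "summable (%m. norm (rGamma (\<nu> + 1 + of_nat m) / fact m * (x::complex) ^ m))"
proof -
  obtain B where B: "B > 0" "\<And>m. norm (rGamma (\<nu> + 1 + of_nat m)) <= B"
    by (rule rGamma_uniformly_bounded[of "{\<nu> + 1}"]) auto
  show ?thesis
  proof (rule summable_comparison_test'[OF summable_pow_fact[of B "norm x"]])
    fix m :: nat
    have "norm (rGamma (\<nu> + 1 + of_nat m)) * norm x ^ m / fact m <= B * norm x ^ m / fact m"
      by (intro divide_right_mono mult_right_mono B) auto
    then show "norm (norm (rGamma (\<nu> + 1 + of_nat m) / fact m * x ^ m)) <= B * norm x ^ m / fact m"
      by (simp add: norm_mult norm_divide norm_power)
  qed
qed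

text \<open>Sonine's first finite integral, which raises the order from \<mu> to \<mu> + b. Term by
  term it is a Beta integral; this enters as the hypothesis \<open>moments\<close>, because it is
  supplied in two ways, for \<mu> = 1/2 with b = 3/2 and for \<mu> = 2 with complex b.\<close>

lemma sonine_integral:
  fixes \<mu> :: real
  assumes \<mu>: "\<mu> > 0" and b: "Re b >= 1" and x: "x > 0"
    and moments: "\<And>m. has_bochner_integral lborel
       (%t. indicator {0<..<1} t *\<^sub>R (of_real ((1 - t) powr (\<mu> + real m)) * rp t (b - 1)))
       (Gamma b * (Gamma (of_real \<mu> + 1 + of_nat m) * rGamma (of_real \<mu> + b + 1 + of_nat m)))"
  shows "has_bochner_integral lborel
     (%t. indicator {0<..<1} t *\<^sub>R (clif (of_real \<mu>) (of_real (x * (1 - t))) * of_real ((1 - t) powr \<mu>) * rp t (b - 1)))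
     (Gamma b * clif (of_real \<mu> + b) (of_real x))"
proof -
  let ?c = "%m. rGamma (complex_of_real \<mu> + 1 + of_nat m) / fact m * of_real x ^ m"
  let ?g = "%m t. indicator {0<..<1} t *\<^sub>R (of_real ((1 - t) powr (\<mu> + real m)) * rp t (b - 1))"
  let ?F = "%t. indicator {0<..<1} t *\<^sub>R (clif (of_real \<mu>) (of_real (x * (1 - t))) * of_real ((1 - t) powr \<mu>) * rp t (b - 1))"
  let ?I = "%m. Gamma b * (rGamma (of_real \<mu> + b + 1 + of_nat m) / fact m * of_real x ^ m)"
  have term_int: "has_bochner_integral lborel (%t. ?c m * ?g m t) (?I m)" for m
  proof -
    have "of_real \<mu> + 1 + of_nat m \<notin> (\<int>\<^sub>\<le>\<^sub>0 :: complex set)"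
    proof
      assume "of_real \<mu> + 1 + of_nat m \<in> (\<int>\<^sub>\<le>\<^sub>0 :: complex set)"
      then obtain n where n: "of_real \<mu> + 1 + of_nat m = (of_int n :: complex)" "n <= 0" by (auto elim!: nonpos_Ints_cases)
      have "Re (of_real \<mu> + 1 + of_nat m) = of_int n" unfolding n(1) by simp
      with \<mu> n(2) show False by simp
    qed
    then have g: "rGamma (of_real \<mu> + 1 + of_nat m) * Gamma (of_real \<mu> + 1 + of_nat m) = (1 :: complex)"
      by (simp add: rGamma_inverse_Gamma Gamma_eq_zero_iff)
    have "?c m * (Gamma b * (Gamma (of_real \<mu> + 1 + of_nat m) * rGamma (of_real \<mu> + b + 1 + of_nat m)))
       = (rGamma (of_real \<mu> + 1 + of_nat m) * Gamma (of_real \<mu> + 1 + of_nat m)) * ?I m"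
      by simp
    also have "\<dots> = ?I m" unfolding g by simp
    finally show ?thesis using has_bochner_integral_mult_right[OF moments[of m], of "?c m"] by (simp only:)
  qed
  have part: "has_bochner_integral lborel (%t. \<Sum>m<n. ?c m * ?g m t) (\<Sum>m<n. ?I m)" for n
    by (intro has_bochner_integral_sum term_int)
  have split: "(1 - t) powr (\<mu> + real m) = (1 - t) powr \<mu> * (1 - t) ^ m" if "t \<in> {0<..<1}" for t m
    using that by (simp add: powr_add powr_realpow)
  have rp1: "norm (rp t (b - 1)) <= 1" if "t \<in> {0<..<1}" for t
    using that b by (simp add: norm_rp powr_le1)
  have cs: "summable (%m. norm (?c m))" by (rule summable_clif_norm)
  define S where "S = (\<Sum>m. norm (?c m))"
  have bnd: "norm (\<Sum>m<n. ?c m * ?g m t) <= S * indicator {0<..<1} t" for n t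
  proof (cases "t \<in> {0<..<1}")
    case True
    have "norm (\<Sum>m<n. ?c m * ?g m t) <= (\<Sum>m<n. norm (?c m))"
    proof (rule sum_norm_le)
      fix m
      have "(1 - t) powr (\<mu> + real m) <= 1" using True \<mu> by (intro powr_le1) auto
      then have "norm (?g m t) <= 1 * 1"
        using True rp1[OF True] by (auto simp: norm_mult intro!: mult_le_one)
      then show "norm (?c m * ?g m t) <= norm (?c m)"
        unfolding norm_mult[of "?c m"] by (intro mult_left_le) auto
    qed
    also have "\<dots> <= S" unfolding S_def by (rule sum_le_suminf[OF cs]) auto
    finally show ?thesis using True by (simp only: indicator_simps mult_1_right)
  next
    case False
    then show ?thesis by simp
  qed
  have lim: "(%n. \<Sum>m<n. ?c m * ?g m t) \<longlonglongrightarrow> ?F t" for t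
  proof (cases "t \<in> {0<..<1}")
    case True
    have "(%m. rGamma (complex_of_real \<mu> + 1 + of_nat m) / fact m * of_real (x * (1 - t)) ^ m * (of_real ((1 - t) powr \<mu>) * rp t (b - 1)))
       sums (clif (of_real \<mu>) (of_real (x * (1 - t))) * (of_real ((1 - t) powr \<mu>) * rp t (b - 1)))"
      by (intro sums_mult2 clif_sums)
    moreover have "rGamma (complex_of_real \<mu> + 1 + of_nat m) / fact m * of_real (x * (1 - t)) ^ m * (of_real ((1 - t) powr \<mu>) * rp t (b - 1))
       = ?c m * ?g m t" for m
      using True by (simp add: split power_mult_distrib)
    ultimately show ?thesis using True by (simp add: sums_def mult.assoc)
  qed simp
  have Fm: "?F \<in> borel_measurable lborel"
  proof -
    have "continuous_on {0<..<1} (%t. clif (of_real \<mu>) (of_real (x * (1 - t))) * of_real ((1 - t) powr \<mu>) * rp t (b - 1))"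
      by (intro continuous_intros) auto
    from borel_measurable_indicator_continuous[OF this] show ?thesis by simp
  qed
  have fm: "(%t. \<Sum>m<n. ?c m * ?g m t) \<in> borel_measurable lborel" for n
    using part[of n] has_bochner_integral_iff borel_measurable_integrable by blast
  have w: "integrable lborel (%t. S * indicator {0<..<1::real} t)"
    by (intro integrable_mult_right integrable_real_indicator) auto
  have I: "integrable lborel ?F"
    by (rule integrable_dominated_convergence[OF Fm fm w AE_I2[OF lim] AE_I2[OF bnd]])
  have L: "(%n. integral\<^sup>L lborel (%t. \<Sum>m<n. ?c m * ?g m t)) \<longlonglongrightarrow> integral\<^sup>L lborel ?F"
    by (rule integral_dominated_convergence[OF Fm fm w AE_I2[OF lim] AE_I2[OF bnd]])
  have "?I sums integral\<^sup>L lborel ?F"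
    using L unfolding sums_def has_bochner_integral_integral_eq[OF part] .
  moreover have "?I sums (Gamma b * clif (of_real \<mu> + b) (of_real x))"
    by (intro sums_mult clif_sums)
  ultimately have "integral\<^sup>L lborel ?F = Gamma b * clif (of_real \<mu> + b) (of_real x)"
    by (rule sums_unique2)
  then show ?thesis using I by (simp add: has_bochner_integral_iff)
qed

text \<open>At order 1/2 the Bessel function is elementary. The duplication formula for the
  coefficients appears as an induction on the index. This order is where the asymptotics
  start.\<close>

lemma clif_half: 
  assumes "x > 0"
  shows "clif (1 / 2) (of_real x) = of_real (sinh (2 * sqrt x) / (sqrt pi * sqrt x))"
proof -
  have r0: "rGamma (3 / 2 :: complex) = 2 / of_real (sqrt pi)"
  proof -
    have "rGamma (1 / 2 :: complex) = 1 / of_real (sqrt pi)"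
      by (simp only: rGamma_inverse_Gamma Gamma_one_half_complex inverse_eq_divide)
    moreover have "rGamma (3 / 2 :: complex) = 2 * rGamma (1 / 2)"
    proof -
      have e: "1 / 2 + 1 = (3 / 2 :: complex)" by simp
      have "(1 / 2) * rGamma (3 / 2 :: complex) = rGamma (1 / 2)"
        using rGamma_plus1[of "1 / 2 :: complex"] unfolding e .
      moreover have "R = 2 * S" if "(1 / 2) * R = S" for R S :: complex
        using that by auto
      ultimately show ?thesis by blast
    qed
    ultimately show ?thesis by (simp only: times_divide_eq_right mult_1_right)
  qed
  have r: "rGamma (1 / 2 + 1 + of_nat m) / fact m = (2 * 4 ^ m / fact (2 * m + 1) / of_real (sqrt pi) :: complex)" for m
  proof (induction m)
    case 0
    then show ?case using r0 by simp
  next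
    case (Suc m)
    have a: "rGamma (1 / 2 + 1 + of_nat m) = (of_nat m + 3 / 2) * rGamma (1 / 2 + 1 + of_nat (Suc m) :: complex)"
      using rGamma_plus1[of "1 / 2 + 1 + of_nat m :: complex"] by (simp add: add_ac)
    have n0: "(of_nat m + 3 / 2 :: complex) \<noteq> 0" "(of_nat (Suc m) :: complex) \<noteq> 0"
    proof -
      have "Re (of_nat m + 3 / 2 :: complex) > 0" by simp
      then show "(of_nat m + 3 / 2 :: complex) \<noteq> 0" by (metis less_irrefl zero_complex.sel(1))
      show "(of_nat (Suc m) :: complex) \<noteq> 0" by (simp del: of_nat_Suc)
    qed
    have "rGamma (1 / 2 + 1 + of_nat (Suc m)) / fact (Suc m) =
       (rGamma (1 / 2 + 1 + of_nat m) / fact m) / ((of_nat m + 3 / 2) * of_nat (Suc m) :: complex)"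
    proof -
      have "R / (S * f) = (P * R / f) / (P * S)" if "P \<noteq> 0" for P R S f :: complex
        using that by simp
      from this[OF n0(1)] show ?thesis unfolding a fact_Suc of_nat_mult .
    qed
    also have "\<dots> = (2 * 4 ^ m / fact (2 * m + 1) / of_real (sqrt pi)) / ((of_nat m + 3 / 2) * of_nat (Suc m))"
      unfolding Suc ..
    also have "\<dots> = 2 * 4 ^ Suc m / fact (2 * Suc m + 1) / of_real (sqrt pi)"
    proof -
      have "(fact (2 * Suc m + 1) :: complex) = of_nat (2 * m + 3) * (of_nat (2 * m + 2) * fact (2 * m + 1))"
        by (simp add: fact_Suc numeral_3_eq_3 del: of_nat_Suc)
      also have "\<dots> = 4 * ((of_nat m + 3 / 2) * of_nat (Suc m)) * fact (2 * m + 1)"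
        by (simp add: field_simps)
      finally have F: "(fact (2 * Suc m + 1) :: complex) = 4 * ((of_nat m + 3 / 2) * of_nat (Suc m)) * fact (2 * m + 1)" .
      have "2 * q / G / R / (P * S) = 2 * (4 * q) / (4 * (P * S) * G) / R" for q G R P S :: complex
        by simp
      then show ?thesis unfolding F power_Suc .
    qed
    finally show ?case .
  qed
  have s: "sqrt x > 0" using assms by simp
  have "(%m. (2 * sqrt x) ^ (2 * m + 1) / fact (2 * m + 1)) sums sinh (2 * sqrt x)"
  proof -
    have "(%n. if even n then 0 else (2 * sqrt x) ^ n /\<^sub>R fact n) sums sinh (2 * sqrt x)"
      by (rule sinh_converges)
    then have "(%m. (%n. if even n then 0 else (2 * sqrt x) ^ n /\<^sub>R fact n) (2 * m + 1)) sums sinh (2 * sqrt x)"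
      by (subst sums_mono_reindex) (auto simp: strict_mono_def elim!: oddE)
    then show ?thesis by (simp add: field_simps)
  qed
  from sums_divide[OF this, of "sqrt pi * sqrt x"]
  have "(%m. (2 * sqrt x) ^ (2 * m + 1) / fact (2 * m + 1) / (sqrt pi * sqrt x)) sums (sinh (2 * sqrt x) / (sqrt pi * sqrt x))" .
  then have "(%m. complex_of_real ((2 * sqrt x) ^ (2 * m + 1) / fact (2 * m + 1) / (sqrt pi * sqrt x))) sums
     of_real (sinh (2 * sqrt x) / (sqrt pi * sqrt x))" by (simp only: sums_of_real_iff)
  moreover have "complex_of_real ((2 * sqrt x) ^ (2 * m + 1) / fact (2 * m + 1) / (sqrt pi * sqrt x))
      = rGamma (1 / 2 + 1 + of_nat m) / fact m * of_real x ^ m" for m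
  proof -
    have p: "(2 * sqrt x) ^ (2 * m + 1) = 2 * 4 ^ m * x ^ m * sqrt x"
      using assms by (simp add: power_mult power_mult_distrib real_sqrt_pow2)
    have "q * X * S / G / (P * S) = q / G / P * X" if "S \<noteq> 0" for q X S G P :: real
      using that by simp
    from this[of "sqrt x"] s
    have "(2 * sqrt x) ^ (2 * m + 1) / fact (2 * m + 1) / (sqrt pi * sqrt x) = 2 * 4 ^ m / fact (2 * m + 1) / sqrt pi * x ^ m"
      unfolding p by simp
    then show ?thesis unfolding r by (simp only: of_real_mult of_real_divide of_real_power of_real_fact of_real_numeral)
  qed
  ultimately show ?thesis using clif_sums[of "1 / 2" "of_real x"] by (simp add: sums_unique2)
qed

lemma asy_half: 
  assumes "x > 0"
  shows "asy (1 / 2) x = of_real (1 - exp (- 4 * sqrt x))"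
proof -
  have "rp x (1 / 2 / 2 + 1 / 4) = of_real (sqrt x)"
  proof -
    have "exp (ln x / 2) = sqrt x" using assms by (simp add: ln_sqrt[symmetric])
    moreover have "rp x (1 / 2 / 2 + 1 / 4) = of_real (exp (ln x / 2))" by (simp add: rp_def flip: exp_of_real)
    ultimately show ?thesis by simp
  qed
  then have "asy (1 / 2) x = of_real (sqrt (4 * pi) * exp (- 2 * sqrt x) * sqrt x * (sinh (2 * sqrt x) / (sqrt pi * sqrt x)))"
    unfolding asy_def clif_half[OF assms] by simp
  also have "sqrt (4 * pi) * exp (- 2 * sqrt x) * sqrt x * (sinh (2 * sqrt x) / (sqrt pi * sqrt x)) = 2 * exp (- 2 * sqrt x) * sinh (2 * sqrt x)"
    using assms by (simp add: real_sqrt_mult)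
  also have "\<dots> = 1 - exp (- 4 * sqrt x)"
    by (simp add: sinh_def field_simps flip: exp_add)
  finally show ?thesis .
qed

lemma rp_of_real: "u > 0 ==> rp u (of_real r) = of_real (u powr r)"
  by (simp add: rp_def powr_def flip: exp_of_real)

text \<open>The substitution t = v / sqrt x in Sonine's integral: the exponent 2 sqrt x (sqrt(1 - v
  / sqrt x) - 1) tends to - v, so the integral approaches Euler's integral for Gamma b as soon as
  \<open>asy (of_real \<mu>)\<close> tends to 1.\<close>

lemma scaled_sonine:
  fixes \<mu> :: real
  assumes \<mu>: "\<mu> > 0" and b: "Re b >= 1" and x: "x > 0"
    and moments: "\<And>m. has_bochner_integral lborel
       (%t. indicator {0<..<1} t *\<^sub>R (of_real ((1 - t) powr (\<mu> + real m)) * rp t (b - 1)))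
       (Gamma b * (Gamma (of_real \<mu> + 1 + of_nat m) * rGamma (of_real \<mu> + b + 1 + of_nat m)))"
  shows "has_bochner_integral lborel
     (%v. indicator {0<..<sqrt x} v *\<^sub>R (asy (of_real \<mu>) (x * (1 - v / sqrt x)) *
        of_real ((1 - v / sqrt x) powr (\<mu> / 2 - 1 / 4) * exp (2 * sqrt x * (sqrt (1 - v / sqrt x) - 1))) * rp v (b - 1)))
     (Gamma b * asy (of_real \<mu> + b) x)"
proof -
  let ?f = "%t. indicator {0<..<1} t *\<^sub>R (clif (of_real \<mu>) (of_real (x * (1 - t))) * of_real ((1 - t) powr \<mu>) * rp t (b - 1))"
  let ?k = "of_real (sqrt (4 * pi) * exp (- 2 * sqrt x)) * rp x ((of_real \<mu> + b) / 2 + 1 / 4) * of_real (1 / sqrt x) :: complex"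
  have sx: "sqrt x > 0" using x by simp
  have "has_bochner_integral lborel ?f (Gamma b * clif (of_real \<mu> + b) (of_real x))"
    by (rule sonine_integral[OF \<mu> b x moments])
  then have "has_bochner_integral lborel (%v. ?f (0 + (1 / sqrt x) * v)) ((Gamma b * clif (of_real \<mu> + b) (of_real x)) /\<^sub>R \<bar>1 / sqrt x\<bar>)"
    using lborel_has_bochner_integral_real_affine_iff[of "1 / sqrt x" ?f _ 0] sx by simp
  from has_bochner_integral_mult_right[OF this, where c = ?k]
  have main: "has_bochner_integral lborel (%v. ?k * ?f (0 + (1 / sqrt x) * v)) (?k * ((Gamma b * clif (of_real \<mu> + b) (of_real x)) /\<^sub>R \<bar>1 / sqrt x\<bar>))" .
  have val: "?k * ((Gamma b * clif (of_real \<mu> + b) (of_real x)) /\<^sub>R \<bar>1 / sqrt x\<bar>) = Gamma b * asy (of_real \<mu> + b) x"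
    using sx by (simp add: asy_def scaleR_conv_of_real)
  \<comment> \<open>Bookkeeping of powers of x: (\<mu> + b) / 2 + 1/4 - 1/2 - (b - 1) / 2 = \<mu> /
    2 + 1/4, the exponent that belongs to order \<mu>.\<close>
  have rpx: "rp x ((of_real \<mu> + b) / 2 + 1 / 4) * of_real (1 / sqrt x) * rp (1 / sqrt x) (b - 1) = rp x (of_real (\<mu> / 2 + 1 / 4))"
  proof -
    have 1: "of_real (1 / sqrt x) = rp x (- 1 / 2)"
    proof -
      have "x powr (- (1 / 2)) = 1 / sqrt x" using x by (simp only: powr_minus_divide powr_half_sqrt less_imp_le)
      moreover have "complex_of_real (- (1 / 2)) = - 1 / 2" by simp
      ultimately show ?thesis using rp_of_real[OF x, of "- (1 / 2)"] by (simp only:)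
    qed
    have 2: "rp (1 / sqrt x) (b - 1) = rp x (- (b - 1) / 2)"
    proof -
      have l: "ln (1 / sqrt x) = - (ln x / 2)" using x by (simp add: ln_div ln_sqrt)
      show ?thesis unfolding rp_def l by (intro arg_cong[of _ _ exp]) (simp add: field_simps)
    qed
    show ?thesis unfolding 1 2 rp_add[symmetric]
      by (rule arg_cong[of _ _ "rp x"]) (simp add: field_simps)
  qed
  have pt: "?k * ?f (0 + (1 / sqrt x) * v) = indicator {0<..<sqrt x} v *\<^sub>R (asy (of_real \<mu>) (x * (1 - v / sqrt x)) *
        of_real ((1 - v / sqrt x) powr (\<mu> / 2 - 1 / 4) * exp (2 * sqrt x * (sqrt (1 - v / sqrt x) - 1))) * rp v (b - 1))" for v
  proof (cases "v \<in> {0<..<sqrt x}")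
    case True
    define u where "u = 1 - v / sqrt x"
    have u: "u > 0" "u < 1" using True sx by (auto simp: u_def field_simps)
    have vv: "v > 0" using True by simp
    have ind: "indicator {0<..<1} (0 + (1 / sqrt x) * v) = (1::real)" using u vv sx by (auto simp: u_def indicator_def)
    have l: "?k * ?f (0 + (1 / sqrt x) * v) = of_real (sqrt (4 * pi) * exp (- 2 * sqrt x)) *
       (rp x ((of_real \<mu> + b) / 2 + 1 / 4) * of_real (1 / sqrt x) * rp (1 / sqrt x) (b - 1)) *
       clif (of_real \<mu>) (of_real (x * u)) * of_real (u powr \<mu>) * rp v (b - 1)"
      using sx vv rp_mult[of "1 / sqrt x" v "b - 1"] unfolding ind u_def by simp
    have r: "asy (of_real \<mu>) (x * u) = of_real (sqrt (4 * pi) * exp (- 2 * sqrt x * sqrt u)) * rp x (of_real (\<mu> / 2 + 1 / 4)) *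
       of_real (u powr (\<mu> / 2 + 1 / 4)) * clif (of_real \<mu>) (of_real (x * u))"
      using x u rp_of_real[OF u(1), of "\<mu> / 2 + 1 / 4"] by (simp add: asy_def rp_mult real_sqrt_mult mult_ac)
    have p: "u powr (\<mu> / 2 + 1 / 4) * u powr (\<mu> / 2 - 1 / 4) = u powr \<mu>"
      by (simp flip: powr_add)
    have e: "exp (- 2 * sqrt x * sqrt u) * exp (2 * sqrt x * (sqrt u - 1)) = exp (- 2 * sqrt x)"
      by (simp add: algebra_simps flip: exp_add)
    have "asy (of_real \<mu>) (x * u) * of_real (u powr (\<mu> / 2 - 1 / 4) * exp (2 * sqrt x * (sqrt u - 1))) * rp v (b - 1)
      = of_real (sqrt (4 * pi) * (exp (- 2 * sqrt x * sqrt u) * exp (2 * sqrt x * (sqrt u - 1)))) * rp x (of_real (\<mu> / 2 + 1 / 4)) *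
       of_real (u powr (\<mu> / 2 + 1 / 4) * u powr (\<mu> / 2 - 1 / 4)) * clif (of_real \<mu>) (of_real (x * u)) * rp v (b - 1)"
      unfolding r by (simp add: mult_ac)
    then have "?k * ?f (0 + (1 / sqrt x) * v) = asy (of_real \<mu>) (x * u) * of_real (u powr (\<mu> / 2 - 1 / 4) * exp (2 * sqrt x * (sqrt u - 1))) * rp v (b - 1)"
      unfolding l rpx p e by (simp only: mult_ac)
    then show ?thesis using True by (simp only: u_def indicator_simps scaleR_one)
  next
    case False
    then have "0 + (1 / sqrt x) * v \<notin> {0<..<1}" using sx by (auto simp: field_simps zero_less_divide_iff)
    then have "indicator {0<..<1} (0 + (1 / sqrt x) * v) = (0 :: real)" by (rule indicator_simps(2))
    moreover have "indicator {0<..<sqrt x} v = (0 :: real)" using False by (rule indicator_simps(2))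
    ultimately show ?thesis by (simp only: scaleR_zero_left mult_zero_right)
  qed
  show ?thesis using main unfolding val pt .
qed

text \<open>Dominated convergence in the scaled integral. From sqrt u <= (1 + u) / 2 the exponential
  is at most exp(- v), and \<mu> >= 1/2 makes the exponent \<mu> / 2 - 1/4 nonnegative. The second
  conclusion keeps the constant explicit in b for the sake of uniformity in the order.\<close>

lemma asy_transfer:
  fixes \<mu> :: real
  assumes \<mu>: "\<mu> >= 1 / 2" and b: "Re b >= 1"
    and moments: "\<And>m. has_bochner_integral lborel
       (%t. indicator {0<..<1} t *\<^sub>R (of_real ((1 - t) powr (\<mu> + real m)) * rp t (b - 1)))
       (Gamma b * (Gamma (of_real \<mu> + 1 + of_nat m) * rGamma (of_real \<mu> + b + 1 + of_nat m)))"
    and lim: "(asy (of_real \<mu>) \<longlongrightarrow> 1) at_top"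
    and bound: "\<And>x. x > 0 ==> norm (asy (of_real \<mu>) x) <= K"
  shows "(asy (of_real \<mu> + b) \<longlongrightarrow> 1) at_top"
    and "x > 0 ==> norm (asy (of_real \<mu> + b) x) <= K * (norm (rGamma b) * norm (Gamma (complex_of_real (Re b))))"
proof -
  let ?s = "%x v. indicator {0<..<sqrt x} v *\<^sub>R (asy (of_real \<mu>) (x * (1 - v / sqrt x)) *
        of_real ((1 - v / sqrt x) powr (\<mu> / 2 - 1 / 4) * exp (2 * sqrt x * (sqrt (1 - v / sqrt x) - 1))) * rp v (b - 1))"
  let ?f = "%v. indicator {0<..} v *\<^sub>R (rp v (b - 1) * of_real (exp (- 1 * v)))"
  let ?w = "%v. K * norm (?f v)"
  have \<mu>0: "\<mu> > 0" using \<mu> by simp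
  have K: "K >= 0" using order_trans[OF norm_ge_zero bound[of 1]] by simp
  have rep: "has_bochner_integral lborel (?s x) (Gamma b * asy (of_real \<mu> + b) x)" if "x > 0" for x
    by (rule scaled_sonine[OF \<mu>0 b that moments])
  have s0: "?s x = (%v. 0)" if "x <= 0" for x using that by (auto simp: indicator_def)
  have sm: "?s x \<in> borel_measurable lborel" for x
  proof (cases "x > 0")
    case True
    then show ?thesis using rep has_bochner_integral_iff borel_measurable_integrable by blast
  next
    case False
    then show ?thesis using s0[of x] by simp
  qed
  have fG: "has_bochner_integral lborel ?f (Gamma b * rp 1 (- b))"
    by (rule has_bochner_integral_Gamma) (use b in auto)
  have nb: "b \<notin> \<int>\<^sub>\<le>\<^sub>0"
  proof
    assume "b \<in> \<int>\<^sub>\<le>\<^sub>0"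
    then obtain n where n: "b = of_int n" "n <= 0" by (auto elim!: nonpos_Ints_cases)
    show False using b n(2) unfolding n(1) by simp
  qed
  then have Gb: "rGamma b * Gamma b = 1"
    by (simp add: rGamma_inverse_Gamma Gamma_eq_zero_iff)
  have w: "integrable lborel ?w"
    using fG by (intro integrable_mult_right integrable_norm) (simp add: has_bochner_integral_iff)
  have bnd: "norm (?s x v) <= ?w v" for x v
  proof (cases "v \<in> {0<..<sqrt x}")
    case True
    then have "0 < v" "v < sqrt x" by auto
    then have sx: "sqrt x > 0" by (rule less_trans)
    then have x: "x > 0" by simp
    define u where "u = 1 - v / sqrt x"
    have u: "u > 0" "u < 1" using True sx by (auto simp: u_def field_simps)
    have 1: "norm (asy (of_real \<mu>) (x * u)) <= K" using x u by (intro bound) auto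
    have 2: "u powr (\<mu> / 2 - 1 / 4) <= 1" using u \<mu> by (intro powr_le1) auto
    have "sqrt u <= (1 + u) / 2"
      using arith_geo_mean_sqrt[of 1 u] u by simp
    then have "2 * sqrt x * (sqrt u - 1) <= 2 * sqrt x * ((u - 1) / 2)"
      using sx by (intro mult_left_mono) auto
    also have "\<dots> = - v" using sx by (simp add: u_def field_simps)
    finally have 3: "exp (2 * sqrt x * (sqrt u - 1)) <= exp (- v)" by simp
    have "norm (asy (of_real \<mu>) (x * u)) * (u powr (\<mu> / 2 - 1 / 4) * exp (2 * sqrt x * (sqrt u - 1))) * norm (rp v (b - 1))
       <= K * (1 * exp (- v)) * norm (rp v (b - 1))"
      using 1 2 3 K by (intro mult_right_mono mult_mono) auto
    then show ?thesis using True by (simp add: norm_mult u_def[symmetric] mult_ac)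
  next
    case False
    then have "?s x v = 0" by simp
    then show ?thesis using K by (simp only: norm_zero) simp
  qed
  have lim_s: "((%x. ?s x v) \<longlongrightarrow> ?f v) at_top" for v
  proof (cases "v > 0")
    case True
    have ev: "eventually (%x. v < sqrt x) at_top" by real_asymp
    have f1: "filterlim (%x. x * (1 - v / sqrt x)) at_top at_top" by real_asymp
    have f2: "((%x. (1 - v / sqrt x) powr (\<mu> / 2 - 1 / 4)) \<longlongrightarrow> 1) at_top" by real_asymp
    have f3: "((%x. exp (2 * sqrt x * (sqrt (1 - v / sqrt x) - 1))) \<longlongrightarrow> exp (- v)) at_top" by real_asymp
    have "((%x. asy (of_real \<mu>) (x * (1 - v / sqrt x)) *
        of_real ((1 - v / sqrt x) powr (\<mu> / 2 - 1 / 4) * exp (2 * sqrt x * (sqrt (1 - v / sqrt x) - 1))) * rp v (b - 1))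
        \<longlongrightarrow> 1 * of_real (1 * exp (- v)) * rp v (b - 1)) at_top"
      by (intro tendsto_intros filterlim_compose[OF lim f1] f2 f3)
    moreover have "1 * of_real (1 * exp (- v)) * rp v (b - 1) = ?f v" using True by simp
    moreover have "eventually (%x. ?s x v = asy (of_real \<mu>) (x * (1 - v / sqrt x)) *
        of_real ((1 - v / sqrt x) powr (\<mu> / 2 - 1 / 4) * exp (2 * sqrt x * (sqrt (1 - v / sqrt x) - 1))) * rp v (b - 1)) at_top"
      using ev by eventually_elim (use True in simp)
    ultimately show ?thesis by (simp only: tendsto_cong)
  next
    case False
    then have "(%x. ?s x v) = (%x. ?f v)" by (auto simp: indicator_def)
    then show ?thesis by (simp only: tendsto_const)
  qed
  have "((%x. integral\<^sup>L lborel (?s x)) \<longlongrightarrow> integral\<^sup>L lborel ?f) at_top"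
  proof (rule integral_dominated_convergence_at_top[OF _ _ w])
    show "?f \<in> borel_measurable lborel" using fG has_bochner_integral_iff borel_measurable_integrable by blast
    show "?s x \<in> borel_measurable lborel" for x by (rule sm)
    show "AE v in lborel. ((%x. ?s x v) \<longlongrightarrow> ?f v) at_top" by (rule AE_I2[OF lim_s])
    show "\<forall>\<^sub>F x in at_top. AE v in lborel. norm (?s x v) <= ?w v" by (rule always_eventually, rule allI, rule AE_I2[OF bnd])
  qed
  moreover have "integral\<^sup>L lborel ?f = Gamma b"
    using fG by (simp add: has_bochner_integral_integral_eq rp_def)
  moreover have "eventually (%x. integral\<^sup>L lborel (?s x) = Gamma b * asy (of_real \<mu> + b) x) at_top"
    using eventually_gt_at_top[of 0] by eventually_elim (rule has_bochner_integral_integral_eq[OF rep])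
  ultimately have "((%x. Gamma b * asy (of_real \<mu> + b) x) \<longlongrightarrow> Gamma b) at_top"
    by (simp only: tendsto_cong)
  from tendsto_mult_left[OF this, of "rGamma b"]
  show "(asy (of_real \<mu> + b) \<longlongrightarrow> 1) at_top"
    unfolding mult.assoc[symmetric] Gb by simp
  show "norm (asy (of_real \<mu> + b) x) <= K * (norm (rGamma b) * norm (Gamma (complex_of_real (Re b))))" if x: "x > 0"
  proof -
    have "norm (Gamma b * asy (of_real \<mu> + b) x) <= integral\<^sup>L lborel ?w"
      unfolding has_bochner_integral_integral_eq[OF rep[OF x], symmetric]
    proof (rule Bochner_Integration.integral_norm_bound_integral)
      show "integrable lborel (?s x)" using rep[OF x] by (simp only: has_bochner_integral_iff)
      show "integrable lborel ?w" by (rule w)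
      show "norm (?s x v) <= ?w v" for v by (rule bnd)
    qed
    also have "\<dots> = K * integral\<^sup>L lborel (%v. norm (?f v))" by simp
    \<comment> \<open>Taking moduli replaces b by its real part, so the constant consists of Gamma
      values and is continuous in b.\<close>
    also have "integral\<^sup>L lborel (%v. norm (?f v)) = norm (Gamma (complex_of_real (Re b)))"
    proof -
      let ?g = "%v. indicator {0<..} v *\<^sub>R (rp v (of_real (Re b) - 1) * of_real (exp (- 1 * v)))"
      have g: "has_bochner_integral lborel ?g (Gamma (complex_of_real (Re b)) * rp 1 (- of_real (Re b)))"
        by (rule has_bochner_integral_Gamma) (use b in auto)
      have "complex_of_real (norm (?f v)) = ?g v" for v
      proof (cases "v > 0")
        case True
        have "rp v (of_real (Re b) - 1) = of_real (v powr (Re b - 1))"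
          using rp_of_real[OF True, of "Re b - 1"] by simp
        then show ?thesis using True by (simp add: norm_mult norm_rp)
      qed simp
      then have fg: "(%v. complex_of_real (norm (?f v))) = ?g" by (rule ext)
      have "complex_of_real (integral\<^sup>L lborel (%v. norm (?f v))) = integral\<^sup>L lborel (%v. complex_of_real (norm (?f v)))"
        by (rule integral_complex_of_real[symmetric])
      also have "\<dots> = integral\<^sup>L lborel ?g" unfolding fg ..
      also have "\<dots> = Gamma (complex_of_real (Re b))" using g by (simp add: has_bochner_integral_integral_eq rp_def)
      finally have "norm (complex_of_real (integral\<^sup>L lborel (%v. norm (?f v)))) = norm (Gamma (complex_of_real (Re b)))" by simp
      moreover have "integral\<^sup>L lborel (%v. norm (?f v)) >= 0" by simp
      ultimately show ?thesis by simp
    qed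
    finally have "norm (rGamma b) * norm (Gamma b * asy (of_real \<mu> + b) x) <= norm (rGamma b) * (K * norm (Gamma (complex_of_real (Re b))))"
      by (rule mult_left_mono) simp
    then have "norm ((rGamma b * Gamma b) * asy (of_real \<mu> + b) x) <= norm (rGamma b) * (K * norm (Gamma (complex_of_real (Re b))))"
      by (simp only: norm_mult mult.assoc)
    then show ?thesis unfolding Gb by (simp add: mult_ac)
  qed
qed

lemma beta_moments_real:
  "has_bochner_integral lborel
       (%t. indicator {0<..<1} t *\<^sub>R (of_real ((1 - t) powr (1 / 2 + real m)) * rp t (3 / 2 - 1)))
       (Gamma (3 / 2) * (Gamma (of_real (1 / 2) + 1 + of_nat m) * rGamma (of_real (1 / 2) + 3 / 2 + 1 + of_nat m)))"
proof -
  let ?f = "%t. t powr (1 / 2) * (1 - t) powr (1 / 2 + real m) :: real"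
  let ?h = "%t. indicator {0<..<1} t *\<^sub>R ?f t"
  have m: "?h \<in> borel_measurable lborel" by measurable
  have I: "integrable lborel ?h"
  proof (rule Bochner_Integration.integrable_bound[where f = "indicator {0<..<1::real} :: real => real"])
    show "AE t in lborel. norm (?h t) <= norm (indicator {0<..<1::real} t :: real)"
    proof (rule AE_I2)
      fix t :: real
      have "0 < t ==> t < 1 ==> t powr (1 / 2) * (1 - t) powr (1 / 2 + real m) <= 1" by (intro mult_le_one powr_le1) auto
      then show "norm (?h t) <= norm (indicator {0<..<1::real} t :: real)"
        by (auto simp: indicator_def)
    qed
  qed (auto intro!: integrable_real_indicator m)
  have "(?f has_integral Beta (3 / 2) (3 / 2 + real m)) {0..1}"
    using has_integral_Beta_real[of "3 / 2" "3 / 2 + real m"] by simp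
  then have "(?f has_integral Beta (3 / 2) (3 / 2 + real m)) {0<..<1}"
    by (simp only: has_integral_Icc_iff_Ioo)
  moreover have "set_integrable lborel {0<..<1} ?f" using I unfolding set_integrable_def .
  ultimately have v: "integral\<^sup>L lborel ?h = Beta (3 / 2) (3 / 2 + real m)"
    using set_borel_integral_eq_integral(2)[of "{0<..<1}" ?f] unfolding set_lebesgue_integral_def
    by (simp only: integral_unique)
  with I have "has_bochner_integral lborel ?h (Beta (3 / 2) (3 / 2 + real m))"
    by (simp add: has_bochner_integral_iff)
  then have "has_bochner_integral lborel (%t. complex_of_real (?h t)) (of_real (Beta (3 / 2) (3 / 2 + real m)))"
    by (rule has_bochner_integral_of_real)
  moreover have "complex_of_real (?h t) = indicator {0<..<1} t *\<^sub>R (of_real ((1 - t) powr (1 / 2 + real m)) * rp t (3 / 2 - 1))" for t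
  proof (cases "t \<in> {0<..<1}")
    case True
    then have "rp t (3 / 2 - 1) = of_real (t powr (1 / 2))" using rp_of_real[of t "1 / 2"] by simp
    then show ?thesis using True by simp
  qed simp
  moreover have "complex_of_real (Beta (3 / 2) (3 / 2 + real m)) =
     Gamma (3 / 2) * (Gamma (of_real (1 / 2) + 1 + of_nat m) * rGamma (of_real (1 / 2) + 3 / 2 + 1 + of_nat m))"
  proof -
    have e: "of_real (1 / 2) + 1 + of_nat m = complex_of_real (3 / 2 + real m)"
      "of_real (1 / 2) + 3 / 2 + 1 + of_nat m = complex_of_real (3 + real m)" "3 / 2 = complex_of_real (3 / 2)"
      by simp_all
    show ?thesis unfolding e(1,2) unfolding e(3) Gamma_complex_of_real rGamma_complex_of_real
      by (simp add: Beta_altdef add_ac)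
  qed
  ultimately show ?thesis by (simp only:)
qed

text \<open>Above order 2 the powers of 1 - t have natural exponents, so complex b is reached by the
  induction in \<open>has_bochner_integral_beta_nat\<close>; order 2 itself is reached from order
  1/2 by a real Beta integral.\<close>

lemma beta_moments_complex:
  assumes "Re b >= 1"
  shows "has_bochner_integral lborel
       (%t. indicator {0<..<1} t *\<^sub>R (of_real ((1 - t) powr (2 + real m)) * rp t (b - 1)))
       (Gamma b * (Gamma (of_real 2 + 1 + of_nat m) * rGamma (of_real 2 + b + 1 + of_nat m)))"
proof -
  have "has_bochner_integral lborel (%t. indicator {0<..<1} t *\<^sub>R (of_real ((1 - t) ^ (m + 2)) * rp t (b - 1))) (fact (m + 2) / pochhammer b (Suc (m + 2)))"
    by (rule has_bochner_integral_beta_nat[OF assms])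
  moreover have "(%t. indicator {0<..<1} t *\<^sub>R (of_real ((1 - t) ^ (m + 2)) * rp t (b - 1))) =
     (%t. indicator {0<..<1} t *\<^sub>R (of_real ((1 - t) powr (2 + real m)) * rp t (b - 1)))"
  proof
    fix t :: real
    have "t < 1 ==> (1 - t) powr (2 + real m) = (1 - t) ^ (m + 2)"
      using powr_realpow[of "1 - t" "m + 2"] by (simp add: add_ac)
    then show "indicator {0<..<1} t *\<^sub>R (of_real ((1 - t) ^ (m + 2)) * rp t (b - 1)) =
      indicator {0<..<1} t *\<^sub>R (of_real ((1 - t) powr (2 + real m)) * rp t (b - 1))"
      by (cases "t \<in> {0<..<1}") auto
  qed
  moreover have "fact (m + 2) / pochhammer b (Suc (m + 2)) =
     Gamma b * (Gamma (of_real 2 + 1 + of_nat m) * rGamma (of_real 2 + b + 1 + of_nat m))"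
  proof -
    have 1: "Gamma (of_real 2 + 1 + of_nat m) = (fact (m + 2) :: complex)"
      using Gamma_fact[of "m + 2", where ?'a = complex] by (simp add: add_ac)
    have nb: "b \<notin> \<int>\<^sub>\<le>\<^sub>0"
    proof
      assume "b \<in> \<int>\<^sub>\<le>\<^sub>0"
      then obtain n where n: "b = of_int n" "n <= 0" by (auto elim!: nonpos_Ints_cases)
      show False using assms n(2) unfolding n(1) by simp
    qed
    then have Gb: "Gamma b * rGamma b = 1"
      by (simp add: rGamma_inverse_Gamma Gamma_eq_zero_iff)
    have e: "of_real 2 + b + 1 + of_nat m = b + of_nat (Suc (m + 2))" by simp
    have "Gamma b * (pochhammer b (Suc (m + 2)) * rGamma (b + of_nat (Suc (m + 2)))) = 1"
      unfolding pochhammer_rGamma[symmetric] by (rule Gb)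
    then have "Gamma b * rGamma (b + of_nat (Suc (m + 2))) = 1 / pochhammer b (Suc (m + 2))"
      by (metis mult.left_commute nonzero_mult_div_cancel_left mult_zero_left zero_neq_one)
    then show ?thesis unfolding 1 e by (simp only: mult.left_commute[of "Gamma b"] times_divide_eq_right mult_1_right)
  qed
  ultimately show ?thesis by (simp only:)
qed

lemma asy_two: "(asy 2 \<longlongrightarrow> 1) at_top" "\<exists>K. \<forall>x>0. norm (asy 2 x) <= K"
proof -
  have l: "(asy (of_real (1 / 2)) \<longlongrightarrow> 1) at_top"
  proof -
    have "((%x. complex_of_real (1 - exp (- 4 * sqrt x))) \<longlongrightarrow> of_real 1) at_top"
      by (intro tendsto_of_real) real_asymp
    moreover have "eventually (%x. asy (of_real (1 / 2)) x = of_real (1 - exp (- 4 * sqrt x))) at_top"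
      using eventually_gt_at_top[of 0] by eventually_elim (use asy_half in simp)
    ultimately show ?thesis by (simp add: tendsto_cong)
  qed
  have bd: "norm (asy (of_real (1 / 2)) x) <= 1" if "x > 0" for x
  proof -
    have "exp (- 4 * sqrt x) <= 1" using that by simp
    then have "\<bar>1 - exp (- 4 * sqrt x)\<bar> <= 1" by (simp add: abs_le_iff)
    then have "norm (complex_of_real (1 - exp (- 4 * sqrt x))) <= 1" by (simp only: norm_of_real)
    then show ?thesis using asy_half[OF that] by simp
  qed
  have e: "of_real (1 / 2) + 3 / 2 = (2 :: complex)" by simp
  note t = asy_transfer[of "1 / 2" "3 / 2", OF _ _ beta_moments_real l bd, unfolded e]
  show "(asy 2 \<longlongrightarrow> 1) at_top" by (rule t(1)) simp_all
  show "\<exists>K. \<forall>x>0. norm (asy 2 x) <= K" using t(2) by auto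
qed

section \<open>Asymptotics for all orders, by lowering the order\<close>

lemma asy_recurrence:
  assumes "x > 0"
  shows "asy \<nu> x = (\<nu> + 1) * of_real (1 / sqrt x) * asy (\<nu> + 1) x + asy (\<nu> + 2) x"
proof -
  have 1: "rp x ((\<nu> + 1) / 2 + 1 / 4) = rp x (\<nu> / 2 + 1 / 4) * of_real (sqrt x)"
  proof -
    have e: "(\<nu> + 1) / 2 + 1 / 4 = \<nu> / 2 + 1 / 4 + of_real (1 / 2)" by (simp add: field_simps)
    show ?thesis unfolding e rp_add rp_of_real[OF assms] using assms by (simp add: powr_half_sqrt)
  qed
  have 2: "rp x ((\<nu> + 2) / 2 + 1 / 4) = rp x (\<nu> / 2 + 1 / 4) * of_real x"
    using rp_add[of x "\<nu> / 2 + 1 / 4" 1] rp_one[OF assms] by (simp add: add_divide_distrib add_ac)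
  have s: "complex_of_real (sqrt x) \<noteq> 0" using assms by simp
  have "E * R * ((\<nu> + 1) * C1 + X * C2) = (\<nu> + 1) * (1 / S) * (E * (R * S) * C1) + E * (R * X) * C2"
    if "S \<noteq> 0" for E R S X C1 C2 :: complex
    using that by (simp add: field_simps)
  from this[OF s] show ?thesis
    unfolding asy_def 1 2 clif_recurrence[of \<nu>] by simp
qed

lemma asy_large:
  assumes "Re \<nu> >= 3"
  shows "(asy \<nu> \<longlongrightarrow> 1) at_top"
proof -
  obtain K where K: "\<And>x. x > 0 ==> norm (asy (of_real 2) x) <= K" using asy_two(2) by auto
  have b: "Re (\<nu> - 2) >= 1" using assms by simp
  have "(asy (of_real 2 + (\<nu> - 2)) \<longlongrightarrow> 1) at_top"
    by (rule asy_transfer(1)[OF _ b beta_moments_complex[OF b] _ K]) (use asy_two(1) in simp_all)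
  then show ?thesis by simp
qed

text \<open>The constant in \<open>asy_transfer\<close> depends continuously on the order, because
  Gamma is evaluated at real numbers that are at least 1.\<close>

lemma asy_large_bounded:
  assumes "compact K" "\<And>\<nu>. \<nu> \<in> K ==> Re \<nu> >= 3"
  shows "\<exists>C. \<forall>\<nu>\<in>K. \<forall>x>0. norm (asy \<nu> x) <= C"
proof -
  obtain B where B: "\<And>x. x > 0 ==> norm (asy (of_real 2) x) <= B" using asy_two(2) by auto
  have bd: "norm (asy \<nu> x) <= B * (norm (rGamma (\<nu> - 2)) * norm (Gamma (complex_of_real (Re (\<nu> - 2)))))"
    if "\<nu> \<in> K" "x > 0" for \<nu> x
  proof -
    have b: "Re (\<nu> - 2) >= 1" using assms(2)[OF that(1)] by simp
    have "norm (asy (of_real 2 + (\<nu> - 2)) x) <= B * (norm (rGamma (\<nu> - 2)) * norm (Gamma (complex_of_real (Re (\<nu> - 2)))))"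
      by (rule asy_transfer(2)[OF _ b beta_moments_complex[OF b] _ B that(2)]) (use asy_two(1) in simp_all)
    then show ?thesis by simp
  qed
  have "continuous_on K (%\<nu>. B * (norm (rGamma (\<nu> - 2)) * norm (Gamma (complex_of_real (Re (\<nu> - 2))))))"
  proof -
    have "continuous_on ((%\<nu>. complex_of_real (Re (\<nu> - 2))) ` K) Gamma"
    proof (rule continuous_on_Gamma, safe)
      fix \<nu> assume "\<nu> \<in> K" "complex_of_real (Re (\<nu> - 2)) \<in> \<int>\<^sub>\<le>\<^sub>0"
      then obtain n where n: "complex_of_real (Re (\<nu> - 2)) = of_int n" "n <= 0" by (auto elim!: nonpos_Ints_cases)
      have "Re (complex_of_real (Re (\<nu> - 2))) = of_int n" unfolding n(1) by simp
      with n(2) assms(2)[OF \<open>\<nu> \<in> K\<close>] show "complex_of_real (Re (\<nu> - 2)) \<in> {}" by simp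
    qed
    then have "continuous_on K (%\<nu>. Gamma (complex_of_real (Re (\<nu> - 2))))"
      by (rule continuous_on_compose2) (auto intro!: continuous_intros)
    then show ?thesis by (intro continuous_intros)
  qed
  from compact_imp_bounded[OF compact_continuous_image[OF this assms(1)]]
  obtain C where "\<forall>z\<in>(%\<nu>. B * (norm (rGamma (\<nu> - 2)) * norm (Gamma (complex_of_real (Re (\<nu> - 2)))))) ` K. norm z <= C"
    unfolding bounded_iff by blast
  then have "\<bar>B * (norm (rGamma (\<nu> - 2)) * norm (Gamma (complex_of_real (Re (\<nu> - 2)))))\<bar> <= C" if "\<nu> \<in> K" for \<nu>
    using that by auto
  with bd show ?thesis by (intro exI[of _ C] ballI allI impI) (meson abs_ge_self order_trans)
qed

text \<open>The recurrence expresses order \<nu> through \<nu> + 1 and \<nu> + 2, the former with a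
  factor 1 / sqrt x. Hence the limit 1 descends in unit steps from the half-plane with real part at
  least 3.\<close>

theorem asy_tendsto: "(asy \<nu> \<longlongrightarrow> 1) at_top"
proof -
  have "\<forall>\<nu>. Re \<nu> >= 3 - real n --> (asy \<nu> \<longlongrightarrow> 1) at_top" for n
  proof (induction n)
    case 0
    then show ?case using asy_large by simp
  next
    case (Suc n)
    show ?case
    proof (intro allI impI)
      fix \<nu> :: complex assume "Re \<nu> >= 3 - real (Suc n)"
      then have 1: "(asy (\<nu> + 1) \<longlongrightarrow> 1) at_top" "(asy (\<nu> + 2) \<longlongrightarrow> 1) at_top"
        using Suc by auto
      have 2: "((%x. complex_of_real (1 / sqrt x)) \<longlongrightarrow> of_real 0) at_top"
        by (intro tendsto_of_real) real_asymp
      have "((%x. (\<nu> + 1) * of_real (1 / sqrt x) * asy (\<nu> + 1) x + asy (\<nu> + 2) x) \<longlongrightarrow> (\<nu> + 1) * of_real 0 * 1 + 1) at_top"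
        by (intro tendsto_intros 1 2)
      moreover have "eventually (%x. asy \<nu> x = (\<nu> + 1) * of_real (1 / sqrt x) * asy (\<nu> + 1) x + asy (\<nu> + 2) x) at_top"
        using eventually_gt_at_top[of 0] by eventually_elim (rule asy_recurrence)
      ultimately show "(asy \<nu> \<longlongrightarrow> 1) at_top" by (simp add: tendsto_cong)
    qed
  qed
  moreover obtain n :: nat where "3 - Re \<nu> <= real n" using real_arch_simple by blast
  then have "Re \<nu> >= 3 - real n" by simp
  ultimately show ?thesis by blast
qed

text \<open>The same descent; for x >= 1 the factor 1 / sqrt x is at most 1. Uniformity over compact
  sets of orders is needed under the Cauchy integral for integer order.\<close>

theorem asy_bounded:
  assumes "compact K"
  shows "\<exists>C. \<forall>\<nu>\<in>K. \<forall>x\<ge>1. norm (asy \<nu> x) <= C"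
proof -
  have "\<forall>K. compact K \<and> (\<forall>\<nu>\<in>K. Re \<nu> >= 3 - real n) --> (\<exists>C. \<forall>\<nu>\<in>K. \<forall>x\<ge>1. norm (asy \<nu> x) <= C)" for n
  proof (induction n)
    case 0
    show ?case
    proof (intro allI impI)
      fix K :: "complex set" assume "compact K \<and> (\<forall>\<nu>\<in>K. Re \<nu> >= 3 - real 0)"
      then obtain C where "\<forall>\<nu>\<in>K. \<forall>x>0. norm (asy \<nu> x) <= C" using asy_large_bounded[of K] by auto
      then show "\<exists>C. \<forall>\<nu>\<in>K. \<forall>x\<ge>1. norm (asy \<nu> x) <= C" by (intro exI[of _ C]) auto
    qed
  next
    case (Suc n)
    show ?case
    proof (intro allI impI)
      fix K :: "complex set" assume K: "compact K \<and> (\<forall>\<nu>\<in>K. Re \<nu> >= 3 - real (Suc n))"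
      have "compact ((%\<nu>. \<nu> + 1) ` K)" "compact ((%\<nu>. \<nu> + 2) ` K)"
        using K by (auto intro!: compact_continuous_image continuous_intros)
      then obtain C1 C2 where C: "\<forall>\<nu>\<in>(%\<nu>. \<nu> + 1) ` K. \<forall>x\<ge>1. norm (asy \<nu> x) <= C1" "\<forall>\<nu>\<in>(%\<nu>. \<nu> + 2) ` K. \<forall>x\<ge>1. norm (asy \<nu> x) <= C2"
        using Suc[rule_format, of "(%\<nu>. \<nu> + 1) ` K"] Suc[rule_format, of "(%\<nu>. \<nu> + 2) ` K"] K by force
      obtain R where R: "\<And>\<nu>. \<nu> \<in> K ==> norm \<nu> <= R" using K compact_imp_bounded bounded_iff by metis
      show "\<exists>C. \<forall>\<nu>\<in>K. \<forall>x\<ge>1. norm (asy \<nu> x) <= C"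
      proof (intro exI[of _ "(R + 1) * 1 * C1 + C2"] ballI allI impI)
        fix \<nu> and x :: real assume \<nu>: "\<nu> \<in> K" and x: "x >= 1"
        have c: "norm (asy (\<nu> + 1) x) <= C1" "norm (asy (\<nu> + 2) x) <= C2" using C \<nu> x by auto
        have n1: "norm (\<nu> + 1) <= R + 1" using R[OF \<nu>] norm_triangle_ineq[of \<nu> 1] by simp
        have R0: "0 <= R + 1" using order_trans[OF norm_ge_zero n1] .
        have "sqrt x >= 1" using x by simp
        then have s: "norm (complex_of_real (1 / sqrt x)) <= 1" by (simp add: norm_divide)
        have "norm (asy \<nu> x) <= norm (\<nu> + 1) * norm (complex_of_real (1 / sqrt x)) * norm (asy (\<nu> + 1) x) + norm (asy (\<nu> + 2) x)"
          using x norm_triangle_ineq by (subst asy_recurrence) (auto simp: norm_mult[symmetric] simp del: of_real_divide norm_of_real intro: norm_triangle_ineq)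
        also have "\<dots> <= (R + 1) * 1 * C1 + C2"
          using n1 s c R0 by (intro add_mono mult_mono) auto
        finally show "norm (asy \<nu> x) <= (R + 1) * 1 * C1 + C2" .
      qed
    qed
  qed
  moreover obtain R where R: "\<And>\<nu>. \<nu> \<in> K ==> norm \<nu> <= R" using assms compact_imp_bounded bounded_iff by metis
  moreover obtain n :: nat where n: "3 + R <= real n" using real_arch_simple by blast
  moreover have "Re \<nu> >= 3 - real n" if "\<nu> \<in> K" for \<nu>
    using R[OF that] n abs_Re_le_cmod[of \<nu>] by linarith
  ultimately show ?thesis using assms by blast
qed

section \<open>Stationary solutions of the normal form\<close>

text \<open>The equation y (y v')' = (N / 4 + A y) v as a first-order system in which
  \<open>v1\<close> stands for y v'. With this choice \<open>v * w1 - w * v1\<close> is constant for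
  two solutions.\<close>

definition csol :: "complex => real => (real => complex) => (real => complex) => bool" where
  "csol N A v v1 \<longleftrightarrow> (\<forall>y>0. (v has_vector_derivative v1 y / of_real y) (at y) \<and>
     (v1 has_vector_derivative (N / 4 + of_real (A * y)) * v y / of_real y) (at y))"

definition sol :: "real => real => (real => real) => (real => real) => bool" where
  "sol N A V V1 \<longleftrightarrow> (\<forall>y>0. (V has_real_derivative V1 y / y) (at y) \<and>
     (V1 has_real_derivative (N / 4 + A * y) * V y / y) (at y))"

lemma sol_imp_csol: "sol N A V V1 ==> csol (of_real N) A (%y. of_real (V y)) (%y. of_real (V1 y))"
  unfolding csol_def
proof (intro allI impI conjI)
  fix y :: real assume "sol N A V V1" "y > 0"
  then have "(V has_real_derivative V1 y / y) (at y)" "(V1 has_real_derivative (N / 4 + A * y) * V y / y) (at y)"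
    unfolding sol_def by auto
  from this[THEN has_vector_derivative_of_real[where 'a = complex]]
  show "((%y. of_real (V y)) has_vector_derivative complex_of_real (V1 y) / of_real y) (at y)"
    "((%y. of_real (V1 y)) has_vector_derivative (of_real N / 4 + of_real (A * y)) * complex_of_real (V y) / of_real y) (at y)"
    by simp_all
qed

lemma csol_Re:
  assumes "csol (of_real N) A v v1"
  shows "sol N A (%y. Re (v y)) (%y. Re (v1 y))"
  unfolding sol_def has_real_derivative_iff_has_vector_derivative
proof (intro allI impI conjI)
  fix y :: real assume y: "y > 0"
  from assms y have d: "(v has_vector_derivative v1 y / of_real y) (at y)"
     "(v1 has_vector_derivative (of_real N / 4 + of_real (A * y)) * v y / of_real y) (at y)" unfolding csol_def by auto
  have e: "(of_real N / 4 + of_real (A * y)) = complex_of_real (N / 4 + A * y)" by simp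
  have Re_div: "Re (z / of_real y) = Re z / y" for z by simp
  have Re_mul: "Re (complex_of_real q * z) = q * Re z" for q z by simp
  show "((%y. Re (v y)) has_vector_derivative Re (v1 y) / y) (at y)"
    using bounded_linear.has_vector_derivative[OF bounded_linear_Re d(1)] unfolding Re_div .
  show "((%y. Re (v1 y)) has_vector_derivative (N / 4 + A * y) * Re (v y) / y) (at y)"
    using bounded_linear.has_vector_derivative[OF bounded_linear_Re d(2)] unfolding Re_div e Re_mul .
qed

lemma csol_lincomb:
  assumes "csol N A v v1" "csol N A w w1"
  shows "csol N A (%y. \<alpha> * v y + \<beta> * w y) (%y. \<alpha> * v1 y + \<beta> * w1 y)"
  unfolding csol_def
proof (intro allI impI conjI)
  fix y :: real assume y: "y > 0"
  show "((%y. \<alpha> * v y + \<beta> * w y) has_vector_derivative (\<alpha> * v1 y + \<beta> * w1 y) / of_real y) (at y)"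
    using assms y unfolding csol_def
    by (intro has_vector_derivative_eq_rhs[OF has_vector_derivative_add[OF has_vector_derivative_mult_right has_vector_derivative_mult_right]])
       (auto simp: add_divide_distrib)
  show "((%y. \<alpha> * v1 y + \<beta> * w1 y) has_vector_derivative (N / 4 + of_real (A * y)) * (\<alpha> * v y + \<beta> * w y) / of_real y) (at y)"
    using assms y unfolding csol_def
    by (intro has_vector_derivative_eq_rhs[OF has_vector_derivative_add[OF has_vector_derivative_mult_right has_vector_derivative_mult_right]])
       (auto simp: add_divide_distrib algebra_simps)
qed

lemma csol_scale: "csol N A v v1 ==> csol N A (%y. \<alpha> * v y) (%y. \<alpha> * v1 y)"
  using csol_lincomb[of N A v v1 v v1 \<alpha> 0] by simp

lemma csol_wronskian:
  assumes "csol N A v v1" "csol N A w w1"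
  obtains W where "\<And>y. y > 0 ==> v y * w1 y - w y * v1 y = W"
proof -
  have "((%y. v y * w1 y - w y * v1 y) has_vector_derivative 0) (at y within {0<..})" if "y \<in> {0<..}" for y
  proof -
    have y: "y > 0" using that by simp
    have d: "(v has_vector_derivative v1 y / of_real y) (at y)" "(w has_vector_derivative w1 y / of_real y) (at y)"
      "(v1 has_vector_derivative (N / 4 + of_real (A * y)) * v y / of_real y) (at y)"
      "(w1 has_vector_derivative (N / 4 + of_real (A * y)) * w y / of_real y) (at y)"
      using assms y unfolding csol_def by auto
    have "((%y. v y * w1 y - w y * v1 y) has_vector_derivative 0) (at y)"
      by (rule has_vector_derivative_eq_rhs[OF has_vector_derivative_diff[OF has_vector_derivative_mult[OF d(1,4)] has_vector_derivative_mult[OF d(2,3)]]])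
         (simp add: mult_ac)
    then show ?thesis by (rule has_vector_derivative_at_within)
  qed
  note zero = this
  obtain W where "\<And>y. y \<in> {0<..} ==> v y * w1 y - w y * v1 y = W"
    by (rule has_vector_derivative_zero_constant[OF _ zero]) (auto intro: convex_real_interval)
  with that show ?thesis by simp
qed

lemma cnj_clif: "cnj (clif \<nu> x) = clif (cnj \<nu>) (cnj x)"
proof -
  have "(%m. cnj (rGamma (\<nu> + 1 + of_nat m) / fact m * x ^ m)) sums cnj (clif \<nu> x)"
    using clif_sums by (simp only: sums_cnj)
  moreover have "cnj (rGamma (\<nu> + 1 + of_nat m) / fact m * x ^ m) = rGamma (cnj \<nu> + 1 + of_nat m) / fact m * (cnj x) ^ m" for m
    by (simp add: cnj_rGamma)
  ultimately have "(%m. rGamma (cnj \<nu> + 1 + of_nat m) / fact m * (cnj x) ^ m) sums cnj (clif \<nu> x)"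
    by (simp only:)
  then show ?thesis using clif_sums by (rule sums_unique2)
qed

lemma cnj_ifun: "cnj (ifun A \<nu> y) = ifun A (cnj \<nu>) y"
  by (simp add: ifun_def cnj_clif rp_def exp_cnj)

definition ifun1 :: "real => complex => real => complex" where
  "ifun1 A \<nu> y = rp y (\<nu> / 2) * (\<nu> / 2 * clif \<nu> (of_real (A * y)) + of_real (A * y) * clif (\<nu> + 1) (of_real (A * y)))"

lemma continuous_on_ifun1 [continuous_intros]:
  assumes "continuous_on S f" "continuous_on S g" "\<And>a. a \<in> S ==> g a > 0"
  shows "continuous_on S (%a. ifun1 A (f a) (g a))"
  unfolding ifun1_def by (intro continuous_intros assms) auto

lemma has_vector_derivative_clif_scaled:
  "((%y. clif \<nu> (of_real (A * y))) has_vector_derivative of_real A * clif (\<nu> + 1) (of_real (A * y))) (at y)"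
proof -
  have "((%y. of_real (A * y)) has_vector_derivative complex_of_real A) (at y)"
    by (rule has_vector_derivative_of_real) (auto intro!: derivative_eq_intros)
  from field_vector_diff_chain_at[OF this has_field_derivative_clif[of \<nu> "of_real (A * y)"]]
  show ?thesis by (simp add: o_def)
qed

lemma csol_ifun: "csol (\<nu>\<^sup>2) A (ifun A \<nu>) (ifun1 A \<nu>)"
  unfolding csol_def
proof (intro allI impI conjI)
  fix y :: real assume y: "y > 0"
  let ?Y = "complex_of_real y" and ?x = "complex_of_real (A * y)"
  have Y: "?Y \<noteq> 0" using y by simp
  note r = has_vector_derivative_rp[OF y, of "\<nu> / 2"] and c = has_vector_derivative_clif_scaled[of _ A y]
  show "(ifun A \<nu> has_vector_derivative ifun1 A \<nu> y / ?Y) (at y)"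
    unfolding ifun_def[abs_def] ifun1_def
    by (rule has_vector_derivative_eq_rhs[OF has_vector_derivative_mult[OF r c]])
       (use Y in \<open>simp add: field_simps\<close>)
  have X: "((%y. complex_of_real (A * y)) has_vector_derivative of_real A) (at y)"
    by (rule has_vector_derivative_of_real) (auto intro!: derivative_eq_intros)
  have d2: "((%y. \<nu> / 2 * clif \<nu> (of_real (A * y)) + of_real (A * y) * clif (\<nu> + 1) (of_real (A * y))) has_vector_derivative
      \<nu> / 2 * (of_real A * clif (\<nu> + 1) ?x) + (?x * (of_real A * clif (\<nu> + 1 + 1) ?x) + of_real A * clif (\<nu> + 1) ?x)) (at y)"
    by (intro has_vector_derivative_add has_vector_derivative_mult_right has_vector_derivative_mult X c)
  show "(ifun1 A \<nu> has_vector_derivative (\<nu>\<^sup>2 / 4 + ?x) * ifun A \<nu> y / ?Y) (at y)"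
    unfolding ifun1_def[abs_def]
  proof (rule has_vector_derivative_eq_rhs[OF has_vector_derivative_mult[OF r d2]])
    define C1 where "C1 = clif (\<nu> + 1) ?x"
    define C2 where "C2 = clif (\<nu> + 2) ?x"
    \<comment> \<open>Expressing order \<nu> through \<nu> + 1 and \<nu> + 2 leaves an identity of
      rational expressions.\<close>
    have rec: "clif \<nu> ?x = (\<nu> + 1) * C1 + ?x * C2" unfolding C1_def C2_def by (rule clif_recurrence)
    have n2: "clif (\<nu> + 1 + 1) ?x = C2" unfolding C2_def by (simp add: add.assoc)
    have x: "?x = of_real A * ?Y" by simp
    have "R * (\<nu> / 2 * (a * C1) + (a * Y * (a * C2) + a * C1)) + \<nu> / 2 * R / Y * (\<nu> / 2 * ((\<nu> + 1) * C1 + a * Y * C2) + a * Y * C1)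
       = (\<nu>\<^sup>2 / 4 + a * Y) * (R * ((\<nu> + 1) * C1 + a * Y * C2)) / Y" if "Y \<noteq> 0" for R a Y :: complex
      using that by (simp add: field_simps power2_eq_square)
    from this[OF Y, of "rp y (\<nu> / 2)" "of_real A"]
    show "rp y (\<nu> / 2) * (\<nu> / 2 * (of_real A * clif (\<nu> + 1) ?x) + (?x * (of_real A * clif (\<nu> + 1 + 1) ?x) + of_real A * clif (\<nu> + 1) ?x)) +
        \<nu> / 2 * rp y (\<nu> / 2) / ?Y * (\<nu> / 2 * clif \<nu> ?x + ?x * clif (\<nu> + 1) ?x) =
        (\<nu>\<^sup>2 / 4 + ?x) * ifun A \<nu> y / ?Y"
      unfolding ifun_def rec n2 C1_def[symmetric] unfolding x .
  qed
qed

text \<open>The powers y^(\<nu> / 2) and y^(- \<nu> / 2) cancel, so the constant Wronskian extends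
  continuously to y = 0, where it equals - \<nu> / (Gamma(1 + \<nu>) Gamma(1 - \<nu>)); the
  reflection formula gives the sine. It vanishes exactly at the integers, which forces the separate
  treatment of integer order.\<close>

lemma wronskian_ifun:
  assumes "y > 0"
  shows "ifun A \<nu> y * ifun1 A (- \<nu>) y - ifun A (- \<nu>) y * ifun1 A \<nu> y = - sin (of_real pi * \<nu>) / of_real pi"
proof -
  let ?P = "%y. clif \<nu> (of_real (A * y)) * (- \<nu> / 2 * clif (- \<nu>) (of_real (A * y)) + of_real (A * y) * clif (- \<nu> + 1) (of_real (A * y)))
     - clif (- \<nu>) (of_real (A * y)) * (\<nu> / 2 * clif \<nu> (of_real (A * y)) + of_real (A * y) * clif (\<nu> + 1) (of_real (A * y)))"
  have P: "ifun A \<nu> y * ifun1 A (- \<nu>) y - ifun A (- \<nu>) y * ifun1 A \<nu> y = ?P y" for y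
  proof -
    have "rp y (\<nu> / 2) * rp y (- \<nu> / 2) = 1" by (simp flip: rp_add)
    moreover have "R * c * (S * d) - S * e * (R * f) = c * d - e * f" if "R * S = 1" for R S c d e f :: complex
      using that by (metis mult.assoc mult.commute mult.right_neutral)
    ultimately show ?thesis unfolding ifun_def ifun1_def by simp
  qed
  have "csol (\<nu>\<^sup>2) A (ifun A (- \<nu>)) (ifun1 A (- \<nu>))" using csol_ifun[of "- \<nu>"] by simp
  from csol_wronskian[OF csol_ifun this] obtain W where W: "\<And>y. y > 0 ==> ?P y = W" unfolding P by blast
  have "continuous_on UNIV ?P" by (intro continuous_intros)
  then have "isCont ?P 0" by (simp add: continuous_on_eq_continuous_at)
  then have "(?P \<longlongrightarrow> ?P 0) (at_right 0)" by (simp add: isCont_def filterlim_at_split)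
  moreover have "eventually (%y. ?P y = W) (at_right 0)"
    using W by (auto simp: eventually_at_right_field intro!: exI[of _ 1])
  then have "(?P \<longlongrightarrow> W) (at_right 0)" by (rule tendsto_eventually)
  ultimately have "W = ?P 0" using tendsto_unique trivial_limit_at_right_real by blast
  also have "\<dots> = - (\<nu> * clif \<nu> 0 * clif (- \<nu>) 0)" by simp
  also have "\<dots> = - (\<nu> * rGamma (\<nu> + 1) * rGamma (1 - \<nu>))"
  proof -
    have c0: "clif \<mu> 0 = rGamma (\<mu> + 1)" for \<mu>
      unfolding clif_def using powser_zero[of "%m. rGamma (\<mu> + 1 + of_nat m) / fact m"] by simp
    show ?thesis unfolding c0 by (simp add: add.commute)
  qed
  also have "\<dots> = - sin (of_real pi * \<nu>) / of_real pi"
    unfolding rGamma_plus1 rGamma_reflection_complex by simp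
  finally show ?thesis unfolding P using W[OF assms] by simp
qed

text \<open>Cramer's rule with Wronskians as coefficients. These can be evaluated at any point, so a
  common zero of \<open>V\<close> and \<open>V1\<close> makes both coefficients vanish; this takes
  the place of a uniqueness theorem for the differential equation.\<close>

lemma csol_representation:
  assumes V: "csol N A V V1" and v: "csol N A v v1" and w: "csol N A w w1"
    and W: "\<And>y. y > 0 ==> v y * w1 y - w y * v1 y = W" "W \<noteq> 0"
  shows "\<exists>\<alpha> \<beta>. (\<forall>y>0. V y = \<alpha> * v y + \<beta> * w y) \<and> (\<forall>y>0. V y = 0 \<and> V1 y = 0 --> \<alpha> = 0 \<and> \<beta> = 0)"
proof -
  obtain a where a: "\<And>y. y > 0 ==> V y * w1 y - w y * V1 y = a" using csol_wronskian[OF V w] by blast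
  obtain b where b: "\<And>y. y > 0 ==> V y * v1 y - v y * V1 y = b" using csol_wronskian[OF V v] by blast
  show ?thesis
  proof (rule exI[of _ "a / W"], rule exI[of _ "- b / W"], intro conjI allI impI)
    fix y :: real assume y: "y > 0"
    have "V y * W = a * v y - b * w y"
      unfolding W(1)[OF y, symmetric] a[OF y, symmetric] b[OF y, symmetric] by (simp add: algebra_simps)
    then show "V y = a / W * v y + - b / W * w y" using W(2) by (simp add: field_simps)
  next
    fix y :: real assume y: "y > 0" and z: "V y = 0 \<and> V1 y = 0"
    show "a / W = 0" "- b / W = 0" using a[OF y] b[OF y] z by simp_all
  qed
qed

section \<open>From a basis of stationary solutions to kernels for every real one\<close>

lemma cgood_cong:
  assumes "cgood A D v M" "\<And>y. y > 0 ==> v y = v' y" "\<And>y x. y > 0 ==> x > 0 ==> M y x = M' y x"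
  shows "cgood A D v' M'"
proof -
  obtain H where "cgood_rep A D v M H" using assms(1) unfolding cgood_def by blast
  then have "cgood_rep A D v' M' H" unfolding cgood_rep_def using assms(2,3) by force
  then show ?thesis unfolding cgood_def by blast
qed

text \<open>The exponential and the factor \<open>laplace_ifun\<close> are real, so real parts may
  be taken throughout.\<close>

lemma cgood_Re:
  assumes "cgood A D v M"
  shows "cgood A D (%y. of_real (Re (v y))) (%y x. of_real (Re (M y x)))"
proof -
  obtain H where H: "cgood_rep A D v M H" using assms(1) unfolding cgood_def by blast
  have "cgood_rep A D (%y. of_real (Re (v y))) (%y x. of_real (Re (M y x))) (%t b j y. of_real (Re (H t b j y)))"
    unfolding cgood_rep_def
  proof (intro allI impI conjI)
    fix t b :: real assume p: "t > 0" "b > 0"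
    note H = H[unfolded cgood_rep_def, rule_format, OF p]
    show "complex_of_real (Re (H t b 0 y)) = of_real (Re (M (t * y) (b * y)))" if "y > 0" for y using H that by simp
    have bl: "bounded_linear (%z. complex_of_real (Re z))"
      by (rule bounded_linear_compose[OF bounded_linear_of_real bounded_linear_Re])
    show "((%y. complex_of_real (Re (H t b (Suc j) y))) has_vector_derivative of_real (Re (H t b j y))) (at y)"
      if "j < D" "y > 0" for j y
      by (rule bounded_linear.has_vector_derivative[OF bl]) (use H that in blast)
    have "continuous_on {0<..} (H t b D)" using H by blast
    then show "continuous_on {0<..} (%y. complex_of_real (Re (H t b D y)))" by (intro continuous_intros)
    obtain C where C: "\<forall>y>0. norm (H t b D y) <= C * exp (y / 2)" using H by blast
    show "\<exists>C. \<forall>y>0. norm (complex_of_real (Re (H t b D y))) <= C * exp (y / 2)"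
      using C by (intro exI[of _ C]) (auto intro: order_trans[OF abs_Re_le_cmod])
    fix s :: real assume s: "s >= 1"
    have "has_bochner_integral lborel (%y. indicator {0<..} y *\<^sub>R (of_real (exp (- s * y)) * H t b D y))
         (of_real (laplace_ifun A t b D s) * v (t * b / s\<^sup>2))" using H s by blast
    from has_bochner_integral_bounded_linear[OF bl this]
    have "has_bochner_integral lborel (%y. complex_of_real (Re (indicator {0<..} y *\<^sub>R (of_real (exp (- s * y)) * H t b D y))))
         (complex_of_real (Re (of_real (laplace_ifun A t b D s) * v (t * b / s\<^sup>2))))" .
    moreover have "complex_of_real (Re (i *\<^sub>R (of_real q * z))) = i *\<^sub>R (of_real q * of_real (Re z))" for i q z
      by (simp add: scaleR_conv_of_real)
    moreover have "complex_of_real (Re (of_real q * z)) = of_real q * of_real (Re z)" for q z by simp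
    ultimately show "has_bochner_integral lborel (%y. indicator {0<..} y *\<^sub>R (complex_of_real (exp (- s * y)) * complex_of_real (Re (H t b D y))))
         (complex_of_real (laplace_ifun A t b D s) * complex_of_real (Re (v (t * b / s\<^sup>2))))" by (simp only:)
  qed
  then show ?thesis unfolding cgood_def by blast
qed

text \<open>Comparison with the common leading behaviour of all I_\<nu>(2 sqrt x): the limit 1 marks
  a dominant solution, the limit 0 the recessive one.\<close>

definition casy :: "(real => complex) => complex => bool" where
  "casy E l \<longleftrightarrow> ((%x. of_real (sqrt (4 * pi) * x powr (1 / 4) * exp (- 2 * sqrt x)) * E x) \<longlongrightarrow> l) at_top"

lemma asy_eq_ifun:
  assumes "x > 0"
  shows "asy \<nu> x = of_real (sqrt (4 * pi) * x powr (1 / 4) * exp (- 2 * sqrt x)) * ifun 1 \<nu> x"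
proof -
  have "rp x (\<nu> / 2 + 1 / 4) = rp x (\<nu> / 2) * of_real (x powr (1 / 4))"
    using rp_of_real[OF assms, of "1 / 4"] by (simp add: rp_add)
  then show ?thesis by (simp add: asy_def ifun_def mult_ac)
qed

lemma casy_ifun: "casy (ifun 1 \<nu>) 1"
proof -
  have "eventually (%x. asy \<nu> x = of_real (sqrt (4 * pi) * x powr (1 / 4) * exp (- 2 * sqrt x)) * ifun 1 \<nu> x) at_top"
    using eventually_gt_at_top[of 0] by eventually_elim (rule asy_eq_ifun)
  from tendsto_cong[OF this] asy_tendsto[of \<nu>] show ?thesis unfolding casy_def by blast
qed

lemma casy_diff: "casy E l ==> casy F m ==> casy (%x. E x - F x) (l - m)"
  unfolding casy_def right_diff_distrib by (rule tendsto_diff)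

text \<open>Common to all orders. For A = 1, \<open>E\<close> is dominant and
  \<open>\<kappa>\<close> recessive; V = \<alpha> v + \<beta> w receives the kernel V E + \<beta> u
  \<kappa>. Since V is real and \<open>\<kappa>\<close> is a constant \<open>\<theta>\<close> times
  a real function, the real part again has the form V e1 + c e2, where c absorbs \<beta> and
  \<theta>.\<close>

lemma core_from_basis:
  assumes v: "csol (of_real N) A v v1" and w: "csol (of_real N) A w w1" and u: "csol (of_real N) A u u1"
    and W: "\<And>y. y > 0 ==> v y * w1 y - w y * v1 y = W" "W \<noteq> 0"
    and E: "csol (of_real N) 1 E E1" "casy E 1" and \<kappa>: "csol (of_real N) 1 \<kappa> \<kappa>1" "casy \<kappa> 0"
    and real: "\<And>x. x > 0 ==> \<kappa> x = \<theta> * of_real (Re (\<kappa> x / \<theta>))" and \<theta>: "\<theta> \<noteq> 0"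
    and gv: "cgood A D v (%y x. v y * E x)" and gw: "cgood A D w (%y x. w y * E x + u y * \<kappa> x)"
  shows "\<exists>e1 d1 e2 d2. sol N 1 e1 d1 \<and> sol N 1 e2 d2 \<and> casy (%x. of_real (e1 x)) 1 \<and> casy (%x. of_real (e2 x)) 0 \<and>
     (\<forall>V V1. sol N A V V1 --> (\<exists>c c1. sol N A c c1 \<and>
        cgood A D (%y. of_real (V y)) (%y x. of_real (V y * e1 x + c y * e2 x))))"
proof -
  define e1 d1 where "e1 x = Re (E x)" and "d1 x = Re (E1 x)" for x
  define e2 d2 where "e2 x = Re (\<kappa> x / \<theta>)" and "d2 x = Re (\<kappa>1 x / \<theta>)" for x
  have "sol N 1 e1 d1" unfolding e1_def[abs_def] d1_def[abs_def] by (rule csol_Re[OF E(1)])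
  moreover have "sol N 1 e2 d2"
    using csol_Re[OF csol_scale[OF \<kappa>(1), of "1 / \<theta>"]] unfolding e2_def[abs_def] d2_def[abs_def] by simp
  moreover have "casy (%x. of_real (e1 x)) 1"
  proof -
    have "((%x. complex_of_real (Re (of_real (sqrt (4 * pi) * x powr (1 / 4) * exp (- 2 * sqrt x)) * E x))) \<longlongrightarrow> of_real (Re 1)) at_top"
      using E(2) unfolding casy_def by (intro tendsto_of_real tendsto_Re)
    moreover have "complex_of_real (Re (of_real q * z)) = of_real q * of_real (Re z)" for q z by simp
    ultimately show ?thesis unfolding casy_def e1_def by simp
  qed
  moreover have "casy (%x. of_real (e2 x)) 0"
  proof -
    have "((%x. complex_of_real (Re ((of_real (sqrt (4 * pi) * x powr (1 / 4) * exp (- 2 * sqrt x)) * \<kappa> x) / \<theta>))) \<longlongrightarrow> of_real (Re (0 / \<theta>))) at_top"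
      using \<kappa>(2) \<theta> unfolding casy_def by (intro tendsto_of_real tendsto_Re tendsto_divide tendsto_const)
    moreover have "complex_of_real (Re ((of_real q * z) / \<theta>)) = of_real q * of_real (Re (z / \<theta>))" for q z
    proof -
      have "Re (complex_of_real q * y) = q * Re y" for y by simp
      from this[of "z / \<theta>"] show ?thesis by (simp only: times_divide_eq_right of_real_mult)
    qed
    moreover have "complex_of_real (Re (0 / \<theta>)) = 0" by simp
    ultimately show ?thesis unfolding casy_def e2_def by (simp only:)
  qed
  moreover have "\<exists>c c1. sol N A c c1 \<and> cgood A D (%y. of_real (V y)) (%y x. of_real (V y * e1 x + c y * e2 x))"
    if V: "sol N A V V1" for V V1
  proof -
    obtain \<alpha> \<beta> where "\<forall>y>0. of_real (V y) = \<alpha> * v y + \<beta> * w y"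
      using csol_representation[OF sol_imp_csol[OF V] v w W] by blast
    then have ab: "of_real (V y) = \<alpha> * v y + \<beta> * w y" if "y > 0" for y using that by blast
    define c c1 where "c y = Re (\<beta> * \<theta> * u y)" and "c1 y = Re (\<beta> * \<theta> * u1 y)" for y
    have "sol N A c c1" unfolding c_def[abs_def] c1_def[abs_def] by (rule csol_Re[OF csol_scale[OF u]])
    moreover have "cgood A D (%y. of_real (V y)) (%y x. of_real (V y * e1 x + c y * e2 x))"
    proof (rule cgood_cong[OF cgood_Re[OF cgood_lincomb[OF gv gw, of \<alpha> \<beta>]]])
      fix y :: real assume y: "y > 0"
      show "complex_of_real (Re (\<alpha> * v y + \<beta> * w y)) = of_real (V y)" unfolding ab[OF y, symmetric] by simp
      fix x :: real assume x: "x > 0"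
      have "\<alpha> * (v y * E x) + \<beta> * (w y * E x + u y * \<kappa> x) = of_real (V y) * E x + \<beta> * u y * \<kappa> x"
        unfolding ab[OF y] by (simp add: algebra_simps)
      also have "\<dots> = of_real (V y) * E x + (\<beta> * \<theta> * u y) * of_real (e2 x)"
        unfolding e2_def by (subst real[OF x]) (simp add: mult_ac)
      finally have "Re (\<alpha> * (v y * E x) + \<beta> * (w y * E x + u y * \<kappa> x)) = V y * e1 x + c y * e2 x"
        by (simp add: e1_def c_def)
      then show "complex_of_real (Re (\<alpha> * (v y * E x) + \<beta> * (w y * E x + u y * \<kappa> x))) = of_real (V y * e1 x + c y * e2 x)"
        by simp
    qed
    ultimately show ?thesis by blast
  qed
  ultimately show ?thesis by blast
qed

text \<open>The number \<open>D\<close> and the pair \<open>e1\<close>, \<open>e2\<close> serve all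
  V at once; only \<open>c\<close> depends on V.\<close>

definition core :: "real => real => bool" where
  "core N A \<longleftrightarrow> (\<exists>D e1 d1 e2 d2. sol N 1 e1 d1 \<and> sol N 1 e2 d2 \<and> casy (%x. of_real (e1 x)) 1 \<and> casy (%x. of_real (e2 x)) 0 \<and>
     (\<forall>V V1. sol N A V V1 --> (\<exists>c c1. sol N A c c1 \<and>
        cgood A D (%y. of_real (V y)) (%y x. of_real (V y * e1 x + c y * e2 x)))))"

definition simple_zeros :: "real => real => bool" where
  "simple_zeros N A \<longleftrightarrow> (\<forall>V V1. sol N A V V1 --> (\<forall>y0>0. V y0 = 0 \<and> V1 y0 = 0 --> (\<forall>y>0. V y = 0)))"

lemma simple_zeros_from_basis:
  assumes v: "csol (of_real N) A v v1" and w: "csol (of_real N) A w w1"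
    and W: "\<And>y. y > 0 ==> v y * w1 y - w y * v1 y = W" "W \<noteq> 0"
  shows "simple_zeros N A"
  unfolding simple_zeros_def
proof (intro allI impI)
  fix V V1 y0 y assume V: "sol N A V V1" and y0: "(0::real) < y0" "V y0 = 0 \<and> V1 y0 = 0" and y: "(0::real) < y"
  obtain \<alpha> \<beta> where ab: "\<forall>y>0. of_real (V y) = \<alpha> * v y + \<beta> * w y"
    "\<forall>y>0. complex_of_real (V y) = 0 \<and> complex_of_real (V1 y) = 0 --> \<alpha> = 0 \<and> \<beta> = 0"
    using csol_representation[OF sol_imp_csol[OF V] v w W] by blast
  have "\<alpha> = 0 \<and> \<beta> = 0" using ab(2) y0 by auto
  then show "V y = 0" using ab(1) y by auto
qed

lemma nat_bound_ex: "\<exists>D::nat. R <= real D"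
  using real_arch_simple by blast

text \<open>The second basis solution has order - \<nu> and must be paired with order - \<nu>.
  Writing \<open>ifun 1 (- \<nu>)\<close> as E + \<kappa> gives u = w, and \<kappa> is a multiple of
  the Macdonald function; it is recessive because the leading asymptotics are the same for all
  orders and cancel.\<close>

lemma core_noninteger:
  fixes N A :: real and \<nu> :: complex
  assumes N: "\<nu>\<^sup>2 = of_real N" and ni: "\<nu> \<notin> \<int>" and cn: "cnj \<nu> = \<nu> \<or> cnj \<nu> = - \<nu>"
  shows "core N A" "simple_zeros N A"
proof -
  have v: "csol (of_real N) A (ifun A \<nu>) (ifun1 A \<nu>)" "csol (of_real N) A (ifun A (- \<nu>)) (ifun1 A (- \<nu>))" for A
    using csol_ifun[of \<nu> A] csol_ifun[of "- \<nu>" A] by (simp_all add: N)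
  have W: "\<And>y. y > 0 ==> ifun A \<nu> y * ifun1 A (- \<nu>) y - ifun A (- \<nu>) y * ifun1 A \<nu> y = - sin (of_real pi * \<nu>) / of_real pi"
    by (rule wronskian_ifun)
  have W0: "- sin (of_real pi * \<nu>) / of_real pi \<noteq> 0"
  proof
    assume "- sin (of_real pi * \<nu>) / of_real pi = 0"
    then have "sin (of_real pi * \<nu>) = 0" by simp
    then obtain n :: int where "of_real pi * \<nu> = of_real (real_of_int n * pi)" by (auto simp: sin_eq_0)
    then have "of_real pi * \<nu> = of_real pi * of_int n" by simp
    then have "\<nu> = of_int n" by (subst (asm) mult_cancel_left) simp
    then show False using ni by simp
  qed
  show "simple_zeros N A" by (rule simple_zeros_from_basis[OF v W W0])
  obtain D :: nat where D: "norm \<nu> <= real D" using nat_bound_ex by blast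
  have D1: "Re \<nu> + real D >= 0" "Re (- \<nu>) + real D >= 0"
    using D abs_Re_le_cmod[of \<nu>] by auto
  \<comment> \<open>For real \<nu> the difference is real. For imaginary \<nu> conjugation exchanges
    its two terms, so it is purely imaginary.\<close>
  define \<theta> where "\<theta> = (if cnj \<nu> = \<nu> then 1 else \<i>)"
  let ?k = "%x. ifun 1 (- \<nu>) x - ifun 1 \<nu> x"
  have th: "\<theta> \<noteq> 0" by (simp add: \<theta>_def)
  have k: "csol (of_real N) 1 ?k (%x. ifun1 1 (- \<nu>) x - ifun1 1 \<nu> x)"
    using csol_lincomb[OF v(2) v(1), of 1 1 "-1"] by simp
  have cas: "casy ?k 0" using casy_diff[OF casy_ifun casy_ifun, of "- \<nu>" \<nu>] by simp
  have re: "?k x = \<theta> * of_real (Re (?k x / \<theta>))" for x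
  proof (cases "cnj \<nu> = \<nu>")
    case True
    then have "cnj (?k x) = ?k x" by (simp add: cnj_ifun)
    then have "?k x \<in> \<real>" by (simp only: Reals_cnj_iff)
    then obtain r where r: "?k x = of_real r" by (auto elim: Reals_cases)
    show ?thesis unfolding r \<theta>_def using True by simp
  next
    case False
    then have "cnj \<nu> = - \<nu>" using cn by simp
    then have "cnj (?k x) = - ?k x" by (simp add: cnj_ifun)
    then have "Re (?k x) = 0" by (metis complex_cnj(1) complex_Re_numeral cnj.simps(1) equation_minus_iff neg_equal_zero uminus_complex.sel(1))
    then show ?thesis using False by (simp add: \<theta>_def complex_eq_iff Re_divide Im_divide)
  qed
  have gw: "cgood A D (ifun A (- \<nu>)) (%y x. ifun A (- \<nu>) y * ifun 1 \<nu> x + ifun A (- \<nu>) y * ?k x)"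
    using cgood_ifun[OF D1(2), of A] by (simp add: algebra_simps)
  show "core N A"
    unfolding core_def
    by (rule exI[of _ D], rule core_from_basis[OF v(1) v(2) v(2) W W0 v(1) casy_ifun k cas re th cgood_ifun[OF D1(1)] gw])
qed

text \<open>
  For integer order \<open>n\<close> the functions of order \<open>n\<close> and \<open>- n\<close> are dependent. The second solution is a
  derivative in \<open>\<nu>\<close> at \<open>n\<close>, written as a Cauchy integral over the circle of radius \<open>1/2\<close>.
\<close>
definition circ :: "real => real => complex" where
  "circ n t = of_real n + exp (2 * of_real pi * \<i> * of_real t) / 2"

definition wt :: "real => complex" where
  "wt t = 2 * exp (- (2 * of_real pi * \<i> * of_real t))"

lemma continuous_on_circ [continuous_intros]: "continuous_on S (circ n)" "continuous_on S wt"
  unfolding circ_def wt_def by (intro continuous_intros; simp)+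

text \<open>Cauchy's formula for the derivative: on the circle of radius 1/2 the form dz / (2 pi i
  (z - n)^2) becomes \<open>wt t\<close> dt.\<close>

lemma integral_wt_circ:
  assumes "f holomorphic_on UNIV"
  shows "integral {0..1} (%t. wt t * f (circ n t)) = deriv f (of_real n)"
proof -
  have "((%u. f u / (u - of_real n) ^ Suc 1) has_contour_integral (2 * pi * \<i> / fact 1) * (deriv ^^ 1) f (of_real n)) (circlepath (of_real n) (1 / 2))"
    by (rule Cauchy_has_contour_integral_higher_derivative_circlepath)
       (use assms in \<open>auto intro: holomorphic_on_imp_continuous_on holomorphic_on_subset\<close>)
  then have "((%t. f (circlepath (of_real n) (1 / 2) t) / (circlepath (of_real n) (1 / 2) t - of_real n) ^ 2 *
      vector_derivative (circlepath (of_real n) (1 / 2)) (at t within {0..1})) has_integral 2 * pi * \<i> * deriv f (of_real n)) {0..1}"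
    unfolding has_contour_integral_def by (simp add: numeral_2_eq_2)
  then have "((%t. 2 * pi * \<i> * (wt t * f (circ n t))) has_integral 2 * pi * \<i> * deriv f (of_real n)) {0..1}"
  proof (rule has_integral_eq[rotated])
    fix t :: real assume t: "t \<in> {0..1}"
    let ?e = "exp (2 * of_real pi * \<i> * of_real t)"
    have c: "circlepath (of_real n) (1 / 2) t = circ n t" by (simp add: circlepath circ_def)
    have v: "vector_derivative (circlepath (of_real n) (1 / 2)) (at t within {0..1}) = 2 * pi * \<i> * (1 / 2) * ?e"
      using vector_derivative_circlepath01[of t "of_real n" "1 / 2"] t by simp
    have w: "wt t = 2 / ?e" by (simp add: wt_def exp_minus field_simps)
    have d: "circ n t - of_real n = ?e / 2" by (simp add: circ_def)
    show "f (circlepath (of_real n) (1 / 2) t) / (circlepath (of_real n) (1 / 2) t - of_real n) ^ 2 *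
      vector_derivative (circlepath (of_real n) (1 / 2)) (at t within {0..1}) = 2 * pi * \<i> * (wt t * f (circ n t))"
      unfolding c v w d by (simp add: field_simps power2_eq_square)
  qed
  then have "integral {0..1} (%t. 2 * pi * \<i> * (wt t * f (circ n t))) = 2 * pi * \<i> * deriv f (of_real n)"
    by (rule integral_unique)
  then show ?thesis by simp
qed

lemma holomorphic_on_ifun [holomorphic_intros]:
  "f holomorphic_on S ==> (%\<nu>. ifun A (f \<nu>) y) holomorphic_on S"
  unfolding ifun_def by (intro holomorphic_intros) auto

lemma holomorphic_on_ifun1 [holomorphic_intros]:
  "f holomorphic_on S ==> (%\<nu>. ifun1 A (f \<nu>) y) holomorphic_on S"
  unfolding ifun1_def by (intro holomorphic_intros) auto

lemma integral_circ_derivative: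
  fixes F G :: "complex => real => complex"
  assumes d: "\<And>\<nu> y. y > 0 ==> (F \<nu> has_vector_derivative G \<nu> y) (at y)"
    and cF: "continuous_on (UNIV \<times> {0<..}) (%(\<nu>, y). F \<nu> y)"
    and cG: "continuous_on (UNIV \<times> {0<..}) (%(\<nu>, y). G \<nu> y)"
    and y: "y > 0"
  shows "((%y. integral {0..1} (%t. wt t * F (circ n t) y)) has_vector_derivative
      integral {0..1} (%t. wt t * G (circ n t) y)) (at y)"
proof -
  have "((%y. integral (cbox 0 1) (%t. wt t * F (circ n t) y)) has_vector_derivative
      integral (cbox 0 1) (%t. wt t * G (circ n t) y)) (at y within {0<..})"
  proof (rule leibniz_rule_vector_derivative)
    fix x t :: real assume "x \<in> {0<..}" "t \<in> cbox 0 1"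
    then show "((%x. wt t * F (circ n t) x) has_vector_derivative wt t * G (circ n t) x) (at x within {0<..})"
      by (intro has_vector_derivative_mult_right has_vector_derivative_at_within[OF d]) auto
  next
    fix x :: real assume x: "x \<in> {0<..}"
    have "continuous_on (cbox 0 1) (%t. (%(\<nu>, y). F \<nu> y) (circ n t, x))"
      by (rule continuous_on_compose2[OF cF]) (use x in \<open>auto intro!: continuous_intros\<close>)
    then show "(%t. wt t * F (circ n t) x) integrable_on cbox 0 1"
      by (intro integrable_continuous continuous_intros) simp
  next
    have "continuous_on ({0<..} \<times> cbox 0 1) (%p. (%(\<nu>, y). G \<nu> y) (circ n (snd p), fst p))"
      by (rule continuous_on_compose2[OF cG])
         (auto intro!: continuous_intros continuous_on_compose2[OF continuous_on_circ(1)])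
    moreover have "continuous_on ({0<..} \<times> cbox 0 1) (%p::real \<times> real. wt (snd p))"
      by (rule continuous_on_compose2[OF continuous_on_circ(2)]) (auto intro!: continuous_intros)
    ultimately show "continuous_on ({0<..} \<times> cbox 0 1) (%(x, t). wt t * G (circ n t) x)"
      by (auto simp: case_prod_unfold intro!: continuous_intros)
  qed (use y in auto)
  then show ?thesis using y by (simp add: at_within_open[of y "{0<..}"])
qed

text \<open>The reciprocal Gamma function vanishes at the nonpositive integers, so the series of
  order - n begins at index n and is a shift of that of order n.\<close>

lemma ifun_neg_nat: 
  assumes "y > 0"
  shows "ifun A (- of_nat n) y = of_real A ^ n * ifun A (of_nat n) y"
proof -
  have shift: "clif (- of_nat n) x = x ^ n * clif (of_nat n) x" for x :: complex
  proof -
    let ?f = "%m. rGamma (- of_nat n + 1 + of_nat m) / fact m * x ^ m"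
    have z: "?f m = 0" if "m < n" for m
    proof -
      have "- of_nat n + 1 + of_nat m = (- of_nat (n - Suc m) :: complex)" using that by (simp add: of_nat_diff)
      then have "rGamma (- of_nat n + 1 + of_nat m :: complex) = 0" by (simp only: rGamma_eq_zero_iff) simp
      then show ?thesis by simp
    qed
    have "(%m. ?f (m + n)) = (%m. x ^ n * (rGamma (of_nat n + 1 + of_nat m) / fact m * x ^ m))"
    proof
      fix m
      have e: "- of_nat n + 1 + of_nat (m + n) = (of_nat (Suc m) :: complex)"
        "of_nat n + 1 + of_nat m = (of_nat (Suc (m + n)) :: complex)" by simp_all
      have r: "rGamma (of_nat (Suc k)) = (1 / fact k :: complex)" for k
        using Gamma_fact[of k, where ?'a = complex] by (simp add: rGamma_inverse_Gamma divide_inverse add.commute)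
      show "?f (m + n) = x ^ n * (rGamma (of_nat n + 1 + of_nat m) / fact m * x ^ m)"
        unfolding e r by (simp add: power_add mult_ac)
    qed
    then have "(%m. ?f (m + n)) sums (x ^ n * clif (of_nat n) x)"
      using sums_mult[OF clif_sums[of "of_nat n" x], of "x ^ n"] by simp
    then have "?f sums (x ^ n * clif (of_nat n) x + (\<Sum>m<n. ?f m))" using sums_iff_shift[of ?f n] by blast
    moreover have "(\<Sum>m<n. ?f m) = 0" using z by (intro sum.neutral) auto
    ultimately show ?thesis using clif_sums[of "- of_nat n" x] by (simp add: sums_unique2)
  qed
  have "rp y (of_nat n / 2) = rp y (- of_nat n / 2) * of_real (y ^ n)"
    unfolding rp_of_nat[OF assms, symmetric] rp_add[symmetric] by (rule arg_cong[of _ _ "rp y"]) simp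
  then show ?thesis unfolding ifun_def shift by (simp add: power_mult_distrib)
qed

text \<open>The factor \<open>A ^ n\<close> makes this vanish at \<nu> = n for all positive y. Its
  \<nu>-derivative there therefore solves the equation of order n: the extra term from
  differentiating \<nu>^2 carries the factor \<open>logf\<close> and is 0.\<close>

definition logf :: "nat => real => complex => real => complex" where
  "logf n A \<nu> y = ifun A (- \<nu>) y - of_real A ^ n * ifun A \<nu> y"

definition logf1 :: "nat => real => complex => real => complex" where
  "logf1 n A \<nu> y = ifun1 A (- \<nu>) y - of_real A ^ n * ifun1 A \<nu> y"

definition logsol :: "nat => real => real => complex" where
  "logsol n A y = integral {0..1} (%t. wt t * logf n A (circ n t) y)"

definition logsol1 :: "nat => real => real => complex" where
  "logsol1 n A y = integral {0..1} (%t. wt t * logf1 n A (circ n t) y)"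

lemma holomorphic_on_logf: "(%\<nu>. logf n A \<nu> y) holomorphic_on S" "(%\<nu>. logf1 n A \<nu> y) holomorphic_on S"
  unfolding logf_def logf1_def by (intro holomorphic_intros)+

lemma logsol_eq_deriv: "logsol n A y = deriv (%\<nu>. logf n A \<nu> y) (of_real n)"
  "logsol1 n A y = deriv (%\<nu>. logf1 n A \<nu> y) (of_real n)"
  unfolding logsol_def logsol1_def by (rule integral_wt_circ[OF holomorphic_on_logf(1)] integral_wt_circ[OF holomorphic_on_logf(2)])+

lemma csol_logf: "csol (\<nu>\<^sup>2) A (logf n A \<nu>) (logf1 n A \<nu>)"
  using csol_lincomb[OF csol_ifun[of "- \<nu>" A] csol_ifun[of \<nu> A, unfolded power2_minus[of \<nu>, symmetric]], of 1 "- (of_real A ^ n)"]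
  unfolding logf_def[abs_def] logf1_def[abs_def] by simp

lemma logf_zero: "y > 0 ==> logf n A (of_nat n) y = 0"
  by (simp add: logf_def ifun_neg_nat)

lemma logf1_zero:
  assumes y: "y > 0"
  shows "logf1 n A (of_nat n) y = 0"
proof -
  have d: "(logf n A (of_nat n) has_vector_derivative logf1 n A (of_nat n) y / of_real y) (at y)"
    using csol_logf[of "of_nat n" A n] y unfolding csol_def by blast
  have "((%_. 0) has_vector_derivative 0) (at y)" by simp
  then have "(logf n A (of_nat n) has_vector_derivative 0) (at y)"
    by (rule has_vector_derivative_transform_within_open[where S = "{0<..}"]) (use y logf_zero in auto)
  from vector_derivative_unique_at[OF d this] y show ?thesis by simp
qed

lemma continuous_on_logf:
  "continuous_on (UNIV \<times> {0<..}) (%(\<nu>, y). logf n A \<nu> y)"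
  "continuous_on (UNIV \<times> {0<..}) (%(\<nu>, y). logf1 n A \<nu> y)"
  unfolding logf_def logf1_def case_prod_unfold by (intro continuous_intros; auto)+

lemma csol_logsol: "csol ((of_nat n)\<^sup>2) A (logsol n A) (logsol1 n A)"
  unfolding csol_def
proof (intro allI impI conjI)
  fix y :: real assume y: "y > 0"
  let ?Y = "complex_of_real y"
  have d: "(logf n A \<nu> has_vector_derivative logf1 n A \<nu> y / of_real y) (at y)"
    "(logf1 n A \<nu> has_vector_derivative (\<nu>\<^sup>2 / 4 + of_real (A * y)) * logf n A \<nu> y / of_real y) (at y)" if "y > 0" for \<nu> y
    using csol_logf[of \<nu> A n] that unfolding csol_def by blast+
  have c1: "continuous_on (UNIV \<times> {0<..}) (%(\<nu>, y). logf1 n A \<nu> y / of_real y)"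
    and c2: "continuous_on (UNIV \<times> {0<..}) (%(\<nu>, y). (\<nu>\<^sup>2 / 4 + of_real (A * y)) * logf n A \<nu> y / of_real y)"
    using continuous_on_logf[of n A] by (auto simp: case_prod_unfold intro!: continuous_intros)
  have "(logsol n A has_vector_derivative integral {0..1} (%t. wt t * (logf1 n A (circ n t) y / ?Y))) (at y)"
    unfolding logsol_def[abs_def] by (rule integral_circ_derivative[OF d(1) continuous_on_logf(1) c1 y])
  moreover have "integral {0..1} (%t. wt t * (logf1 n A (circ n t) y / ?Y)) = logsol1 n A y / ?Y"
    unfolding logsol1_def times_divide_eq_right by simp
  ultimately show "(logsol n A has_vector_derivative logsol1 n A y / ?Y) (at y)" by (simp only:)
  have "(logsol1 n A has_vector_derivative integral {0..1} (%t. wt t * (((circ n t)\<^sup>2 / 4 + of_real (A * y)) * logf n A (circ n t) y / ?Y))) (at y)"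
    unfolding logsol1_def[abs_def] by (rule integral_circ_derivative[OF d(2) continuous_on_logf(2) c2 y])
  moreover have "integral {0..1} (%t. wt t * (((circ n t)\<^sup>2 / 4 + of_real (A * y)) * logf n A (circ n t) y / ?Y))
     = deriv (%\<nu>. (\<nu>\<^sup>2 / 4 + of_real (A * y)) * logf n A \<nu> y / ?Y) (of_real n)"
    by (rule integral_wt_circ) (use y in \<open>auto intro!: holomorphic_intros holomorphic_on_logf\<close>)
  moreover have "deriv (%\<nu>. (\<nu>\<^sup>2 / 4 + of_real (A * y)) * logf n A \<nu> y / ?Y) (of_real n)
      = ((of_nat n)\<^sup>2 / 4 + of_real (A * y)) * logsol n A y / ?Y"
  proof (rule DERIV_imp_deriv)
    have dl: "((%\<nu>. logf n A \<nu> y) has_field_derivative logsol n A y) (at (of_real n))"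
      unfolding logsol_eq_deriv by (rule holomorphic_derivI[OF holomorphic_on_logf(1)[of n A y UNIV]]) auto
    show "((%\<nu>. (\<nu>\<^sup>2 / 4 + of_real (A * y)) * logf n A \<nu> y / ?Y) has_field_derivative
       ((of_nat n)\<^sup>2 / 4 + of_real (A * y)) * logsol n A y / ?Y) (at (of_real n))"
      using y logf_zero[OF y, of n A]
      by (auto intro!: derivative_eq_intros dl[simplified])
  qed
  ultimately show "(logsol1 n A has_vector_derivative ((of_nat n)\<^sup>2 / 4 + of_real (A * y)) * logsol n A y / ?Y) (at y)" by simp
qed

lemma has_field_derivative_at_circ:
  assumes "f holomorphic_on UNIV"
  shows "(f has_field_derivative deriv f z) (at z)"
  by (rule holomorphic_derivI[OF assms]) auto

text \<open>The identity of \<open>wronskian_ifun\<close> differentiated in \<nu> at n; terms with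
  undifferentiated \<open>logf\<close> or \<open>logf1\<close> vanish there. The value is nonzero,
  so \<open>logsol\<close> completes the basis.\<close>

lemma wronskian_logsol:
  assumes y: "y > 0"
  shows "ifun A (of_nat n) y * logsol1 n A y - logsol n A y * ifun1 A (of_nat n) y = - cos (of_real pi * of_nat n)"
proof -
  have eq: "ifun A \<nu> y * logf1 n A \<nu> y - logf n A \<nu> y * ifun1 A \<nu> y = - sin (of_real pi * \<nu>) / of_real pi" for \<nu>
    using wronskian_ifun[OF y, of A \<nu>] by (simp add: logf_def logf1_def algebra_simps)
  have h: "(%\<nu>. ifun A \<nu> y) holomorphic_on UNIV" "(%\<nu>. ifun1 A \<nu> y) holomorphic_on UNIV"
    by (intro holomorphic_intros)+
  have d1: "((%\<nu>. logf n A \<nu> y) has_field_derivative logsol n A y) (at (of_nat n))"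
    "((%\<nu>. logf1 n A \<nu> y) has_field_derivative logsol1 n A y) (at (of_nat n))"
    using has_field_derivative_at_circ[OF holomorphic_on_logf(1)[of n A y UNIV], of "of_nat n"]
      has_field_derivative_at_circ[OF holomorphic_on_logf(2)[of n A y UNIV], of "of_nat n"]
    by (simp_all add: logsol_eq_deriv)
  have "((%\<nu>. ifun A \<nu> y * logf1 n A \<nu> y - logf n A \<nu> y * ifun1 A \<nu> y) has_field_derivative
      (ifun A (of_nat n) y * logsol1 n A y + deriv (%\<nu>. ifun A \<nu> y) (of_nat n) * logf1 n A (of_nat n) y)
      - (logf n A (of_nat n) y * deriv (%\<nu>. ifun1 A \<nu> y) (of_nat n) + logsol n A y * ifun1 A (of_nat n) y)) (at (of_nat n))"
    by (intro DERIV_diff DERIV_mult' d1 has_field_derivative_at_circ h)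
  then have "((%\<nu>. - sin (of_real pi * \<nu>) / of_real pi) has_field_derivative
      ifun A (of_nat n) y * logsol1 n A y - logsol n A y * ifun1 A (of_nat n) y) (at (of_nat n))"
    unfolding eq logf_zero[OF y] logf1_zero[OF y] by simp
  moreover have "((%\<nu>::complex. - sin (of_real pi * \<nu>) / of_real pi) has_field_derivative - cos (of_real pi * of_nat n)) (at (of_nat n))"
    by (auto intro!: derivative_eq_intros)
  ultimately show ?thesis by (rule DERIV_unique)
qed

text \<open>On the circle the orders \<nu> and - \<nu> both have normalised limit 1, so the
  integrand tends to 0, dominated through \<open>asy_bounded\<close> on the two circles. The
  constant \<open>4 * C\<close> is 2 for the modulus of \<open>wt\<close> times 2 for the two
  terms.\<close>

lemma casy_logsol: "casy (logsol n 1) 0"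
proof -
  let ?q = "%x. complex_of_real (sqrt (4 * pi) * x powr (1 / 4) * exp (- 2 * sqrt x))"
  let ?s = "%x t. indicator {0..1} t *\<^sub>R (wt t * (?q x * (ifun 1 (- circ n t) x - ifun 1 (circ n t) x)))"
  have cmp: "compact (circ n ` {0..1} \<union> (%t. - circ n t) ` {0..1})"
    by (intro compact_Un compact_continuous_image continuous_intros) auto
  obtain C where C: "\<And>\<nu> x. \<nu> \<in> circ n ` {0..1} \<union> (%t. - circ n t) ` {0..1} ==> x >= 1 ==> norm (asy \<nu> x) <= C"
    using asy_bounded[OF cmp] by blast
  have sx: "?s x t = indicator {0..1} t *\<^sub>R (wt t * (asy (- circ n t) x - asy (circ n t) x))" if "x > 0" for x t
    using that by (simp only: asy_eq_ifun right_diff_distrib)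
  have cont: "continuous_on {0..1} (%t. wt t * (?q x * (ifun 1 (- circ n t) x - ifun 1 (circ n t) x)))" if "x > 0" for x
    using that by (intro continuous_intros) auto
  have "((%x. integral\<^sup>L lborel (if x > 0 then ?s x else (%_. 0))) \<longlongrightarrow> integral\<^sup>L lborel (%_::real. 0::complex)) at_top"
  proof (rule integral_dominated_convergence_at_top[where w = "%t. 4 * C * indicator {0..1} t"])
    show "(if x > 0 then ?s x else (%_. 0)) \<in> borel_measurable lborel" for x
    proof (cases "x > 0")
      case True
      from borel_measurable_indicator_continuous[OF cont[OF True]] True show ?thesis by simp
    qed simp
    show "integrable lborel (%t. 4 * C * indicator {0..1::real} t)"
      by (intro integrable_mult_right integrable_real_indicator) auto
    show "AE t in lborel. ((%x. (if x > 0 then ?s x else (%_. 0)) t) \<longlongrightarrow> 0) at_top"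
    proof (rule AE_I2)
      fix t :: real
      have "((%x. indicator {0..1} t *\<^sub>R (wt t * (asy (- circ n t) x - asy (circ n t) x))) \<longlongrightarrow> indicator {0..1} t *\<^sub>R (wt t * (1 - 1))) at_top"
        by (intro tendsto_intros asy_tendsto)
      moreover have "eventually (%x. (if x > 0 then ?s x else (%_. 0)) t = indicator {0..1} t *\<^sub>R (wt t * (asy (- circ n t) x - asy (circ n t) x))) at_top"
        using eventually_gt_at_top[of 0] by eventually_elim (simp only: sx if_True)
      ultimately show "((%x. (if x > 0 then ?s x else (%_. 0)) t) \<longlongrightarrow> 0) at_top"
        by (simp add: tendsto_cong)
    qed
    show "\<forall>\<^sub>F x in at_top. AE t in lborel. norm ((if x > 0 then ?s x else (%_. 0)) t) <= 4 * C * indicator {0..1} t"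
      using eventually_ge_at_top[of 1]
    proof eventually_elim
      case (elim x)
      have "norm (?s x t) <= 4 * C * indicator {0..1} t" for t
      proof (cases "t \<in> {0..1}")
        case True
        have "norm (asy (- circ n t) x - asy (circ n t) x) <= C + C"
          using C[of "- circ n t" x] C[of "circ n t" x] True elim
          by (intro order_trans[OF norm_triangle_ineq4] add_mono) auto
        moreover have "norm (wt t) = 2" by (simp add: wt_def norm_mult)
        moreover have e: "?s x t = indicator {0..1} t *\<^sub>R (wt t * (asy (- circ n t) x - asy (circ n t) x))"
          using elim by (intro sx) simp
        ultimately show ?thesis unfolding e using True by (simp add: norm_mult)
      qed simp
      then show ?case using elim by (intro AE_I2) simp
    qed
  qed simp
  moreover have "eventually (%x. integral\<^sup>L lborel (if x > 0 then ?s x else (%_. 0)) = ?q x * logsol n 1 x) at_top"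
    using eventually_gt_at_top[of 0]
  proof eventually_elim
    case (elim x)
    from set_borel_integral_eq_integral(2)[OF borel_integrable_atLeastAtMost'[OF cont[OF elim]]]
    have "integral\<^sup>L lborel (?s x) = integral {0..1} (%t. wt t * (?q x * (ifun 1 (- circ n t) x - ifun 1 (circ n t) x)))"
      unfolding set_lebesgue_integral_def .
    also have "\<dots> = integral {0..1} (%t. ?q x * (wt t * logf n 1 (circ n t) x))"
      by (rule integral_cong) (simp add: logf_def)
    also have "\<dots> = ?q x * logsol n 1 x" unfolding logsol_def by (rule integral_mult_right)
    finally show ?case using elim by simp
  qed
  ultimately show ?thesis unfolding casy_def by (simp add: tendsto_cong)
qed

lemma Im_deriv_real:
  assumes "f holomorphic_on UNIV" "\<And>r. Im (f (of_real r)) = 0"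
  shows "Im (deriv f (of_real r)) = 0"
proof -
  have "((%r. f (of_real r)) has_vector_derivative deriv f (of_real r)) (at r)"
    using has_vector_derivative_real_field[OF has_field_derivative_at_circ[OF assms(1)]] by simp
  from bounded_linear.has_vector_derivative[OF bounded_linear_Im this]
  have "((%r. 0) has_vector_derivative Im (deriv f (of_real r))) (at r)" using assms(2) by simp
  moreover have "((%r. 0::real) has_vector_derivative 0) (at r)" by simp
  ultimately show ?thesis by (rule vector_derivative_unique_at)
qed

text \<open>The combination ifun A (- \<nu>) y ifun 1 (- \<nu>) x - A^n ifun A \<nu> y ifun 1 \<nu>
  x is differentiated in \<nu> at n. By the product rule and \<open>ifun_neg_nat\<close> the result
  is w(y) E(x) + u(y) \<kappa>(x) with u = A^n ifun A n and \<kappa> = logsol n 1.\<close>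

lemma core_nat: "core ((real n)\<^sup>2) A" "simple_zeros ((real n)\<^sup>2) A"
proof -
  let ?N = "(real n)\<^sup>2" and ?n = "of_nat n :: complex"
  have N: "complex_of_real ?N = ?n\<^sup>2" by simp
  have v: "csol (of_real ?N) A (ifun A ?n) (ifun1 A ?n)" for A unfolding N by (rule csol_ifun)
  have w: "csol (of_real ?N) A (logsol n A) (logsol1 n A)" for A unfolding N by (rule csol_logsol)
  note W = wronskian_logsol[of _ A n]
  have W0: "- cos (of_real pi * of_nat n) \<noteq> (0 :: complex)"
  proof -
    have "cos (of_real pi * of_nat n) = cos (complex_of_real (pi * real n))" by simp
    also have "\<dots> = complex_of_real (cos (pi * real n))" by (rule cos_of_real)
    also have "cos (pi * real n) = (-1) ^ n" by (simp add: mult.commute)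
    finally show ?thesis by simp
  qed
  show "simple_zeros ?N A" by (rule simple_zeros_from_basis[OF v w W W0])
  \<comment> \<open>The circle and its reflection stay in the disc of radius n + 1 about 0, so D = n
    + 1 suffices for both.\<close>
  have nc: "norm (circ n t) <= real (n + 1)" for t
  proof -
    have "norm (exp (2 * of_real pi * \<i> * of_real t) / 2) <= 1" by (simp add: norm_divide)
    then show ?thesis unfolding circ_def using norm_triangle_ineq[of "of_real (real n)" "exp (2 * of_real pi * \<i> * of_real t) / 2"] by simp
  qed
  have D: "Re (circ n t) + real (n + 1) >= 0" "Re (- circ n t) + real (n + 1) >= 0" for t
    using nc[of t] abs_Re_le_cmod[of "circ n t"] by auto
  let ?u = "%y. of_real A ^ n * ifun A ?n y"
  have u: "csol (of_real ?N) A ?u (%y. of_real A ^ n * ifun1 A ?n y)" by (rule csol_scale[OF v])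
  have gv: "cgood A (n + 1) (ifun A ?n) (%y x. ifun A ?n y * ifun 1 ?n x)"
    by (rule cgood_ifun) simp
  have g1: "cgood A (n + 1) (%y. integral {0..1} (%t. wt t * ifun A (- circ n t) y))
      (%y x. integral {0..1} (%t. wt t * (ifun A (- circ n t) y * ifun 1 (- circ n t) x)))"
    by (rule cgood_superposition) (use D in \<open>auto intro!: continuous_intros\<close>)
  have g2: "cgood A (n + 1) (%y. integral {0..1} (%t. wt t * ifun A (circ n t) y))
      (%y x. integral {0..1} (%t. wt t * (ifun A (circ n t) y * ifun 1 (circ n t) x)))"
    by (rule cgood_superposition) (use D in \<open>auto intro!: continuous_intros\<close>)
  have gw: "cgood A (n + 1) (logsol n A) (%y x. logsol n A y * ifun 1 ?n x + ?u y * logsol n 1 x)"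
  proof (rule cgood_cong[OF cgood_lincomb[OF g1 g2, of 1 "- (of_real A ^ n)"]])
    fix y :: real assume y: "y > 0"
    have h: "(%\<nu>. ifun A (- \<nu>) y) holomorphic_on UNIV" "(%\<nu>. ifun A \<nu> y) holomorphic_on UNIV" for A y
      by (intro holomorphic_intros)+
    note dh = has_field_derivative_at_circ[OF h(1)] has_field_derivative_at_circ[OF h(2)]
    have L: "logsol n A y = deriv (%\<nu>. ifun A (- \<nu>) y) ?n - of_real A ^ n * deriv (%\<nu>. ifun A \<nu> y) ?n" for A y
    proof -
      have "((%\<nu>. logf n A \<nu> y) has_field_derivative deriv (%\<nu>. ifun A (- \<nu>) y) ?n - of_real A ^ n * deriv (%\<nu>. ifun A \<nu> y) ?n) (at ?n)"
        unfolding logf_def by (intro DERIV_diff DERIV_cmult dh)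
      then show ?thesis unfolding logsol_eq_deriv by (simp add: DERIV_imp_deriv)
    qed
    have I: "integral {0..1} (%t. wt t * ifun A (- circ n t) y) = deriv (%\<nu>. ifun A (- \<nu>) y) ?n"
       "integral {0..1} (%t. wt t * ifun A (circ n t) y) = deriv (%\<nu>. ifun A \<nu> y) ?n"
      using integral_wt_circ[OF h(1)[of A y], of n] integral_wt_circ[OF h(2)[of A y], of n] by simp_all
    show "1 * integral {0..1} (%t. wt t * ifun A (- circ n t) y) + - (of_real A ^ n) * integral {0..1} (%t. wt t * ifun A (circ n t) y) = logsol n A y"
      unfolding I L by simp
    fix x :: real assume x: "x > 0"
    have hp: "(%\<nu>. ifun A (- \<nu>) y * ifun 1 (- \<nu>) x) holomorphic_on UNIV" "(%\<nu>. ifun A \<nu> y * ifun 1 \<nu> x) holomorphic_on UNIV"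
      by (intro holomorphic_intros)+
    have dp: "deriv (%\<nu>. ifun A (- \<nu>) y * ifun 1 (- \<nu>) x) ?n =
        ifun A (- ?n) y * deriv (%\<nu>. ifun 1 (- \<nu>) x) ?n + deriv (%\<nu>. ifun A (- \<nu>) y) ?n * ifun 1 (- ?n) x"
      "deriv (%\<nu>. ifun A \<nu> y * ifun 1 \<nu> x) ?n =
        ifun A ?n y * deriv (%\<nu>. ifun 1 \<nu> x) ?n + deriv (%\<nu>. ifun A \<nu> y) ?n * ifun 1 ?n x"
      by (rule DERIV_imp_deriv, rule DERIV_mult', rule dh, rule dh)+
    have J: "integral {0..1} (%t. wt t * (ifun A (- circ n t) y * ifun 1 (- circ n t) x)) = deriv (%\<nu>. ifun A (- \<nu>) y * ifun 1 (- \<nu>) x) ?n"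
       "integral {0..1} (%t. wt t * (ifun A (circ n t) y * ifun 1 (circ n t) x)) = deriv (%\<nu>. ifun A \<nu> y * ifun 1 \<nu> x) ?n"
      using integral_wt_circ[OF hp(1), of n] integral_wt_circ[OF hp(2), of n] by simp_all
    show "1 * integral {0..1} (%t. wt t * (ifun A (- circ n t) y * ifun 1 (- circ n t) x)) +
        - (of_real A ^ n) * integral {0..1} (%t. wt t * (ifun A (circ n t) y * ifun 1 (circ n t) x)) =
        logsol n A y * ifun 1 ?n x + ?u y * logsol n 1 x"
      unfolding J dp L ifun_neg_nat[OF y] ifun_neg_nat[OF x] by (simp add: algebra_simps)
  qed
  \<comment> \<open>\<open>logf\<close> is real at real orders, hence so is its derivative in the
    order.\<close>
  have re: "logsol n 1 x = 1 * of_real (Re (logsol n 1 x / 1))" for x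
  proof -
    have "Im (logf n 1 (of_real r) x) = 0" for r
    proof -
      have "cnj (logf n 1 (of_real r) x) = logf n 1 (of_real r) x" by (simp add: logf_def cnj_ifun)
      then show ?thesis by (metis Reals_cnj_iff complex_is_Real_iff)
    qed
    from Im_deriv_real[OF holomorphic_on_logf(1) this] have "Im (logsol n 1 x) = 0" unfolding logsol_eq_deriv .
    then show ?thesis by (simp add: complex_eq_iff)
  qed
  show "core ?N A"
    unfolding core_def
    by (rule exI[of _ "n + 1"], rule core_from_basis[OF v w u W W0 v casy_ifun w casy_logsol re _ gv gw]) simp_all
qed

text \<open>A square root \<nu> of a real number N is real or purely imaginary, so conjugation sends
  it to \<nu> or - \<nu>; if it is an integer, N is the square of a natural number.\<close>

theorem core_exists: "core N A" "simple_zeros N A"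
proof -
  have "\<exists>\<nu>. \<nu>\<^sup>2 = complex_of_real N \<and> (cnj \<nu> = \<nu> \<or> cnj \<nu> = - \<nu>) \<and> (\<nu> \<in> \<int> --> (\<exists>n. N = (real n)\<^sup>2))"
  proof (cases "N >= 0")
    case True
    have "(complex_of_real (sqrt N))\<^sup>2 = of_real N" using True by (simp flip: of_real_power)
    moreover have "\<exists>n. N = (real n)\<^sup>2" if int: "complex_of_real (sqrt N) \<in> \<int>"
    proof -
      obtain k :: int where k: "complex_of_real (sqrt N) = of_int k" using int by (auto elim: Ints_cases)
      have "Re (complex_of_real (sqrt N)) = Re (of_int k)" unfolding k ..
      then have "sqrt N = real_of_int k" by simp
      then have "N = (real_of_int k)\<^sup>2" using True by (metis real_sqrt_pow2)
      also have "\<dots> = (real (nat \<bar>k\<bar>))\<^sup>2" by simp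
      finally show ?thesis by blast
    qed
    ultimately show ?thesis by (intro exI[of _ "complex_of_real (sqrt N)"]) auto
  next
    case False
    have "(\<i> * complex_of_real (sqrt (- N)))\<^sup>2 = of_real N" using False by (simp add: power_mult_distrib flip: of_real_power)
    moreover have "\<i> * complex_of_real (sqrt (- N)) \<notin> \<int>"
    proof
      assume "\<i> * complex_of_real (sqrt (- N)) \<in> \<int>"
      then obtain k :: int where k: "\<i> * complex_of_real (sqrt (- N)) = of_int k" by (auto elim: Ints_cases)
      have "Im (\<i> * complex_of_real (sqrt (- N))) = Im (of_int k)" unfolding k ..
      then show False using False by simp
    qed
    ultimately show ?thesis by (intro exI[of _ "\<i> * complex_of_real (sqrt (- N))"]) auto
  qed
  then obtain \<nu> where \<nu>: "\<nu>\<^sup>2 = complex_of_real N" "cnj \<nu> = \<nu> \<or> cnj \<nu> = - \<nu>" "\<nu> \<in> \<int> --> (\<exists>n. N = (real n)\<^sup>2)" by blast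
  show "core N A" "simple_zeros N A"
    using core_noninteger[OF \<nu>(1) _ \<nu>(2), of A] core_nat[of _ A] \<nu>(3) by (cases "\<nu> \<in> \<int>"; auto)+
qed

section \<open>Kernels of the normal form and their initial values\<close>

lemma sol_wronskian:
  assumes "sol N A v v1" "sol N A w w1"
  shows "\<exists>W. \<forall>y>0. v y * w1 y - w y * v1 y = W"
proof -
  obtain W where W: "\<And>y. y > 0 ==> complex_of_real (v y) * of_real (w1 y) - of_real (w y) * of_real (v1 y) = W"
    using csol_wronskian[OF sol_imp_csol[OF assms(1)] sol_imp_csol[OF assms(2)]] by blast
  have "v y * w1 y - w y * v1 y = Re W" if "y > 0" for y
    unfolding W[OF that, symmetric] by simp
  then show ?thesis by blast
qed

lemma solD:
  assumes "sol N A V V1" "y > 0"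
  shows "(V has_real_derivative V1 y / y) (at y)" "(V1 has_real_derivative (N / 4 + A * y) * V y / y) (at y)"
  using assms unfolding sol_def by auto

section \<open>Decay of the recessive solution\<close>

definition rasy :: "(real => real) => real => bool" where
  "rasy e l \<longleftrightarrow> ((%x. sqrt (4 * pi) * x powr (1 / 4) * exp (- 2 * sqrt x) * e x) \<longlongrightarrow> l) at_top"

lemma casy_imp_rasy: 
  assumes "casy (%x. of_real (e x)) l"
  shows "rasy e (Re l)"
  using tendsto_Re[OF assms[unfolded casy_def]] unfolding rasy_def by simp

lemma nonneg_if_decreasing_to_zero:
  fixes f :: "real => real"
  assumes "\<And>x. x >= X ==> (f has_real_derivative f' x) (at x)" "\<And>x. x >= X ==> f' x <= 0"
    and lim: "(f \<longlongrightarrow> 0) at_top" and x: "x >= X"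
  shows "f x >= 0"
proof (rule tendsto_upperbound[OF lim])
  show "\<forall>\<^sub>F y in at_top. f y <= f x"
    using eventually_ge_at_top[of x]
  proof eventually_elim
    case (elim y)
    show ?case
    proof (rule DERIV_nonpos_imp_nonincreasing[OF elim])
      fix u assume "x <= u" "u <= y"
      then have "u >= X" using x by simp
      then show "\<exists>l. (f has_real_derivative l) (at u) \<and> l <= 0" using assms(1,2) by blast
    qed
  qed
qed simp

text \<open>The limit 0 in \<open>rasy\<close> only says that e2 is small compared with e1. The
  ratio r = e2 / e1 tends to 0 and satisfies r' = W / (x e1^2), of size exp(- 4 sqrt x) / sqrt x;
  integrating from infinity bounds r by a multiple of exp(- 4 sqrt x), and e2 itself then decays
  like exp(- 2 sqrt x) up to powers of x.\<close>

lemma recessive_decay: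
  assumes s1: "sol N 1 e1 d1" and s2: "sol N 1 e2 d2" and a1: "rasy e1 1" and a2: "rasy e2 0"
  obtains X where "X > 0" "\<And>x. x >= X ==> \<bar>e2 x\<bar> <= 1"
proof -
  define q where "q x = sqrt (4 * pi) * x powr (1 / 4) * exp (- 2 * sqrt x)" for x :: real
  have q1: "((%x. q x * e1 x) \<longlongrightarrow> 1) at_top" and q2: "((%x. q x * e2 x) \<longlongrightarrow> 0) at_top"
    using a1 a2 unfolding rasy_def q_def by simp_all
  obtain W where W: "\<And>y. y > 0 ==> e1 y * d2 y - e2 y * d1 y = W" using sol_wronskian[OF s1 s2] by blast
  have "eventually (%x. q x * e1 x > 1 / 2) at_top" "eventually (%x. q x * e1 x < 2) at_top"
    by (rule order_tendstoD[OF q1]; simp)+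
  then have "eventually (%x. q x * e1 x > 1 / 2 \<and> q x * e1 x < 2 \<and> x >= 1) at_top"
    using eventually_ge_at_top[of 1] by eventually_elim simp
  then obtain X where X: "\<And>x. x >= X ==> q x * e1 x > 1 / 2 \<and> q x * e1 x < 2 \<and> x >= 1"
    unfolding eventually_at_top_linorder by blast
  have qp: "q x > 0" if "x >= X" for x using X[OF that] by (simp add: q_def)
  have e1p: "e1 x > 0" if "x >= X" for x using X[OF that] qp[OF that] by (metis divide_pos_pos less_trans zero_less_mult_pos zero_less_numeral zero_less_one)
  define r where "r x = e2 x / e1 x" for x
  have r0: "(r \<longlongrightarrow> 0) at_top"
  proof -
    have "((%x. (q x * e2 x) / (q x * e1 x)) \<longlongrightarrow> 0 / 1) at_top" by (intro tendsto_divide q1 q2) simp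
    moreover have "eventually (%x. (q x * e2 x) / (q x * e1 x) = r x) at_top"
      using eventually_ge_at_top[of X] by eventually_elim (use qp in \<open>force simp: r_def\<close>)
    ultimately show ?thesis by (simp add: tendsto_cong)
  qed
  have rd: "(r has_real_derivative W / (x * (e1 x)\<^sup>2)) (at x)" if "x >= X" for x
  proof -
    have x: "x > 0" using X[OF that] by simp
    have "(r has_real_derivative (d2 x / x * e1 x - e2 x * (d1 x / x)) / (e1 x * e1 x)) (at x)"
      unfolding r_def[abs_def] by (rule DERIV_divide[OF solD(1)[OF s2 x] solD(1)[OF s1 x]]) (use e1p[OF that] in simp)
    moreover have "(d2 x / x * e1 x - e2 x * (d1 x / x)) / (e1 x * e1 x) = W / (x * (e1 x)\<^sup>2)"
      unfolding W[OF x, symmetric] using x e1p[OF that] by (simp add: field_simps power2_eq_square)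
    ultimately show ?thesis by simp
  qed
  \<comment> \<open>From \<open>q x * e1 x > 1 / 2\<close> one has 1 / e1^2 <= 4 q^2 = 16 pi sqrt x
    exp(- 4 sqrt x), while the derivative of \<open>G\<close> is - 2 C exp(- 4 sqrt x) / sqrt x;
    hence 8 pi.\<close>
  define C where "C = 8 * pi * \<bar>W\<bar>"
  define G where "G x = C * exp (- 4 * sqrt x)" for x
  have Gd: "(G has_real_derivative - (2 * C * exp (- 4 * sqrt x) / sqrt x)) (at x)" if "x >= X" for x
    unfolding G_def[abs_def] using X[OF that] by (auto intro!: derivative_eq_intros simp: field_simps)
  have G0: "(G \<longlongrightarrow> 0) at_top" unfolding G_def[abs_def] by real_asymp
  have rb: "\<bar>W / (x * (e1 x)\<^sup>2)\<bar> <= 2 * C * exp (- 4 * sqrt x) / sqrt x" if "x >= X" for x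
  proof -
    have x: "x >= 1" using X[OF that] by simp
    have "1 <= 2 * q x * e1 x" using X[OF that] by simp
    then have "1 <= (2 * q x * e1 x)\<^sup>2" by (simp add: one_le_power)
    then have i: "1 / (e1 x)\<^sup>2 <= 4 * (q x)\<^sup>2" using e1p[OF that] by (simp add: field_simps power_mult_distrib)
    have q2: "(q x)\<^sup>2 = 4 * pi * sqrt x * exp (- 4 * sqrt x)"
    proof -
      have "(x powr (1 / 4))\<^sup>2 = sqrt x" using x by (simp add: powr_half_sqrt flip: powr_realpow powr_powr[symmetric] add: powr_powr powr_numeral)
      moreover have "(exp (- 2 * sqrt x))\<^sup>2 = exp (- 4 * sqrt x)" by (simp add: exp_double[symmetric] power2_eq_square flip: exp_add)
      ultimately show ?thesis unfolding q_def power_mult_distrib by simp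
    qed
    have "\<bar>W / (x * (e1 x)\<^sup>2)\<bar> = \<bar>W\<bar> / x * (1 / (e1 x)\<^sup>2)" using x by (simp add: abs_mult)
    also have "\<dots> <= \<bar>W\<bar> / x * (4 * (q x)\<^sup>2)" using x by (intro mult_left_mono i) auto
    also have "\<dots> = 2 * C * exp (- 4 * sqrt x) * (sqrt x / x)" unfolding q2 C_def by simp
    also have "sqrt x / x = 1 / sqrt x" using x by (simp add: real_div_sqrt field_simps)
    finally show ?thesis by simp
  qed
  have rG: "\<bar>r x\<bar> <= G x" if "x >= X" for x
  proof -
    have "G x - r x >= 0"
    proof (rule nonneg_if_decreasing_to_zero[of X "%x. G x - r x", OF DERIV_diff[OF Gd rd]])
      show "- (2 * C * exp (- 4 * sqrt x) / sqrt x) - W / (x * (e1 x)\<^sup>2) <= 0" if "x >= X" for x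
        using rb[OF that] unfolding abs_le_iff by linarith
      show "((%x. G x - r x) \<longlongrightarrow> 0) at_top" using tendsto_diff[OF G0 r0] by simp
    qed (use that in auto)
    moreover have "G x + r x >= 0"
    proof (rule nonneg_if_decreasing_to_zero[of X "%x. G x + r x", OF DERIV_add[OF Gd rd]])
      show "- (2 * C * exp (- 4 * sqrt x) / sqrt x) + W / (x * (e1 x)\<^sup>2) <= 0" if "x >= X" for x
        using rb[OF that] unfolding abs_le_iff by linarith
      show "((%x. G x + r x) \<longlongrightarrow> 0) at_top" using tendsto_add[OF G0 r0] by simp
    qed (use that in auto)
    ultimately show ?thesis by simp
  qed
  have e2b: "\<bar>e2 x\<bar> <= 2 * C / q x * exp (- 4 * sqrt x)" if "x >= X" for x
  proof -
    have "\<bar>e2 x\<bar> = \<bar>r x\<bar> * e1 x" using e1p[OF that] by (simp add: r_def abs_mult)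
    also have "\<dots> <= G x * e1 x" using rG[OF that] e1p[OF that] by (intro mult_right_mono) auto
    also have "\<dots> <= G x * (2 / q x)"
      using X[OF that] qp[OF that] by (intro mult_left_mono) (auto simp: G_def C_def field_simps)
    finally show ?thesis by (simp add: G_def mult_ac)
  qed
  have "((%x. x\<^sup>2 * (2 * C / q x * exp (- 4 * sqrt x))) \<longlongrightarrow> 0) at_top"
    unfolding q_def by real_asymp
  then have "eventually (%x. x\<^sup>2 * (2 * C / q x * exp (- 4 * sqrt x)) < 1) at_top"
    by (rule order_tendstoD(2)) simp
  then have "eventually (%x. \<bar>e2 x\<bar> <= 1 / x\<^sup>2 \<and> x >= 1) at_top"
    using eventually_ge_at_top[of X] eventually_ge_at_top[of 1]
  proof eventually_elim
    case (elim x)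
    have "x\<^sup>2 * \<bar>e2 x\<bar> <= x\<^sup>2 * (2 * C / q x * exp (- 4 * sqrt x))" using e2b[OF elim(2)] by (intro mult_left_mono) auto
    then have "x\<^sup>2 * \<bar>e2 x\<bar> <= 1" using elim(1) by simp
    then show ?case using elim(3) by (simp add: field_simps)
  qed
  then obtain Y where Y: "\<And>x. x >= Y ==> \<bar>e2 x\<bar> <= 1 / x\<^sup>2 \<and> x >= 1" unfolding eventually_at_top_linorder by blast
  have Y1: "Y >= 1" using Y[of Y] by simp
  show ?thesis
  proof (rule that[of Y])
    show "Y > 0" using Y1 by simp
    show "\<bar>e2 x\<bar> <= 1" if "x >= Y" for x
    proof -
      have "1 / x\<^sup>2 <= 1" using Y[OF that] by (simp add: divide_le_eq one_le_power)
      then show ?thesis using Y[OF that] by linarith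
    qed
  qed
qed

text \<open>For e = I_\<nu>(2 sqrt x) this is, up to scaling, the transition density of a squared
  Bessel process, conjugated by a power and damped by exp(- A t).\<close>

definition ker :: "real => (real => real) => real => real => real => real" where
  "ker A e y z t = exp (- A * t - (z + y) / t) / t * e (z * y / t\<^sup>2)"

text \<open>Joint continuity, also of the second derivative in z, is what allows every term of the
  equation to be taken under an integral in y.\<close>

definition kernel_pde :: "real => real => (real => real => real => real) => bool" where
  "kernel_pde N A G \<longleftrightarrow> (\<exists>Gt Gz Gzz.
     continuous_on ({0<..} \<times> {0<..} \<times> {0<..}) (%(y, z, t). G y z t) \<and>
     continuous_on ({0<..} \<times> {0<..} \<times> {0<..}) (%(y, z, t). Gt y z t) \<and>
     continuous_on ({0<..} \<times> {0<..} \<times> {0<..}) (%(y, z, t). Gz y z t) \<and>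
     continuous_on ({0<..} \<times> {0<..} \<times> {0<..}) (%(y, z, t). Gzz y z t) \<and>
     (\<forall>y>0. \<forall>z>0. \<forall>t>0.
       ((%s. G y z s) has_real_derivative Gt y z t) (at t) \<and>
       ((%x. G y x t) has_real_derivative Gz y z t) (at z) \<and>
       ((%x. Gz y x t) has_real_derivative Gzz y z t) (at z) \<and>
       Gt y z t = z * Gzz y z t + Gz y z t - (N / (4 * z) + A) * G y z t))"

lemma continuous_on_sol:
  assumes "sol N A V V1"
  shows "continuous_on {0<..} V" "continuous_on {0<..} V1"
  using solD[OF assms] by (auto intro!: continuous_at_imp_continuous_on DERIV_isCont)

lemma continuous_on_sol_compose:
  assumes "sol N A V V1" "continuous_on S f" "\<And>p. p \<in> S ==> f p > 0"
  shows "continuous_on S (%p. V (f p))" "continuous_on S (%p. V1 (f p))"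
  using continuous_on_compose2[OF continuous_on_sol(1)[OF assms(1)] assms(2)]
    continuous_on_compose2[OF continuous_on_sol(2)[OF assms(1)] assms(2)] assms(3) by auto

context
  fixes N A :: real and e d :: "real => real"
  assumes s: "sol N 1 e d"
begin

lemma ker_parts_derivatives:
  assumes "y > 0" "z > 0" "t > 0"
  shows "((%z. e (z * y / t\<^sup>2)) has_real_derivative d (z * y / t\<^sup>2) / z) (at z)"
    "((%z. d (z * y / t\<^sup>2)) has_real_derivative (N / 4 + z * y / t\<^sup>2) * e (z * y / t\<^sup>2) / z) (at z)"
    "((%t. e (z * y / t\<^sup>2)) has_real_derivative - 2 * d (z * y / t\<^sup>2) / t) (at t)"
    "((%z. exp (- A * t - (z + y) / t) / t) has_real_derivative - (1 / t) * (exp (- A * t - (z + y) / t) / t)) (at z)"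
    "((%t. exp (- A * t - (z + y) / t) / t) has_real_derivative (- A + (z + y) / t\<^sup>2 - 1 / t) * (exp (- A * t - (z + y) / t) / t)) (at t)"
proof -
  have x: "z * y / t\<^sup>2 > 0" using assms by simp
  have xz: "((%z. z * y / t\<^sup>2) has_real_derivative y / t\<^sup>2) (at z)"
    by (rule DERIV_cong[OF DERIV_cdivide[OF DERIV_cmult_right[OF DERIV_ident]]]) simp
  have xt: "((%t. z * y / t\<^sup>2) has_real_derivative - 2 * z * y / t ^ 3) (at t)"
    using assms by (auto intro!: derivative_eq_intros simp: field_simps power2_eq_square power3_eq_cube)
  note se = solD(1)[OF s x] and sd = solD(2)[OF s x]
  show "((%z. e (z * y / t\<^sup>2)) has_real_derivative d (z * y / t\<^sup>2) / z) (at z)"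
    by (rule DERIV_cong[OF DERIV_chain2[OF se xz]]) (use assms in \<open>simp add: field_simps\<close>)
  show "((%t. e (z * y / t\<^sup>2)) has_real_derivative - 2 * d (z * y / t\<^sup>2) / t) (at t)"
    by (rule DERIV_cong[OF DERIV_chain2[OF se xt]]) (use assms in \<open>simp add: field_simps power2_eq_square power3_eq_cube\<close>)
  show "((%z. d (z * y / t\<^sup>2)) has_real_derivative (N / 4 + z * y / t\<^sup>2) * e (z * y / t\<^sup>2) / z) (at z)"
    by (rule DERIV_cong[OF DERIV_chain2[OF sd xz]]) (use assms in \<open>simp add: field_simps\<close>)
  show "((%z. exp (- A * t - (z + y) / t) / t) has_real_derivative - (1 / t) * (exp (- A * t - (z + y) / t) / t)) (at z)"
    using assms by (auto intro!: derivative_eq_intros simp: field_simps)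
  show "((%t. exp (- A * t - (z + y) / t) / t) has_real_derivative (- A + (z + y) / t\<^sup>2 - 1 / t) * (exp (- A * t - (z + y) / t) / t)) (at t)"
    using assms by (auto intro!: derivative_eq_intros simp: field_simps power2_eq_square)
qed

lemma kernel_pde_ker: "kernel_pde N A (ker A e)"
proof -
  define P where "P y z t = exp (- A * t - (z + y) / t) / t" for y z t :: real
  define E where "E y z t = e (z * y / t\<^sup>2)" for y z t
  define F where "F y z t = d (z * y / t\<^sup>2)" for y z t
  have cs: "continuous_on ({0<..} \<times> {0<..} \<times> {0<..}) (%q. P (fst q) (fst (snd q)) (snd (snd q)))"
    "continuous_on ({0<..} \<times> {0<..} \<times> {0<..}) (%q. E (fst q) (fst (snd q)) (snd (snd q)))"
    "continuous_on ({0<..} \<times> {0<..} \<times> {0<..}) (%q. F (fst q) (fst (snd q)) (snd (snd q)))"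
    unfolding P_def E_def F_def
    by (intro continuous_intros continuous_on_sol_compose[OF s]; auto)+
  have dd: "((%x. E y x t) has_real_derivative F y z t / z) (at z)"
    "((%x. F y x t) has_real_derivative (N / 4 + z * y / t\<^sup>2) * E y z t / z) (at z)"
    "((%t. E y z t) has_real_derivative - 2 * F y z t / t) (at t)"
    "((%x. P y x t) has_real_derivative - (1 / t) * P y z t) (at z)"
    "((%t. P y z t) has_real_derivative (- A + (z + y) / t\<^sup>2 - 1 / t) * P y z t) (at t)"
    if "y > 0" "z > 0" "t > 0" for y z t
    unfolding P_def E_def F_def by (rule ker_parts_derivatives[OF that])+
  define Gz where "Gz y z t = P y z t * (- E y z t / t + F y z t / z)" for y z t
  define Gzz where "Gzz y z t = P y z t * (E y z t / t\<^sup>2 - 2 * F y z t / (t * z) - F y z t / z\<^sup>2 + (N / 4 + z * y / t\<^sup>2) * E y z t / z\<^sup>2)" for y z t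
  define Gt where "Gt y z t = P y z t * ((- A + (z + y) / t\<^sup>2 - 1 / t) * E y z t - 2 * F y z t / t)" for y z t
  have G: "ker A e = (%y z t. P y z t * E y z t)"
    by (intro ext) (simp add: ker_def P_def E_def)
  show ?thesis
    unfolding kernel_pde_def G
  proof (rule exI[of _ Gt], rule exI[of _ Gz], rule exI[of _ Gzz], intro conjI allI impI)
    show "continuous_on ({0<..} \<times> {0<..} \<times> {0<..}) (%(y, z, t). P y z t * E y z t)"
      "continuous_on ({0<..} \<times> {0<..} \<times> {0<..}) (%(y, z, t). Gt y z t)"
      "continuous_on ({0<..} \<times> {0<..} \<times> {0<..}) (%(y, z, t). Gz y z t)"
      "continuous_on ({0<..} \<times> {0<..} \<times> {0<..}) (%(y, z, t). Gzz y z t)"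
      unfolding Gt_def Gz_def Gzz_def case_prod_unfold by (intro continuous_intros cs; auto)+
    fix y z t :: real assume p: "y > 0" "z > 0" "t > 0"
    note dd = dd[OF p]
    have ne: "y \<noteq> 0" "z \<noteq> 0" "t \<noteq> 0" using p by auto
    show "((%s. P y z s * E y z s) has_real_derivative Gt y z t) (at t)"
      by (rule DERIV_cong[OF DERIV_mult[OF dd(5,3)]]) (simp add: Gt_def algebra_simps)
    show "((%x. P y x t * E y x t) has_real_derivative Gz y z t) (at z)"
      by (rule DERIV_cong[OF DERIV_mult[OF dd(4,1)]]) (simp add: Gz_def algebra_simps)
    have i: "((%x. - E y x t / t + F y x t / x) has_real_derivative
        - (F y z t / z) / t + ((N / 4 + z * y / t\<^sup>2) * E y z t / z * z - F y z t * 1) / (z * z)) (at z)"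
      by (intro DERIV_add DERIV_cdivide DERIV_minus DERIV_divide dd DERIV_ident ne)
    show "((%x. Gz y x t) has_real_derivative Gzz y z t) (at z)"
      unfolding Gz_def
      by (rule DERIV_cong[OF DERIV_mult[OF dd(4) i]]) (use ne in \<open>simp add: Gzz_def field_simps power2_eq_square\<close>)
    show "Gt y z t = z * Gzz y z t + Gz y z t - (N / (4 * z) + A) * (P y z t * E y z t)"
      unfolding Gt_def Gz_def Gzz_def using ne by (simp add: field_simps power2_eq_square)
  qed
qed

end

text \<open>The weight will only be integrable, since the regularised quotient of the data by the
  stationary solution may jump; all smoothness is carried by the kernel \<open>g\<close>.\<close>

definition wint :: "real => real => (real => real) => (real => real) => real" where
  "wint a b w g = (LINT y:{a..b}|lborel. w y * g y)"

section \<open>Limits and derivatives under the weighted integral\<close>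

lemma set_integrable_mult_continuous:
  fixes w g :: "real => real"
  assumes w: "set_integrable lborel {a..b} w" and g: "continuous_on {a..b} g"
  shows "set_integrable lborel {a..b} (%y. w y * g y)"
proof -
  obtain B where "\<forall>y\<in>g ` {a..b}. norm y <= B"
    using compact_imp_bounded[OF compact_continuous_image[OF g compact_Icc]] unfolding bounded_iff by blast
  then have B: "\<bar>g y\<bar> <= B" if "y \<in> {a..b}" for y using that by auto
  have m: "(%y. indicator {a..b} y *\<^sub>R g y) \<in> borel_measurable lborel"
    using borel_measurable_indicator_continuous[OF g] by simp
  have mw: "(%y. indicator {a..b} y *\<^sub>R w y) \<in> borel_measurable lborel"
    using w unfolding set_integrable_def by (rule borel_measurable_integrable)
  have eq: "(%y. indicator {a..b} y *\<^sub>R (w y * g y)) = (%y. (indicator {a..b} y *\<^sub>R w y) * (indicator {a..b} y *\<^sub>R g y))"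
    by (auto simp: indicator_def)
  show ?thesis
    unfolding set_integrable_def
  proof (rule Bochner_Integration.integrable_bound)
    show "integrable lborel (%y. B * (indicator {a..b} y *\<^sub>R w y))"
      using w unfolding set_integrable_def by (rule integrable_mult_right)
    show "(%y. indicator {a..b} y *\<^sub>R (w y * g y)) \<in> borel_measurable lborel"
      unfolding eq using m mw by measurable
    show "AE y in lborel. norm (indicator {a..b} y *\<^sub>R (w y * g y)) <= norm (B * (indicator {a..b} y *\<^sub>R w y))"
    proof (rule AE_I2)
      fix y
      have "\<bar>w y\<bar> * \<bar>g y\<bar> <= \<bar>w y\<bar> * \<bar>B\<bar>" if "y \<in> {a..b}" using B[OF that] by (intro mult_left_mono) auto
      then show "norm (indicator {a..b} y *\<^sub>R (w y * g y)) <= norm (B * (indicator {a..b} y *\<^sub>R w y))"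
        by (cases "y \<in> {a..b}") (auto simp: abs_mult mult_ac)
    qed
  qed
qed

lemma wint_seq:
  fixes w :: "real => real" and f :: "nat => real => real"
  assumes w: "set_integrable lborel {a..b} w" and f: "\<And>n. continuous_on {a..b} (f n)" and g: "continuous_on {a..b} g"
    and lim: "\<And>y. y \<in> {a..b} ==> (%n. f n y) \<longlonglongrightarrow> g y"
    and bound: "\<And>n y. y \<in> {a..b} ==> \<bar>f n y\<bar> <= B"
  shows "(%n. wint a b w (f n)) \<longlonglongrightarrow> wint a b w g"
  unfolding wint_def set_lebesgue_integral_def
proof (rule integral_dominated_convergence)
  show "integrable lborel (%y. B * \<bar>indicator {a..b} y *\<^sub>R w y\<bar>)"
    using w unfolding set_integrable_def by (intro integrable_mult_right integrable_abs)
  show "(%y. indicator {a..b} y *\<^sub>R (w y * g y)) \<in> borel_measurable lborel"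
    using set_integrable_mult_continuous[OF w g] unfolding set_integrable_def by (rule borel_measurable_integrable)
  show "(%y. indicator {a..b} y *\<^sub>R (w y * f n y)) \<in> borel_measurable lborel" for n
    using set_integrable_mult_continuous[OF w f] unfolding set_integrable_def by (rule borel_measurable_integrable)
  show "AE y in lborel. (%n. indicator {a..b} y *\<^sub>R (w y * f n y)) \<longlonglongrightarrow> indicator {a..b} y *\<^sub>R (w y * g y)"
  proof (rule AE_I2)
    fix y show "(%n. indicator {a..b} y *\<^sub>R (w y * f n y)) \<longlonglongrightarrow> indicator {a..b} y *\<^sub>R (w y * g y)"
      by (cases "y \<in> {a..b}") (auto intro!: tendsto_intros lim)
  qed
  show "AE y in lborel. norm (indicator {a..b} y *\<^sub>R (w y * f n y)) <= B * \<bar>indicator {a..b} y *\<^sub>R w y\<bar>" for n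
  proof (rule AE_I2)
    fix y
    have "\<bar>w y\<bar> * \<bar>f n y\<bar> <= \<bar>w y\<bar> * B" if "y \<in> {a..b}" using bound[OF that] by (intro mult_left_mono) auto
    then show "norm (indicator {a..b} y *\<^sub>R (w y * f n y)) <= B * \<bar>indicator {a..b} y *\<^sub>R w y\<bar>"
      by (cases "y \<in> {a..b}") (auto simp: abs_mult mult_ac)
  qed
qed

lemma wint_abs_le:
  assumes w: "set_integrable lborel {a..b} w" and g: "continuous_on {a..b} g" and B: "\<And>y. y \<in> {a..b} ==> \<bar>g y\<bar> <= B"
  shows "\<bar>wint a b w g\<bar> <= B * (LINT y:{a..b}|lborel. \<bar>w y\<bar>)"
proof -
  have i: "integrable lborel (%y. indicator {a..b} y *\<^sub>R \<bar>w y\<bar>)"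
    using integrable_abs[OF w[unfolded set_integrable_def]]
    by (rule back_subst[of "integrable lborel"]) (auto simp: indicator_def)
  have "norm (LINT y|lborel. indicator {a..b} y *\<^sub>R (w y * g y)) <= (LINT y|lborel. B * (indicator {a..b} y *\<^sub>R \<bar>w y\<bar>))"
  proof (rule Bochner_Integration.integral_norm_bound_integral)
    show "integrable lborel (%y. indicator {a..b} y *\<^sub>R (w y * g y))"
      using set_integrable_mult_continuous[OF w g] unfolding set_integrable_def .
    show "integrable lborel (%y. B * (indicator {a..b} y *\<^sub>R \<bar>w y\<bar>))" by (intro integrable_mult_right i)
    fix y
    have "\<bar>w y\<bar> * \<bar>g y\<bar> <= \<bar>w y\<bar> * B" if "y \<in> {a..b}" using B[OF that] by (intro mult_left_mono) auto
    then show "norm (indicator {a..b} y *\<^sub>R (w y * g y)) <= B * (indicator {a..b} y *\<^sub>R \<bar>w y\<bar>)"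
      by (cases "y \<in> {a..b}") (auto simp: abs_mult mult_ac)
  qed
  then show ?thesis unfolding wint_def set_lebesgue_integral_def by simp
qed

text \<open>A convergent sequence together with its limit is compact, so the kernel is bounded along
  it and dominated convergence applies.\<close>

lemma wint_continuous:
  fixes G :: "real => real => real => real"
  assumes w: "set_integrable lborel {a..b} w"
    and G: "continuous_on ({a..b} \<times> {0<..} \<times> {0<..}) (%(y, z, t). G y z t)"
  shows "continuous_on ({0<..} \<times> {0<..}) (%(z, t). wint a b w (%y. G y z t))"
  unfolding continuous_on_sequentially
proof (intro allI ballI impI, elim conjE)
  fix X and p :: "real \<times> real"
  assume p: "p \<in> {0<..} \<times> {0<..}" and X: "\<forall>n. X n \<in> {0<..} \<times> {0<..}" and l: "X \<longlonglongrightarrow> p"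
  let ?K = "insert p (range X)"
  have K: "compact ?K" by (rule compact_sequence_with_limit[OF l])
  have cK: "continuous_on ({a..b} \<times> ?K) (%(y, z, t). G y z t)"
  proof (rule continuous_on_subset[OF G])
    have "?K \<subseteq> {0<..} \<times> {0<..}" using p X by blast
    then show "{a..b} \<times> ?K \<subseteq> {a..b} \<times> {0<..} \<times> {0<..}" by blast
  qed
  have "compact ((%(y, z, t). G y z t) ` ({a..b} \<times> ?K))"
    by (intro compact_continuous_image cK compact_Times K compact_Icc)
  from compact_imp_bounded[OF this] obtain B where "\<forall>q\<in>(%(y, z, t). G y z t) ` ({a..b} \<times> ?K). norm q <= B"
    unfolding bounded_iff by blast
  then have B: "\<bar>(%(y, z, t). G y z t) q\<bar> <= B" if "q \<in> {a..b} \<times> ?K" for q using imageI[OF that, of "%(y, z, t). G y z t"] by (auto simp only: real_norm_def)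
  have cy: "continuous_on {a..b} (%y. G y (fst q) (snd q))" if "q \<in> ?K" for q
  proof -
    have "continuous_on {a..b} (%y. (%(y, z, t). G y z t) (y, q))"
      by (rule continuous_on_compose2[OF cK]) (use that in \<open>auto intro!: continuous_intros\<close>)
    then show ?thesis by (simp add: case_prod_unfold)
  qed
  have "(%n. wint a b w (%y. G y (fst (X n)) (snd (X n)))) \<longlonglongrightarrow> wint a b w (%y. G y (fst p) (snd p))"
  proof (rule wint_seq[OF w])
    show "continuous_on {a..b} (%y. G y (fst (X n)) (snd (X n)))" for n by (rule cy) auto
    show "continuous_on {a..b} (%y. G y (fst p) (snd p))" by (rule cy) auto
    fix y assume y: "y \<in> {a..b}"
    have "continuous_on ?K (%q. (%(y, z, t). G y z t) (y, q))"
      by (rule continuous_on_compose2[OF cK]) (use y in \<open>auto intro!: continuous_intros\<close>)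
    then have "continuous_on ?K (%q. G y (fst q) (snd q))" by (simp add: case_prod_unfold)
    then show "(%n. G y (fst (X n)) (snd (X n))) \<longlonglongrightarrow> G y (fst p) (snd p)"
      using l unfolding continuous_on_sequentially by (auto simp: o_def)
    show "\<bar>G y (fst (X n)) (snd (X n))\<bar> <= B" for n using B[of "(y, X n)"] y by (simp add: case_prod_unfold)
  qed
  then show "((%(z, t). wint a b w (%y. G y z t)) \<circ> X) \<longlonglongrightarrow> (%(z, t). wint a b w (%y. G y z t)) p"
    by (simp add: case_prod_unfold o_def)
qed

text \<open>Difference quotients are bounded by the mean value inequality on [s / 2, 2 s], once the
  finitely many increments of size at least s / 2 are discarded.\<close>

lemma wint_deriv:
  fixes f f' :: "real => real => real"
  assumes w: "set_integrable lborel {a..b} w"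
    and f: "\<And>s. s > 0 ==> continuous_on {a..b} (%y. f y s)"
    and d: "\<And>y s. y \<in> {a..b} ==> s > 0 ==> ((%s. f y s) has_real_derivative f' y s) (at s)"
    and f': "continuous_on ({a..b} \<times> {0<..}) (%(y, s). f' y s)"
    and s: "s > 0"
  shows "((%s. wint a b w (%y. f y s)) has_real_derivative wint a b w (%y. f' y s)) (at s)"
  unfolding DERIV_def tendsto_at_iff_sequentially
proof (intro allI impI)
  fix X assume X0: "\<forall>i. X i \<in> UNIV - {0::real}" and l0: "X \<longlonglongrightarrow> 0"
  have Xne: "X n \<noteq> 0" for n using X0 by auto
  have "eventually (%n. \<bar>X n\<bar> < s / 2) sequentially"
    using order_tendstoD(2)[OF tendsto_rabs[OF l0], of "s / 2"] s by simp
  then obtain m where m: "\<And>n. n >= m ==> \<bar>X n\<bar> < s / 2" unfolding eventually_sequentially by blast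
  have "compact ((%(y, s). f' y s) ` ({a..b} \<times> {s / 2..2 * s}))"
    by (intro compact_continuous_image continuous_on_subset[OF f'] compact_Times compact_Icc) (use s in auto)
  from compact_imp_bounded[OF this] obtain B where "\<forall>q\<in>(%(y, s). f' y s) ` ({a..b} \<times> {s / 2..2 * s}). norm q <= B"
    unfolding bounded_iff by blast
  then have B: "\<bar>f' y u\<bar> <= B" if "y \<in> {a..b}" "u \<in> {s / 2..2 * s}" for y u
    using imageI[of "(y, u)" "{a..b} \<times> {s / 2..2 * s}" "%(y, s). f' y s"] that by auto
  define Y where "Y n = X (n + m)" for n
  have Y: "\<bar>Y n\<bar> < s / 2" "Y n \<noteq> 0" for n using m Xne by (auto simp: Y_def)
  have lY: "Y \<longlonglongrightarrow> 0" unfolding Y_def by (rule LIMSEQ_ignore_initial_segment[OF l0])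
  have pos: "s + Y n > 0" for n using Y(1)[of n] s by (simp add: abs_less_iff)
  let ?q = "%n y. (f y (s + Y n) - f y s) / Y n"
  have "(%n. wint a b w (?q n)) \<longlonglongrightarrow> wint a b w (%y. f' y s)"
  proof (rule wint_seq[OF w])
    show "continuous_on {a..b} (?q n)" for n using Y(2) by (intro continuous_intros f pos s) auto
    have "continuous_on {a..b} (%y. (%(y, s). f' y s) (y, s))"
      by (rule continuous_on_compose2[OF f']) (use s in \<open>auto intro!: continuous_intros\<close>)
    then show "continuous_on {a..b} (%y. f' y s)" by simp
    fix y assume y: "y \<in> {a..b}"
    have "(%h. (f y (s + h) - f y s) / h) \<midarrow>0\<rightarrow> f' y s"
      using d[OF y s] by (simp only: DERIV_def)
    then show "(%n. ?q n y) \<longlonglongrightarrow> f' y s"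
      unfolding tendsto_at_iff_sequentially using lY Y(2) by (auto simp: o_def)
    fix n
    show "\<bar>?q n y\<bar> <= B"
    proof -
      have "\<bar>f y (s + Y n) - f y s\<bar> <= B * \<bar>(s + Y n) - s\<bar>"
      proof (rule field_differentiable_bound[of "{s / 2..2 * s}" "%s. f y s" "%s. f' y s", unfolded real_norm_def])
        show "((%s. f y s) has_real_derivative f' y u) (at u within {s / 2..2 * s})" if "u \<in> {s / 2..2 * s}" for u
          by (rule has_field_derivative_at_within[OF d[OF y]]) (use that s in auto)
        show "\<bar>f' y u\<bar> <= B" if "u \<in> {s / 2..2 * s}" for u using B[OF y that] .
        show "s + Y n \<in> {s / 2..2 * s}" using Y(1)[of n] s by (auto simp: abs_less_iff)
      qed (use s in auto)
      then show ?thesis using Y(2)[of n] by (simp add: abs_divide divide_le_eq)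
    qed
  qed
  moreover have "wint a b w (?q n) = (wint a b w (%y. f y (s + Y n)) - wint a b w (%y. f y s)) / Y n" for n
  proof -
    have i: "set_integrable lborel {a..b} (%y. w y * f y (s + Y n))" "set_integrable lborel {a..b} (%y. w y * f y s)"
      by (intro set_integrable_mult_continuous[OF w] f pos s)+
    have "wint a b w (?q n) = (LINT y:{a..b}|lborel. (w y * f y (s + Y n) - w y * f y s) / Y n)"
      unfolding wint_def by (simp add: right_diff_distrib)
    also have "\<dots> = (LINT y:{a..b}|lborel. w y * f y (s + Y n) - w y * f y s) / Y n"
      by (rule set_integral_divide_zero)
    also have "\<dots> = (wint a b w (%y. f y (s + Y n)) - wint a b w (%y. f y s)) / Y n"
      unfolding wint_def by (subst set_integral_diff(2)[OF i]) simp
    finally show ?thesis .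
  qed
  ultimately have "(%n. (%h. (wint a b w (%y. f y (s + h)) - wint a b w (%y. f y s)) / h) (X (n + m))) \<longlonglongrightarrow> wint a b w (%y. f' y s)"
    unfolding Y_def by simp
  then have "(%n. (%h. (wint a b w (%y. f y (s + h)) - wint a b w (%y. f y s)) / h) (X n)) \<longlonglongrightarrow> wint a b w (%y. f' y s)"
    by (rule LIMSEQ_offset[where f = "%n. (%h. (wint a b w (%y. f y (s + h)) - wint a b w (%y. f y s)) / h) (X n)" and k = m])
  then show "((%h. (wint a b w (%y. f y (s + h)) - wint a b w (%y. f y s)) / h) \<circ> X) \<longlonglongrightarrow> wint a b w (%y. f' y s)"
    by (simp add: o_def)
qed

lemma linear_pde_wint:
  assumes w: "set_integrable lborel {a..b} w" and a: "a > 0" and G: "kernel_pde N A G"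
  shows "linear_pde (%z. z) (%_. 1) (%z. - (N / (4 * z) + A)) ({0<..} \<times> {0<..}) (%z t. wint a b w (%y. G y z t))"
proof -
  from G obtain Gt Gz Gzz where c:
     "continuous_on ({0<..} \<times> {0<..} \<times> {0<..}) (%(y, z, t). G y z t)"
     "continuous_on ({0<..} \<times> {0<..} \<times> {0<..}) (%(y, z, t). Gt y z t)"
     "continuous_on ({0<..} \<times> {0<..} \<times> {0<..}) (%(y, z, t). Gz y z t)"
     "continuous_on ({0<..} \<times> {0<..} \<times> {0<..}) (%(y, z, t). Gzz y z t)"
   and d: "\<forall>y>0. \<forall>z>0. \<forall>t>0.
       ((%s. G y z s) has_real_derivative Gt y z t) (at t) \<and>
       ((%x. G y x t) has_real_derivative Gz y z t) (at z) \<and>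
       ((%x. Gz y x t) has_real_derivative Gzz y z t) (at z) \<and>
       Gt y z t = z * Gzz y z t + Gz y z t - (N / (4 * z) + A) * G y z t"
    unfolding kernel_pde_def by blast
  have sub: "{a..b} \<times> {0<..} \<times> {0<..} \<subseteq> ({0<..} :: real set) \<times> ({0<..} :: real set) \<times> ({0<..} :: real set)" using a by auto
  note cab = c[THEN continuous_on_subset, OF sub]
  have cy: "continuous_on {a..b} (%y. F y z t)" if "continuous_on ({a..b} \<times> {0<..} \<times> {0<..}) (%(y, z, t). F y z t)" "z > 0" "t > 0" for F :: "real => real => real => real" and z t
  proof -
    have "continuous_on {a..b} (%y. (%(y, z, t). F y z t) (y, z, t))"
      by (rule continuous_on_compose2[OF that(1)]) (use that in \<open>auto intro!: continuous_intros\<close>)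
    then show ?thesis by simp
  qed
  have cz: "continuous_on ({a..b} \<times> {0<..}) (%(y, z). F y z t)" if "continuous_on ({a..b} \<times> {0<..} \<times> {0<..}) (%(y, z, t). F y z t)" "t > 0" for F :: "real => real => real => real" and t
  proof -
    have "continuous_on ({a..b} \<times> {0<..}) (%q. (%(y, z, t). F y z t) (fst q, snd q, t))"
      by (rule continuous_on_compose2[OF that(1)]) (use that in \<open>auto intro!: continuous_intros\<close>)
    then show ?thesis by (simp add: case_prod_unfold)
  qed
  have ct: "continuous_on ({a..b} \<times> {0<..}) (%(y, t). F y z t)" if "continuous_on ({a..b} \<times> {0<..} \<times> {0<..}) (%(y, z, t). F y z t)" "z > 0" for F :: "real => real => real => real" and z
  proof -
    have "continuous_on ({a..b} \<times> {0<..}) (%q. (%(y, z, t). F y z t) (fst q, z, snd q))"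
      by (rule continuous_on_compose2[OF that(1)]) (use that in \<open>auto intro!: continuous_intros\<close>)
    then show ?thesis by (simp add: case_prod_unfold)
  qed
  show ?thesis
    unfolding linear_pde_def
  proof (rule exI[of _ "%z t. wint a b w (%y. Gt y z t)"], rule exI[of _ "%z t. wint a b w (%y. Gz y z t)"],
      rule exI[of _ "%z t. wint a b w (%y. Gzz y z t)"], intro conjI ballI)
    show "continuous_on ({0<..} \<times> {0<..}) (%(z, t). wint a b w (%y. Gt y z t))"
      "continuous_on ({0<..} \<times> {0<..}) (%(z, t). wint a b w (%y. Gz y z t))"
      by (rule wint_continuous[OF w cab(2)], rule wint_continuous[OF w cab(3)])
    fix p :: "real \<times> real" assume "p \<in> {0<..} \<times> {0<..}"
    then obtain z t where p: "p = (z, t)" and z: "z > 0" and t: "t > 0" by auto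
    have dt: "((%s. G y z s) has_real_derivative Gt y z s) (at s)" if "y \<in> {a..b}" "s > 0" for y s
      using d[rule_format, of y z s] that a z by (metis atLeastAtMost_iff less_le_trans)
    have dz: "((%x. G y x t) has_real_derivative Gz y x t) (at x)" if "y \<in> {a..b}" "x > 0" for y x
      using d[rule_format, of y x t] that a t by (metis atLeastAtMost_iff less_le_trans)
    have dzz: "((%x. Gz y x t) has_real_derivative Gzz y x t) (at x)" if "y \<in> {a..b}" "x > 0" for y x
      using d[rule_format, of y x t] that a t by (metis atLeastAtMost_iff less_le_trans)
    have 1: "((%s. wint a b w (%y. G y z s)) has_real_derivative wint a b w (%y. Gt y z t)) (at t)"
      by (rule wint_deriv[OF w cy[OF cab(1) z] dt ct[OF cab(2) z] t])
    have 2: "((%x. wint a b w (%y. G y x t)) has_real_derivative wint a b w (%y. Gz y z t)) (at z)"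
      by (rule wint_deriv[OF w cy[OF cab(1) _ t] dz cz[OF cab(3) t] z])
    have 3: "((%x. wint a b w (%y. Gz y x t)) has_real_derivative wint a b w (%y. Gzz y z t)) (at z)"
      by (rule wint_deriv[OF w cy[OF cab(3) _ t] dzz cz[OF cab(4) t] z])
    have i: "set_integrable lborel {a..b} (%y. w y * G y z t)" "set_integrable lborel {a..b} (%y. w y * Gz y z t)"
      "set_integrable lborel {a..b} (%y. w y * Gzz y z t)"
      by (intro set_integrable_mult_continuous[OF w] cy z t cab)+
    have "wint a b w (%y. Gt y z t) = (LINT y:{a..b}|lborel. (z * (w y * Gzz y z t) + w y * Gz y z t) - (N / (4 * z) + A) * (w y * G y z t))"
      unfolding wint_def
    proof (rule set_lebesgue_integral_cong)
      show "\<forall>y. y \<in> {a..b} --> w y * Gt y z t = (z * (w y * Gzz y z t) + w y * Gz y z t) - (N / (4 * z) + A) * (w y * G y z t)"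
      proof (intro allI impI)
        fix y assume "y \<in> {a..b}"
        then have "Gt y z t = z * Gzz y z t + Gz y z t - (N / (4 * z) + A) * G y z t" using d a z t by auto
        then show "w y * Gt y z t = (z * (w y * Gzz y z t) + w y * Gz y z t) - (N / (4 * z) + A) * (w y * G y z t)"
          by (simp only:) (simp add: algebra_simps)
      qed
    qed simp
    also have "\<dots> = z * wint a b w (%y. Gzz y z t) + wint a b w (%y. Gz y z t) - (N / (4 * z) + A) * wint a b w (%y. G y z t)"
      unfolding wint_def using i
      by (simp only: set_integral_diff(2) set_integral_add set_integrable_mult_right set_integral_mult_right)
    finally have 4: "wint a b w (%y. Gt y z t) = z * wint a b w (%y. Gzz y z t) + 1 * wint a b w (%y. Gz y z t)
        + - (N / (4 * z) + A) * wint a b w (%y. G y z t)" by (simp only: mult_1 mult_minus_left diff_conv_add_uminus)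
    show "case p of (z, t) =>
       ((%s. wint a b w (%y. G y z s)) has_real_derivative wint a b w (%y. Gt y z t)) (at t) \<and>
       ((%x. wint a b w (%y. G y x t)) has_real_derivative wint a b w (%y. Gz y z t)) (at z) \<and>
       ((%x. wint a b w (%y. Gz y x t)) has_real_derivative wint a b w (%y. Gzz y z t)) (at z) \<and>
       wint a b w (%y. Gt y z t) = z * wint a b w (%y. Gzz y z t) + 1 * wint a b w (%y. Gz y z t)
        + - (N / (4 * z) + A) * wint a b w (%y. G y z t)"
      using 1 2 3 4 p by simp
  qed
qed

section \<open>Behaviour of the kernels as time tends to 0\<close>

lemma eventually_near_initial:
  assumes "z0 > (0::real)" "\<delta> > (0::real)"
  shows "eventually (%(z, t). z > z0 / 2 \<and> z < 2 * z0 \<and> 0 < t \<and> t < \<delta>) (at (z0, 0) within {0<..} \<times> {0<..})"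
proof -
  have "eventually (%p. fst p > z0 / 2 \<and> fst p < 2 * z0 \<and> snd p < \<delta>) (at (z0, 0::real) within {0<..} \<times> {0<..})"
  proof (intro eventually_conj)
    have f: "((%p. fst p) \<longlongrightarrow> fst (z0, 0::real)) (at (z0, 0::real) within {0<..} \<times> {0<..})"
      by (rule tendsto_fst[OF tendsto_ident_at])
    have s: "((%p. snd p) \<longlongrightarrow> snd (z0, 0::real)) (at (z0, 0::real) within {0<..} \<times> {0<..})"
      by (rule tendsto_snd[OF tendsto_ident_at])
    show "eventually (%p. fst p > z0 / 2) (at (z0, 0::real) within {0<..} \<times> {0<..})"
      "eventually (%p. fst p < 2 * z0) (at (z0, 0::real) within {0<..} \<times> {0<..})"
      "eventually (%p. snd p < \<delta>) (at (z0, 0::real) within {0<..} \<times> {0<..})"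
      by (rule order_tendstoD(1)[OF f] order_tendstoD(2)[OF f] order_tendstoD(2)[OF s]; use assms in simp)+
  qed
  moreover have "eventually (%p. p \<in> {0<..} \<times> {0<..}) (at (z0, 0::real) within {0<..} \<times> {0<..})"
    by (simp add: eventually_at_filter)
  ultimately show ?thesis by eventually_elim auto
qed

lemma tendsto_snd_at_right:
  "filterlim snd (at_right 0) (at (z0::real, 0::real) within {0<..} \<times> {0<..})"
proof -
  have "((%p. snd p) \<longlongrightarrow> snd (z0, 0::real)) (at (z0, 0::real) within {0<..} \<times> {0<..})"
    by (rule tendsto_snd[OF tendsto_ident_at])
  moreover have "eventually (%p. snd p \<in> {0<..} \<and> snd p \<noteq> 0) (at (z0, 0::real) within {0<..} \<times> {0<..})"
    by (rule eventually_at_filter[THEN iffD2], rule always_eventually) auto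
  ultimately show ?thesis by (simp add: filterlim_at)
qed

text \<open>For small t the argument z y / t^2 exceeds \<open>X\<close> on all of {a..b}, where
  \<open>e\<close> is bounded by 1. What remains is a constant times exp(- a / t) / t.\<close>

lemma recessive_kernel_vanishes:
  assumes a: "a > 0" and z0: "z0 > 0" and w: "set_integrable lborel {a..b} w"
    and s: "sol N 1 e d" and X: "X > 0" "\<And>x. x >= X ==> \<bar>e x\<bar> <= 1"
  shows "((%(z, t). wint a b w (%y. ker A e y z t)) \<longlongrightarrow> 0) (at (z0, 0) within {0<..} \<times> {0<..})"
proof -
  define I where "I = (LINT y:{a..b}|lborel. \<bar>w y\<bar>)"
  \<comment> \<open>Chosen so that z > z0 / 2, y >= a and t < \<delta> force z y / t^2 >= X.\<close>
  define \<delta> where "\<delta> = sqrt (z0 / 2 * a / X)"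
  have \<delta>: "\<delta> > 0" using a z0 X by (simp add: \<delta>_def)
  have ck: "continuous_on {a..b} (%y. ker A e y z t)" if "z > 0" "t > 0" for z t
    unfolding ker_def using that a
    by (intro continuous_intros continuous_on_sol_compose[OF s]) auto
  have large: "z * y / t\<^sup>2 >= X" if "z > z0 / 2" "0 < t" "t < \<delta>" "y \<in> {a..b}" for z t y
  proof -
    have "t\<^sup>2 <= \<delta>\<^sup>2" using that by (intro power_mono) auto
    also have "\<dots> = z0 / 2 * a / X" using a z0 X by (simp add: \<delta>_def)
    finally have "X * t\<^sup>2 <= z0 / 2 * a" using X by (simp add: field_simps)
    also have "\<dots> <= z * y" using that a z0 by (intro mult_mono) auto
    finally show ?thesis using that by (simp add: field_simps)
  qed
  have pre: "exp (- A * t - (z + y) / t) / t <= exp \<bar>A\<bar> * exp (- a / t) / t" if "z > 0" "0 < t" "t < 1" "y \<in> {a..b}" for z t y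
  proof -
    have "- A * t <= \<bar>A\<bar> * 1"
    proof -
      have "- A * t <= \<bar>A\<bar> * t" using that by (intro mult_right_mono) auto
      also have "\<dots> <= \<bar>A\<bar> * 1" using that by (intro mult_left_mono) auto
      finally show ?thesis .
    qed
    moreover have "a / t <= (z + y) / t" using that by (intro divide_right_mono) auto
    ultimately have "- A * t - (z + y) / t <= \<bar>A\<bar> + - a / t" by simp
    then have "exp (- A * t - (z + y) / t) <= exp (\<bar>A\<bar> + - a / t)" by (simp only: exp_le_cancel_iff)
    then have "exp (- A * t - (z + y) / t) <= exp \<bar>A\<bar> * exp (- a / t)" by (simp only: exp_add)
    then show ?thesis using that by (intro divide_right_mono) auto
  qed
  let ?F = "at (z0, 0::real) within {0<..} \<times> {0<..}"
  have ev: "eventually (%(z, t). z > z0 / 2 \<and> z < 2 * z0 \<and> 0 < t \<and> t < min \<delta> 1) ?F"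
    by (rule eventually_near_initial[OF z0]) (use \<delta> in simp)
  have B1: "eventually (%p. norm ((%(z, t). wint a b w (%y. ker A e y z t)) p) <= exp \<bar>A\<bar> * exp (- a / snd p) / snd p * I) ?F"
    using ev
  proof eventually_elim
    case (elim p)
    obtain z t where p: "p = (z, t)" by (cases p)
    with elim z0 have h: "z > z0 / 2" "z > 0" "0 < t" "t < \<delta>" "t < 1" by auto
    have "\<bar>wint a b w (%y. ker A e y z t)\<bar> <= exp \<bar>A\<bar> * exp (- a / t) / t * I"
      unfolding I_def
    proof (rule wint_abs_le[OF w ck[OF h(2,3)]])
      fix y assume y: "y \<in> {a..b}"
      show "\<bar>ker A e y z t\<bar> <= exp \<bar>A\<bar> * exp (- a / t) / t"
        unfolding ker_def abs_mult using mult_mono[OF pre[OF h(2,3,5) y] X(2)[OF large[OF h(1,3,4) y]]] h by simp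
    qed
    then show ?case by (simp add: p)
  qed
  have L1: "((%t. exp \<bar>A\<bar> * exp (- a / t) / t * I) \<longlongrightarrow> 0) (at_right 0)" using a by real_asymp
  show "((%(z, t). wint a b w (%y. ker A e y z t)) \<longlongrightarrow> 0) ?F"
    by (rule Lim_null_comparison[OF B1 filterlim_compose[OF L1 tendsto_snd_at_right]])
qed

lemma integral_gaussian:
  "integrable lborel (%x::real. exp (- x\<^sup>2))" "(LINT x|lborel. exp (- x\<^sup>2)) = sqrt pi"
proof -
  have "has_bochner_integral lborel (%x::real. exp (- x\<^sup>2)) (2 *\<^sub>R (sqrt pi / 2))"
    by (rule has_bochner_integral_even_function[OF gaussian_moment_0]) simp
  then show "integrable lborel (%x::real. exp (- x\<^sup>2))" "(LINT x|lborel. exp (- x\<^sup>2)) = sqrt pi"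
    by (auto simp: has_bochner_integral_iff)
qed

definition asyq :: "(real => real) => real => real" where
  "asyq e x = sqrt (4 * pi) * x powr (1 / 4) * exp (- 2 * sqrt x) * e x"

text \<open>In r = sqrt y the growth exp(2 r sqrt z / t) of \<open>e\<close> completes the square: -
  (z + r^2) / t + 2 r sqrt z / t = - ((r - sqrt z) / sqrt t)^2. The factors 2 r and sqrt t are the
  Jacobians of y = r^2 and of r = sqrt z + sqrt t q.\<close>

lemma ker_gaussian_form:
  assumes z: "z > 0" and t: "t > 0" and r: "r > 0"
  shows "sqrt t * (2 * r * ker A e (r\<^sup>2) z t)
    = exp (- A * t) * exp (- ((r - sqrt z) / sqrt t)\<^sup>2) / sqrt pi * asyq e (z * r\<^sup>2 / t\<^sup>2) * sqrt (r / sqrt z)"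
proof -
  define x where "x = z * r\<^sup>2 / t\<^sup>2"
  have sx: "sqrt x = sqrt z * r / t" using t r by (simp add: x_def real_sqrt_mult real_sqrt_divide)
  have x0: "x > 0" using z t r by (simp add: x_def)
  have "x powr (1 / 4) = (x powr (1 / 2)) powr (1 / 2)" by (simp add: powr_powr)
  also have "\<dots> = sqrt (sqrt z * r / t)" using x0 by (simp add: powr_half_sqrt sx flip: sx)
  finally have x4: "x powr (1 / 4) = sqrt (sqrt z * r / t)" .
  have s1: "sqrt (sqrt z * r / t) * sqrt (r / sqrt z) = r / sqrt t"
  proof -
    have "sqrt (sqrt z * r / t) * sqrt (r / sqrt z) = sqrt ((sqrt z * r / t) * (r / sqrt z))" by (simp only: real_sqrt_mult)
    also have "(sqrt z * r / t) * (r / sqrt z) = r\<^sup>2 / t" using z by (simp add: power2_eq_square)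
    finally show ?thesis using r by (simp add: real_sqrt_divide)
  qed
  have e1: "exp (- A * t) * exp (- ((r - sqrt z) / sqrt t)\<^sup>2) * exp (- 2 * sqrt x) = exp (- A * t - (z + r\<^sup>2) / t)"
  proof -
    have "((r - sqrt z) / sqrt t)\<^sup>2 = (r\<^sup>2 - 2 * r * sqrt z + z) / t"
      using t z by (simp add: power_divide power2_diff)
    then have "- A * t + - ((r - sqrt z) / sqrt t)\<^sup>2 + - 2 * sqrt x = - A * t - (z + r\<^sup>2) / t"
      using t unfolding sx by (simp add: diff_divide_distrib add_divide_distrib)
    then show ?thesis by (simp only: exp_add[symmetric])
  qed
  have s4: "sqrt (4 * pi) / sqrt pi = 2" by (simp add: real_sqrt_mult)
  have "exp (- A * t) * exp (- ((r - sqrt z) / sqrt t)\<^sup>2) / sqrt pi * asyq e x * sqrt (r / sqrt z)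
      = (sqrt (4 * pi) / sqrt pi) * (exp (- A * t) * exp (- ((r - sqrt z) / sqrt t)\<^sup>2) * exp (- 2 * sqrt x))
        * (sqrt (sqrt z * r / t) * sqrt (r / sqrt z)) * e x"
    unfolding asyq_def x4 by simp
  also have "\<dots> = 2 * exp (- A * t - (z + r\<^sup>2) / t) * (r / sqrt t) * e x"
    by (simp only: s1 e1 s4)
  also have "r / sqrt t = sqrt t * (r / t)" using t by (simp add: real_div_sqrt field_simps)
  finally show ?thesis unfolding ker_def x_def by simp
qed

text \<open>The integrand after the substitution r = sqrt z + sqrt t q, a Gaussian in q times slowly
  varying factors; the indicator is the image of {a..b}.\<close>

definition gker :: "real => (real => real) => (real => real) => real => real => real => real => real => real" where
  "gker A e \<phi> a b z t q = indicator {sqrt a..sqrt b} (sqrt z + sqrt t * q) * (\<phi> ((sqrt z + sqrt t * q)\<^sup>2)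
        * (exp (- A * t) * exp (- q\<^sup>2) / sqrt pi * asyq e (z * (sqrt z + sqrt t * q)\<^sup>2 / t\<^sup>2) * sqrt ((sqrt z + sqrt t * q) / sqrt z)))"

text \<open>Of the two substitutions y = r^2 and r = sqrt z + sqrt t q, the first makes the peak
  Gaussian and the second centres it and scales by its width.\<close>

lemma wint_ker_substitution:
  assumes a: "0 < a" "a <= b" and \<phi>: "continuous_on UNIV \<phi>" and s: "sol N 1 e d" and z: "z > 0" and t: "t > 0"
  shows "integrable lborel (gker A e \<phi> a b z t)"
    and "wint a b \<phi> (%y. ker A e y z t) = (LINT q|lborel. gker A e \<phi> a b z t q)"
proof -
  let ?k = "%y. \<phi> y * ker A e y z t"
  let ?h = "%r. ?k (r\<^sup>2) * (2 * r) * indicator {sqrt a..sqrt b} r"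
  have sa: "sqrt a > 0" using a by simp
  have ck: "continuous_on {a..b} ?k"
    unfolding ker_def using a t z
    by (intro continuous_intros continuous_on_sol_compose[OF s] continuous_on_subset[OF \<phi>]) auto
  have i: "set_integrable lborel {(sqrt a)\<^sup>2..(sqrt b)\<^sup>2} ?k"
    using ck a by (intro borel_integrable_atLeastAtMost') simp
  have "wint a b \<phi> (%y. ker A e y z t) = (LINT y|lborel. ?k y * indicator {(sqrt a)\<^sup>2..(sqrt b)\<^sup>2} y)"
    using a unfolding wint_def set_lebesgue_integral_def by (simp add: mult_ac)
  also have "\<dots> = (LINT r|lborel. ?h r)"
    by (rule integral_substitution(2)[where g = "%r. r\<^sup>2" and g' = "%r. 2 * r", OF i]) (use a in \<open>auto intro!: derivative_eq_intros continuous_intros intro: order_trans[OF less_imp_le[OF sa]]\<close>)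
  also have "\<dots> = \<bar>sqrt t\<bar> *\<^sub>R (LINT q|lborel. ?h (sqrt z + sqrt t * q))"
    by (rule lborel_integral_real_affine) (use t in simp)
  also have "\<dots> = (LINT q|lborel. sqrt t * ?h (sqrt z + sqrt t * q))" using t by simp
  finally have 1: "wint a b \<phi> (%y. ker A e y z t) = (LINT q|lborel. sqrt t * ?h (sqrt z + sqrt t * q))" .
  have eq: "sqrt t * ?h (sqrt z + sqrt t * q) = gker A e \<phi> a b z t q" for q
  proof (cases "sqrt z + sqrt t * q \<in> {sqrt a..sqrt b}")
    case True
    define r where "r = sqrt z + sqrt t * q"
    have r: "r > 0" using True sa unfolding r_def[symmetric] atLeastAtMost_iff by linarith
    have q: "q = (r - sqrt z) / sqrt t" using t by (simp add: r_def)
    have "sqrt t * (?k (r\<^sup>2) * (2 * r)) = \<phi> (r\<^sup>2) * (sqrt t * (2 * r * ker A e (r\<^sup>2) z t))" by simp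
    also have "\<dots> = \<phi> (r\<^sup>2) * (exp (- A * t) * exp (- q\<^sup>2) / sqrt pi * asyq e (z * r\<^sup>2 / t\<^sup>2) * sqrt (r / sqrt z))"
      unfolding ker_gaussian_form[OF z t r] q ..
    finally show ?thesis using True by (simp add: r_def gker_def)
  qed (simp add: gker_def)
  have "set_integrable lborel {sqrt a..sqrt b} (%r. ?k (r\<^sup>2) * (2 * r))"
    by (rule integral_substitution(1)[where g = "%r. r\<^sup>2" and g' = "%r. 2 * r", OF i]) (use a in \<open>auto intro!: derivative_eq_intros continuous_intros intro: order_trans[OF less_imp_le[OF sa]]\<close>)
  then have "integrable lborel ?h" unfolding set_integrable_def by (simp add: mult_ac)
  then have "integrable lborel (%q. sqrt t * ?h (sqrt z + sqrt t * q))"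
    using t by (intro integrable_mult_right lborel_integrable_real_affine) auto
  then show "integrable lborel (gker A e \<phi> a b z t)" unfolding eq .
  show "wint a b \<phi> (%y. ker A e y z t) = (LINT q|lborel. gker A e \<phi> a b z t q)" using 1 unfolding eq .
qed

text \<open>After substitution the integrand tends to \<phi>(z0) exp(- q^2) / sqrt pi, the
  normalisation being exactly that of \<open>rasy e 1\<close>. On the support z y / t^2 is large, so
  \<open>asyq e\<close> is bounded and a multiple of exp(- q^2) dominates.\<close>

lemma dominant_kernel_initial_limit:
  assumes a: "0 < a" "a <= b" and \<phi>: "continuous_on UNIV \<phi>" "\<And>y. y \<notin> {a..b} ==> \<phi> y = 0"
    and s: "sol N 1 e d" and E: "rasy e 1" and z0: "z0 > 0"
  shows "((%(z, t). wint a b \<phi> (%y. ker A e y z t)) \<longlongrightarrow> \<phi> z0) (at (z0, 0) within {0<..} \<times> {0<..})"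
  unfolding tendsto_at_iff_sequentially
proof (intro allI impI)
  fix X :: "nat => real \<times> real"
  assume XS: "\<forall>i. X i \<in> {0<..} \<times> {0<..} - {(z0, 0)}" and Xl: "X \<longlonglongrightarrow> (z0, 0)"
  have E': "(asyq e \<longlongrightarrow> 1) at_top" using E unfolding rasy_def asyq_def .
  have "eventually (%x. asyq e x < 2 \<and> asyq e x > - 2 \<and> x >= 1) at_top"
    by (intro eventually_conj order_tendstoD[OF E'] eventually_ge_at_top) auto
  then obtain Y where Y: "\<And>x. x >= Y ==> asyq e x < 2 \<and> asyq e x > - 2 \<and> x >= 1"
    unfolding eventually_at_top_linorder by blast
  have Y1: "Y >= 1" using Y[of Y] by simp
  obtain M where M: "\<And>y. \<bar>\<phi> y\<bar> <= M"
  proof -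
    obtain M where "\<forall>y\<in>\<phi> ` {a..b}. norm y <= M"
      using compact_imp_bounded[OF compact_continuous_image[OF continuous_on_subset[OF \<phi>(1)] compact_Icc]] unfolding bounded_iff by blast
    then have "\<bar>\<phi> y\<bar> <= max M 0" for y using \<phi>(2)[of y] by (cases "y \<in> {a..b}") (auto simp: le_max_iff_disj)
    then show ?thesis using that by blast
  qed
  \<comment> \<open>The root keeps z y / t^2 above \<open>Y\<close> for z > z0 / 2 and y >= a; the
    minimum with 1 bounds exp(- A t).\<close>
  define \<delta> where "\<delta> = min 1 (sqrt (z0 / 2 * a / Y))"
  have \<delta>: "\<delta> > 0" using a z0 Y1 by (simp add: \<delta>_def)
  have zl: "(%n. fst (X n)) \<longlonglongrightarrow> z0" and tl: "(%n. snd (X n)) \<longlonglongrightarrow> 0"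
    using tendsto_fst[OF Xl] tendsto_snd[OF Xl] by auto
  have "eventually (%n. fst (X n) > z0 / 2 \<and> snd (X n) < \<delta>) sequentially"
    by (intro eventually_conj order_tendstoD(1)[OF zl] order_tendstoD(2)[OF tl]) (use z0 \<delta> in auto)
  then obtain m where m: "\<And>n. n >= m ==> fst (X n) > z0 / 2 \<and> snd (X n) < \<delta>" unfolding eventually_sequentially by blast
  define z where "z n = fst (X (n + m))" for n
  define t where "t n = snd (X (n + m))" for n
  have z: "z n > z0 / 2" "z n > 0" for n using m[of "n + m"] z0 by (auto simp: z_def)
  have t: "0 < t n" "t n < \<delta>" for n using m[of "n + m"] XS by (auto simp: t_def mem_Times_iff)
  have zl': "z \<longlonglongrightarrow> z0" and tl': "t \<longlonglongrightarrow> 0"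
    unfolding z_def t_def using zl tl by (auto intro: LIMSEQ_ignore_initial_segment)
  define r where "r n q = sqrt (z n) + sqrt (t n) * q" for n q
  define J where "J n q = indicator {sqrt a..sqrt b} (r n q) * (\<phi> ((r n q)\<^sup>2)
        * (exp (- A * t n) * exp (- q\<^sup>2) / sqrt pi * asyq e (z n * (r n q)\<^sup>2 / (t n)\<^sup>2) * sqrt (r n q / sqrt (z n))))" for n q
  have Ji: "integrable lborel (J n)" and Jw: "wint a b \<phi> (%y. ker A e y (z n) (t n)) = (LINT q|lborel. J n q)" for n
    using wint_ker_substitution[OF a \<phi>(1) s z(2)[of n] t(1)[of n], of A] unfolding J_def[abs_def] r_def gker_def[abs_def] by auto
  \<comment> \<open>Factor by factor: \<open>M\<close> for \<phi>, exp of the modulus of A for exp(-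
    A t), 2 for \<open>asyq e\<close>, and the last root for r <= sqrt b and z > z0 / 2.\<close>
  define C where "C = M * (exp \<bar>A\<bar> / sqrt pi * 2 * sqrt (sqrt b / sqrt (z0 / 2)))"
  have "(%n. LINT q|lborel. J n q) \<longlonglongrightarrow> (LINT q|lborel. \<phi> z0 / sqrt pi * exp (- q\<^sup>2))"
  proof (rule integral_dominated_convergence[where w = "%q. C * exp (- q\<^sup>2)"])
    show "integrable lborel (%q. C * exp (- q\<^sup>2))" by (intro integrable_mult_right integral_gaussian)
    show "(%q. \<phi> z0 / sqrt pi * exp (- q\<^sup>2)) \<in> borel_measurable lborel" by measurable
    show "J n \<in> borel_measurable lborel" for n by (rule borel_measurable_integrable[OF Ji])
    show "AE q in lborel. norm (J n q) <= C * exp (- q\<^sup>2)" for n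
    proof (rule AE_I2)
      fix q
      show "norm (J n q) <= C * exp (- q\<^sup>2)"
      proof (cases "r n q \<in> {sqrt a..sqrt b}")
        case False
        have "M >= 0" using M[of 0] by linarith
        then have "C >= 0" using a z0 unfolding C_def by (intro mult_nonneg_nonneg) auto
        then show ?thesis using False by (simp add: J_def)
      next
        case True
        have r0: "r n q > 0" using True a by (auto intro: less_le_trans[of _ "sqrt a"])
        have "(sqrt a)\<^sup>2 <= (r n q)\<^sup>2" using True a by (intro power_mono) auto
        then have ra: "a <= (r n q)\<^sup>2" using a by simp
        have "(t n)\<^sup>2 <= (sqrt (z0 / 2 * a / Y))\<^sup>2" using t[of n] by (intro power_mono) (auto simp: \<delta>_def)
        also have "\<dots> = z0 / 2 * a / Y" using a z0 Y1 by simp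
        finally have "Y * (t n)\<^sup>2 <= z0 / 2 * a" using Y1 by (simp add: field_simps)
        also have "\<dots> <= z n * (r n q)\<^sup>2" using z[of n] a z0 ra by (intro mult_mono) auto
        finally have "z n * (r n q)\<^sup>2 / (t n)\<^sup>2 >= Y" using t(1)[of n] by (simp add: field_simps)
        from Y[OF this] have as: "\<bar>asyq e (z n * (r n q)\<^sup>2 / (t n)\<^sup>2)\<bar> <= 2" by (simp add: abs_le_iff)
        have "- A * t n <= \<bar>A\<bar> * 1"
        proof -
          have "- A * t n <= \<bar>A\<bar> * t n" using t(1)[of n] by (intro mult_right_mono) auto
          also have "\<dots> <= \<bar>A\<bar> * 1" using t[of n] by (intro mult_left_mono) (auto simp: \<delta>_def)
          finally show ?thesis .
        qed
        then have eA: "exp (- A * t n) <= exp \<bar>A\<bar>" by simp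
        have sq: "\<bar>sqrt (r n q / sqrt (z n))\<bar> <= sqrt (sqrt b / sqrt (z0 / 2))"
        proof -
          have "sqrt (z0 / 2) <= sqrt (z n)" using z(1)[of n] by (intro real_sqrt_le_mono less_imp_le)
          then have "r n q / sqrt (z n) <= sqrt b / sqrt (z0 / 2)" using True r0 z(2)[of n] z0 a by (intro frac_le) auto
          then show ?thesis using r0 z(2)[of n] by simp
        qed
        have "norm (J n q) = \<bar>\<phi> ((r n q)\<^sup>2)\<bar> * (exp (- A * t n) / sqrt pi * \<bar>asyq e (z n * (r n q)\<^sup>2 / (t n)\<^sup>2)\<bar> * \<bar>sqrt (r n q / sqrt (z n))\<bar>) * exp (- q\<^sup>2)"
          using True by (simp add: J_def abs_mult)
        also have "\<dots> <= C * exp (- q\<^sup>2)"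
          unfolding C_def
          by (intro mult_right_mono mult_mono M eA as sq divide_right_mono) (auto intro!: mult_nonneg_nonneg order_trans[OF abs_ge_zero M])
        finally show ?thesis .
      qed
    qed
    show "AE q in lborel. (%n. J n q) \<longlonglongrightarrow> \<phi> z0 / sqrt pi * exp (- q\<^sup>2)"
    proof (rule AE_I2)
      fix q
      have rl: "(%n. r n q) \<longlonglongrightarrow> sqrt z0"
        unfolding r_def using tendsto_add[OF tendsto_real_sqrt[OF zl'] tendsto_mult[OF tendsto_real_sqrt[OF tl'] tendsto_const[of q]]] by simp
      have rz: "sqrt z0 > 0" using z0 by simp
      have evr: "eventually (%n. r n q > 0) sequentially" by (rule order_tendstoD(1)[OF rl rz])
      \<comment> \<open>\<open>J'\<close> omits the indicator. As \<phi> vanishes outside {a..b},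
        both agree once r is positive, so z0 at an endpoint or outside the interval needs no
        separate argument.\<close>
      define J' where "J' n = \<phi> ((r n q)\<^sup>2)
        * (exp (- A * t n) * exp (- q\<^sup>2) / sqrt pi * asyq e (z n * (r n q)\<^sup>2 / (t n)\<^sup>2) * sqrt (r n q / sqrt (z n)))" for n
      have JJ: "eventually (%n. J' n = J n q) sequentially"
        using evr
      proof eventually_elim
        case (elim n)
        show ?case
        proof (cases "r n q \<in> {sqrt a..sqrt b}")
          case False
          have "(r n q)\<^sup>2 \<notin> {a..b}"
          proof
            assume "(r n q)\<^sup>2 \<in> {a..b}"
            then have "sqrt a <= sqrt ((r n q)\<^sup>2)" "sqrt ((r n q)\<^sup>2) <= sqrt b" by (simp_all only: real_sqrt_le_iff atLeastAtMost_iff)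
            then show False using False elim by simp
          qed
          then show ?thesis using False \<phi>(2) by (simp add: J_def J'_def)
        qed (simp add: J_def J'_def)
      qed
      have "filterlim (%n. z n * (r n q)\<^sup>2 / (t n)\<^sup>2) at_top sequentially"
      proof (rule LIM_at_top_divide[of _ "z0 * (sqrt z0)\<^sup>2" ])
        show "(%n. z n * (r n q)\<^sup>2) \<longlonglongrightarrow> z0 * (sqrt z0)\<^sup>2" by (intro tendsto_intros zl' rl)
        show "0 < z0 * (sqrt z0)\<^sup>2" using z0 by simp
        show "(%n. (t n)\<^sup>2) \<longlonglongrightarrow> 0" using tendsto_power[OF tl', of 2] by simp
        show "eventually (%n. 0 < (t n)\<^sup>2) sequentially" using t(1) by (auto intro!: always_eventually simp: less_le)
      qed
      then have el: "(%n. asyq e (z n * (r n q)\<^sup>2 / (t n)\<^sup>2)) \<longlonglongrightarrow> 1" by (rule filterlim_compose[OF E'])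
      have "isCont \<phi> ((sqrt z0)\<^sup>2)" using \<phi>(1) by (simp add: continuous_on_eq_continuous_at)
      then have pl: "(%n. \<phi> ((r n q)\<^sup>2)) \<longlonglongrightarrow> \<phi> ((sqrt z0)\<^sup>2)" by (rule isCont_tendsto_compose) (intro tendsto_intros rl)
      have "J' \<longlonglongrightarrow> \<phi> ((sqrt z0)\<^sup>2) * (exp (- A * 0) * exp (- q\<^sup>2) / sqrt pi * 1 * sqrt (sqrt z0 / sqrt z0))"
        unfolding J'_def by (intro tendsto_intros pl el tl' zl' rl) (use rz in auto)
      then have "J' \<longlonglongrightarrow> \<phi> z0 / sqrt pi * exp (- q\<^sup>2)" using z0 by simp
      then show "(%n. J n q) \<longlonglongrightarrow> \<phi> z0 / sqrt pi * exp (- q\<^sup>2)" using tendsto_cong[OF JJ] by simp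
    qed
  qed
  also have "(LINT q|lborel. \<phi> z0 / sqrt pi * exp (- q\<^sup>2)) = \<phi> z0" by (simp add: integral_gaussian)
  finally have "(%n. wint a b \<phi> (%y. ker A e y (z n) (t n))) \<longlonglongrightarrow> \<phi> z0" by (simp only: Jw)
  then have "(%n. ((%(z, t). wint a b \<phi> (%y. ker A e y z t)) \<circ> X) (n + m)) \<longlonglongrightarrow> \<phi> z0"
    by (simp add: z_def t_def case_prod_unfold o_def)
  then show "((%(z, t). wint a b \<phi> (%y. ker A e y z t)) \<circ> X) \<longlonglongrightarrow> \<phi> z0" by (rule LIMSEQ_offset)
qed

section \<open>Division by a function with simple zeros\<close>

definition zs :: "(real => real) => real set" where
  "zs w = {x. 0 < x \<and> w x = 0}"

text \<open>Nearness is measured relative to x: zeros may accumulate at 0, and points within x / 2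
  of x stay in a compact part of the positive axis.\<close>

definition near_zs :: "(real => real) => real set" where
  "near_zs w = {x. 0 < x \<and> (\<exists>n\<in>zs w. \<bar>x - n\<bar> < x / 2)}"

definition nearest_zero :: "(real => real) => real => real" where
  "nearest_zero w x = (SOME n. n \<in> zs w \<and> (\<forall>m\<in>zs w. \<bar>x - n\<bar> <= \<bar>x - m\<bar>))"

text \<open>Regularised quotient: subtracting the value at the nearest zero keeps it bounded for
  Lipschitz \<phi>, and it stays linear in \<phi>. If \<phi> is a multiple of w, the subtracted
  value is 0 and the true quotient results; the agreement of the two pairings depends on
  this.\<close>

definition divw :: "(real => real) => (real => real) => real => real" where
  "divw w \<phi> x = (\<phi> x - (if x \<in> near_zs w then \<phi> (nearest_zero w x) else 0)) / w x"

text \<open>The minimum is attained over the zeros in the compact interval [x / 2, 3 x / 2]; all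
  other zeros are at distance at least x / 2.\<close>

lemma nearest_zero:
  assumes w: "continuous_on {0<..} w" and x: "x \<in> near_zs w"
  shows "nearest_zero w x \<in> zs w" "\<And>m. m \<in> zs w ==> \<bar>x - nearest_zero w x\<bar> <= \<bar>x - m\<bar>"
proof -
  obtain n0 where n0: "n0 \<in> zs w" "\<bar>x - n0\<bar> < x / 2" and x0: "x > 0" using x unfolding near_zs_def by blast
  let ?K = "{x / 2..3 * x / 2}"
  have cl: "closed {u \<in> ?K. w u = 0}"
    by (rule continuous_closed_preimage_constant[OF continuous_on_subset[OF w]]) (use x0 in auto)
  have n0m: "n0 \<in> ?K \<inter> {u \<in> ?K. w u = 0}" using n0(1) n0(2)[unfolded abs_less_iff] x0 by (auto simp: zs_def field_simps)
  then have ne: "?K \<inter> {u \<in> ?K. w u = 0} \<noteq> {}" by blast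
  have ca: "continuous_on (?K \<inter> {u \<in> ?K. w u = 0}) (%n. \<bar>x - n\<bar>)" by (intro continuous_intros)
  have "compact (?K \<inter> {u \<in> ?K. w u = 0})" by (intro compact_Int_closed compact_Icc cl)
  then obtain n where n: "n \<in> ?K \<inter> {u \<in> ?K. w u = 0}" and nm: "\<forall>m\<in>?K \<inter> {u \<in> ?K. w u = 0}. \<bar>x - n\<bar> <= \<bar>x - m\<bar>"
    using continuous_attains_inf[OF _ ne, of "%n. \<bar>x - n\<bar>"] ca by blast
  have nn: "\<bar>x - n\<bar> <= \<bar>x - n0\<bar>" using nm n0m by blast
  have "\<exists>n. n \<in> zs w \<and> (\<forall>m\<in>zs w. \<bar>x - n\<bar> <= \<bar>x - m\<bar>)"
  proof (intro exI conjI ballI)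
    show "n \<in> zs w" using n x0 by (auto simp: zs_def)
    fix m assume m: "m \<in> zs w"
    show "\<bar>x - n\<bar> <= \<bar>x - m\<bar>"
    proof (cases "m \<in> ?K")
      case True
      then show ?thesis using nm m by (auto simp: zs_def)
    next
      case False
      then have "\<bar>x - m\<bar> >= x / 2" by (auto simp: abs_if)
      then show ?thesis using nn n0(2) by linarith
    qed
  qed
  from someI_ex[OF this] show "nearest_zero w x \<in> zs w" "\<And>m. m \<in> zs w ==> \<bar>x - nearest_zero w x\<bar> <= \<bar>x - m\<bar>"
    unfolding nearest_zero_def by blast+
qed

text \<open>Nearest points are monotone whatever is chosen at ties, and monotone functions are
  measurable; nothing about the choice made by \<open>SOME\<close> has to be known.\<close>

lemma mono_on_nearest_zero:
  assumes w: "continuous_on {0<..} w"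
  shows "mono_on (near_zs w) (nearest_zero w)"
proof (rule mono_onI)
  fix x y assume x: "x \<in> near_zs w" and y: "y \<in> near_zs w" and xy: "x <= y"
  show "nearest_zero w x <= nearest_zero w y"
  proof (cases "x = y")
    case False
    then show ?thesis
      using nearest_zero(2)[OF w x nearest_zero(1)[OF w y]] nearest_zero(2)[OF w y nearest_zero(1)[OF w x]] xy
      by (auto simp: abs_if split: if_splits)
  qed simp
qed

lemma open_near_zs: "open (near_zs w)"
proof -
  have "near_zs w = (\<Union>n\<in>zs w. {x. 0 < x} \<inter> {x. \<bar>x - n\<bar> < x / 2})" unfolding near_zs_def by auto
  moreover have "open \<dots>"
    by (intro open_UN open_Int ballI open_Collect_less continuous_intros) auto
  ultimately show ?thesis by simp
qed

lemma borel_measurable_divw: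
  assumes w: "continuous_on {0<..} w" and \<phi>: "continuous_on UNIV \<phi>"
  shows "(%x. indicator {0<..} x * divw w \<phi> x) \<in> borel_measurable borel"
proof -
  have m\<phi>: "\<phi> \<in> borel_measurable borel" by (rule borel_measurable_continuous_onI[OF \<phi>])
  have "nearest_zero w \<in> borel_measurable (restrict_space borel (near_zs w))"
    by (rule borel_measurable_mono_on_fnc[OF mono_on_nearest_zero[OF w]])
  then have "(%x. \<phi> (nearest_zero w x)) \<in> borel_measurable (restrict_space borel (near_zs w))"
    by (rule measurable_compose[OF _ m\<phi>])
  then have 1: "(%x. indicator (near_zs w) x *\<^sub>R \<phi> (nearest_zero w x)) \<in> borel_measurable borel"
    by (subst (asm) borel_measurable_restrict_space_iff) (use open_near_zs in \<open>auto\<close>)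
  have 2: "(%x. indicator {0<..} x *\<^sub>R w x) \<in> borel_measurable borel"
    by (rule borel_measurable_continuous_on_indicator[OF _ w]) simp
  have eq: "indicator {0<..} x * divw w \<phi> x = (\<phi> x - indicator (near_zs w) x *\<^sub>R \<phi> (nearest_zero w x)) / (indicator {0<..} x *\<^sub>R w x)" for x
    by (auto simp: divw_def indicator_def)
  show ?thesis unfolding eq by (intro borel_measurable_divide borel_measurable_diff m\<phi> 1 2)
qed

text \<open>By compactness, points that violate the bound with constants tending to 0 accumulate at
  a zero l of w, and along them the difference quotients of w at l tend to 0, against simplicity of
  the zero.\<close>

lemma simple_zeros_lower_bound:
  fixes w w' :: "real => real"
  assumes w: "\<And>x. x > 0 ==> (w has_real_derivative w' x) (at x)" and s: "\<And>x. x > 0 ==> w x = 0 ==> w' x \<noteq> 0"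
    and a: "0 < a"
  shows "\<exists>c>0. \<forall>x\<in>{a..b}. c * (if x \<in> near_zs w then \<bar>x - nearest_zero w x\<bar> else 1) <= \<bar>w x\<bar>"
proof (rule ccontr)
  let ?d = "%x. if x \<in> near_zs w then \<bar>x - nearest_zero w x\<bar> else 1"
  have cw: "continuous_on {0<..} w" using w by (auto intro!: continuous_at_imp_continuous_on DERIV_isCont)
  assume "\<not> (\<exists>c>0. \<forall>x\<in>{a..b}. c * ?d x <= \<bar>w x\<bar>)"
  then have "\<forall>n. \<exists>x\<in>{a..b}. \<bar>w x\<bar> < 1 / real (Suc n) * ?d x"
    by (metis (no_types, lifting) of_nat_0_less_iff zero_less_Suc zero_less_divide_1_iff not_le)
  then obtain x where x: "\<And>n. x n \<in> {a..b}" and xw: "\<And>n. \<bar>w (x n)\<bar> < 1 / real (Suc n) * ?d (x n)" by metis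
  obtain l r where l: "l \<in> {a..b}" and r: "strict_mono (r :: nat => nat)" and lim: "(x \<circ> r) \<longlonglongrightarrow> l"
    using compact_Icc[of a b, unfolded compact_def] x by metis
  have l0: "l > 0" using l a by auto
  have wl: "(%n. w (x (r n))) \<longlonglongrightarrow> w l"
    using isCont_tendsto_compose[OF DERIV_isCont[OF w[OF l0]] lim] by (simp add: o_def)
  have db: "?d (x n) <= b + 1" for n
  proof (cases "x n \<in> near_zs w")
    case True
    then obtain m where m: "m \<in> zs w" "\<bar>x n - m\<bar> < x n / 2" unfolding near_zs_def by blast
    then have "?d (x n) <= x n / 2" using nearest_zero(2)[OF cw True m(1)] True by simp
    then show ?thesis using x[of n] a by auto
  qed (use x[of n] a in auto)
  have i0: "(%n. 1 / real (Suc (r n))) \<longlonglongrightarrow> 0"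
    using LIMSEQ_subseq_LIMSEQ[OF LIMSEQ_Suc[OF lim_1_over_n] r] by (simp add: o_def)
  have "(%n. w (x (r n))) \<longlonglongrightarrow> 0"
  proof (rule Lim_null_comparison)
    show "(%n. 1 / real (Suc (r n)) * (b + 1)) \<longlonglongrightarrow> 0" using tendsto_mult_right[OF i0, of "b + 1"] by simp
    show "eventually (%n. norm (w (x (r n))) <= 1 / real (Suc (r n)) * (b + 1)) sequentially"
    proof (rule always_eventually, rule allI)
      fix n
      have "1 / real (Suc (r n)) * ?d (x (r n)) <= 1 / real (Suc (r n)) * (b + 1)" by (intro mult_left_mono db) simp
      then show "norm (w (x (r n))) <= 1 / real (Suc (r n)) * (b + 1)" using xw[of "r n"] unfolding real_norm_def by linarith
    qed
  qed
  then have wl0: "w l = 0" using wl LIMSEQ_unique by blast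
  have lz: "l \<in> zs w" using wl0 l0 by (simp add: zs_def)
  have "eventually (%n. \<bar>x (r n) - l\<bar> < a / 2) sequentially"
    using tendstoD[OF lim, of "a / 2"] a by (simp add: dist_real_def)
  then obtain m where m: "\<And>n. n >= m ==> \<bar>x (r n) - l\<bar> < a / 2" unfolding eventually_sequentially by blast
  \<comment> \<open>The distance to the nearest zero is at most the distance to l, which turns the
    violated bound into one for the difference quotient at l.\<close>
  have nz: "\<bar>w (x (r n))\<bar> < 1 / real (Suc (r n)) * \<bar>x (r n) - l\<bar>" if "n >= m" for n
  proof -
    have "x (r n) \<in> near_zs w" unfolding near_zs_def using m[OF that] lz x[of "r n"] a by (auto intro!: bexI[of _ l])
    then have "?d (x (r n)) <= \<bar>x (r n) - l\<bar>" using nearest_zero(2)[OF cw _ lz] by simp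
    then have "1 / real (Suc (r n)) * ?d (x (r n)) <= 1 / real (Suc (r n)) * \<bar>x (r n) - l\<bar>" by (intro mult_left_mono) auto
    then show ?thesis using xw[of "r n"] by linarith
  qed
  have ne: "x (r n) \<noteq> l" if "n >= m" for n using nz[OF that] wl0 by auto
  have "(%n. (w (x (r (n + m))) - w l) / (x (r (n + m)) - l)) \<longlonglongrightarrow> w' l"
  proof -
    have "((%y. (w y - w l) / (y - l)) \<longlongrightarrow> w' l) (at l)" using w[OF l0] unfolding has_field_derivative_iff .
    moreover have "(%n. x (r (n + m))) \<longlonglongrightarrow> l" using LIMSEQ_ignore_initial_segment[OF lim, of m] by (simp add: o_def)
    ultimately show ?thesis unfolding tendsto_at_iff_sequentially using ne by (auto simp: o_def)
  qed
  moreover have "(%n. (w (x (r (n + m))) - w l) / (x (r (n + m)) - l)) \<longlonglongrightarrow> 0"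
  proof (rule Lim_null_comparison)
    show "(%n. 1 / real (Suc (r (n + m)))) \<longlonglongrightarrow> 0" using LIMSEQ_ignore_initial_segment[OF i0, of m] .
    show "eventually (%n. norm ((w (x (r (n + m))) - w l) / (x (r (n + m)) - l)) <= 1 / real (Suc (r (n + m)))) sequentially"
    proof (rule always_eventually, rule allI)
      fix n
      have p: "\<bar>x (r (n + m)) - l\<bar> > 0" using ne[of "n + m"] by simp
      show "norm ((w (x (r (n + m))) - w l) / (x (r (n + m)) - l)) <= 1 / real (Suc (r (n + m)))"
        unfolding real_norm_def abs_divide pos_divide_le_eq[OF p] using nz[of "n + m"] by (simp add: wl0)
    qed
  qed
  ultimately have "w' l = 0" using LIMSEQ_unique by blast
  then show False using s[OF l0 wl0] by simp
qed

text \<open>A limit point of zeros inside the interval would be a zero with vanishing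
  derivative.\<close>

lemma finite_simple_zeros:
  fixes w w' :: "real => real"
  assumes w: "\<And>x. x > 0 ==> (w has_real_derivative w' x) (at x)" and s: "\<And>x. x > 0 ==> w x = 0 ==> w' x \<noteq> 0"
    and a: "0 < a"
  shows "finite ({a..b} \<inter> zs w)"
proof (rule finite_not_islimpt_in_compact[OF compact_Icc])
  fix l assume l: "l \<in> {a..b}"
  have l0: "l > 0" using l a by auto
  show "\<not> l islimpt zs w"
  proof
    assume "l islimpt zs w"
    then obtain x where x: "\<And>n. x n \<in> zs w - {l}" and lim: "x \<longlonglongrightarrow> l" unfolding islimpt_sequential by blast
    have "(%n. w (x n)) \<longlonglongrightarrow> w l" by (rule isCont_tendsto_compose[OF DERIV_isCont[OF w[OF l0]] lim])
    then have wl0: "w l = 0" using x by (simp add: zs_def LIMSEQ_const_iff)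
    have "((%y. (w y - w l) / (y - l)) \<longlongrightarrow> w' l) (at l)" using w[OF l0] unfolding has_field_derivative_iff .
    then have "(%n. (w (x n) - w l) / (x n - l)) \<longlonglongrightarrow> w' l"
      unfolding tendsto_at_iff_sequentially using x lim by (auto simp: o_def)
    then have "w' l = 0" using x wl0 by (simp add: zs_def LIMSEQ_const_iff)
    then show False using s[OF l0 wl0] by simp
  qed
qed

text \<open>The Lipschitz bound is demanded only when w has zeros; this is why the order of the
  final distribution can be 0 for a weight without zeros. The support may grow from {a..b} to {a /
  2..2 * b}, since the nearest zero lies within x / 2 of x.\<close>

lemma divw_bounded:
  fixes w w' :: "real => real"
  assumes w: "\<And>x. x > 0 ==> (w has_real_derivative w' x) (at x)" and s: "\<And>x. x > 0 ==> w x = 0 ==> w' x \<noteq> 0"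
    and a: "0 < a"
  shows "\<exists>C>0. \<forall>\<phi> M. (\<forall>x. \<bar>\<phi> x\<bar> <= M) \<and> (\<forall>x. x \<notin> {a..b} --> \<phi> x = 0) \<and>
      (zs w \<noteq> {} --> (\<forall>x>0. \<forall>y>0. \<bar>\<phi> x - \<phi> y\<bar> <= M * \<bar>x - y\<bar>)) -->
      (\<forall>x>0. \<bar>divw w \<phi> x\<bar> <= C * M \<and> (x \<notin> {a / 2..2 * b} --> divw w \<phi> x = 0))"
proof -
  have cw: "continuous_on {0<..} w" using w by (auto intro!: continuous_at_imp_continuous_on DERIV_isCont)
  have a2: "0 < a / 2" using a by simp
  obtain c where c: "c > 0" and cb: "\<And>x. x \<in> {a / 2..2 * b} ==> c * (if x \<in> near_zs w then \<bar>x - nearest_zero w x\<bar> else 1) <= \<bar>w x\<bar>"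
    using simple_zeros_lower_bound[OF w s a2, of "2 * b"] by blast
  show ?thesis
  proof (intro exI[of _ "1 / c"] conjI allI impI; (elim conjE)?)
    show "1 / c > 0" using c by simp
    fix \<phi> :: "real => real" and M x :: real
    assume M: "\<forall>x. \<bar>\<phi> x\<bar> <= M" and sp: "\<forall>x. x \<notin> {a..b} --> \<phi> x = 0"
      and Lp: "zs w \<noteq> {} --> (\<forall>x>0. \<forall>y>0. \<bar>\<phi> x - \<phi> y\<bar> <= M * \<bar>x - y\<bar>)" and x: "x > 0"
    have M0: "M >= 0" using M by (meson abs_ge_zero order_trans)
    have out: "divw w \<phi> x = 0" if o: "x \<notin> {a / 2..2 * b}"
    proof -
      have 1: "\<phi> x = 0" using sp o x a by (auto simp: not_le)
      show ?thesis
      proof (cases "x \<in> near_zs w")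
        case True
        then obtain m where m: "m \<in> zs w" "\<bar>x - m\<bar> < x / 2" unfolding near_zs_def by blast
        then have "\<bar>x - nearest_zero w x\<bar> < x / 2" using nearest_zero(2)[OF cw True m(1)] by simp
        then have "nearest_zero w x \<notin> {a..b}" using o x a by (auto simp: abs_if split: if_splits)
        then show ?thesis using 1 sp True by (simp add: divw_def)
      qed (simp add: divw_def 1)
    qed
    then show "x \<notin> {a / 2..2 * b} ==> divw w \<phi> x = 0" .
    show "\<bar>divw w \<phi> x\<bar> <= 1 / c * M"
    proof (cases "x \<in> {a / 2..2 * b} \<and> w x \<noteq> 0")
      case False
      then have "divw w \<phi> x = 0" using out by (auto simp: divw_def)
      then show ?thesis using M0 c by simp
    next
      case True
      have wp: "\<bar>w x\<bar> > 0" using True by simp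
      have "\<bar>\<phi> x - (if x \<in> near_zs w then \<phi> (nearest_zero w x) else 0)\<bar> <= M * (if x \<in> near_zs w then \<bar>x - nearest_zero w x\<bar> else 1)"
      proof (cases "x \<in> near_zs w")
        case n: True
        have "nearest_zero w x \<in> zs w" by (rule nearest_zero(1)[OF cw n])
        then show ?thesis using n Lp x by (auto simp: zs_def)
      qed (use M in simp)
      also have "\<dots> <= M * (\<bar>w x\<bar> / c)" using cb[of x] True c M0 by (intro mult_left_mono) (auto simp: field_simps)
      finally have "\<bar>\<phi> x - (if x \<in> near_zs w then \<phi> (nearest_zero w x) else 0)\<bar> <= 1 / c * M * \<bar>w x\<bar>" by simp
      then show ?thesis unfolding divw_def abs_divide pos_divide_le_eq[OF wp] .
    qed
  qed
qed

lemma divw_mult: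
  assumes w: "continuous_on {0<..} w" and \<phi>: "\<And>y. y > 0 ==> \<phi> y = \<psi> y * w y" and x: "x > 0" "w x \<noteq> 0"
  shows "divw w \<phi> x = \<psi> x"
proof -
  have "\<phi> (nearest_zero w x) = 0" if "x \<in> near_zs w"
    using nearest_zero(1)[OF w that] \<phi>[of "nearest_zero w x"] by (simp add: zs_def)
  then show ?thesis using \<phi>[OF x(1)] x(2) by (simp add: divw_def)
qed

lemma divw_linear: "divw w (%y. a * \<phi> y + b * \<eta> y) x = a * divw w \<phi> x + b * divw w \<eta> x"
  by (simp add: divw_def algebra_simps add_divide_distrib diff_divide_distrib)

section \<open>The pairing with weighted data\<close>

definition smooth :: "(real => real) => bool" where
  "smooth \<psi> \<longleftrightarrow> (\<forall>j z. (deriv ^^ j) \<psi> differentiable (at z))"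

text \<open>The derivative of exp(- y) G(t y) in y is - exp(- y) (Lop t G)(t y). Integration by
  parts thus trades one antiderivative of the kernel for one application of \<open>Lop\<close> to
  the test function.\<close>

definition Lop :: "real => (real => real) => real => real" where
  "Lop t \<psi> z = \<psi> z - t * deriv \<psi> z"

lemma smooth_funpow_deriv:
  assumes "smooth \<psi>"
  shows "((deriv ^^ j) \<psi> has_real_derivative (deriv ^^ Suc j) \<psi> z) (at z)"
  using assms unfolding smooth_def by (simp add: DERIV_deriv_iff_real_differentiable)

lemma smooth_deriv: "smooth \<psi> ==> (\<psi> has_real_derivative deriv \<psi> z) (at z)"
  using smooth_funpow_deriv[of \<psi> 0] by simp

lemma funpow_deriv_lincomb:
  assumes "smooth \<psi>" "smooth \<eta>"
  shows "(deriv ^^ j) (%z. a * \<psi> z + b * \<eta> z) = (%z. a * (deriv ^^ j) \<psi> z + b * (deriv ^^ j) \<eta> z)"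
proof (induction j)
  case (Suc j)
  have "deriv (%z. a * (deriv ^^ j) \<psi> z + b * (deriv ^^ j) \<eta> z) z = a * (deriv ^^ Suc j) \<psi> z + b * (deriv ^^ Suc j) \<eta> z" for z
    by (intro DERIV_imp_deriv DERIV_add DERIV_cmult smooth_funpow_deriv assms)
  then show ?case unfolding funpow.simps o_apply Suc.IH by (intro ext)
qed simp

lemma smooth_lincomb:
  assumes "smooth \<psi>" "smooth \<eta>"
  shows "smooth (%z. a * \<psi> z + b * \<eta> z)"
  unfolding smooth_def funpow_deriv_lincomb[OF assms]
  using assms unfolding smooth_def by (intro allI) (auto intro!: derivative_intros)

lemma funpow_deriv_deriv: "(deriv ^^ j) (deriv \<psi>) = (deriv ^^ Suc j) \<psi>"
  by (simp only: funpow_Suc_right o_apply)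

lemma smooth_deriv_smooth: "smooth \<psi> ==> smooth (deriv \<psi>)"
  unfolding smooth_def funpow_deriv_deriv by blast

lemma Lop_lincomb: "Lop t \<psi> = (%z. 1 * \<psi> z + (- t) * deriv \<psi> z)"
  by (simp add: Lop_def fun_eq_iff)

lemma funpow_deriv_Lop:
  assumes "smooth \<psi>"
  shows "(deriv ^^ j) (Lop t \<psi>) z = (deriv ^^ j) \<psi> z - t * (deriv ^^ Suc j) \<psi> z"
  unfolding Lop_lincomb funpow_deriv_lincomb[OF assms smooth_deriv_smooth[OF assms]] funpow_deriv_deriv by simp

lemma smooth_Lop: "smooth \<psi> ==> smooth (Lop t \<psi>)"
  unfolding Lop_lincomb by (intro smooth_lincomb smooth_deriv_smooth)

lemma funpow_Lop_Suc: "(Lop t ^^ Suc n) \<psi> z = (Lop t ^^ n) \<psi> z - t * deriv ((Lop t ^^ n) \<psi>) z"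
  by (simp only: funpow.simps o_apply) (rule Lop_def)

lemma smooth_funpow_Lop: "smooth \<psi> ==> smooth ((Lop t ^^ n) \<psi>)"
  by (induction n) (auto intro: smooth_Lop)

lemma smooth_continuous: "smooth \<psi> ==> continuous_on S \<psi>"
  using smooth_deriv by (auto intro!: continuous_at_imp_continuous_on DERIV_isCont)

lemma funpow_Lop_lincomb:
  assumes "smooth \<psi>" "smooth \<eta>"
  shows "(Lop t ^^ n) (%z. a * \<psi> z + b * \<eta> z) = (%z. a * (Lop t ^^ n) \<psi> z + b * (Lop t ^^ n) \<eta> z)"
proof (induction n)
  case (Suc n)
  have "deriv (%z. a * (Lop t ^^ n) \<psi> z + b * (Lop t ^^ n) \<eta> z) z = a * deriv ((Lop t ^^ n) \<psi>) z + b * deriv ((Lop t ^^ n) \<eta>) z" for z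
    by (intro DERIV_imp_deriv DERIV_add DERIV_cmult smooth_deriv smooth_funpow_Lop assms)
  then show ?case unfolding fun_eq_iff funpow_Lop_Suc Suc.IH by (simp add: algebra_simps)
qed simp

lemma funpow_Lop_bound:
  assumes "smooth \<psi>" "t > 0" "\<And>j. j <= k + n ==> \<bar>(deriv ^^ j) \<psi> z\<bar> <= B"
  shows "\<bar>(deriv ^^ k) ((Lop t ^^ n) \<psi>) z\<bar> <= (1 + t) ^ n * B"
  using assms(3)
proof (induction n arbitrary: k)
  case 0
  then show ?case by simp
next
  case (Suc n)
  have "\<bar>(deriv ^^ k) ((Lop t ^^ Suc n) \<psi>) z\<bar> = \<bar>(deriv ^^ k) ((Lop t ^^ n) \<psi>) z - t * (deriv ^^ Suc k) ((Lop t ^^ n) \<psi>) z\<bar>"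
    using funpow_deriv_Lop[OF smooth_funpow_Lop[OF assms(1), where t = t and n = n], where t = t and j = k and z = z] by simp
  also have "\<dots> <= \<bar>(deriv ^^ k) ((Lop t ^^ n) \<psi>) z\<bar> + t * \<bar>(deriv ^^ Suc k) ((Lop t ^^ n) \<psi>) z\<bar>"
    using abs_triangle_ineq4[of "(deriv ^^ k) ((Lop t ^^ n) \<psi>) z" "t * (deriv ^^ Suc k) ((Lop t ^^ n) \<psi>) z"] assms(2)
    by (simp only: abs_mult abs_of_pos)
  also have "\<dots> <= (1 + t) ^ n * B + t * ((1 + t) ^ n * B)"
    using assms(2) by (intro add_mono mult_left_mono Suc.IH) (auto intro!: Suc.prems)
  finally show ?case by (simp add: algebra_simps)
qed

text \<open>Exponentials are eigenfunctions, and the eigenvalue 1 + l t is exactly the Laplace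
  variable s of the resulting integral; its D-th power cancels the s^(-D) in
  \<open>laplace_ifun\<close>.\<close>

lemma funpow_Lop_exp: "(Lop t ^^ n) (%z. exp (- l * z)) = (%z. (1 + l * t) ^ n * exp (- l * z))"
proof (induction n)
  case (Suc n)
  have "deriv (%z. (1 + l * t) ^ n * exp (- l * z)) z = - l * ((1 + l * t) ^ n * exp (- l * z))" for z
    by (rule DERIV_imp_deriv) (auto intro!: derivative_eq_intros)
  then show ?case unfolding fun_eq_iff funpow_Lop_Suc Suc.IH by (simp add: algebra_simps)
qed simp

lemma funpow_Lop_support:
  assumes "\<And>z. z > 0 ==> z \<notin> {a..b} ==> \<psi> z = 0" "z > 0" "z \<notin> {a..b}"
  shows "(Lop t ^^ n) \<psi> z = 0"
  using assms(2,3)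
proof (induction n arbitrary: z)
  case (Suc n)
  have "((Lop t ^^ n) \<psi> has_real_derivative 0) (at z)"
  proof (rule DERIV_cong_ev[OF refl _ refl, THEN iffD2])
    show "((%_. 0) has_real_derivative 0) (at z)" by simp
    have "eventually (%x. x \<in> {0<..} \<inter> - {a..b}) (nhds z)"
      by (rule eventually_nhds_in_open) (use Suc.prems in \<open>auto intro!: open_Int\<close>)
    then show "eventually (%x. (Lop t ^^ n) \<psi> x = 0) (nhds z)"
      by eventually_elim (use Suc.IH in auto)
  qed
  then have "deriv ((Lop t ^^ n) \<psi>) z = 0" by (rule DERIV_imp_deriv)
  then show ?case unfolding funpow_Lop_Suc using Suc by simp
qed (use assms(1) in auto)

text \<open>The real form of \<open>cgood_rep\<close>. The antiderivatives are a parameter here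
  because the pairing is built from them.\<close>

definition rgood :: "real => nat => (real => real) => (real => real => real) => (real => real => nat => real => real) => bool" where
  "rgood A D V M h \<longleftrightarrow> (\<forall>t>0. \<forall>b>0.
      (\<forall>y>0. h t b 0 y = M (t * y) (b * y)) \<and>
      (\<forall>j<D. \<forall>y>0. (h t b (Suc j) has_real_derivative h t b j y) (at y)) \<and>
      continuous_on {0<..} (h t b D) \<and>
      (\<exists>C. \<forall>y>0. \<bar>h t b D y\<bar> <= C * exp (y / 2)) \<and>
      (\<forall>s\<ge>1. (LINT y|lborel. indicator {0<..} y * (exp (- s * y) * h t b D y)) = laplace_ifun A t b D s * V (t * b / s\<^sup>2)))"

lemma cgood_imp_rgood:
  assumes "cgood A D (%y. of_real (V y)) (%y x. of_real (M y x))"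
  shows "\<exists>h. rgood A D V M h"
proof -
  obtain H where H: "cgood_rep A D (%y. of_real (V y)) (%y x. of_real (M y x)) H"
    using assms unfolding cgood_def by blast
  have "rgood A D V M (%t b j y. Re (H t b j y))"
    unfolding rgood_def
  proof (intro allI impI conjI)
    fix t b :: real assume p: "t > 0" "b > 0"
    note H = H[unfolded cgood_rep_def, rule_format, OF p]
    show "Re (H t b 0 y) = M (t * y) (b * y)" if "y > 0" for y using H that by simp
    show "((%y. Re (H t b (Suc j) y)) has_real_derivative Re (H t b j y)) (at y)" if "j < D" "y > 0" for j y
    proof -
      have "(H t b (Suc j) has_vector_derivative H t b j y) (at y)" using H that by blast
      from bounded_linear.has_vector_derivative[OF bounded_linear_Re this]
      show ?thesis unfolding has_real_derivative_iff_has_vector_derivative .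
    qed
    show "continuous_on {0<..} (%y. Re (H t b D y))" using H by (intro continuous_on_Re) blast
    obtain C where "\<forall>y>0. norm (H t b D y) <= C * exp (y / 2)" using H by blast
    then show "\<exists>C. \<forall>y>0. \<bar>Re (H t b D y)\<bar> <= C * exp (y / 2)" by (meson abs_Re_le_cmod order_trans)
    fix s :: real assume "s >= 1"
    then have "has_bochner_integral lborel (%y. indicator {0<..} y *\<^sub>R (of_real (exp (- s * y)) * H t b D y))
         (of_real (laplace_ifun A t b D s) * of_real (V (t * b / s\<^sup>2)))" using H by blast
    from has_bochner_integral_bounded_linear[OF bounded_linear_Re this]
    have "has_bochner_integral lborel (%y. indicator {0<..} y * (exp (- s * y) * Re (H t b D y))) (laplace_ifun A t b D s * V (t * b / s\<^sup>2))"
      by simp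
    then show "(LINT y|lborel. indicator {0<..} y * (exp (- s * y) * Re (H t b D y))) = laplace_ifun A t b D s * V (t * b / s\<^sup>2)"
      by (rule has_bochner_integral_integral_eq)
  qed
  then show ?thesis by blast
qed

text \<open>Formally the integral of \<psi>(u) exp(- A t - (z + u) / t) / t * M(u, z u / t^2) over u
  > 0, after u = t y and D integrations by parts. Boundary terms at 0 are discarded; this is where
  distributions supported at 0 enter.\<close>

definition Pw :: "(real => real => nat => real => real) => real => nat => (real => real) => real => real => real" where
  "Pw h A D \<psi> z t = exp (- A * t - z / t) *
     (LINT y|lborel. indicator {0<..} y * (exp (- y) * h t (z / t) D y * (Lop t ^^ D) \<psi> (t * y)))"

text \<open>Against exp(- y) stand exp(y / 2) from the antiderivative and exp(y / 4) from the linear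
  growth of the test function, by 1 + t y <= (1 + 4 t) exp(y / 4); what is left is exp(- y /
  4).\<close>

lemma Pw_bounded:
  assumes r: "rgood A D V M h" and z: "z > 0" and t: "t > 0"
  shows "\<exists>C\<ge>0. \<forall>\<psi> m. smooth \<psi> \<and> (\<forall>j\<le>D. \<forall>y\<ge>0. \<bar>(deriv ^^ j) \<psi> y\<bar> <= m * (1 + y)) -->
    integrable lborel (%y. indicator {0<..} y * (exp (- y) * h t (z / t) D y * (Lop t ^^ D) \<psi> (t * y))) \<and>
    \<bar>Pw h A D \<psi> z t\<bar> <= C * m"
proof -
  have b: "z / t > 0" using z t by simp
  note r = r[unfolded rgood_def, rule_format, OF t b]
  obtain C where C: "\<And>y. y > 0 ==> \<bar>h t (z / t) D y\<bar> <= C * exp (y / 2)" using r by blast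
  have C0: "C >= 0" using order_trans[OF abs_ge_zero C[of 1]] by (simp add: zero_le_mult_iff)
  define K where "K = C * ((1 + t) ^ D * (1 + 4 * t))"
  have K0: "K >= 0" unfolding K_def using C0 t by (intro mult_nonneg_nonneg) auto
  define I where "I = (LINT y|lborel. indicator {0<..} y * exp (- (1 / 4) * y) :: real)"
  have I0: "I >= 0" unfolding I_def by (intro integral_nonneg_AE AE_I2) auto
  show ?thesis
  proof (rule exI[of _ "exp (- A * t - z / t) * (K * I)"], rule conjI; (intro allI impI)?)
    show "0 <= exp (- A * t - z / t) * (K * I)" using K0 I0 by simp
    fix \<psi> m assume "smooth \<psi> \<and> (\<forall>j\<le>D. \<forall>y\<ge>0. \<bar>(deriv ^^ j) \<psi> y\<bar> <= m * (1 + y))"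
    then have sm: "smooth \<psi>" and bd: "\<And>j y. j <= D ==> y >= 0 ==> \<bar>(deriv ^^ j) \<psi> y\<bar> <= m * (1 + y)" by auto
    have m0: "m >= 0" using order_trans[OF abs_ge_zero bd[of 0 0]] by simp
    let ?f = "%y. indicator {0<..} y * (exp (- y) * h t (z / t) D y * (Lop t ^^ D) \<psi> (t * y))"
    let ?g = "%y. K * m * (indicator {0<..} y * exp (- (1 / 4) * y)) :: real"
    have gi: "integrable lborel ?g" by (intro integrable_mult_right integrable_exp_indicator) simp
    have fm: "?f \<in> borel_measurable lborel"
    proof -
      have "continuous_on {0<..} (%y. exp (- y) * h t (z / t) D y * (Lop t ^^ D) \<psi> (t * y))"
        using r by (intro continuous_intros continuous_on_compose2[OF smooth_continuous[OF smooth_funpow_Lop[OF sm], of UNIV]]) auto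
      from borel_measurable_indicator_continuous[OF this] show ?thesis by simp
    qed
    have fg: "norm (?f y) <= ?g y" for y
    proof (cases "y > 0")
      case True
      have "\<bar>(Lop t ^^ D) \<psi> (t * y)\<bar> <= (1 + t) ^ D * (m * (1 + t * y))"
        using funpow_Lop_bound[OF sm t, of 0 D "t * y" "m * (1 + t * y)"] bd True t by simp
      also have "\<dots> <= (1 + t) ^ D * (m * ((1 + 4 * t) * exp (y / 4)))"
      proof -
        have "1 + t * y <= (1 + 4 * t) * (1 + y / 4)" using t True by (simp add: field_simps)
        also have "\<dots> <= (1 + 4 * t) * exp (y / 4)" using t exp_ge_add_one_self[of "y / 4"] by (intro mult_left_mono) auto
        finally show ?thesis using t m0 by (intro mult_left_mono) auto
      qed
      finally have L: "\<bar>(Lop t ^^ D) \<psi> (t * y)\<bar> <= (1 + t) ^ D * (m * ((1 + 4 * t) * exp (y / 4)))" .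
      have "norm (?f y) = exp (- y) * \<bar>h t (z / t) D y\<bar> * \<bar>(Lop t ^^ D) \<psi> (t * y)\<bar>" using True by (simp add: abs_mult)
      also have "\<dots> <= exp (- y) * (C * exp (y / 2)) * ((1 + t) ^ D * (m * ((1 + 4 * t) * exp (y / 4))))"
        using C[OF True] C0 by (intro mult_mono L) (auto intro!: mult_nonneg_nonneg)
      also have "\<dots> = K * m * (exp (- y) * exp (y / 2) * exp (y / 4))" by (simp add: K_def)
      also have "exp (- y) * exp (y / 2) * exp (y / 4) = exp (- (1 / 4) * y)" by (simp flip: exp_add)
      finally show ?thesis using True by simp
    qed simp
    have fi: "integrable lborel ?f" by (rule Bochner_Integration.integrable_bound[OF gi fm]) (use fg in \<open>auto intro: order_trans[OF _ abs_ge_self]\<close>)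
    have "\<bar>LINT y|lborel. ?f y\<bar> <= (LINT y|lborel. ?g y)"
      using Bochner_Integration.integral_norm_bound_integral[OF fi gi fg] by simp
    also have "\<dots> = K * m * I" unfolding I_def by (rule integral_mult_right_zero)
    finally have "\<bar>Pw h A D \<psi> z t\<bar> <= exp (- A * t - z / t) * (K * m * I)"
      unfolding Pw_def abs_mult by (simp only: abs_exp_cancel mult_left_mono exp_ge_zero)
    then have "\<bar>Pw h A D \<psi> z t\<bar> <= exp (- A * t - z / t) * (K * I) * m" by (simp add: mult_ac)
    with fi show "integrable lborel ?f \<and> \<bar>Pw h A D \<psi> z t\<bar> <= exp (- A * t - z / t) * (K * I) * m" by blast
  qed
qed

lemma Pw_lincomb:
  assumes r: "rgood A D V M h" and z: "z > 0" and t: "t > 0"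
    and sm: "smooth \<psi>" "smooth \<eta>"
    and m: "\<forall>j\<le>D. \<forall>y\<ge>0. \<bar>(deriv ^^ j) \<psi> y\<bar> <= m * (1 + y)" "\<forall>j\<le>D. \<forall>y\<ge>0. \<bar>(deriv ^^ j) \<eta> y\<bar> <= m' * (1 + y)"
  shows "Pw h A D (%y. a * \<psi> y + b * \<eta> y) z t = a * Pw h A D \<psi> z t + b * Pw h A D \<eta> z t"
proof -
  let ?f = "%\<psi> y. indicator {0<..} y * (exp (- y) * h t (z / t) D y * (Lop t ^^ D) \<psi> (t * y))"
  have i: "integrable lborel (?f \<psi>)" "integrable lborel (?f \<eta>)" using Pw_bounded[OF r z t] sm m by blast+
  have "(LINT y|lborel. ?f (%y. a * \<psi> y + b * \<eta> y) y) = (LINT y|lborel. a * ?f \<psi> y + b * ?f \<eta> y)"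
    unfolding funpow_Lop_lincomb[OF sm] by (rule Bochner_Integration.integral_cong) (auto simp: algebra_simps)
  also have "\<dots> = a * (LINT y|lborel. ?f \<psi> y) + b * (LINT y|lborel. ?f \<eta> y)"
    using i by (simp only: Bochner_Integration.integral_add integrable_mult_right integral_mult_right_zero)
  finally show ?thesis unfolding Pw_def by (simp add: algebra_simps)
qed

text \<open>With s = 1 + l t the D-th power of the eigenvalue of \<open>Lop\<close> cancels the
  extra s^(-D), so the value is independent of D. The choice b = z / t makes the argument t b / s^2
  of V equal to z / s^2.\<close>

lemma Pw_exp:
  assumes r: "rgood A D V M h" and z: "z > 0" and t: "t > 0" and l: "l >= 0"
  shows "Pw h A D (%y. exp (- l * y)) z t = exp (- l * (z + A * t\<^sup>2) / (1 + l * t)) / (1 + l * t) * V (z / (1 + l * t)\<^sup>2)"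
proof -
  have b: "z / t > 0" using z t by simp
  define s where "s = 1 + l * t"
  have s: "s >= 1" "s > 0" "s \<noteq> 0" using l t by (auto simp: s_def add_pos_nonneg) (simp add: add_nonneg_eq_0_iff)?
  have "(LINT y|lborel. indicator {0<..} y * (exp (- y) * h t (z / t) D y * (Lop t ^^ D) (%y. exp (- l * y)) (t * y)))
     = (LINT y|lborel. s ^ D * (indicator {0<..} y * (exp (- s * y) * h t (z / t) D y)))"
  proof (rule Bochner_Integration.integral_cong[OF refl])
    fix y
    have "exp (- y) * exp (- l * (t * y)) = exp (- s * y)" by (simp add: s_def algebra_simps flip: exp_add)
    moreover have "indicator {0<..} y * (exp (- y) * h t (z / t) D y * (Lop t ^^ D) (%y. exp (- l * y)) (t * y))
      = s ^ D * (indicator {0<..} y * ((exp (- y) * exp (- l * (t * y))) * h t (z / t) D y))"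
      unfolding funpow_Lop_exp s_def[symmetric] by simp
    ultimately show "indicator {0<..} y * (exp (- y) * h t (z / t) D y * (Lop t ^^ D) (%y. exp (- l * y)) (t * y))
      = s ^ D * (indicator {0<..} y * (exp (- s * y) * h t (z / t) D y))" by (simp only:)
  qed
  also have "\<dots> = s ^ D * (laplace_ifun A t (z / t) D s * V (t * (z / t) / s\<^sup>2))"
    unfolding integral_mult_right_zero using r[unfolded rgood_def, rule_format, OF t b] s(1) by simp
  finally have 1: "Pw h A D (%y. exp (- l * y)) z t
      = exp (- A * t - z / t) * (s ^ D * (laplace_ifun A t (z / t) D s * V (t * (z / t) / s\<^sup>2)))"
    unfolding Pw_def by simp
  have 2: "exp (- A * t - z / t) * exp ((A * t + z / t) / s) = exp (- l * (z + A * t\<^sup>2) / s)"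
  proof -
    have "(- A * t - z / t) * s + (A * t + z / t) = - l * (z + A * t\<^sup>2)"
      using t by (simp add: s_def field_simps power2_eq_square)
    then have "- A * t - z / t + (A * t + z / t) / s = - l * (z + A * t\<^sup>2) / s"
      using s(3) by (metis add_divide_distrib nonzero_mult_div_cancel_right)
    then show ?thesis by (simp only: exp_add[symmetric])
  qed
  have 3: "s ^ D * (exp ((A * t + z / t) / s) / s ^ Suc D * V (z / s\<^sup>2)) = exp ((A * t + z / t) / s) / s * V (z / s\<^sup>2)"
    using s by simp
  have 4: "t * (z / t) = z" using t by simp
  show ?thesis
    unfolding 1 laplace_ifun_def 4 3 s_def[symmetric] 2[symmetric] by (simp only: times_divide_eq_right times_divide_eq_left mult.assoc)
qed

text \<open>When \<psi> is supported away from 0 and infinity there are no boundary terms, and all D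
  integrations by parts can be undone.\<close>

lemma Pw_compact:
  assumes r: "rgood A D V M h" and z: "z > 0" and t: "t > 0" and sm: "smooth \<psi>"
    and a: "0 < a" "\<And>y. y > 0 ==> y \<notin> {a..b} ==> \<psi> y = 0"
    and Mc: "continuous_on {0<..} (%y. M (t * y) (z / t * y))"
  shows "Pw h A D \<psi> z t = (LINT u|lborel. indicator {0<..} u * (\<psi> u * (exp (- A * t - (z + u) / t) / t * M u (z * u / t\<^sup>2))))"
proof -
  have zt: "z / t > 0" using z t by simp
  note r = r[unfolded rgood_def, rule_format, OF t zt]
  define k where "k = h t (z / t)"
  \<comment> \<open>The points t p and t q lie outside {a..b} on either side; the maximum in
    \<open>q\<close> ensures p <= q without any relation between a and b.\<close>
  define p where "p = a / (2 * t)"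
  define q where "q = max p ((\<bar>b\<bar> + 1) / t)"
  have p: "p > 0" "p <= q" using a t by (auto simp: p_def q_def)
  have out: "t * y \<notin> {a..b}" if "y <= p \<or> y >= q" for y
  proof -
    have "y <= p \<or> y >= (\<bar>b\<bar> + 1) / t" using that by (auto simp: q_def)
    then show ?thesis
    proof
      assume "y <= p"
      then have "t * y <= a / 2" using t by (simp add: p_def field_simps)
      then show ?thesis using a by auto
    next
      assume "y >= (\<bar>b\<bar> + 1) / t"
      then have "\<bar>b\<bar> + 1 <= t * y" using t by (simp add: field_simps)
      then show ?thesis by auto
    qed
  qed
  have k0: "k 0 y = M (t * y) (z / t * y)" if "y > 0" for y using r that by (simp add: k_def)
  have kd: "(k (Suc j) has_real_derivative k j y) (at y)" if "j < D" "y > 0" for j y using r that by (simp add: k_def)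
  have kc: "continuous_on {0<..} (k j)" if "j <= D" for j
  proof (cases j)
    case 0
    show ?thesis unfolding 0 using Mc by (rule continuous_on_cong[THEN iffD1, rotated -1]) (auto simp: k0)
  next
    case (Suc i)
    then show ?thesis using kd[of i] that by (auto intro!: continuous_at_imp_continuous_on DERIV_isCont)
  qed
  define Q where "Q j G = (LINT y|lborel. indicator {0<..} y * (exp (- y) * k j y * G (t * y)))" for j and G :: "real => real"
  have Qpq: "Q j G = (LINT y:{p..q}|lborel. exp (- y) * k j y * G (t * y))" if "\<And>y. y > 0 ==> y \<notin> {a..b} ==> G y = 0" for j G
    unfolding Q_def set_lebesgue_integral_def
  proof (rule Bochner_Integration.integral_cong[OF refl])
    fix y
    show "indicator {0<..} y * (exp (- y) * k j y * G (t * y)) = indicator {p..q} y *\<^sub>R (exp (- y) * k j y * G (t * y))"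
      using that[of "t * y"] out[of y] p t by (cases "y \<in> {p..q}") (auto simp: not_le indicator_def)
  qed
  \<comment> \<open>One integration by parts on [p, q]; the boundary values vanish as t p and t q
    are outside the support of G.\<close>
  have step: "Q (Suc j) (Lop t G) = Q j G" if j: "j < D" and G: "smooth G" "\<And>y. y > 0 ==> y \<notin> {a..b} ==> G y = 0" for j G
  proof -
    have LG: "Lop t G y = 0" if "y > 0" "y \<notin> {a..b}" for y using funpow_Lop_support[where \<psi> = G and n = 1 and t = t, OF G(2) that] by simp
    have sub: "{p..q} \<subseteq> {0<..}" using p by auto
    have c1: "continuous_on {p..q} (%y. exp (- y) * k j y * G (t * y))"
      using j by (intro continuous_intros continuous_on_compose2[OF smooth_continuous[OF G(1), of UNIV]] continuous_on_subset[OF kc sub]) auto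
    have c2: "continuous_on {p..q} (%y. exp (- y) * k (Suc j) y * Lop t G (t * y))"
      using j by (intro continuous_intros continuous_on_compose2[OF smooth_continuous[OF smooth_Lop[OF G(1)], of UNIV]] continuous_on_subset[OF kc sub]) auto
    let ?F = "%y. exp (- y) * k (Suc j) y * G (t * y)"
    have "has_bochner_integral lborel (%y. indicator {p..q} y *\<^sub>R (exp (- y) * k j y * G (t * y) - exp (- y) * k (Suc j) y * Lop t G (t * y))) (?F q - ?F p)"
    proof (rule has_bochner_integral_FTC_Icc[OF p(2)])
      fix y assume "p <= y" "y <= q"
      then have y: "y > 0" using p by simp
      have "(?F has_real_derivative exp (- y) * k j y * G (t * y) - exp (- y) * k (Suc j) y * Lop t G (t * y)) (at y)"
        by (rule derivative_eq_intros kd[OF j y] DERIV_chain2[OF smooth_deriv[OF G(1)]] refl)+ (simp add: Lop_def algebra_simps)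
      then show "(?F has_vector_derivative exp (- y) * k j y * G (t * y) - exp (- y) * k (Suc j) y * Lop t G (t * y)) (at y within {p..q})"
        unfolding has_real_derivative_iff_has_vector_derivative by (rule has_vector_derivative_at_within)
    qed (intro continuous_intros c1 c2)
    then have "(LINT y:{p..q}|lborel. exp (- y) * k j y * G (t * y) - exp (- y) * k (Suc j) y * Lop t G (t * y)) = 0"
      unfolding set_lebesgue_integral_def using G(2)[OF _ out[of p]] G(2)[OF _ out[of q]] p t by (simp add: has_bochner_integral_integral_eq)
    moreover have "set_integrable lborel {p..q} (%y. exp (- y) * k j y * G (t * y))"
        "set_integrable lborel {p..q} (%y. exp (- y) * k (Suc j) y * Lop t G (t * y))"
      by (rule borel_integrable_atLeastAtMost'[OF c1], rule borel_integrable_atLeastAtMost'[OF c2])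
    moreover have "Q (Suc j) (Lop t G) = (LINT y:{p..q}|lborel. exp (- y) * k (Suc j) y * Lop t G (t * y))" by (rule Qpq[OF LG])
    moreover have "Q j G = (LINT y:{p..q}|lborel. exp (- y) * k j y * G (t * y))" by (rule Qpq[OF G(2)])
    ultimately show ?thesis by (simp add: set_integral_diff)
  qed
  have "Q n ((Lop t ^^ n) \<psi>) = Q 0 \<psi>" if "n <= D" for n
    using that
  proof (induction n)
    case (Suc n)
    have "Q (Suc n) (Lop t ((Lop t ^^ n) \<psi>)) = Q n ((Lop t ^^ n) \<psi>)"
      by (rule step[OF _ smooth_funpow_Lop[OF sm] funpow_Lop_support[OF a(2)]]) (use Suc.prems in auto)
    then show ?case using Suc by simp
  qed simp
  then have "Q D ((Lop t ^^ D) \<psi>) = Q 0 \<psi>" by blast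
  then have "Pw h A D \<psi> z t = exp (- A * t - z / t) * Q 0 \<psi>" unfolding Pw_def Q_def k_def by simp
  also have "Q 0 \<psi> = \<bar>1 / t\<bar> *\<^sub>R (LINT u|lborel. indicator {0<..} (0 + 1 / t * u) * (exp (- (0 + 1 / t * u)) * k 0 (0 + 1 / t * u) * \<psi> (t * (0 + 1 / t * u))))"
    unfolding Q_def by (rule lborel_integral_real_affine) (use t in simp)
  also have "exp (- A * t - z / t) * \<dots> = (LINT u|lborel. exp (- A * t - z / t) * (1 / t) * (indicator {0<..} (0 + 1 / t * u) * (exp (- (0 + 1 / t * u)) * k 0 (0 + 1 / t * u) * \<psi> (t * (0 + 1 / t * u)))))"
    using t by simp
  also have "\<dots> = (LINT u|lborel. indicator {0<..} u * (\<psi> u * (exp (- A * t - (z + u) / t) / t * M u (z * u / t\<^sup>2))))"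
  proof (rule Bochner_Integration.integral_cong[OF refl])
    fix u :: real
    show "exp (- A * t - z / t) * (1 / t) * (indicator {0<..} (0 + 1 / t * u) * (exp (- (0 + 1 / t * u)) * k 0 (0 + 1 / t * u) * \<psi> (t * (0 + 1 / t * u))))
       = indicator {0<..} u * (\<psi> u * (exp (- A * t - (z + u) / t) / t * M u (z * u / t\<^sup>2)))"
    proof (cases "u > 0")
      case True
      have u: "u / t > 0" "t * (u / t) = u" "z / t * (u / t) = z * u / t\<^sup>2" using True t by (auto simp: power2_eq_square)
      have e: "exp (- A * t - z / t) * exp (- (u / t)) = exp (- A * t - (z + u) / t)"
        by (simp add: add_divide_distrib diff_diff_eq2 flip: exp_add) (simp add: algebra_simps)?
      have "exp (- A * t - z / t) * (1 / t) * (exp (- (u / t)) * M u (z * u / t\<^sup>2) * \<psi> u)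
         = \<psi> u * (exp (- A * t - z / t) * exp (- (u / t)) / t * M u (z * u / t\<^sup>2))" by simp
      moreover have "k 0 (u / t) = M u (z * u / t\<^sup>2)" using k0[OF u(1)] unfolding u(2,3) .
      moreover have "0 + 1 / t * u = u / t" by simp
      moreover have "indicator {0<..} u = (1::real)" "indicator {0<..} (u / t) = (1::real)" using True u(1) by auto
      ultimately show ?thesis using u(2) e by (simp only: mult_1)
    next
      case False
      then have "\<not> u / t > 0" using t by (simp add: zero_less_divide_iff)
      then show ?thesis using False by simp
    qed
  qed
  finally show ?thesis .
qed

section \<open>Reduction to the normal form\<close>

text \<open>Derivatives are carried as the function times its logarithmic derivative. These add for
  products, which keeps the computations with long exponential factors short.\<close>

lemma DERIV_log_mult:
  fixes f g :: "real => real"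
  assumes "(f has_real_derivative f x * a) (at x)" "(g has_real_derivative g x * b) (at x)"
  shows "((%x. f x * g x) has_real_derivative f x * g x * (a + b)) (at x)"
  by (rule DERIV_cong[OF DERIV_mult[OF assms]]) (simp add: algebra_simps)

lemma DERIV_log_exp:
  fixes e :: "real => real"
  assumes "(e has_real_derivative e') (at x)"
  shows "((%x. exp (e x)) has_real_derivative exp (e x) * e') (at x)"
  using DERIV_chain2[OF DERIV_exp assms] .

lemma DERIV_log_powr:
  assumes "(g has_real_derivative g') (at x)" "g x > 0"
  shows "((%x. g x powr r) has_real_derivative g x powr r * (r * g' / g x)) (at x)"
  by (rule DERIV_cong[OF DERIV_fun_powr[OF assms]]) (use assms(2) in \<open>simp add: powr_diff\<close>)

lemma DERIV_log_inverse:
  fixes f :: "real => real"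
  assumes "(f has_real_derivative f x * a) (at x)" "f x \<noteq> 0"
  shows "((%x. 1 / f x) has_real_derivative 1 / f x * (- a)) (at x)"
  by (rule DERIV_cong[OF DERIV_divide[OF DERIV_const assms(1,2)]]) (use assms(2) in \<open>simp add: field_simps\<close>)

locale riccati_pde =
  fixes \<sigma> \<gamma> A B :: real and f g h F :: "real => real"
  assumes \<sigma>: "\<sigma> > 0" and \<gamma>: "\<gamma> \<noteq> 2"
    and h: "\<And>x. x > 0 ==> h x = x powr (1 - \<gamma>) * f x"
    and riccati: "riccati_solution \<sigma> \<gamma> A B g h"
    and F: "\<And>x. x > 0 ==> (F has_real_derivative f x / x powr \<gamma>) (at x)"
begin

definition "\<rho> = 2 - \<gamma>"
definition "k = \<sigma> * \<rho>\<^sup>2"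
text \<open>The square of the Bessel order, (1 + 2 B / \<sigma>^2) / \<rho>^2; it may be negative,
  in which case the order is imaginary.\<close>

definition "N = (\<sigma> + 2 * B / \<sigma>) / k"
text \<open>The exponential removes the drift f; the factor sqrt x corrects for the second
  derivative of x^\<rho>. Together they make the first-order coefficient in z = x^\<rho> exactly the
  constant k.\<close>

definition "gfac x = sqrt x * exp (- (F x / (2 * \<sigma>)))"

lemma \<rho>: "\<rho> \<noteq> 0" and k: "k > 0" "k \<noteq> 0"
  using \<sigma> \<gamma> by (auto simp: \<rho>_def k_def)

lemma f_eq: "x > 0 ==> f x = h x * x / x powr \<rho>"
  and powr_\<gamma>: "x > 0 ==> x powr \<gamma> = x\<^sup>2 / x powr \<rho>"
proof -
  assume x: "x > 0"
  have "x powr 2 = x\<^sup>2" using x by (simp add: powr_numeral)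
  then show p: "x powr \<gamma> = x\<^sup>2 / x powr \<rho>" using x unfolding \<rho>_def by (simp add: powr_diff)
  have "x powr (1 - \<gamma>) = x / x powr \<gamma>" using x by (simp add: powr_diff)
  then show "f x = h x * x / x powr \<rho>" using x unfolding h[OF x] p by (simp add: power2_eq_square)
qed

lemma hd: "x > 0 ==> (h has_real_derivative deriv h x) (at x)"
  using riccati unfolding riccati_solution_def by (simp add: DERIV_deriv_iff_real_differentiable)

text \<open>The form in which the Riccati equation enters the computations: g is eliminated in
  favour of h and h'.\<close>

lemma g_eq: "x > 0 ==> g x = A + (B - (\<sigma> * x * deriv h x - \<sigma> * h x + 1 / 2 * (h x)\<^sup>2)) / (2 * \<sigma> * x powr \<rho>)"
proof -
  assume x: "x > 0"
  have "\<sigma> * x * deriv h x - \<sigma> * h x + 1/2 * (h x)\<^sup>2 + 2 * \<sigma> * x powr \<rho> * g x = 2 * \<sigma> * A * x powr \<rho> + B"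
    using riccati x unfolding riccati_solution_def \<rho>_def by blast
  moreover have "2 * \<sigma> * x powr \<rho> \<noteq> 0" using x \<sigma> by simp
  ultimately show ?thesis by (simp add: field_simps)
qed

lemma Fd: "x > 0 ==> (F has_real_derivative h x / x) (at x)"
  by (rule DERIV_cong[OF F]) (simp_all add: f_eq powr_\<gamma> power2_eq_square)

lemma continuous_on_hF: "continuous_on {0<..} h" "continuous_on {0<..} F"
  using hd Fd by (auto intro!: continuous_at_imp_continuous_on DERIV_isCont)

lemma gfac_pos: "x > 0 ==> gfac x > 0"
  by (simp add: gfac_def)

lemma gfac_deriv: "x > 0 ==> (gfac has_real_derivative gfac x * ((1 - h x / \<sigma>) / (2 * x))) (at x)"
proof -
  assume x: "x > 0"
  have 1: "(sqrt has_real_derivative sqrt x * (1 / (2 * x))) (at x)"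
    by (rule DERIV_cong[OF DERIV_real_sqrt[OF x]]) (use x in \<open>simp add: field_simps\<close>)
  have 2: "((%x. - (F x / (2 * \<sigma>))) has_real_derivative - (h x / x / (2 * \<sigma>))) (at x)"
    by (intro DERIV_minus DERIV_cdivide Fd x)
  show ?thesis
    unfolding gfac_def[abs_def]
    by (rule DERIV_cong[OF DERIV_log_mult[OF 1 DERIV_log_exp[OF 2]]]) (use x \<sigma> in \<open>simp add: field_simps\<close>)
qed

lemma gfac_deriv2:
  assumes x: "x > 0"
  shows "((%x. gfac x * ((1 - h x / \<sigma>) / (2 * x))) has_real_derivative
    gfac x * (((1 - h x / \<sigma>)\<^sup>2 / 4 - 1 / 2 - (x * deriv h x - h x) / (2 * \<sigma>)) / x\<^sup>2)) (at x)"
proof -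
  have "((%x. (1 - h x / \<sigma>) / (2 * x)) has_real_derivative ((0 - deriv h x / \<sigma>) * (2 * x) - (1 - h x / \<sigma>) * (2 * 1)) / ((2 * x) * (2 * x))) (at x)"
    by (intro DERIV_divide DERIV_diff DERIV_const DERIV_cdivide hd x DERIV_cmult DERIV_ident) (use x in simp)
  from DERIV_mult[OF gfac_deriv[OF x] this] show ?thesis
    by (rule DERIV_cong) (use x \<sigma> in \<open>simp add: field_simps power2_eq_square\<close>)
qed

lemma continuous_on_gfac: "continuous_on {0<..} gfac"
  using gfac_deriv by (auto intro!: continuous_at_imp_continuous_on DERIV_isCont)

lemma powr_\<rho>_deriv: "x > 0 ==> ((%x. x powr \<rho>) has_real_derivative \<rho> * x powr \<rho> / x) (at x)"
  by (rule DERIV_cong[OF DERIV_log_powr[OF DERIV_ident]]) auto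

lemma powr_\<rho>_deriv2: 
  assumes x: "x > 0"
  shows "((%x. \<rho> * x powr \<rho> / x) has_real_derivative \<rho> * (\<rho> - 1) * x powr \<rho> / x\<^sup>2) (at x)"
  by (rule DERIV_cong[OF DERIV_divide[OF DERIV_cmult[OF powr_\<rho>_deriv[OF x], of \<rho>] DERIV_ident]])
    (use x in \<open>simp_all add: field_simps power2_eq_square\<close>)

lemma continuous_on_fst_pos: "continuous_on {0<..} q ==> continuous_on ({0<..} \<times> {0<..}) (%(x, t::real). q (x::real) :: real)"
  unfolding case_prod_unfold by (rule continuous_on_compose2[of "{0<..}" q _ fst]) (auto intro: continuous_on_fst continuous_on_id)

text \<open>The terms in h, h^2 and x h' produced by the gauge factor cancel against those in g by
  the Riccati equation; the zeroth-order coefficient that survives is (\<sigma> / 4 + B / (2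
  \<sigma>)) / x^\<rho> + A, with a minus sign.\<close>

lemma linear_pde_gfac:
  assumes V: "linear_pde (%z. z) (%_. 1) (%z. - (N / (4 * z) + A / k)) ({0<..} \<times> {0<..}) V"
  shows "solves_pde \<sigma> \<gamma> f g ({0<..} \<times> {0<..}) (%x t. gfac x * V (x powr \<rho>) (k * t))"
  unfolding solves_pde_eq_linear_pde
proof (rule linear_pde_transform[OF V,
    where mt = "%_ _. 0" and mx = "%x _. gfac x * ((1 - h x / \<sigma>) / (2 * x))"
      and mxx = "%x _. gfac x * (((1 - h x / \<sigma>)\<^sup>2 / 4 - 1 / 2 - (x * deriv h x - h x) / (2 * \<sigma>)) / x\<^sup>2)"
      and Zt = "%_ _. 0" and Zx = "%x _. \<rho> * x powr \<rho> / x" and Zxx = "%x _. \<rho> * (\<rho> - 1) * x powr \<rho> / x\<^sup>2" and Tt = "%_. k"])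
  show "open ({0<..} \<times> {0<..} :: (real \<times> real) set)" by (intro open_Times open_greaterThan)
  show "((%t. k * t) has_real_derivative k) (at t)" for t using DERIV_cmult[OF DERIV_ident, of k] by simp
  show "continuous_on ({0<..} \<times> {0<..}) (%(x, t::real). gfac x)" by (rule continuous_on_fst_pos[OF continuous_on_gfac])
  show "continuous_on ({0<..} \<times> {0<..}) (%(x, t::real). gfac x * ((1 - h x / \<sigma>) / (2 * x)))"
    by (rule continuous_on_fst_pos) (use \<sigma> in \<open>auto intro!: continuous_intros continuous_on_gfac continuous_on_hF\<close>)
  show "continuous_on ({0<..} \<times> {0<..}) (%(x, t::real). x powr \<rho>)"
    by (rule continuous_on_fst_pos) (auto intro!: continuous_intros)
  show "continuous_on ({0<..} \<times> {0<..}) (%(x, t::real). \<rho> * x powr \<rho> / x)"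
    by (rule continuous_on_fst_pos) (auto intro!: continuous_intros)
  show "continuous_on ({0<..} \<times> {0<..}) (%(x::real, t). k * t)" by (auto simp: case_prod_unfold intro!: continuous_intros)
  fix x t :: real assume "(x, t) \<in> {0<..} \<times> {0<..}"
  then have x: "x > 0" and t: "t > 0" by auto
  have P: "x powr \<rho> > 0" using x by simp
  show "(x powr \<rho>, k * t) \<in> {0<..} \<times> {0<..}" using x t k by simp
  show "((%y. gfac y) has_real_derivative gfac x * ((1 - h x / \<sigma>) / (2 * x))) (at x)" by (rule gfac_deriv[OF x])
  show "((%x. gfac x * ((1 - h x / \<sigma>) / (2 * x))) has_real_derivative
    gfac x * (((1 - h x / \<sigma>)\<^sup>2 / 4 - 1 / 2 - (x * deriv h x - h x) / (2 * \<sigma>)) / x\<^sup>2)) (at x)" by (rule gfac_deriv2[OF x])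
  show "((%y. y powr \<rho>) has_real_derivative \<rho> * x powr \<rho> / x) (at x)" by (rule powr_\<rho>_deriv[OF x])
  show "((%y. \<rho> * y powr \<rho> / y) has_real_derivative \<rho> * (\<rho> - 1) * x powr \<rho> / x\<^sup>2) (at x)" by (rule powr_\<rho>_deriv2[OF x])
  show "k * x powr \<rho> = \<sigma> * x powr \<gamma> * (\<rho> * x powr \<rho> / x)\<^sup>2"
    unfolding powr_\<gamma>[OF x] k_def using x P by (simp add: field_simps power2_eq_square)
  show "gfac x * 0 + gfac x * k * 1
      = \<sigma> * x powr \<gamma> * (2 * (gfac x * ((1 - h x / \<sigma>) / (2 * x))) * (\<rho> * x powr \<rho> / x) + gfac x * (\<rho> * (\<rho> - 1) * x powr \<rho> / x\<^sup>2)) + f x * gfac x * (\<rho> * x powr \<rho> / x)"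
    unfolding powr_\<gamma>[OF x] f_eq[OF x] k_def using x P \<sigma> by (simp add: field_simps power2_eq_square)
  have N: "k * (N / (4 * x powr \<rho>) + A / k) = (\<sigma> / 4 + B / (2 * \<sigma>)) / x powr \<rho> + A"
    unfolding N_def using k P by (simp add: field_simps)
  have "0 + gfac x * k * (- (N / (4 * x powr \<rho>) + A / k)) = - gfac x * (k * (N / (4 * x powr \<rho>) + A / k))"
    by (simp only: add_0 mult_minus_right mult_minus_left mult.assoc)
  also have "\<dots> = - gfac x * ((\<sigma> / 4 + B / (2 * \<sigma>)) / x powr \<rho> + A)" unfolding N ..
  also have "\<dots> = \<sigma> * x powr \<gamma> * (gfac x * (((1 - h x / \<sigma>)\<^sup>2 / 4 - 1 / 2 - (x * deriv h x - h x) / (2 * \<sigma>)) / x\<^sup>2))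
      + f x * (gfac x * ((1 - h x / \<sigma>) / (2 * x))) + - g x * gfac x"
    unfolding powr_\<gamma>[OF x] f_eq[OF x] g_eq[OF x] using x P \<sigma> by (simp add: field_simps power2_eq_square)
  finally show "0 + gfac x * k * (- (N / (4 * x powr \<rho>) + A / k))
      = \<sigma> * x powr \<gamma> * (gfac x * (((1 - h x / \<sigma>)\<^sup>2 / 4 - 1 / 2 - (x * deriv h x - h x) / (2 * \<sigma>)) / x\<^sup>2))
      + f x * (gfac x * ((1 - h x / \<sigma>) / (2 * x))) + - g x * gfac x" .
qed auto

lemma stationary_imp_sol:
  assumes st: "stationary_solution \<sigma> \<gamma> f g u"
  shows "\<exists>V1. sol N (A / k) (%z. u (z powr (1 / \<rho>)) / gfac (z powr (1 / \<rho>))) V1"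
    and "\<And>x. x > 0 ==> (u has_real_derivative deriv u x) (at x)"
proof -
  have ud: "(u has_real_derivative deriv u x) (at x)" "(deriv u has_real_derivative deriv (deriv u) x) (at x)"
    and eq: "\<sigma> * x powr \<gamma> * deriv (deriv u) x + f x * deriv u x - g x * u x = 0" if "x > 0" for x
    using st that unfolding stationary_solution_def by (auto simp: DERIV_deriv_iff_real_differentiable)
  then show "\<And>x. x > 0 ==> (u has_real_derivative deriv u x) (at x)" by blast
  \<comment> \<open>Since the derivative of u / gfac in x is \<rho> W / x, this W becomes z times
    the derivative in z = x^\<rho>, the second component required by \<open>sol\<close>.\<close>
  define W where "W x = (x * deriv u x - u x * ((1 - h x / \<sigma>) / 2)) / (\<rho> * gfac x)" for x
  have Vd: "((%x. u x / gfac x) has_real_derivative \<rho> * W x / x) (at x)" if x: "x > 0" for x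
    by (rule DERIV_cong[OF DERIV_divide[OF ud(1)[OF x] gfac_deriv[OF x]]])
      (use gfac_pos[OF x] x \<rho> \<sigma> in \<open>simp_all add: W_def field_simps\<close>)
  have Wd: "(W has_real_derivative \<rho> * (N / 4 + A / k * x powr \<rho>) * (u x / gfac x) / x) (at x)" if x: "x > 0" for x
  proof -
    have G: "gfac x > 0" by (rule gfac_pos[OF x])
    have P: "x powr \<rho> > 0" using x by simp
    define n where "n = 1 * deriv u x + deriv (deriv u) x * x - (deriv u x * ((1 - h x / \<sigma>) / 2) + (0 - deriv h x / \<sigma>) / 2 * u x)"
    have nd: "((%x. x * deriv u x - u x * ((1 - h x / \<sigma>) / 2)) has_real_derivative n) (at x)"
      unfolding n_def by (intro DERIV_diff DERIV_mult DERIV_ident ud x DERIV_cdivide DERIV_const hd)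
    have uu: "deriv (deriv u) x = (g x * u x - f x * deriv u x) / (\<sigma> * x powr \<gamma>)" using eq[OF x] \<sigma> x by (simp add: field_simps)
    have n: "n = deriv u x * (1 - h x / \<sigma>) / 2 + u x * (g x * x powr \<rho> / \<sigma> + x * deriv h x / (2 * \<sigma>)) / x"
      unfolding n_def uu f_eq[OF x] powr_\<gamma>[OF x] using x P \<sigma> by (simp add: field_simps power2_eq_square)
    have "(W has_real_derivative (n * (\<rho> * gfac x) - (x * deriv u x - u x * ((1 - h x / \<sigma>) / 2)) * (\<rho> * (gfac x * ((1 - h x / \<sigma>) / (2 * x)))))
        / ((\<rho> * gfac x) * (\<rho> * gfac x))) (at x)"
      unfolding W_def[abs_def] by (rule DERIV_divide[OF nd DERIV_cmult[OF gfac_deriv[OF x]]]) (use G \<rho> in simp)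
    \<comment> \<open>The terms with u' cancel, so the derivative of \<open>W\<close> is a multiple
      of u / gfac.\<close>
    moreover have e1: "(n * (\<rho> * gfac x) - (x * deriv u x - u x * ((1 - h x / \<sigma>) / 2)) * (\<rho> * (gfac x * ((1 - h x / \<sigma>) / (2 * x)))))
        / ((\<rho> * gfac x) * (\<rho> * gfac x))
      = (u x / gfac x) * (g x * x powr \<rho> / \<sigma> + x * deriv h x / (2 * \<sigma>) + (1 - h x / \<sigma>)\<^sup>2 / 4) / (\<rho> * x)"
      unfolding n using x G \<rho> by (simp add: divide_simps) (simp add: algebra_simps power2_eq_square)
    moreover have e2: "g x * x powr \<rho> / \<sigma> + x * deriv h x / (2 * \<sigma>) + (1 - h x / \<sigma>)\<^sup>2 / 4 = 1 / 4 + B / (2 * \<sigma>\<^sup>2) + A * x powr \<rho> / \<sigma>"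
      unfolding g_eq[OF x] using x P \<sigma> by (simp add: field_simps power2_eq_square)
    moreover have e3: "1 / 4 + B / (2 * \<sigma>\<^sup>2) + A * x powr \<rho> / \<sigma> = \<rho>\<^sup>2 * (N / 4 + A / k * x powr \<rho>)"
      unfolding N_def k_def using \<sigma> \<rho> by (simp add: field_simps power2_eq_square)
    moreover have "(u x / gfac x) * (\<rho>\<^sup>2 * (N / 4 + A / k * x powr \<rho>)) / (\<rho> * x) = \<rho> * (N / 4 + A / k * x powr \<rho>) * (u x / gfac x) / x"
      using \<rho> by (simp add: power2_eq_square)
    ultimately show ?thesis by (simp only:)
  qed
  have zd: "((%z. z powr (1 / \<rho>)) has_real_derivative z powr (1 / \<rho>) / (\<rho> * z)) (at z)" if "z > 0" for z :: real
    by (rule DERIV_cong[OF DERIV_log_powr[OF DERIV_ident]]) (use that in auto)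
  have zz: "(z powr (1 / \<rho>)) powr \<rho> = z" if "z > 0" for z using that \<rho> by (simp add: powr_powr)
  show "\<exists>V1. sol N (A / k) (%z. u (z powr (1 / \<rho>)) / gfac (z powr (1 / \<rho>))) V1"
    unfolding sol_def
  proof (intro exI[of _ "%z. W (z powr (1 / \<rho>))"] allI impI conjI)
    fix z :: real assume z: "z > 0"
    have x: "z powr (1 / \<rho>) > 0" using z by simp
    show "((%z. u (z powr (1 / \<rho>)) / gfac (z powr (1 / \<rho>))) has_real_derivative W (z powr (1 / \<rho>)) / z) (at z)"
      by (rule DERIV_cong[OF DERIV_chain2[OF Vd[OF x] zd[OF z]]]) (use x z \<rho> in simp)
    show "((%z. W (z powr (1 / \<rho>))) has_real_derivative (N / 4 + A / k * z) * (u (z powr (1 / \<rho>)) / gfac (z powr (1 / \<rho>))) / z) (at z)"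
      by (rule DERIV_cong[OF DERIV_chain2[OF Wd[OF x] zd[OF z]]]) (use x z \<rho> in \<open>simp add: zz\<close>)
  qed
qed

text \<open>With s = 1 + 4 \<epsilon> t the change of variables is Z = x / s^(2 / \<rho>), T = t /
  s. The verification rests on Z^\<rho> = x^\<rho> / s^2 and on the Riccati equation at both x and
  Z, which eliminates g at the two points.\<close>

lemma solves_pde_Ubar:
  assumes u: "solves_pde \<sigma> \<gamma> f g ({0<..} \<times> {0<..}) u"
  shows "solves_pde \<sigma> \<gamma> f g {(x, t). x > 0 \<and> t > 0 \<and> 1 + 4 * \<epsilon> * t > 0} (Ubar \<sigma> \<gamma> A F \<epsilon> u)"
proof -
  define S where "S = {(x, t). x > (0::real) \<and> t > 0 \<and> 1 + 4 * \<epsilon> * t > 0}"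
  define p where "p = 4 * \<epsilon>"
  define s where "s t = 1 + 4 * \<epsilon> * t" for t
  define Z where "Z x t = x / s t powr (2 / \<rho>)" for x t
  define m1 where "m1 t = 1 / s t powr ((1 - \<gamma>) / \<rho>)" for t
  define m2 where "m2 x t = exp (- 4 * \<epsilon> * (x powr \<rho> + A * \<sigma> * \<rho>\<^sup>2 * t\<^sup>2) / (\<sigma> * \<rho>\<^sup>2 * s t))" for x t
  define m3 where "m3 x t = exp (1 / (2 * \<sigma>) * (F (Z x t) - F x))" for x t
  define m where "m x t = m1 t * m2 x t * m3 x t" for x t
  \<comment> \<open>Logarithmic derivative of the multiplier in t; \<open>lx\<close> is the one in x
    and \<open>lxx\<close> is the x-derivative of \<open>lx\<close>. Only these enter the three
    coefficient conditions.\<close>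
  define lt where "lt x t = - ((1 - \<gamma>) * p / (\<rho> * s t)) + (p\<^sup>2 * (x powr \<rho> + A * k * t\<^sup>2) / (k * (s t)\<^sup>2) - 2 * p * A * t / s t) - p * h (Z x t) / (\<sigma> * \<rho> * s t)" for x t
  define lx where "lx x t = - (p * \<rho> * x powr \<rho> / (k * s t * x)) + (h (Z x t) - h x) / (2 * \<sigma> * x)" for x t
  define lxx where "lxx x t = - (p * \<rho> * (\<rho> - 1) * x powr \<rho> / (k * s t * x\<^sup>2)) + (Z x t * deriv h (Z x t) - h (Z x t) - x * deriv h x + h x) / (2 * \<sigma> * x\<^sup>2)" for x t
  have sd: "(s has_real_derivative p) (at t)" for t unfolding s_def[abs_def] p_def by (auto intro!: derivative_eq_intros)
  have Z0: "Z x t > 0" if "x > 0" "s t > 0" for x t using that by (simp add: Z_def)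
  have Zd: "((%s. Z x s) has_real_derivative Z x t * (- (2 * p / (\<rho> * s t)))) (at t)" if "s t > 0" for x t
  proof -
    have "((%t. s t powr (2 / \<rho>)) has_real_derivative s t powr (2 / \<rho>) * (2 / \<rho> * p / s t)) (at t)" by (rule DERIV_log_powr[OF sd that])
    from DERIV_cmult[OF DERIV_log_inverse[OF this], of x] that
    have "((%t. x * (1 / s t powr (2 / \<rho>))) has_real_derivative x * (1 / s t powr (2 / \<rho>) * - (2 / \<rho> * p / s t))) (at t)" by simp
    then show ?thesis unfolding Z_def by (simp add: mult_ac)
  qed
  have Zxd: "((%y. Z y t) has_real_derivative Z x t / x) (at x)" if "x > 0" for x t
    unfolding Z_def by (rule DERIV_cong[OF DERIV_cdivide[OF DERIV_ident]]) (use that in simp)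
  have hZ: "((%y. h (Z y t)) has_real_derivative deriv h (Z x t) * (Z x t / x)) (at x)" if "x > 0" "s t > 0" for x t
    by (rule DERIV_chain2[OF hd[OF Z0[OF that]] Zxd[OF that(1)]])
  have m0: "m x t \<noteq> 0" if "s t > 0" for x t using that by (simp add: m_def m1_def m2_def m3_def)
  have mtd: "((%s. m x s) has_real_derivative m x t * lt x t) (at t)" if x: "x > 0" and t: "s t > 0" for x t
  proof -
    have 1: "(m1 has_real_derivative m1 t * (- ((1 - \<gamma>) / \<rho> * p / s t))) (at t)"
      unfolding m1_def[abs_def] by (rule DERIV_log_inverse[OF DERIV_log_powr[OF sd t]]) (use t in simp)
    define e where "e = ((- 4 * \<epsilon> * (0 + A * \<sigma> * \<rho>\<^sup>2 * (2 * t))) * (\<sigma> * \<rho>\<^sup>2 * s t) - (- 4 * \<epsilon> * (x powr \<rho> + A * \<sigma> * \<rho>\<^sup>2 * t\<^sup>2)) * (\<sigma> * \<rho>\<^sup>2 * p)) / ((\<sigma> * \<rho>\<^sup>2 * s t) * (\<sigma> * \<rho>\<^sup>2 * s t))"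
    have "((%t. t\<^sup>2) has_real_derivative 2 * t) (at t)" by (auto intro!: derivative_eq_intros)
    then have "((%t. - 4 * \<epsilon> * (x powr \<rho> + A * \<sigma> * \<rho>\<^sup>2 * t\<^sup>2) / (\<sigma> * \<rho>\<^sup>2 * s t)) has_real_derivative e) (at t)"
      unfolding e_def by (intro DERIV_divide DERIV_cmult DERIV_add DERIV_const sd) (use \<sigma> \<rho> t in auto)
    from DERIV_log_exp[OF this] have 2: "((%t. m2 x t) has_real_derivative m2 x t * e) (at t)" unfolding m2_def .
    have "((%t. 1 / (2 * \<sigma>) * (F (Z x t) - F x)) has_real_derivative 1 / (2 * \<sigma>) * (h (Z x t) / Z x t * (Z x t * (- (2 * p / (\<rho> * s t)))) - 0)) (at t)"
      by (intro DERIV_cmult DERIV_diff DERIV_const DERIV_chain2[OF Fd[OF Z0[OF x t]] Zd[OF t]])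
    from DERIV_log_exp[OF this]
    have 3: "((%t. m3 x t) has_real_derivative m3 x t * (1 / (2 * \<sigma>) * (h (Z x t) / Z x t * (Z x t * (- (2 * p / (\<rho> * s t)))) - 0))) (at t)" unfolding m3_def .
    have ee: "e = p\<^sup>2 * (x powr \<rho> + A * k * t\<^sup>2) / (k * (s t)\<^sup>2) - 2 * p * A * t / s t"
    proof -
      have "e = (p * (x powr \<rho> + A * k * t\<^sup>2) * (k * p) - (p * (A * k * (2 * t))) * (k * s t)) / ((k * s t) * (k * s t))"
        unfolding e_def k_def p_def by (simp add: algebra_simps)
      moreover have "p * (x powr \<rho> + A * k * t\<^sup>2) * (k * p) / ((k * s t) * (k * s t)) = p\<^sup>2 * (x powr \<rho> + A * k * t\<^sup>2) / (k * (s t)\<^sup>2)"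
        using k t by (simp add: power2_eq_square mult_ac)
      moreover have "(p * (A * k * (2 * t))) * (k * s t) / ((k * s t) * (k * s t)) = 2 * p * A * t / s t" using k t by simp
      ultimately show ?thesis by (simp only: diff_divide_distrib)
    qed
    have 4: "1 / (2 * \<sigma>) * (h (Z x t) / Z x t * (Z x t * (- (2 * p / (\<rho> * s t)))) - 0) = - (p * h (Z x t) / (\<sigma> * \<rho> * s t))"
      using Z0[OF x t] by (simp add: mult_ac)
    show ?thesis unfolding m_def
      by (rule DERIV_cong[OF DERIV_log_mult[OF DERIV_log_mult[OF 1 2] 3]]) (simp only: lt_def ee 4, simp add: mult_ac)
  qed
  have mxd: "((%y. m y t) has_real_derivative m x t * lx x t) (at x)" if x: "x > 0" and t: "s t > 0" for x t
  proof -
    have 1: "((%x. m1 t) has_real_derivative m1 t * 0) (at x)" by simp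
    have "((%x. - 4 * \<epsilon> * (x powr \<rho> + A * \<sigma> * \<rho>\<^sup>2 * t\<^sup>2) / (\<sigma> * \<rho>\<^sup>2 * s t)) has_real_derivative - 4 * \<epsilon> * (\<rho> * x powr \<rho> / x + 0) / (\<sigma> * \<rho>\<^sup>2 * s t)) (at x)"
      by (intro DERIV_cdivide DERIV_cmult DERIV_add DERIV_const powr_\<rho>_deriv x)
    from DERIV_log_exp[OF this] have 2: "((%x. m2 x t) has_real_derivative m2 x t * (- 4 * \<epsilon> * (\<rho> * x powr \<rho> / x + 0) / (\<sigma> * \<rho>\<^sup>2 * s t))) (at x)" unfolding m2_def .
    have "((%x. 1 / (2 * \<sigma>) * (F (Z x t) - F x)) has_real_derivative 1 / (2 * \<sigma>) * (h (Z x t) / Z x t * (Z x t / x) - h x / x)) (at x)"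
      by (intro DERIV_cmult DERIV_diff Fd x DERIV_chain2[OF Fd[OF Z0[OF x t]] Zxd[OF x]])
    from DERIV_log_exp[OF this]
    have 3: "((%x. m3 x t) has_real_derivative m3 x t * (1 / (2 * \<sigma>) * (h (Z x t) / Z x t * (Z x t / x) - h x / x))) (at x)" unfolding m3_def .
    have 4: "- 4 * \<epsilon> * (\<rho> * x powr \<rho> / x + 0) / (\<sigma> * \<rho>\<^sup>2 * s t) = - (p * \<rho> * x powr \<rho> / (k * s t * x))"
      unfolding p_def k_def by (simp add: mult_ac)
    have 5: "1 / (2 * \<sigma>) * (h (Z x t) / Z x t * (Z x t / x) - h x / x) = (h (Z x t) - h x) / (2 * \<sigma> * x)"
      using Z0[OF x t] x by (simp add: diff_divide_distrib mult_ac)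
    show ?thesis unfolding m_def
      by (rule DERIV_cong[OF DERIV_log_mult[OF DERIV_log_mult[OF 1 2] 3]]) (simp only: lx_def 4 5, simp add: mult_ac)
  qed
  have lxd: "((%y. lx y t) has_real_derivative lxx x t) (at x)" if x: "x > 0" and t: "s t > 0" for x t
  proof -
    have a: "((%x. p / (k * s t) * (\<rho> * x powr \<rho> / x)) has_real_derivative p / (k * s t) * (\<rho> * (\<rho> - 1) * x powr \<rho> / x\<^sup>2)) (at x)"
      by (intro DERIV_cmult powr_\<rho>_deriv2 x)
    have b: "((%x. (h (Z x t) - h x) / (2 * \<sigma> * x)) has_real_derivative
        ((deriv h (Z x t) * (Z x t / x) - deriv h x) * (2 * \<sigma> * x) - (h (Z x t) - h x) * (2 * \<sigma> * 1)) / ((2 * \<sigma> * x) * (2 * \<sigma> * x))) (at x)"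
      by (intro DERIV_divide DERIV_diff hZ hd x t DERIV_cmult DERIV_ident) (use x \<sigma> in simp)
    have eq: "lx y t = - (p / (k * s t) * (\<rho> * y powr \<rho> / y)) + (h (Z y t) - h y) / (2 * \<sigma> * y)" for y by (simp add: lx_def mult_ac)
    have c: "((deriv h (Z x t) * (Z x t / x) - deriv h x) * (2 * \<sigma> * x) - (h (Z x t) - h x) * (2 * \<sigma> * 1)) / ((2 * \<sigma> * x) * (2 * \<sigma> * x))
       = (Z x t * deriv h (Z x t) - h (Z x t) - x * deriv h x + h x) / (2 * \<sigma> * x\<^sup>2)"
      using x \<sigma> by (simp add: divide_simps) (simp add: algebra_simps power2_eq_square)
    show ?thesis unfolding eq
      by (rule DERIV_cong[OF DERIV_add[OF DERIV_minus[OF a] b]]) (simp only: c lxx_def, simp add: mult_ac)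
  qed
  have cs: "continuous_on S (%q. s (snd q))" unfolding s_def by (intro continuous_intros)
  have S: "fst q > 0" "s (snd q) > 0" "snd q > 0" if "q \<in> S" for q using that by (auto simp: S_def s_def)
  have S0: "fst q \<noteq> 0" "s (snd q) \<noteq> 0" if "q \<in> S" for q using S[OF that] by auto
  have cP: "continuous_on S (%q. fst q powr \<rho>)" by (intro continuous_intros) (use S0 in auto)
  have cZ: "continuous_on S (%q. Z (fst q) (snd q))" unfolding Z_def using S0 by (intro continuous_intros cs) auto
  have ch: "continuous_on S (%q. h (Z (fst q) (snd q)))" "continuous_on S (%q. F (Z (fst q) (snd q)))"
    by (rule continuous_on_compose2[OF continuous_on_hF(1) cZ] continuous_on_compose2[OF continuous_on_hF(2) cZ]; use Z0 S in auto)+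
  have ch': "continuous_on S (%q. h (fst q))" "continuous_on S (%q. F (fst q))"
    by (rule continuous_on_compose2[OF continuous_on_hF(1)] continuous_on_compose2[OF continuous_on_hF(2)]; use S in \<open>auto intro!: continuous_intros\<close>)+
  have cm: "continuous_on S (%q. m (fst q) (snd q))" unfolding m_def m1_def m2_def m3_def
    using S0 \<sigma> \<rho> by (intro continuous_intros cs cP ch ch') auto
  have clt: "continuous_on S (%q. lt (fst q) (snd q))" unfolding lt_def
    using S0 \<sigma> \<rho> k by (intro continuous_intros cs cP ch ch') auto
  have clx: "continuous_on S (%q. lx (fst q) (snd q))" unfolding lx_def
    using S0 \<sigma> \<rho> k by (intro continuous_intros cs cP ch ch') auto
  have "linear_pde (%x. \<sigma> * x powr \<gamma>) f (%x. - g x) S (%x t. m x t * u (Z x t) (t / s t))"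
  proof (rule linear_pde_transform[OF u[unfolded solves_pde_eq_linear_pde],
      where mt = "%x t. m x t * lt x t" and mx = "%x t. m x t * lx x t" and mxx = "%x t. m x t * lx x t * lx x t + lxx x t * m x t"
       and Zt = "%x t. Z x t * (- (2 * p / (\<rho> * s t)))" and Zx = "%x t. Z x t / x" and Zxx = "%_ _. 0" and Tt = "%t. 1 / (s t)\<^sup>2"])
    show "open ({0<..} \<times> {0<..} :: (real \<times> real) set)" by (intro open_Times open_greaterThan)
    show "continuous_on S (%(x, t). m x t)" "continuous_on S (%(x, t). m x t * lt x t)" "continuous_on S (%(x, t). m x t * lx x t)"
      "continuous_on S (%(x, t). Z x t)"
      using cm clt clx cZ by (auto simp: case_prod_unfold intro!: continuous_on_mult)
    show "continuous_on S (%(x, t). Z x t * (- (2 * p / (\<rho> * s t))))" "continuous_on S (%(x, t). Z x t / x)"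
      "continuous_on S (%(x, t). t / s t)" "continuous_on S (%(x, t). 1 / (s t)\<^sup>2)"
      unfolding case_prod_unfold using S0 \<rho> by (intro continuous_intros cZ cs; auto)+
    fix x t assume "(x, t) \<in> S"
    then have x: "x > 0" and t: "s t > 0" and t0: "t > 0" using S by auto
    show "(Z x t, t / s t) \<in> {0<..} \<times> {0<..}" using Z0[OF x t] t t0 by simp
    show "((%s. m x s) has_real_derivative m x t * lt x t) (at t)" by (rule mtd[OF x t])
    show "((%y. m y t) has_real_derivative m x t * lx x t) (at x)" by (rule mxd[OF x t])
    show "((%y. m y t * lx y t) has_real_derivative m x t * lx x t * lx x t + lxx x t * m x t) (at x)"
      by (rule DERIV_mult[OF mxd[OF x t] lxd[OF x t]])
    show "((%s. Z x s) has_real_derivative Z x t * (- (2 * p / (\<rho> * s t)))) (at t)" by (rule Zd[OF t])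
    show "((%y. Z y t) has_real_derivative Z x t / x) (at x)" by (rule Zxd[OF x])
    show "((%y. Z y t / y) has_real_derivative 0) (at x)"
      by (rule DERIV_cong[OF DERIV_divide[OF Zxd[OF x] DERIV_ident]]) (use x in simp_all)
    show "((%t. t / s t) has_real_derivative 1 / (s t)\<^sup>2) (at t)"
      by (rule DERIV_cong[OF DERIV_divide[OF DERIV_ident sd]]) (use t in \<open>simp_all add: s_def p_def power2_eq_square\<close>)
    have P: "x powr \<rho> > 0" using x by simp
    have ZP: "Z x t powr \<rho> = x powr \<rho> / (s t)\<^sup>2"
    proof -
      have "(s t powr (2 / \<rho>)) powr \<rho> = (s t)\<^sup>2" using t \<rho> by (simp add: powr_powr powr_numeral)
      then show ?thesis using x t by (simp add: Z_def powr_divide)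
    qed
    note Zp = Z0[OF x t]
    show "1 / (s t)\<^sup>2 * (\<sigma> * Z x t powr \<gamma>) = \<sigma> * x powr \<gamma> * (Z x t / x)\<^sup>2"
      unfolding powr_\<gamma>[OF x] powr_\<gamma>[OF Zp] ZP using x t P by (simp add: field_simps power2_eq_square)
    have "- (2 * p / (\<rho> * s t)) * Z x t + 1 / (s t)\<^sup>2 * f (Z x t) = \<sigma> * x powr \<gamma> * (2 * lx x t * (Z x t / x)) + f x * (Z x t / x)"
      unfolding powr_\<gamma>[OF x] f_eq[OF x] f_eq[OF Zp] ZP lx_def k_def using x t P \<sigma> \<rho>
      by (simp add: divide_simps) (simp add: algebra_simps power2_eq_square)
    then have "m x t * (- (2 * p / (\<rho> * s t)) * Z x t + 1 / (s t)\<^sup>2 * f (Z x t)) = m x t * (\<sigma> * x powr \<gamma> * (2 * lx x t * (Z x t / x)) + f x * (Z x t / x))"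
      by (simp only:)
    then show "m x t * (Z x t * (- (2 * p / (\<rho> * s t)))) + m x t * (1 / (s t)\<^sup>2) * f (Z x t)
      = \<sigma> * x powr \<gamma> * (2 * (m x t * lx x t) * (Z x t / x) + m x t * 0) + f x * m x t * (Z x t / x)"
      by (simp only: mult_zero_right add_0_right) (simp only: algebra_simps)
    \<comment> \<open>x h'(x) and Z h'(Z) are the combinations that occur in the Riccati equation;
      with them the last condition is an identity of rational expressions.\<close>
    define e E where "e = x * deriv h x" and "E = Z x t * deriv h (Z x t)"
    define P s' H where "P = x powr \<rho>" and "s' = s t" and "H = h (Z x t)"
    have P0: "P > 0" "s' > 0" using x t by (auto simp: P_def s'_def)
    have pt: "s' = 1 + p * t" by (simp add: s'_def s_def p_def)
    have gx: "g x = A + (B - (\<sigma> * e - \<sigma> * h x + 1 / 2 * (h x)\<^sup>2)) / (2 * \<sigma> * P)" using g_eq[OF x] unfolding e_def P_def by (simp only: mult.assoc)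
    have gZ: "1 / s'\<^sup>2 * g (Z x t) = A / s'\<^sup>2 + (B - (\<sigma> * E - \<sigma> * H + 1 / 2 * H\<^sup>2)) / (2 * \<sigma> * P)"
      unfolding g_eq[OF Zp] ZP E_def P_def s'_def H_def using t \<sigma> P by (simp add: field_simps)
    define X where "X = - (p / (\<sigma> * \<rho> * s')) * P + (H - h x) / (2 * \<sigma>)"
    have lxX: "lx x t = X / x" unfolding lx_def X_def P_def[symmetric] s'_def[symmetric] H_def[symmetric] k_def using x \<rho> \<sigma> P0
      by (simp add: field_simps power2_eq_square)
    have lxxX: "lxx x t = (- (p * (\<rho> - 1) / (\<sigma> * \<rho> * s')) * P + (E - H - e + h x) / (2 * \<sigma>)) / x\<^sup>2"
      unfolding lxx_def E_def[symmetric] e_def[symmetric] P_def[symmetric] s'_def[symmetric] H_def[symmetric] k_def using x \<rho> \<sigma> P0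
      by (simp add: field_simps power2_eq_square)
    have r: "\<sigma> * x powr \<gamma> * (lx x t * lx x t + lxx x t) + f x * lx x t
        = \<sigma> / P * (X\<^sup>2 + (- (p * (\<rho> - 1) / (\<sigma> * \<rho> * s')) * P + (E - H - e + h x) / (2 * \<sigma>))) + h x / P * X"
      unfolding lxX lxxX powr_\<gamma>[OF x] f_eq[OF x] P_def[symmetric] using x P0 by (simp add: field_simps power2_eq_square)
    \<comment> \<open>Completing the square: X + h(x) / (2 \<sigma>) contains H in place of H -
      h(x), so products of H and h(x) disappear.\<close>
    have XX: "\<sigma> / P * X\<^sup>2 + h x / P * X = p\<^sup>2 * P / (k * s'\<^sup>2) - p * H / (\<sigma> * \<rho> * s') + (H\<^sup>2 - (h x)\<^sup>2) / (4 * \<sigma> * P)"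
      unfolding X_def k_def using P0 \<sigma> \<rho> by (simp add: divide_simps) (simp add: algebra_simps power2_eq_square)
    have lt': "lt x t = - ((1 - \<gamma>) * p / (\<rho> * s')) + p\<^sup>2 * P / (k * s'\<^sup>2) + A * ((p * t)\<^sup>2 / s'\<^sup>2 - 2 * (p * t) / s') - p * H / (\<sigma> * \<rho> * s')"
      unfolding lt_def P_def[symmetric] s'_def[symmetric] H_def[symmetric] using k P0 by (simp add: field_simps power2_eq_square)
    \<comment> \<open>The term with A t^2 in the exponent of \<open>Ubar\<close> is there for this
      reason: it turns the A / s^2 coming from the image point into A.\<close>
    have At: "(p * t)\<^sup>2 / s'\<^sup>2 - 2 * (p * t) / s' - 1 / s'\<^sup>2 = - 1"
    proof -
      have "(p * t)\<^sup>2 - 2 * (p * t) * s' - 1 = - s'\<^sup>2" unfolding pt by (simp add: algebra_simps power2_eq_square)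
      then have "((p * t)\<^sup>2 - 2 * (p * t) * s' - 1) / s'\<^sup>2 = - 1" using P0 by simp
      moreover have "((p * t)\<^sup>2 - 2 * (p * t) * s' - 1) / s'\<^sup>2 = (p * t)\<^sup>2 / s'\<^sup>2 - 2 * (p * t) / s' - 1 / s'\<^sup>2"
        using P0 by (simp add: diff_divide_distrib power2_eq_square)
      ultimately show ?thesis by simp
    qed
    have "lt x t - 1 / s'\<^sup>2 * g (Z x t) = - ((1 - \<gamma>) * p / (\<rho> * s')) + p\<^sup>2 * P / (k * s'\<^sup>2) - p * H / (\<sigma> * \<rho> * s')
       + A * ((p * t)\<^sup>2 / s'\<^sup>2 - 2 * (p * t) / s' - 1 / s'\<^sup>2) - (B - (\<sigma> * E - \<sigma> * H + 1 / 2 * H\<^sup>2)) / (2 * \<sigma> * P)"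
      unfolding lt' gZ by (simp add: algebra_simps)
    also have "\<dots> = (\<sigma> / P * X\<^sup>2 + h x / P * X) + \<sigma> / P * (- (p * (\<rho> - 1) / (\<sigma> * \<rho> * s')) * P + (E - H - e + h x) / (2 * \<sigma>)) - g x"
      unfolding At XX gx \<rho>_def[symmetric] using P0 \<sigma> \<rho> by (simp add: divide_simps \<rho>_def) (simp add: algebra_simps power2_eq_square)
    also have "\<dots> = \<sigma> * x powr \<gamma> * (lx x t * lx x t + lxx x t) + f x * lx x t - g x" unfolding r by (simp add: algebra_simps)
    finally have "m x t * (lt x t - 1 / s'\<^sup>2 * g (Z x t)) = m x t * (\<sigma> * x powr \<gamma> * (lx x t * lx x t + lxx x t) + f x * lx x t - g x)" by (simp only:)
    then show "m x t * lt x t + m x t * (1 / (s t)\<^sup>2) * - g (Z x t)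
      = \<sigma> * x powr \<gamma> * (m x t * lx x t * lx x t + lxx x t * m x t) + f x * (m x t * lx x t) + - g x * m x t"
      unfolding s'_def by (simp only: algebra_simps)
  qed
  then show ?thesis
    unfolding solves_pde_eq_linear_pde S_def Ubar_def[abs_def] m_def m1_def m2_def m3_def Z_def s_def \<rho>_def by simp
qed

end

section \<open>The fundamental solution\<close>

lemma linear_pde_add:
  assumes "linear_pde a b d S u" "linear_pde a b d S v"
  shows "linear_pde a b d S (%x t. u x t + v x t)"
proof -
  obtain ut ux uxx where u: "continuous_on S (%(x, t). ut x t)" "continuous_on S (%(x, t). ux x t)"
    "\<forall>(x, t)\<in>S. ((%s. u x s) has_real_derivative ut x t) (at t) \<and> ((%y. u y t) has_real_derivative ux x t) (at x) \<and>
       ((%y. ux y t) has_real_derivative uxx x t) (at x) \<and> ut x t = a x * uxx x t + b x * ux x t + d x * u x t"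
    using assms(1) unfolding linear_pde_def by blast
  obtain vt vx vxx where v: "continuous_on S (%(x, t). vt x t)" "continuous_on S (%(x, t). vx x t)"
    "\<forall>(x, t)\<in>S. ((%s. v x s) has_real_derivative vt x t) (at t) \<and> ((%y. v y t) has_real_derivative vx x t) (at x) \<and>
       ((%y. vx y t) has_real_derivative vxx x t) (at x) \<and> vt x t = a x * vxx x t + b x * vx x t + d x * v x t"
    using assms(2) unfolding linear_pde_def by blast
  show ?thesis
    unfolding linear_pde_def
  proof (rule exI[of _ "%x t. ut x t + vt x t"], rule exI[of _ "%x t. ux x t + vx x t"], rule exI[of _ "%x t. uxx x t + vxx x t"], intro conjI)
    show "continuous_on S (%(x, t). ut x t + vt x t)" "continuous_on S (%(x, t). ux x t + vx x t)"
      using u(1,2) v(1,2) unfolding case_prod_unfold by (auto intro: continuous_on_add)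
    show "\<forall>(x, t)\<in>S. ((%s. u x s + v x s) has_real_derivative ut x t + vt x t) (at t) \<and>
       ((%y. u y t + v y t) has_real_derivative ux x t + vx x t) (at x) \<and>
       ((%y. ux y t + vx y t) has_real_derivative uxx x t + vxx x t) (at x) \<and>
       ut x t + vt x t = a x * (uxx x t + vxx x t) + b x * (ux x t + vx x t) + d x * (u x t + v x t)"
    proof (rule ballI, safe)
      fix x t assume "(x, t) \<in> S"
      with u(3) v(3) have *: "((%s. u x s) has_real_derivative ut x t) (at t) \<and> ((%y. u y t) has_real_derivative ux x t) (at x) \<and>
         ((%y. ux y t) has_real_derivative uxx x t) (at x) \<and> ut x t = a x * uxx x t + b x * ux x t + d x * u x t"
        "((%s. v x s) has_real_derivative vt x t) (at t) \<and> ((%y. v y t) has_real_derivative vx x t) (at x) \<and>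
         ((%y. vx y t) has_real_derivative vxx x t) (at x) \<and> vt x t = a x * vxx x t + b x * vx x t + d x * v x t" by blast+
      then show "((%s. u x s + v x s) has_real_derivative ut x t + vt x t) (at t)"
        "((%y. u y t + v y t) has_real_derivative ux x t + vx x t) (at x)"
        "((%y. ux y t + vx y t) has_real_derivative uxx x t + vxx x t) (at x)" by (auto intro: DERIV_add)
      show "ut x t + vt x t = a x * (uxx x t + vxx x t) + b x * (ux x t + vx x t) + d x * (u x t + v x t)"
        using *[THEN conjunct2, THEN conjunct2, THEN conjunct2] by (simp add: algebra_simps)
    qed
  qed
qed

text \<open>If V vanishes identically, all weighted data are 0 and so must be their pairings;
  therefore the zero family of antiderivatives is taken in that case.\<close>

lemma core_data:
  assumes V: "sol N A V V1"
  shows "\<exists>D e1 d1 e2 d2 c hh. sol N 1 e1 d1 \<and> sol N 1 e2 d2 \<and> rasy e1 1 \<and> rasy e2 0 \<and> continuous_on {0<..} c \<and>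
    rgood A D V (%y x. V y * e1 x + c y * e2 x) hh \<and> ((\<forall>y>0. V y = 0) --> (\<forall>\<tau> b j y. hh \<tau> b j y = 0))"
proof -
  obtain D e1 d1 e2 d2 where s: "sol N 1 e1 d1" "sol N 1 e2 d2"
      "casy (%x. of_real (e1 x)) 1" "casy (%x. of_real (e2 x)) 0"
    and ex: "\<forall>V V1. sol N A V V1 --> (\<exists>c c1. sol N A c c1 \<and>
        cgood A D (%y. of_real (V y)) (%y x. of_real (V y * e1 x + c y * e2 x)))"
    using core_exists(1)[of N A] unfolding core_def by blast
  have r: "rasy e1 1" "rasy e2 0" using casy_imp_rasy[OF s(3)] casy_imp_rasy[OF s(4)] by simp_all
  show ?thesis
  proof (cases "\<forall>y>0. V y = 0")
    case True
    have "rgood A D V (%y x. V y * e1 x + 0 * e2 x) (%\<tau> b j y. 0)"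
      unfolding rgood_def using True by (auto intro!: exI[of _ 0])
    then have "sol N 1 e1 d1 \<and> sol N 1 e2 d2 \<and> rasy e1 1 \<and> rasy e2 0 \<and> continuous_on {0<..} (%_. 0 :: real) \<and>
      rgood A D V (%y x. V y * e1 x + (%_. 0) y * e2 x) (%\<tau> b j y. 0) \<and> ((\<forall>y>0. V y = 0) --> (\<forall>\<tau> b j y. (%(\<tau>::real) (b::real) (j::nat) (y::real). 0 :: real) \<tau> b j y = 0))"
      using s r by (intro conjI) auto
    then show ?thesis by blast
  next
    case False
    obtain c c1 where c: "sol N A c c1" "cgood A D (%y. of_real (V y)) (%y x. of_real (V y * e1 x + c y * e2 x))"
      using ex V by blast
    obtain hh where "rgood A D V (%y x. V y * e1 x + c y * e2 x) hh" using cgood_imp_rgood[OF c(2)] by blast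
    then show ?thesis using s r continuous_on_sol(1)[OF c(1)] False by blast
  qed
qed

lemma integral_indicator_eq_wint:
  assumes "0 < a" "\<And>y. y > 0 ==> y \<notin> {a..b} ==> w y = 0"
  shows "(LINT y|lborel. indicator {0<..} y * (w y * G y)) = wint a b w G"
  unfolding wint_def set_lebesgue_integral_def
  by (rule Bochner_Integration.integral_cong[OF refl]) (use assms in \<open>force simp: indicator_def\<close>)

lemma wint_cong: "(\<And>y. y \<in> {a..b} ==> w y = w' y) ==> wint a b w G = wint a b w' G"
  unfolding wint_def set_lebesgue_integral_def
  by (rule Bochner_Integration.integral_cong[OF refl]) (auto simp: indicator_def)

lemma continuous_on_zero_extension:
  fixes q :: "real => real"
  assumes q: "continuous_on {0<..} q" and a: "0 < a" "\<And>y. y > 0 ==> y \<notin> {a..b} ==> q y = 0"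
  shows "continuous_on UNIV (%y. if y > 0 then q y else 0)"
proof -
  have "continuous_on ({0<..} \<union> {..<a}) (%y. if y > 0 then q y else 0)"
  proof (rule continuous_on_open_Un)
    show "continuous_on {0<..} (%y. if y > 0 then q y else 0)"
      by (rule continuous_on_eq[OF q]) simp
    show "continuous_on {..<a} (%y. if y > 0 then q y else 0)"
      by (rule continuous_on_eq[OF continuous_on_const[of _ 0]]) (use a in auto)
  qed auto
  moreover have "{0<..} \<union> {..<a} = UNIV" using a by auto
  ultimately show ?thesis by simp
qed

section \<open>The two spaces of data\<close>

lemma bounded_smooth_imp_smooth: "\<psi> \<in> bounded_smooth ==> smooth \<psi>"
  unfolding bounded_smooth_def smooth_def by blast

lemma bounded_smooth_bound:
  assumes "\<psi> \<in> bounded_smooth"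
  shows "\<exists>m. \<forall>j\<le>D. \<forall>y\<ge>0. \<bar>(deriv ^^ j) \<psi> y\<bar> <= m * (1 + y)"
proof -
  have "\<exists>m. \<forall>y\<ge>0. \<bar>(deriv ^^ j) \<psi> y\<bar> <= m" for j
  proof -
    have "bounded ((deriv ^^ j) \<psi> ` {0..})" using assms unfolding bounded_smooth_def by blast
    then obtain m where "\<forall>x\<in>(deriv ^^ j) \<psi> ` {0..}. norm x <= m" unfolding bounded_iff by blast
    then have "\<forall>y\<ge>0. \<bar>(deriv ^^ j) \<psi> y\<bar> <= m" by auto
    then show ?thesis by blast
  qed
  then obtain m where m: "\<And>j y. y >= 0 ==> \<bar>(deriv ^^ j) \<psi> y\<bar> <= m j" by metis
  have m0: "m j >= 0" for j using order_trans[OF abs_ge_zero m[of 0 j]] by simp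
  have "\<bar>(deriv ^^ j) \<psi> y\<bar> <= (\<Sum>j\<le>D. m j) * (1 + y)" if "j <= D" "y >= 0" for j y
  proof -
    have "\<bar>(deriv ^^ j) \<psi> y\<bar> <= m j" using m that by blast
    also have "\<dots> <= (\<Sum>j\<le>D. m j)" by (rule member_le_sum) (use that m0 in auto)
    also have "\<dots> <= (\<Sum>j\<le>D. m j) * (1 + y)"
      using mult_left_mono[of 1 "1 + y" "\<Sum>j\<le>D. m j"] that sum_nonneg[of "{..D}" m] m0 by simp
    finally show ?thesis .
  qed
  then show ?thesis by blast
qed

lemma bounded_smooth_lincomb:
  assumes "\<psi> \<in> bounded_smooth" "\<eta> \<in> bounded_smooth"
  shows "(%z. a * \<psi> z + b * \<eta> z) \<in> bounded_smooth"
proof -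
  note sm = bounded_smooth_imp_smooth[OF assms(1)] bounded_smooth_imp_smooth[OF assms(2)]
  have "bounded ((deriv ^^ j) (%z. a * \<psi> z + b * \<eta> z) ` {0..})" for j
  proof -
    have "bounded ((deriv ^^ j) \<psi> ` {0..})" "bounded ((deriv ^^ j) \<eta> ` {0..})" using assms unfolding bounded_smooth_def by auto
    then obtain K L where K: "\<And>z. z >= 0 ==> \<bar>(deriv ^^ j) \<psi> z\<bar> <= K" and L: "\<And>z. z >= 0 ==> \<bar>(deriv ^^ j) \<eta> z\<bar> <= L"
      unfolding bounded_iff by auto
    have "\<bar>a * (deriv ^^ j) \<psi> z + b * (deriv ^^ j) \<eta> z\<bar> <= \<bar>a\<bar> * K + \<bar>b\<bar> * L" if "z >= 0" for z
      by (rule order_trans[OF abs_triangle_ineq]) (use K[OF that] L[OF that] in \<open>auto simp: abs_mult intro!: add_mono mult_left_mono\<close>)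
    then show ?thesis unfolding funpow_deriv_lincomb[OF sm] bounded_iff by auto
  qed
  then show ?thesis using smooth_lincomb[OF sm, of a b] unfolding bounded_smooth_def smooth_def by blast
qed

lemma zero_bounded_smooth: "(%z. 0) \<in> bounded_smooth"
proof -
  have "(deriv ^^ j) (%z. 0 :: real) = (%z. 0)" for j by (induction j) auto
  then show ?thesis unfolding bounded_smooth_def by (auto simp: image_constant_conv)
qed

lemma exp_bounded_smooth:
  assumes "l >= 0"
  shows "(%z. exp (- l * z)) \<in> bounded_smooth"
proof -
  have eq: "(deriv ^^ j) (%z. exp (- l * z)) = (%z. (- l) ^ j * exp (- l * z))" for j
  proof (induction j)
    case (Suc j)
    have "deriv (%z. (- l) ^ j * exp (- l * z)) z = (- l) ^ Suc j * exp (- l * z)" for z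
      by (rule DERIV_imp_deriv) (auto intro!: derivative_eq_intros)
    then show ?case unfolding funpow.simps o_apply Suc.IH by (intro ext)
  qed simp
  have "\<bar>(- l) ^ j * exp (- l * z)\<bar> <= l ^ j" if "z >= 0" for j z
    using assms that by (simp add: abs_mult power_abs mult_left_le)
  then have "bounded ((%z. (- l) ^ j * exp (- l * z)) ` {0..})" for j unfolding bounded_iff by auto
  moreover have "(%z. (- l) ^ j * exp (- l * z)) differentiable (at z)" for j z
    by (auto intro!: derivative_eq_intros simp: real_differentiable_def)
  ultimately show ?thesis unfolding bounded_smooth_def mem_Collect_eq eq by blast
qed

text \<open>The orders 0 and 1 are the ones that occur: continuous data, or one derivative when the
  weight has zeros.\<close>

lemma compact_data_in_lincomb:
  assumes "m <= 1" "\<phi> \<in> compact_data_in m K" "\<eta> \<in> compact_data_in m L"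
  shows "(%y. a * \<phi> y + b * \<eta> y) \<in> compact_data_in m (K \<union> L)"
proof (cases m)
  case 0
  then show ?thesis using assms unfolding compact_data_in_def by (auto intro!: continuous_intros)
next
  case (Suc m')
  then have m: "m = 1" using assms by simp
  have d: "\<phi> differentiable (at y)" "\<eta> differentiable (at y)" for y using assms(2,3) unfolding m compact_data_in_def by auto
  have dd: "deriv (%y. a * \<phi> y + b * \<eta> y) = (%y. a * deriv \<phi> y + b * deriv \<eta> y)"
    by (intro ext DERIV_imp_deriv DERIV_add DERIV_cmult) (use d in \<open>auto simp: DERIV_deriv_iff_real_differentiable\<close>)
  have c: "continuous_on UNIV \<phi>" "continuous_on UNIV \<eta>" "continuous_on UNIV (deriv \<phi>)" "continuous_on UNIV (deriv \<eta>)"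
    using assms(2,3) unfolding m compact_data_in_def by (auto simp: le_Suc_eq)
  show ?thesis
    unfolding compact_data_in_def m using assms(2,3) c d
    by (auto simp: dd le_Suc_eq compact_data_in_def intro!: continuous_intros derivative_intros)
qed

lemma compact_data_lincomb:
  assumes "m <= 1" "\<phi> \<in> compact_data m" "\<eta> \<in> compact_data m"
  shows "(%y. a * \<phi> y + b * \<eta> y) \<in> compact_data m"
proof -
  obtain K L where K: "compact K" "K \<subseteq> {0<..}" "\<phi> \<in> compact_data_in m K" and L: "compact L" "L \<subseteq> {0<..}" "\<eta> \<in> compact_data_in m L"
    using assms unfolding compact_data_def by auto
  then have "compact (K \<union> L)" "K \<union> L \<subseteq> {0<..}" by auto
  then show ?thesis using compact_data_in_lincomb[OF assms(1) K(3) L(3)] unfolding compact_data_def by blast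
qed

lemma zero_compact_data: "m <= 1 ==> (%y. 0) \<in> compact_data m"
  unfolding compact_data_def compact_data_in_def by (auto intro!: exI[of _ "{}"] simp: le_Suc_eq)

lemma compact_positive_bounds:
  assumes "compact K" "K \<subseteq> ({0<..} :: real set)"
  obtains a b where "0 < a" "a <= b" "K \<subseteq> {a..b}"
proof (cases "K = {}")
  case True
  then show ?thesis using that[of 1 1] by simp
next
  case False
  obtain a where a: "a \<in> K" "\<And>x. x \<in> K ==> a <= x" using compact_attains_inf[OF assms(1) False] by blast
  obtain b where b: "b \<in> K" "\<And>x. x \<in> K ==> x <= b" using compact_attains_sup[OF assms(1) False] by blast
  show ?thesis by (rule that[of a b]) (use a b assms(2) in auto)
qed

lemma compact_data_in_bounds:
  assumes \<phi>: "\<phi> \<in> compact_data_in m K" and K: "K \<subseteq> {a..b}"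
  shows "continuous_on UNIV \<phi>" "\<And>y. y \<notin> {a..b} ==> \<phi> y = 0"
    and "\<And>M x y. m = 1 ==> \<forall>j\<le>m. \<forall>y. \<bar>(deriv ^^ j) \<phi> y\<bar> <= M ==> \<bar>\<phi> x - \<phi> y\<bar> <= M * \<bar>x - y\<bar>"
    and "m <= 1 ==> \<exists>M. \<forall>j\<le>m. \<forall>y. \<bar>(deriv ^^ j) \<phi> y\<bar> <= M"
proof -
  show c: "continuous_on UNIV \<phi>" using \<phi> unfolding compact_data_in_def by force
  show z: "\<phi> y = 0" if "y \<notin> {a..b}" for y using that \<phi> K unfolding compact_data_in_def by auto
  show "\<bar>\<phi> x - \<phi> y\<bar> <= M * \<bar>x - y\<bar>" if m: "m = 1" and M: "\<forall>j\<le>m. \<forall>y. \<bar>(deriv ^^ j) \<phi> y\<bar> <= M" for M x y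
  proof (rule field_differentiable_bound[of UNIV \<phi> "deriv \<phi>", unfolded real_norm_def])
    show "(\<phi> has_real_derivative deriv \<phi> u) (at u within UNIV)" for u
      using \<phi> m unfolding compact_data_in_def by (auto simp: DERIV_deriv_iff_real_differentiable)
    show "\<bar>deriv \<phi> u\<bar> <= M" for u using M[rule_format, of 1 u] m by simp
  qed auto
  have bd: "\<exists>M. \<forall>y. \<bar>q y\<bar> <= M" if qc: "continuous_on UNIV q" and qz: "\<And>y. y \<notin> {a..b} ==> q y = 0" for q :: "real => real"
  proof -
    obtain M where "\<forall>y\<in>q ` {a..b}. norm y <= M"
      using compact_imp_bounded[OF compact_continuous_image[OF continuous_on_subset[OF qc] compact_Icc]] unfolding bounded_iff by blast
    then have "\<bar>q y\<bar> <= max M 0" for y using qz[of y] by (cases "y \<in> {a..b}") (auto simp: le_max_iff_disj)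
    then show ?thesis by blast
  qed
  show "\<exists>M. \<forall>j\<le>m. \<forall>y. \<bar>(deriv ^^ j) \<phi> y\<bar> <= M" if "m <= 1"
  proof (cases "m = 0")
    case True
    then show ?thesis using bd[OF c z] by simp
  next
    case False
    then have m: "m = 1" using that by simp
    have "deriv \<phi> y = 0" if "y \<notin> {a..b}" for y
    proof -
      have "(\<phi> has_real_derivative 0) (at y)"
      proof (rule DERIV_cong_ev[OF refl _ refl, THEN iffD2])
        have "eventually (%x. x \<in> - {a..b}) (nhds y)" by (rule eventually_nhds_in_open) (use that in auto)
        then show "eventually (%x. \<phi> x = 0) (nhds y)" by eventually_elim (use z in auto)
      qed simp
      then show ?thesis by (rule DERIV_imp_deriv)
    qed
    moreover have "continuous_on UNIV (deriv \<phi>)" using \<phi> unfolding compact_data_in_def m by force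
    ultimately obtain M where M: "\<forall>y. \<bar>deriv \<phi> y\<bar> <= M" using bd[of "deriv \<phi>"] by blast
    obtain M' where M': "\<forall>y. \<bar>\<phi> y\<bar> <= M'" using bd[OF c z] by blast
    have "\<forall>j\<le>m. \<forall>y. \<bar>(deriv ^^ j) \<phi> y\<bar> <= max M M'"
      using M M' by (auto simp: m le_Suc_eq le_max_iff_disj)
    then show ?thesis by blast
  qed
qed

section \<open>The pairing with compactly supported data\<close>

locale kernel_data = riccati_pde +
  fixes u0 V1 e1 d1 e2 d2 c :: "real => real" and D :: nat and hh :: "real => real => nat => real => real"
  assumes V: "sol N (A / k) (%z. u0 (z powr (1 / \<rho>)) / gfac (z powr (1 / \<rho>))) V1"
    and u0: "\<And>x. x > 0 ==> (u0 has_real_derivative deriv u0 x) (at x)"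
    and s1: "sol N 1 e1 d1" and s2: "sol N 1 e2 d2" and r1: "rasy e1 1" and r2: "rasy e2 0"
    and c: "continuous_on {0<..} c"
    and rg: "rgood (A / k) D (%z. u0 (z powr (1 / \<rho>)) / gfac (z powr (1 / \<rho>)))
        (%y x. u0 (y powr (1 / \<rho>)) / gfac (y powr (1 / \<rho>)) * e1 x + c y * e2 x) hh"
    and hz: "(\<forall>y>0. u0 (y powr (1 / \<rho>)) / gfac (y powr (1 / \<rho>)) = 0) ==> hh t b j y = 0"
begin

definition "xi z = z powr (1 / \<rho>)" for z :: real
definition "V0 z = u0 (xi z) / gfac (xi z)" for z
definition "tlf \<phi> z = \<phi> (xi z) / gfac (xi z)" for \<phi> :: "real => real" and z
definition "om \<phi> z = divw u0 \<phi> (xi z)" for \<phi> and z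
text \<open>\<open>tlf\<close> transports data to the normal form in the way \<open>V0\<close> is
  obtained from \<open>u0\<close>, and \<open>om\<close> is the regularised \<phi> / u0. For \<phi>
  = \<psi> u0 they become \<psi> V0 and, off the zeros, \<psi>, so that \<open>Pc\<close> integrates
  \<psi> against the kernel V0 e1 + c e2.\<close>

definition "Pc \<phi> z t = (LINT y|lborel. indicator {0<..} y * (tlf \<phi> y * ker (A / k) e1 y z t))
  + (LINT y|lborel. indicator {0<..} y * ((om \<phi> y * c y) * ker (A / k) e2 y z t))" for \<phi> z t
text \<open>At a zero of u0 the quotient is controlled by a Lipschitz constant of the data, which
  costs one derivative.\<close>

definition "m = (if \<forall>y>0. u0 y \<noteq> 0 then 0 else (1::nat))"

lemma m_le: "m <= 1" by (simp add: m_def)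

lemma V0: "sol N (A / k) V0 V1" unfolding V0_def[abs_def] xi_def using V .

lemma xi: "z > 0 ==> xi z > 0" "z > 0 ==> xi z powr \<rho> = z" "x > 0 ==> xi (x powr \<rho>) = x"
  using \<rho> by (simp_all add: xi_def powr_powr)

lemma continuous_on_xi: "continuous_on {0<..} xi"
  unfolding xi_def[abs_def] by (auto intro!: continuous_intros)

text \<open>For negative \<rho> the power map reverses the order, hence the minimum and maximum of
  the transformed end points.\<close>

lemma xi_support:
  assumes "0 < a" "a <= b"
  shows "\<exists>a' b'. 0 < a' \<and> (\<forall>y>0. xi y \<in> {a..b} --> y \<in> {a'..b'})"
proof (intro exI conjI allI impI)
  show "0 < min (a powr \<rho>) (b powr \<rho>)" using assms by simp
  fix y :: real assume y: "y > 0" "xi y \<in> {a..b}"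
  have "min (a powr \<rho>) (b powr \<rho>) <= xi y powr \<rho> \<and> xi y powr \<rho> <= max (a powr \<rho>) (b powr \<rho>)"
  proof (cases "\<rho> >= 0")
    case True
    then have "a powr \<rho> <= xi y powr \<rho>" "xi y powr \<rho> <= b powr \<rho>" using y assms xi(1)[OF y(1)] by (auto intro!: powr_mono2)
    then show ?thesis by auto
  next
    case False
    then have "xi y powr \<rho> <= a powr \<rho>" "b powr \<rho> <= xi y powr \<rho>" using y assms xi(1)[OF y(1)] by (auto intro!: powr_mono2')
    then show ?thesis by auto
  qed
  then show "y \<in> {min (a powr \<rho>) (b powr \<rho>)..max (a powr \<rho>) (b powr \<rho>)}" using xi(2)[OF y(1)] by simp
qed

lemma u0_V0: "x > 0 ==> u0 x = gfac x * V0 (x powr \<rho>)"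
  using gfac_pos[of x] by (simp add: V0_def xi)

lemma continuous_on_u0: "continuous_on {0<..} u0"
  using u0 by (auto intro!: continuous_at_imp_continuous_on DERIV_isCont)

lemma V0_deriv: "z > 0 ==> (V0 has_real_derivative V1 z / z) (at z)"
  by (rule solD(1)[OF V0])

lemma V0_zero:
  assumes "z > 0" "V0 z = 0" "V1 z = 0" "y > 0"
  shows "V0 y = 0"
  using core_exists(2)[of N "A / k"] V0 assms unfolding simple_zeros_def by blast

text \<open>A double zero of u0 would be a common zero of V0 and V1, which
  \<open>simple_zeros\<close> rules out for a nonzero solution.\<close>

lemma u0_simple:
  assumes ne: "\<not> (\<forall>x>0. u0 x = 0)" and x: "x > 0" "u0 x = 0"
  shows "deriv u0 x \<noteq> 0"
proof
  assume d: "deriv u0 x = 0"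
  define z where "z = x powr \<rho>"
  have z: "z > 0" "xi z = x" using x xi by (auto simp: z_def)
  have "(xi has_real_derivative z powr (1 / \<rho>) * (1 / \<rho> * 1 / z)) (at z)"
    unfolding xi_def[abs_def] by (rule DERIV_log_powr[OF DERIV_ident z(1)])
  moreover have "((%x. u0 x / gfac x) has_real_derivative (0 * gfac x - 0 * (gfac x * ((1 - h x / \<sigma>) / (2 * x)))) / (gfac x * gfac x)) (at (xi z))"
    unfolding z(2) using DERIV_divide[OF u0[OF x(1)] gfac_deriv[OF x(1)]] gfac_pos[OF x(1)] unfolding d x(2) by simp
  ultimately have "(V0 has_real_derivative (0 * gfac x - 0 * (gfac x * ((1 - h x / \<sigma>) / (2 * x)))) / (gfac x * gfac x) * (z powr (1 / \<rho>) * (1 / \<rho> * 1 / z))) (at z)"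
    unfolding V0_def[abs_def] by (rule DERIV_chain2[rotated])
  then have "V1 z / z = 0" using DERIV_unique[OF V0_deriv[OF z(1)]] by simp
  then have V10: "V1 z = 0" using z by simp
  have V00: "V0 z = 0" using x z by (simp add: V0_def)
  have "u0 y = 0" if y: "y > 0" for y using u0_V0[OF y] V0_zero[OF z(1) V00 V10, of "y powr \<rho>"] y by simp
  then show False using ne by blast
qed

lemma divw_bound:
  assumes a: "0 < a"
  shows "\<exists>C>0. \<forall>\<phi> M. (\<forall>x. \<bar>\<phi> x\<bar> <= M) \<and> (\<forall>x. x \<notin> {a..b} --> \<phi> x = 0) \<and>
      (m = 1 --> (\<forall>x y. \<bar>\<phi> x - \<phi> y\<bar> <= M * \<bar>x - y\<bar>)) -->
      (\<forall>x>0. \<bar>divw u0 \<phi> x\<bar> <= C * M \<and> (x \<notin> {a / 2..2 * b} --> divw u0 \<phi> x = 0))"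
proof (cases "\<forall>x>0. u0 x = 0")
  \<comment> \<open>Division by 0 yields 0, so the quotient vanishes together with u0 and
    \<open>Pc\<close> consists of the dominant kernel alone.\<close>
  case True
  then have "divw u0 \<phi> x = 0" if "x > 0" for \<phi> x using that by (simp add: divw_def)
  moreover have "M >= 0" if "\<forall>x. \<bar>\<phi> x\<bar> <= M" for \<phi> :: "real => real" and M using that by (meson abs_ge_zero order_trans)
  ultimately show ?thesis by (intro exI[of _ 1]) auto
next
  case False
  obtain C where C: "C > 0" and CC: "\<forall>\<phi> M. (\<forall>x. \<bar>\<phi> x\<bar> <= M) \<and> (\<forall>x. x \<notin> {a..b} --> \<phi> x = 0) \<and>
      (zs u0 \<noteq> {} --> (\<forall>x>0. \<forall>y>0. \<bar>\<phi> x - \<phi> y\<bar> <= M * \<bar>x - y\<bar>)) -->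
      (\<forall>x>0. \<bar>divw u0 \<phi> x\<bar> <= C * M \<and> (x \<notin> {a / 2..2 * b} --> divw u0 \<phi> x = 0))"
    using divw_bounded[OF u0 u0_simple[OF False] a, of b] by blast
  have zm: "m = 1" if "zs u0 \<noteq> {}" using that unfolding zs_def m_def by auto
  show ?thesis
  proof (rule exI[of _ C], rule conjI[OF C], intro allI impI)
    fix \<phi> M x
    assume "(\<forall>x. \<bar>\<phi> x\<bar> <= M) \<and> (\<forall>x. x \<notin> {a..b} --> \<phi> x = 0) \<and> (m = 1 --> (\<forall>x y. \<bar>\<phi> x - \<phi> y\<bar> <= M * \<bar>x - y\<bar>))"
      and x: "(0::real) < x"
    then have "(\<forall>x. \<bar>\<phi> x\<bar> <= M) \<and> (\<forall>x. x \<notin> {a..b} --> \<phi> x = 0) \<and>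
      (zs u0 \<noteq> {} --> (\<forall>x>0. \<forall>y>0. \<bar>\<phi> x - \<phi> y\<bar> <= M * \<bar>x - y\<bar>))" using zm by blast
    then show "\<bar>divw u0 \<phi> x\<bar> <= C * M \<and> (x \<notin> {a / 2..2 * b} --> divw u0 \<phi> x = 0)" using CC x by blast
  qed
qed

lemma set_integrable_om:
  assumes \<phi>: "continuous_on UNIV \<phi>" and a: "0 < a" and K0: "\<And>x. x > 0 ==> \<bar>divw u0 \<phi> x\<bar> <= K0"
  shows "set_integrable lborel {a..b} (%y. om \<phi> y * c y)"
proof -
  have mx: "(%y. indicator {0<..} y *\<^sub>R xi y) \<in> borel_measurable borel"
    by (rule borel_measurable_indicator_continuous[OF continuous_on_xi]) simp
  \<comment> \<open>\<open>xi\<close> and the quotient are each under control for positive arguments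
    only; with the indicators inserted the composition is measurable on the line, and it agrees with
    \<open>om \<phi>\<close> on {a..b}.\<close>
  have "(%y. indicator {0<..} (indicator {0<..} y *\<^sub>R xi y) * divw u0 \<phi> (indicator {0<..} y *\<^sub>R xi y)) \<in> borel_measurable borel"
    by (rule measurable_compose[OF mx borel_measurable_divw[OF continuous_on_u0 \<phi>]])
  moreover have cm: "(%y. indicator {a..b} y *\<^sub>R c y) \<in> borel_measurable borel"
    by (rule borel_measurable_indicator_continuous[OF continuous_on_subset[OF c]]) (use a in auto)
  ultimately have ms: "(%y. (indicator {0<..} (indicator {0<..} y *\<^sub>R xi y) * divw u0 \<phi> (indicator {0<..} y *\<^sub>R xi y)) * (indicator {a..b} y *\<^sub>R c y)) \<in> borel_measurable borel"
    by (rule borel_measurable_times)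
  have eq: "indicator {a..b} y *\<^sub>R (om \<phi> y * c y) = (indicator {0<..} (indicator {0<..} y *\<^sub>R xi y) * divw u0 \<phi> (indicator {0<..} y *\<^sub>R xi y)) * (indicator {a..b} y *\<^sub>R c y)" for y
    using a xi(1)[of y] by (auto simp: indicator_def om_def)
  have ci: "set_integrable lborel {a..b} c" by (rule borel_integrable_atLeastAtMost'[OF continuous_on_subset[OF c]]) (use a in auto)
  show ?thesis unfolding set_integrable_def
  proof (rule Bochner_Integration.integrable_bound)
    show "integrable lborel (%y. K0 * (indicator {a..b} y *\<^sub>R c y))" using ci unfolding set_integrable_def by (rule integrable_mult_right)
    show "(%y. indicator {a..b} y *\<^sub>R (om \<phi> y * c y)) \<in> borel_measurable lborel" unfolding eq using ms by simp
    show "AE y in lborel. norm (indicator {a..b} y *\<^sub>R (om \<phi> y * c y)) <= norm (K0 * (indicator {a..b} y *\<^sub>R c y))"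
    proof (rule AE_I2)
      fix y
      have "\<bar>om \<phi> y\<bar> * \<bar>c y\<bar> <= \<bar>K0\<bar> * \<bar>c y\<bar>" if "y \<in> {a..b}"
        using K0[OF xi(1)[of y]] that a unfolding om_def by (intro mult_right_mono) auto
      then show "norm (indicator {a..b} y *\<^sub>R (om \<phi> y * c y)) <= norm (K0 * (indicator {a..b} y *\<^sub>R c y))"
        by (cases "y \<in> {a..b}") (auto simp: abs_mult)
    qed
  qed
qed

lemma continuous_on_gfac_xi: "continuous_on {0<..} (%z. gfac (xi z))"
  by (rule continuous_on_compose2[OF continuous_on_gfac continuous_on_xi]) (auto intro: xi(1))

lemma gfac_xi_nonzero: "z > 0 ==> gfac (xi z) \<noteq> 0"
  using gfac_pos[OF xi(1)[of z]] by simp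

lemma continuous_on_tlf:
  assumes "continuous_on UNIV \<phi>"
  shows "continuous_on {0<..} (tlf \<phi>)"
proof -
  have "continuous_on {0<..} (%z. \<phi> (xi z))" by (rule continuous_on_compose2[OF assms continuous_on_xi]) simp
  then show ?thesis unfolding tlf_def[abs_def]
    by (rule continuous_on_divide[OF _ continuous_on_gfac_xi]) (auto dest: gfac_xi_nonzero)
qed

lemma continuous_on_ker: "0 < a ==> z > 0 ==> t > 0 ==> sol N 1 e d ==> continuous_on {a..b} (%y. ker (A / k) e y z t)"
  unfolding ker_def by (intro continuous_intros continuous_on_sol_compose(1)[where V = e]) auto

text \<open>Collects what compact support gives for the transformed data, with a single interval for
  both summands of \<open>Pc\<close>.\<close>

definition "supp_ok \<phi> a b \<longleftrightarrow> 0 < a \<and> (\<forall>y>0. y \<notin> {a..b} --> tlf \<phi> y = 0 \<and> om \<phi> y = 0) \<and>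
     set_integrable lborel {a..b} (tlf \<phi>) \<and> set_integrable lborel {a..b} (%y. om \<phi> y * c y) \<and>
     (\<forall>z t. Pc \<phi> z t = wint a b (tlf \<phi>) (%y. ker (A / k) e1 y z t) + wint a b (%y. om \<phi> y * c y) (%y. ker (A / k) e2 y z t))" for \<phi> a b

lemma supp_okD:
  assumes "supp_ok \<phi> a b"
  shows "0 < a" and "\<forall>y>0. y \<notin> {a..b} --> tlf \<phi> y = 0 \<and> om \<phi> y = 0"
    and "set_integrable lborel {a..b} (tlf \<phi>)" and "set_integrable lborel {a..b} (%y. om \<phi> y * c y)"
    and "\<forall>z t. Pc \<phi> z t = wint a b (tlf \<phi>) (%y. ker (A / k) e1 y z t) + wint a b (%y. om \<phi> y * c y) (%y. ker (A / k) e2 y z t)"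
proof -
  note 0 = assms[unfolded supp_ok_def]
  note 1 = conjunct2[OF 0] note 2 = conjunct2[OF 1] note 3 = conjunct2[OF 2]
  show "0 < a" and "\<forall>y>0. y \<notin> {a..b} --> tlf \<phi> y = 0 \<and> om \<phi> y = 0"
    and "set_integrable lborel {a..b} (tlf \<phi>)" and "set_integrable lborel {a..b} (%y. om \<phi> y * c y)"
    and "\<forall>z t. Pc \<phi> z t = wint a b (tlf \<phi>) (%y. ker (A / k) e1 y z t) + wint a b (%y. om \<phi> y * c y) (%y. ker (A / k) e2 y z t)"
    by (fact conjunct1[OF 0] conjunct1[OF 1] conjunct1[OF 2] conjunct1[OF 3] conjunct2[OF 3])+
qed

text \<open>The interval and the constant depend on {a..b} but not on \<phi>; this uniformity
  becomes the estimate in \<open>distribution_of_order\<close>.\<close>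

lemma Pc_wint:
  assumes a: "0 < a" "a <= b"
  shows "\<exists>a' b' C. \<forall>\<phi> M. \<phi> \<in> compact_data_in m {a..b} --> (\<forall>j\<le>m. \<forall>y. \<bar>(deriv ^^ j) \<phi> y\<bar> <= M) -->
     (\<forall>x>0. \<bar>divw u0 \<phi> x\<bar> <= C * M) \<and> supp_ok \<phi> a' b'"
proof -
  obtain C where C: "C > 0" and CC: "\<forall>\<phi> M. (\<forall>x. \<bar>\<phi> x\<bar> <= M) \<and> (\<forall>x. x \<notin> {a..b} --> \<phi> x = 0) \<and>
      (m = 1 --> (\<forall>x y. \<bar>\<phi> x - \<phi> y\<bar> <= M * \<bar>x - y\<bar>)) -->
      (\<forall>x>0. \<bar>divw u0 \<phi> x\<bar> <= C * M \<and> (x \<notin> {a / 2..2 * b} --> divw u0 \<phi> x = 0))"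
    using divw_bound[OF a(1)] by blast
  obtain a' b' where a': "0 < a'" and sup: "\<forall>y>0. xi y \<in> {a / 2..2 * b} --> y \<in> {a'..b'}"
    using xi_support[of "a / 2" "2 * b"] a by auto
  show ?thesis
  proof (rule exI[of _ a'], rule exI[of _ b'], rule exI[of _ C], intro allI impI)
    fix \<phi> M assume \<phi>: "\<phi> \<in> compact_data_in m {a..b}" and M: "\<forall>j\<le>m. \<forall>y. \<bar>(deriv ^^ j) \<phi> y\<bar> <= M"
    note b = compact_data_in_bounds[OF \<phi> order_refl]
    have M0: "\<forall>x. \<bar>\<phi> x\<bar> <= M" using M by (metis funpow_0 le0)
    have "m = 1 --> (\<forall>x y. \<bar>\<phi> x - \<phi> y\<bar> <= M * \<bar>x - y\<bar>)" using b(3) M by blast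
    with CC M0 b(2) have dv: "\<forall>x>0. \<bar>divw u0 \<phi> x\<bar> <= C * M \<and> (x \<notin> {a / 2..2 * b} --> divw u0 \<phi> x = 0)" by blast
    then have B: "\<forall>x>0. \<bar>divw u0 \<phi> x\<bar> <= C * M" by blast
    have z: "tlf \<phi> y = 0 \<and> om \<phi> y = 0" if y: "y > 0" "y \<notin> {a'..b'}" for y
    proof -
      have n: "xi y \<notin> {a / 2..2 * b}" using sup y by blast
      then have "xi y \<notin> {a..b}" using a by auto
      then have "\<phi> (xi y) = 0" using b(2) by blast
      moreover have "divw u0 \<phi> (xi y) = 0" using dv n xi(1)[OF y(1)] by blast
      ultimately show ?thesis by (simp add: tlf_def om_def)
    qed
    have i1: "set_integrable lborel {a'..b'} (tlf \<phi>)"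
      by (rule borel_integrable_atLeastAtMost'[OF continuous_on_subset[OF continuous_on_tlf[OF b(1)]]]) (use a' in auto)
    have i2: "set_integrable lborel {a'..b'} (%y. om \<phi> y * c y)"
      by (rule set_integrable_om[OF b(1) a', where ?K0.0 = "C * M"]) (use B in blast)
    have "Pc \<phi> z t = wint a' b' (tlf \<phi>) (%y. ker (A / k) e1 y z t) + wint a' b' (%y. om \<phi> y * c y) (%y. ker (A / k) e2 y z t)" for z t
      unfolding Pc_def using integral_indicator_eq_wint[OF a', of b' "tlf \<phi>"] integral_indicator_eq_wint[OF a', of b' "%y. om \<phi> y * c y"] z
      by simp
    then have "supp_ok \<phi> a' b'" unfolding supp_ok_def using z by (intro conjI a' i1 i2 allI impI) auto
    with B show "(\<forall>x>0. \<bar>divw u0 \<phi> x\<bar> <= C * M) \<and> supp_ok \<phi> a' b'" ..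
  qed
qed

lemma compact_data_obtain:
  assumes "\<phi> \<in> compact_data m"
  obtains a b M where "0 < a" "a <= b" "\<phi> \<in> compact_data_in m {a..b}" "\<forall>j\<le>m. \<forall>y. \<bar>(deriv ^^ j) \<phi> y\<bar> <= M"
proof -
  obtain K where K: "compact K" "K \<subseteq> {0<..}" "\<phi> \<in> compact_data_in m K" using assms unfolding compact_data_def by blast
  obtain a b where ab: "0 < a" "a <= b" "K \<subseteq> {a..b}" using compact_positive_bounds[OF K(1,2)] by blast
  have 1: "\<phi> \<in> compact_data_in m {a..b}" using K(3) ab(3) unfolding compact_data_in_def by auto
  obtain M where "\<forall>j\<le>m. \<forall>y. \<bar>(deriv ^^ j) \<phi> y\<bar> <= M" using compact_data_in_bounds(4)[OF K(3) ab(3) m_le] by blast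
  with that ab 1 show ?thesis by blast
qed

lemma supp_ok_exists:
  assumes "\<phi> \<in> compact_data m"
  shows "\<exists>a b. supp_ok \<phi> a b"
proof -
  obtain a b M where ab: "0 < a" "a <= b" "\<phi> \<in> compact_data_in m {a..b}" "\<forall>j\<le>m. \<forall>y. \<bar>(deriv ^^ j) \<phi> y\<bar> <= M"
    by (rule compact_data_obtain[OF assms])
  from Pc_wint[OF ab(1,2)] ab(3,4) show ?thesis by blast
qed

lemma linear_pde_Pc:
  assumes "\<phi> \<in> compact_data m"
  shows "linear_pde (%z. z) (%_. 1) (%z. - (N / (4 * z) + A / k)) ({0<..} \<times> {0<..}) (Pc \<phi>)"
proof -
  obtain a b where "supp_ok \<phi> a b" using supp_ok_exists[OF assms] by blast
  note a = supp_okD(1)[OF this] and z = supp_okD(2)[OF this] and i = supp_okD(3,4)[OF this] and P = supp_okD(5)[OF this]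
  have "Pc \<phi> = (%z t. wint a b (tlf \<phi>) (%y. ker (A / k) e1 y z t) + wint a b (%y. om \<phi> y * c y) (%y. ker (A / k) e2 y z t))"
    using P by (intro ext) blast
  then show ?thesis
    using linear_pde_add[OF linear_pde_wint[OF i(1) a kernel_pde_ker[OF s1]] linear_pde_wint[OF i(2) a kernel_pde_ker[OF s2]]] by simp
qed

text \<open>The first summand is an approximate identity applied to \<open>tlf \<phi>\<close>; the
  second tends to 0 because e2 is bounded near infinity and its weight is integrable.\<close>

lemma Pc_initial:
  assumes \<phi>: "\<phi> \<in> compact_data m" and z0: "z0 > 0"
  shows "((%(z, t). Pc \<phi> z t) \<longlongrightarrow> tlf \<phi> z0) (at (z0, 0) within {0<..} \<times> {0<..})"
proof -
  obtain a0 b0 M where ab0: "0 < a0" "a0 <= b0" "\<phi> \<in> compact_data_in m {a0..b0}" "\<forall>j\<le>m. \<forall>y. \<bar>(deriv ^^ j) \<phi> y\<bar> <= M"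
    using compact_data_obtain[OF \<phi>] by blast
  have c\<phi>: "continuous_on UNIV \<phi>" by (rule compact_data_in_bounds(1)[OF ab0(3) order_refl])
  obtain a b where "supp_ok \<phi> a b" using supp_ok_exists[OF \<phi>] by blast
  note a = supp_okD(1)[OF this] and z = supp_okD(2)[OF this] and i = supp_okD(3,4)[OF this] and P = supp_okD(5)[OF this]
  define b' where "b' = max a b"
  \<comment> \<open>\<open>tlf \<phi>\<close> is continuous on positive arguments only;
    \<open>q\<close> extends it by 0 to the line, as the lemma on initial values requires, and
    \<open>b'\<close> keeps the interval nonempty.\<close>
  define q where "q y = (if y > 0 then tlf \<phi> y else 0)" for y
  have q: "continuous_on UNIV q" unfolding q_def[abs_def]
    by (rule continuous_on_zero_extension[OF continuous_on_tlf[OF c\<phi>] a]) (use z in blast)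
  have q0: "q y = 0" if "y \<notin> {a..b'}" for y using that z by (auto simp: q_def b'_def)
  have qw: "wint a b (tlf \<phi>) G = wint a b' q G" for G
  proof -
    have "wint a b (tlf \<phi>) G = (LINT y|lborel. indicator {0<..} y * (tlf \<phi> y * G y))" by (rule integral_indicator_eq_wint[OF a, symmetric]) (use z in blast)
    also have "\<dots> = (LINT y|lborel. indicator {0<..} y * (q y * G y))" by (rule Bochner_Integration.integral_cong) (auto simp: q_def indicator_def)
    also have "\<dots> = wint a b' q G" by (rule integral_indicator_eq_wint[OF a]) (use q0 in blast)
    finally show ?thesis .
  qed
  have 1: "((%(z, t). wint a b (tlf \<phi>) (%y. ker (A / k) e1 y z t)) \<longlongrightarrow> q z0) (at (z0, 0) within {0<..} \<times> {0<..})"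
    unfolding qw by (rule dominant_kernel_initial_limit[OF a _ q q0 s1 r1 z0]) (auto simp: b'_def)
  obtain X where X: "X > 0" "\<And>x. x >= X ==> \<bar>e2 x\<bar> <= 1"
    using recessive_decay[OF s1 s2 r1 r2] by blast
  have 2: "((%(z, t). wint a b (%y. om \<phi> y * c y) (%y. ker (A / k) e2 y z t)) \<longlongrightarrow> 0) (at (z0, 0) within {0<..} \<times> {0<..})"
    by (rule recessive_kernel_vanishes[OF a z0 i(2) s2 X])
  from tendsto_add[OF 1 2] show ?thesis using P z0 by (simp add: case_prod_unfold q_def)
qed

lemma Pc_lincomb:
  assumes "\<phi> \<in> compact_data m" "\<eta> \<in> compact_data m" and z: "z > 0" "t > 0"
  shows "Pc (%y. \<alpha> * \<phi> y + \<beta> * \<eta> y) z t = \<alpha> * Pc \<phi> z t + \<beta> * Pc \<eta> z t"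
proof -
  have int: "integrable lborel (%y. indicator {0<..} y * (tlf \<phi> y * ker (A / k) e1 y z t))"
      "integrable lborel (%y. indicator {0<..} y * ((om \<phi> y * c y) * ker (A / k) e2 y z t))" if \<phi>: "\<phi> \<in> compact_data m" for \<phi>
  proof -
    obtain a b where "supp_ok \<phi> a b" using supp_ok_exists[OF \<phi>] by blast
    note a = supp_okD(1)[OF this] and zz = supp_okD(2)[OF this] and i = supp_okD(3,4)[OF this]
    have "set_integrable lborel {a..b} (%y. tlf \<phi> y * ker (A / k) e1 y z t)" "set_integrable lborel {a..b} (%y. (om \<phi> y * c y) * ker (A / k) e2 y z t)"
      by (rule set_integrable_mult_continuous[OF i(1) continuous_on_ker[OF a z s1]], rule set_integrable_mult_continuous[OF i(2) continuous_on_ker[OF a z s2]])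
    moreover have "(%y. indicator {a..b} y *\<^sub>R (tlf \<phi> y * ker (A / k) e1 y z t)) = (%y. indicator {0<..} y * (tlf \<phi> y * ker (A / k) e1 y z t))"
      "(%y. indicator {a..b} y *\<^sub>R ((om \<phi> y * c y) * ker (A / k) e2 y z t)) = (%y. indicator {0<..} y * ((om \<phi> y * c y) * ker (A / k) e2 y z t))"
      using zz a by (force simp: indicator_def fun_eq_iff)+
    ultimately show "integrable lborel (%y. indicator {0<..} y * (tlf \<phi> y * ker (A / k) e1 y z t))"
      "integrable lborel (%y. indicator {0<..} y * ((om \<phi> y * c y) * ker (A / k) e2 y z t))" unfolding set_integrable_def by simp_all
  qed
  have t: "tlf (%y. \<alpha> * \<phi> y + \<beta> * \<eta> y) y = \<alpha> * tlf \<phi> y + \<beta> * tlf \<eta> y" for y by (simp add: tlf_def add_divide_distrib)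
  have o: "om (%y. \<alpha> * \<phi> y + \<beta> * \<eta> y) y = \<alpha> * om \<phi> y + \<beta> * om \<eta> y" for y by (simp add: om_def divw_linear)
  have "(LINT y|lborel. indicator {0<..} y * (tlf (%y. \<alpha> * \<phi> y + \<beta> * \<eta> y) y * ker (A / k) e1 y z t))
    = (LINT y|lborel. \<alpha> * (indicator {0<..} y * (tlf \<phi> y * ker (A / k) e1 y z t)) + \<beta> * (indicator {0<..} y * (tlf \<eta> y * ker (A / k) e1 y z t)))"
    unfolding t by (rule Bochner_Integration.integral_cong) (simp_all add: algebra_simps)
  moreover have "\<dots> = \<alpha> * (LINT y|lborel. indicator {0<..} y * (tlf \<phi> y * ker (A / k) e1 y z t)) + \<beta> * (LINT y|lborel. indicator {0<..} y * (tlf \<eta> y * ker (A / k) e1 y z t))"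
    by (simp only: Bochner_Integration.integral_add integrable_mult_right int assms integral_mult_right_zero)
  moreover have "(LINT y|lborel. indicator {0<..} y * ((om (%y. \<alpha> * \<phi> y + \<beta> * \<eta> y) y * c y) * ker (A / k) e2 y z t))
    = (LINT y|lborel. \<alpha> * (indicator {0<..} y * ((om \<phi> y * c y) * ker (A / k) e2 y z t)) + \<beta> * (indicator {0<..} y * ((om \<eta> y * c y) * ker (A / k) e2 y z t)))"
    unfolding o by (rule Bochner_Integration.integral_cong) (simp_all add: algebra_simps)
  moreover have "\<dots> = \<alpha> * (LINT y|lborel. indicator {0<..} y * ((om \<phi> y * c y) * ker (A / k) e2 y z t)) + \<beta> * (LINT y|lborel. indicator {0<..} y * ((om \<eta> y * c y) * ker (A / k) e2 y z t))"
    by (simp only: Bochner_Integration.integral_add integrable_mult_right int assms integral_mult_right_zero)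
  ultimately show ?thesis unfolding Pc_def by (simp add: algebra_simps)
qed

lemma Pc_bound:
  assumes K: "compact K" "K \<subseteq> {0<..}" and z: "z > 0" "t > 0"
  shows "\<exists>C. \<forall>\<phi>\<in>compact_data_in m K. \<forall>M. (\<forall>j\<le>m. \<forall>y. \<bar>(deriv ^^ j) \<phi> y\<bar> <= M) --> \<bar>Pc \<phi> z t\<bar> <= C * M"
proof -
  obtain a0 b0 where ab0: "0 < a0" "a0 <= b0" "K \<subseteq> {a0..b0}" using compact_positive_bounds[OF K] by blast
  obtain a b C where W: "\<forall>\<phi> M. \<phi> \<in> compact_data_in m {a0..b0} --> (\<forall>j\<le>m. \<forall>y. \<bar>(deriv ^^ j) \<phi> y\<bar> <= M) -->
     (\<forall>x>0. \<bar>divw u0 \<phi> x\<bar> <= C * M) \<and> supp_ok \<phi> a b"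
    using Pc_wint[OF ab0(1,2)] by blast
  \<comment> \<open>The zero function serves as a datum through which \<open>supp_ok\<close> reveals
    that the left end a is positive.\<close>
  have "(%y. 0) \<in> compact_data_in m {a0..b0}" "\<forall>j\<le>m. \<forall>y. \<bar>(deriv ^^ j) (%y. 0 :: real) y\<bar> <= 0"
    using m_le by (auto simp: compact_data_in_def le_Suc_eq)
  with W have "supp_ok (%y. 0) a b" by blast
  note a = supp_okD(1)[OF this]
  have sub: "{a..b} \<subseteq> {0<..}" using a by auto
  let ?w = "%y. 1 / gfac (xi y) * ker (A / k) e1 y z t"
  have ck: "continuous_on {a..b} (%y. \<bar>?w y\<bar> + C * \<bar>c y * ker (A / k) e2 y z t\<bar>)"
    by (intro continuous_on_add continuous_on_mult continuous_on_divide continuous_on_const continuous_on_rabs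
        continuous_on_ker[OF a z s1] continuous_on_ker[OF a z s2] continuous_on_subset[OF c sub]
        continuous_on_subset[OF continuous_on_gfac_xi sub])
      (use a gfac_xi_nonzero in auto)
  define J where "J = (LINT y:{a..b}|lborel. \<bar>?w y\<bar> + C * \<bar>c y * ker (A / k) e2 y z t\<bar>)"
  have "\<bar>Pc \<phi> z t\<bar> <= J * M" if \<phi>: "\<phi> \<in> compact_data_in m K" and M: "\<forall>j\<le>m. \<forall>y. \<bar>(deriv ^^ j) \<phi> y\<bar> <= M" for \<phi> M
  proof -
    have "\<phi> \<in> compact_data_in m {a0..b0}" using \<phi> ab0(3) unfolding compact_data_in_def by auto
    with W M have B: "\<forall>x>0. \<bar>divw u0 \<phi> x\<bar> <= C * M" and S: "supp_ok \<phi> a b" by blast+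
    note i = supp_okD(3,4)[OF S] and P = supp_okD(5)[OF S, rule_format]
    have M0: "\<bar>\<phi> x\<bar> <= M" for x using M by (metis funpow_0 le0)
    have i': "set_integrable lborel {a..b} (%y. tlf \<phi> y * ker (A / k) e1 y z t)" "set_integrable lborel {a..b} (%y. (om \<phi> y * c y) * ker (A / k) e2 y z t)"
      by (rule set_integrable_mult_continuous[OF i(1) continuous_on_ker[OF a z s1]], rule set_integrable_mult_continuous[OF i(2) continuous_on_ker[OF a z s2]])
    have eq: "Pc \<phi> z t = (LINT y:{a..b}|lborel. tlf \<phi> y * ker (A / k) e1 y z t + (om \<phi> y * c y) * ker (A / k) e2 y z t)"
      unfolding P wint_def by (rule set_integral_add(2)[OF i', symmetric])
    have "\<bar>Pc \<phi> z t\<bar> <= (LINT y:{a..b}|lborel. M * (\<bar>?w y\<bar> + C * \<bar>c y * ker (A / k) e2 y z t\<bar>))"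
      unfolding eq set_lebesgue_integral_def real_norm_def[symmetric]
    proof (rule Bochner_Integration.integral_norm_bound_integral)
      show "integrable lborel (%y. indicator {a..b} y *\<^sub>R (tlf \<phi> y * ker (A / k) e1 y z t + (om \<phi> y * c y) * ker (A / k) e2 y z t))"
        using set_integral_add(1)[OF i'] unfolding set_integrable_def .
      show "integrable lborel (%y. indicator {a..b} y *\<^sub>R (M * (norm (?w y) + C * norm (c y * ker (A / k) e2 y z t))))"
        using set_integrable_mult_right[OF borel_integrable_atLeastAtMost'[OF ck], of M] unfolding set_integrable_def real_norm_def by blast
      fix y
      have "\<bar>tlf \<phi> y * ker (A / k) e1 y z t + (om \<phi> y * c y) * ker (A / k) e2 y z t\<bar> <= M * (\<bar>?w y\<bar> + C * \<bar>c y * ker (A / k) e2 y z t\<bar>)" if "y \<in> {a..b}"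
      proof -
        have "\<bar>tlf \<phi> y * ker (A / k) e1 y z t\<bar> = \<bar>\<phi> (xi y)\<bar> * \<bar>?w y\<bar>" by (simp add: tlf_def abs_mult)
        also have "\<dots> <= M * \<bar>?w y\<bar>" by (intro mult_right_mono M0) simp
        finally have 1: "\<bar>tlf \<phi> y * ker (A / k) e1 y z t\<bar> <= M * \<bar>?w y\<bar>" .
        have "\<bar>(om \<phi> y * c y) * ker (A / k) e2 y z t\<bar> = \<bar>divw u0 \<phi> (xi y)\<bar> * \<bar>c y * ker (A / k) e2 y z t\<bar>" by (simp add: om_def abs_mult)
        also have "\<dots> <= C * M * \<bar>c y * ker (A / k) e2 y z t\<bar>" using B xi(1)[of y] that a by (intro mult_right_mono) auto
        finally show ?thesis using 1 abs_triangle_ineq[of "tlf \<phi> y * ker (A / k) e1 y z t" "(om \<phi> y * c y) * ker (A / k) e2 y z t"]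
          by (simp add: algebra_simps)
      qed
      then show "norm (indicator {a..b} y *\<^sub>R (tlf \<phi> y * ker (A / k) e1 y z t + (om \<phi> y * c y) * ker (A / k) e2 y z t))
         <= indicator {a..b} y *\<^sub>R (M * (norm (?w y) + C * norm (c y * ker (A / k) e2 y z t)))"
        by (cases "y \<in> {a..b}") (auto simp: abs_mult)
    qed
    also have "(LINT y:{a..b}|lborel. M * (\<bar>?w y\<bar> + C * \<bar>c y * ker (A / k) e2 y z t\<bar>)) = M * J"
      unfolding J_def by (rule set_integral_mult_right)
    finally show ?thesis by (simp only: mult.commute)
  qed
  then show ?thesis by blast
qed

end

text \<open>Derivatives at positive points are local, so agreement on the open quadrant suffices;
  the formula for \<open>p\<close> holds there only.\<close>

lemma solves_pde_cong:
  assumes u: "solves_pde \<sigma> \<gamma> f g ({0<..} \<times> {0<..}) u" and eq: "\<And>x t. x > 0 ==> t > 0 ==> u x t = v x t"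
  shows "solves_pde \<sigma> \<gamma> f g ({0<..} \<times> {0<..}) v"
proof -
  obtain ut ux uxx where c: "continuous_on ({0<..} \<times> {0<..}) (%(x, t). ut x t)" "continuous_on ({0<..} \<times> {0<..}) (%(x, t). ux x t)"
    and d: "\<forall>(x, t)\<in>{0<..} \<times> {0<..}. ((%s. u x s) has_real_derivative ut x t) (at t) \<and> ((%y. u y t) has_real_derivative ux x t) (at x) \<and>
       ((%y. ux y t) has_real_derivative uxx x t) (at x) \<and> ut x t = \<sigma> * x powr \<gamma> * uxx x t + f x * ux x t - g x * u x t"
    using u unfolding solves_pde_def by blast
  have "((%s. v x s) has_real_derivative ut x t) (at t) \<and> ((%y. v y t) has_real_derivative ux x t) (at x) \<and>
       ((%y. ux y t) has_real_derivative uxx x t) (at x) \<and> ut x t = \<sigma> * x powr \<gamma> * uxx x t + f x * ux x t - g x * v x t"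
    if x: "x > 0" and t: "t > 0" for x t
  proof -
    have q: "(x, t) \<in> {0<..} \<times> {0<..}" using x t by simp
    have dd: "((%s. u x s) has_real_derivative ut x t) (at t) \<and> ((%y. u y t) has_real_derivative ux x t) (at x) \<and>
       ((%y. ux y t) has_real_derivative uxx x t) (at x) \<and> ut x t = \<sigma> * x powr \<gamma> * uxx x t + f x * ux x t - g x * u x t"
      using bspec[OF d q] unfolding prod.case .
    note du = dd[THEN conjunct1] dd[THEN conjunct2, THEN conjunct1]
    have "((%s. v x s) has_real_derivative ut x t) (at t)"
      by (rule has_field_derivative_transform_within_open[of "%s. u x s" _ _ "{0<..}"]) (use du x t eq in \<open>simp_all only: open_greaterThan greaterThan_iff\<close>)
    moreover have "((%y. v y t) has_real_derivative ux x t) (at x)"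
      by (rule has_field_derivative_transform_within_open[of "%y. u y t" _ _ "{0<..}"]) (use du x t eq in \<open>simp_all only: open_greaterThan greaterThan_iff\<close>)
    ultimately show ?thesis using dd eq[OF x t] by simp
  qed
  then have "\<forall>(x, t)\<in>{0<..} \<times> {0<..}. ((%s. v x s) has_real_derivative ut x t) (at t) \<and> ((%y. v y t) has_real_derivative ux x t) (at x) \<and>
       ((%y. ux y t) has_real_derivative uxx x t) (at x) \<and> ut x t = \<sigma> * x powr \<gamma> * uxx x t + f x * ux x t - g x * v x t"
    by blast
  with c show ?thesis unfolding solves_pde_def by blast
qed

section \<open>Joining the two pairings into one kernel\<close>

context kernel_data
begin

lemma rgV: "rgood (A / k) D V0 (%y x. V0 y * e1 x + c y * e2 x) hh"
  using rg unfolding V0_def[abs_def] xi_def .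

text \<open>The consistency on which the joint pairing rests. A nonzero u0 vanishes on no open set,
  so \<psi> inherits compact support from \<phi> = \<psi> u0 and \<open>Pw_compact\<close> applies;
  on the other side \<open>om \<phi>\<close> equals \<psi> outside finitely many zeros.\<close>

lemma Pc_eq_Pw:
  assumes \<phi>: "\<phi> \<in> compact_data m" and \<psi>: "\<psi> \<in> bounded_smooth"
    and eq: "\<And>y. y > 0 ==> \<phi> y = \<psi> (y powr \<rho>) * u0 y" and z: "z > 0" and t: "\<tau> > 0"
  shows "Pc \<phi> z \<tau> = Pw hh (A / k) D \<psi> z \<tau>"
proof (cases "\<forall>x>0. u0 x = 0")
  case True
  have "hh \<tau> b j y = 0" for b j y by (rule hz) (use True xi(1) in \<open>auto simp: xi_def\<close>)
  then have "Pw hh (A / k) D \<psi> z \<tau> = 0" by (simp add: Pw_def)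
  moreover have "indicator {0<..} y * (tlf \<phi> y * ker (A / k) e1 y z \<tau>) = 0" "indicator {0<..} y * ((om \<phi> y * c y) * ker (A / k) e2 y z \<tau>) = 0" for y
    using True eq xi(1)[of y] by (auto simp: tlf_def om_def divw_def indicator_def)
  ultimately show ?thesis unfolding Pc_def by (simp only: Bochner_Integration.integral_zero add_0)
next
  case False
  note sm = bounded_smooth_imp_smooth[OF \<psi>]
  obtain a0 b0 M where ab0: "0 < a0" "a0 <= b0" "\<phi> \<in> compact_data_in m {a0..b0}" "\<forall>j\<le>m. \<forall>y. \<bar>(deriv ^^ j) \<phi> y\<bar> <= M"
    using compact_data_obtain[OF \<phi>] by blast
  obtain a b where a: "0 < a" and sup: "\<forall>y>0. xi y \<in> {a0..b0} --> y \<in> {a..b}" using xi_support[OF ab0(1,2)] by blast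
  have out: "\<phi> (xi y) = 0" if "y > 0" "y \<notin> {a..b}" for y
    using compact_data_in_bounds(2)[OF ab0(3) order_refl, of "xi y"] sup that by blast
  have \<phi>x: "\<phi> (xi y) = \<psi> y * u0 (xi y)" if "y > 0" for y using eq[OF xi(1)[OF that]] xi(2)[OF that] by simp
  have uV: "u0 (xi y) = gfac (xi y) * V0 y" if "y > 0" for y using u0_V0[OF xi(1)[OF that]] xi(2)[OF that] by simp
  have V0n: "\<not> (V0 y = 0 \<and> V1 y = 0)" if "y > 0" for y
  proof
    assume "V0 y = 0 \<and> V1 y = 0"
    then have "u0 x = 0" if x: "x > 0" for x using u0_V0[OF x] V0_zero[OF \<open>y > 0\<close>, of "x powr \<rho>"] x by simp
    then show False using False by blast
  qed
  \<comment> \<open>If \<psi> were nonzero at such a point, it would be so nearby, and V0 would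
    vanish in a neighbourhood; then V0 and V1 would have a common zero.\<close>
  have \<psi>0: "\<psi> y = 0" if y: "y > 0" "y \<notin> {a..b}" for y
  proof (rule ccontr)
    assume n: "\<psi> y \<noteq> 0"
    have "eventually (%x. \<psi> x \<in> - {0}) (nhds y)"
      using smooth_continuous[OF sm, of UNIV] n
      by (intro topological_tendstoD[of \<psi> "\<psi> y"]) (auto simp: continuous_on_eq_continuous_at isCont_def tendsto_nhds_iff)
    moreover have "eventually (%x. x \<in> {0<..} \<inter> - {a..b}) (nhds y)" by (rule eventually_nhds_in_open) (use y in \<open>auto intro!: open_Int\<close>)
    ultimately have ev: "eventually (%x. V0 x = 0) (nhds y)"
    proof eventually_elim
      case (elim x)
      then have "x > 0" "\<psi> x * u0 (xi x) = 0" using out[of x] \<phi>x[of x] by auto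
      then show ?case using elim uV[of x] gfac_pos[OF xi(1)[of x]] by auto
    qed
    have "(V0 has_real_derivative 0) (at y)"
      by (rule DERIV_cong_ev[OF refl ev refl, THEN iffD2]) simp
    then have "V1 y = 0" using DERIV_unique[OF V0_deriv[OF y(1)]] y(1) by fastforce
    then show False using V0n[OF y(1)] eventually_nhds_x_imp_x[OF ev] by blast
  qed
  have sub: "{a..b} \<subseteq> {0<..}" using a by auto
  have cV: "continuous_on {0<..} V0" by (rule continuous_on_sol(1)[OF V0])
  have c\<psi>: "continuous_on S \<psi>" for S by (rule smooth_continuous[OF sm])
  have Mc: "continuous_on {0<..} (%y. V0 (\<tau> * y) * e1 (z / \<tau> * y) + c (\<tau> * y) * e2 (z / \<tau> * y))"
    using z t by (intro continuous_intros continuous_on_compose2[OF cV] continuous_on_compose2[OF c]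
        continuous_on_sol_compose(1)[OF s1] continuous_on_sol_compose(1)[OF s2]) auto
  have i: "set_integrable lborel {a..b} (%u. (\<psi> u * V0 u) * ker (A / k) e1 u z \<tau>)" "set_integrable lborel {a..b} (%u. (\<psi> u * c u) * ker (A / k) e2 u z \<tau>)"
    by (intro borel_integrable_atLeastAtMost' continuous_intros c\<psi> continuous_on_subset[OF cV sub] continuous_on_subset[OF c sub]
        continuous_on_ker[OF a z t s1] continuous_on_ker[OF a z t s2])+
  have "Pw hh (A / k) D \<psi> z \<tau> = (LINT u|lborel. indicator {0<..} u * (\<psi> u * (exp (- (A / k) * \<tau> - (z + u) / \<tau>) / \<tau> * (V0 u * e1 (z * u / \<tau>\<^sup>2) + c u * e2 (z * u / \<tau>\<^sup>2)))))"
    by (rule Pw_compact[OF rgV z t sm a _ Mc]) (use \<psi>0 in blast)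
  also have "\<dots> = wint a b \<psi> (%u. exp (- (A / k) * \<tau> - (z + u) / \<tau>) / \<tau> * (V0 u * e1 (z * u / \<tau>\<^sup>2) + c u * e2 (z * u / \<tau>\<^sup>2)))"
    by (rule integral_indicator_eq_wint[OF a \<psi>0])
  also have "\<dots> = (LINT u:{a..b}|lborel. (\<psi> u * V0 u) * ker (A / k) e1 u z \<tau> + (\<psi> u * c u) * ker (A / k) e2 u z \<tau>)"
    unfolding wint_def ker_def by (simp add: algebra_simps)
  also have "\<dots> = wint a b (%u. \<psi> u * V0 u) (%u. ker (A / k) e1 u z \<tau>) + wint a b (%u. \<psi> u * c u) (%u. ker (A / k) e2 u z \<tau>)"
    unfolding wint_def by (rule set_integral_add(2)[OF i])
  finally have W: "Pw hh (A / k) D \<psi> z \<tau> = \<dots>" .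
  have "(LINT y|lborel. indicator {0<..} y * (tlf \<phi> y * ker (A / k) e1 y z \<tau>)) = wint a b (tlf \<phi>) (%u. ker (A / k) e1 u z \<tau>)"
    by (rule integral_indicator_eq_wint[OF a]) (simp add: tlf_def out)
  also have "\<dots> = wint a b (%u. \<psi> u * V0 u) (%u. ker (A / k) e1 u z \<tau>)"
    by (rule wint_cong) (use a \<phi>x in \<open>simp add: tlf_def V0_def\<close>)
  finally have 1: "(LINT y|lborel. indicator {0<..} y * (tlf \<phi> y * ker (A / k) e1 y z \<tau>)) = wint a b (%u. \<psi> u * V0 u) (%u. ker (A / k) e1 u z \<tau>)" .
  have fin: "finite ({a..b} \<inter> zs V0)"
    by (rule finite_simple_zeros[where w' = "%z. V1 z / z", OF V0_deriv _ a]) (use V0n in auto)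
  have "(LINT y|lborel. indicator {0<..} y * ((om \<phi> y * c y) * ker (A / k) e2 y z \<tau>)) = (LINT y|lborel. indicator {0<..} y * ((\<psi> y * c y) * ker (A / k) e2 y z \<tau>))"
  proof (rule integral_discrete_difference[where X = "{a..b} \<inter> zs V0"])
    show "countable ({a..b} \<inter> zs V0)" using fin by (rule countable_finite)
    fix y assume y: "y \<notin> {a..b} \<inter> zs V0"
    have "om \<phi> y = \<psi> y" if y0: "y > 0"
    proof (cases "u0 (xi y) = 0")
      case True
      then have "V0 y = 0" by (simp add: V0_def)
      then have "\<psi> y = 0" using y y0 \<psi>0 by (auto simp: zs_def)
      then show ?thesis using True by (simp add: om_def divw_def)
    next
      case False
      then show ?thesis unfolding om_def
        using divw_mult[OF continuous_on_u0, of \<phi> "%y. \<psi> (y powr \<rho>)", OF eq xi(1)[OF y0]] xi(2)[OF y0] by simp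
    qed
    then show "indicator {0<..} y * ((om \<phi> y * c y) * ker (A / k) e2 y z \<tau>) = indicator {0<..} y * ((\<psi> y * c y) * ker (A / k) e2 y z \<tau>)"
      by (cases "y > 0") auto
  qed auto
  also have "\<dots> = wint a b (%u. \<psi> u * c u) (%u. ker (A / k) e2 u z \<tau>)"
    by (rule integral_indicator_eq_wint[OF a]) (simp add: \<psi>0)
  finally show ?thesis unfolding Pc_def W 1 by simp
qed

lemma Pw_lincomb_smooth:
  assumes "\<psi> \<in> bounded_smooth" "\<eta> \<in> bounded_smooth" "z > 0" "\<tau> > 0"
  shows "Pw hh (A / k) D (%y. \<alpha> * \<psi> y + \<beta> * \<eta> y) z \<tau> = \<alpha> * Pw hh (A / k) D \<psi> z \<tau> + \<beta> * Pw hh (A / k) D \<eta> z \<tau>"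
proof -
  obtain m1 where "\<forall>j\<le>D. \<forall>y\<ge>0. \<bar>(deriv ^^ j) \<psi> y\<bar> <= m1 * (1 + y)" using bounded_smooth_bound[OF assms(1)] by blast
  moreover obtain m2 where "\<forall>j\<le>D. \<forall>y\<ge>0. \<bar>(deriv ^^ j) \<eta> y\<bar> <= m2 * (1 + y)" using bounded_smooth_bound[OF assms(2)] by blast
  ultimately show ?thesis
    by (rule Pw_lincomb[OF rgV assms(3,4) bounded_smooth_imp_smooth[OF assms(1)] bounded_smooth_imp_smooth[OF assms(2)]])
qed

lemma Pw_zero: "z > 0 ==> \<tau> > 0 ==> Pw hh (A / k) D (%_. 0) z \<tau> = 0"
  using Pw_lincomb_smooth[OF zero_bounded_smooth zero_bounded_smooth, of z \<tau> 0 0] by simp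

lemma Pc_zero: "z > 0 ==> \<tau> > 0 ==> Pc (%_. 0) z \<tau> = 0"
  using Pc_lincomb[OF zero_compact_data[OF m_le] zero_compact_data[OF m_le], of z \<tau> 0 0] by simp

definition rep :: "(real => real) => (real => real) => (real => real) => bool" where
  "rep q \<phi> \<psi> \<longleftrightarrow> \<phi> \<in> compact_data m \<and> \<psi> \<in> bounded_smooth \<and> (\<forall>y>0. q y = \<phi> y + \<psi> (y powr \<rho>) * u0 y)"

text \<open>A datum may split into a compact and a weighted part in several ways; \<open>THE\<close>
  selects the value common to all splittings, and the formula depends on q only through its values
  at positive arguments.\<close>

definition p :: kernel where
  "p t x q = gfac x * (THE r. \<exists>\<phi> \<psi>. rep q \<phi> \<psi> \<and> r = Pc \<phi> (x powr \<rho>) (k * t) + Pw hh (A / k) D \<psi> (x powr \<rho>) (k * t))"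

text \<open>The difference of two splittings of the same datum is compactly supported and weighted
  at once, which is the situation of \<open>Pc_eq_Pw\<close>.\<close>

lemma p_rep:
  assumes r: "rep q \<phi> \<psi>" and x: "x > 0" and t: "t > 0"
  shows "p t x q = gfac x * (Pc \<phi> (x powr \<rho>) (k * t) + Pw hh (A / k) D \<psi> (x powr \<rho>) (k * t))"
proof -
  have zt: "x powr \<rho> > 0" "k * t > 0" using x t k by auto
  have "Pc \<phi>' (x powr \<rho>) (k * t) + Pw hh (A / k) D \<psi>' (x powr \<rho>) (k * t) = Pc \<phi> (x powr \<rho>) (k * t) + Pw hh (A / k) D \<psi> (x powr \<rho>) (k * t)"
    if r': "rep q \<phi>' \<psi>'" for \<phi>' \<psi>'
  proof -
    note R = r[unfolded rep_def] and R' = r'[unfolded rep_def]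
    have "Pc (%y. 1 * \<phi>' y + (- 1) * \<phi> y) (x powr \<rho>) (k * t) = Pw hh (A / k) D (%y. 1 * \<psi> y + (- 1) * \<psi>' y) (x powr \<rho>) (k * t)"
    proof (rule Pc_eq_Pw[OF _ _ _ zt])
      show "(%y. 1 * \<phi>' y + (- 1) * \<phi> y) \<in> compact_data m" by (rule compact_data_lincomb[OF m_le]) (use R R' in auto)
      show "(%y. 1 * \<psi> y + (- 1) * \<psi>' y) \<in> bounded_smooth" by (rule bounded_smooth_lincomb) (use R R' in auto)
      fix y :: real assume "y > 0"
      then have "\<phi> y + \<psi> (y powr \<rho>) * u0 y = \<phi>' y + \<psi>' (y powr \<rho>) * u0 y" using R R' by metis
      then show "1 * \<phi>' y + - 1 * \<phi> y = (1 * \<psi> (y powr \<rho>) + - 1 * \<psi>' (y powr \<rho>)) * u0 y" by (simp add: algebra_simps)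
    qed
    moreover have "Pc (%y. 1 * \<phi>' y + (- 1) * \<phi> y) (x powr \<rho>) (k * t) = 1 * Pc \<phi>' (x powr \<rho>) (k * t) + (- 1) * Pc \<phi> (x powr \<rho>) (k * t)"
      by (rule Pc_lincomb[OF _ _ zt]) (use R R' in auto)
    moreover have "Pw hh (A / k) D (%y. 1 * \<psi> y + (- 1) * \<psi>' y) (x powr \<rho>) (k * t) = 1 * Pw hh (A / k) D \<psi> (x powr \<rho>) (k * t) + (- 1) * Pw hh (A / k) D \<psi>' (x powr \<rho>) (k * t)"
      by (rule Pw_lincomb_smooth[OF _ _ zt]) (use R R' in auto)
    ultimately show ?thesis by linarith
  qed
  then have "(THE r. \<exists>\<phi> \<psi>. rep q \<phi> \<psi> \<and> r = Pc \<phi> (x powr \<rho>) (k * t) + Pw hh (A / k) D \<psi> (x powr \<rho>) (k * t))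
      = Pc \<phi> (x powr \<rho>) (k * t) + Pw hh (A / k) D \<psi> (x powr \<rho>) (k * t)"
    using r by (intro the_equality) blast+
  then show ?thesis unfolding p_def by simp
qed

lemma rep_compact: "\<phi> \<in> compact_data m ==> rep \<phi> \<phi> (%_. 0)"
  unfolding rep_def using zero_bounded_smooth by simp

lemma rep_weighted: "\<psi> \<in> bounded_smooth ==> rep (%y. \<psi> (y powr \<rho>) * u0 y) (%_. 0) \<psi>"
  unfolding rep_def using zero_compact_data[OF m_le] by simp

lemma p_compact: "\<phi> \<in> compact_data m ==> x > 0 ==> t > 0 ==> p t x \<phi> = gfac x * Pc \<phi> (x powr \<rho>) (k * t)"
  using p_rep[OF rep_compact] Pw_zero[of "x powr \<rho>" "k * t"] k by simp

lemma p_weighted: "\<psi> \<in> bounded_smooth ==> x > 0 ==> t > 0 ==>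
    p t x (%y. \<psi> (y powr \<rho>) * u0 y) = gfac x * Pw hh (A / k) D \<psi> (x powr \<rho>) (k * t)"
  using p_rep[OF rep_weighted] Pc_zero[of "x powr \<rho>" "k * t"] k by simp

lemma rep_lincomb:
  assumes "rep q \<phi> \<psi>" "rep q' \<phi>' \<psi>'"
  shows "rep (%y. \<alpha> * q y + \<beta> * q' y) (%y. \<alpha> * \<phi> y + \<beta> * \<phi>' y) (%y. \<alpha> * \<psi> y + \<beta> * \<psi>' y)"
  using assms compact_data_lincomb[OF m_le] bounded_smooth_lincomb unfolding rep_def by (auto simp: algebra_simps)

lemma p_lincomb:
  assumes r: "rep q \<phi> \<psi>" "rep q' \<phi>' \<psi>'" and x: "x > 0" and t: "t > 0"
  shows "p t x (%y. \<alpha> * q y + \<beta> * q' y) = \<alpha> * p t x q + \<beta> * p t x q'"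
proof -
  have zt: "x powr \<rho> > 0" "k * t > 0" using x t k by auto
  have "Pc (%y. \<alpha> * \<phi> y + \<beta> * \<phi>' y) (x powr \<rho>) (k * t) = \<alpha> * Pc \<phi> (x powr \<rho>) (k * t) + \<beta> * Pc \<phi>' (x powr \<rho>) (k * t)"
    by (rule Pc_lincomb[OF _ _ zt]) (use r in \<open>auto simp: rep_def\<close>)
  moreover have "Pw hh (A / k) D (%y. \<alpha> * \<psi> y + \<beta> * \<psi>' y) (x powr \<rho>) (k * t) = \<alpha> * Pw hh (A / k) D \<psi> (x powr \<rho>) (k * t) + \<beta> * Pw hh (A / k) D \<psi>' (x powr \<rho>) (k * t)"
    by (rule Pw_lincomb_smooth[OF _ _ zt]) (use r in \<open>auto simp: rep_def\<close>)
  ultimately show ?thesis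
    unfolding p_rep[OF rep_lincomb[OF r] x t] p_rep[OF r(1) x t] p_rep[OF r(2) x t] by (simp add: algebra_simps)
qed

lemma p_distribution:
  assumes x: "x > 0" and t: "t > 0"
  shows "distribution_of_order m (p t x)"
  unfolding distribution_of_order_def linear_functional_on_def
proof (intro conjI ballI allI impI; (elim conjE)?)
  show "p t x (%y. \<alpha> * \<phi> y + \<beta> * \<eta> y) = \<alpha> * p t x \<phi> + \<beta> * p t x \<eta>" if "\<phi> \<in> compact_data m" "\<eta> \<in> compact_data m" for \<phi> \<eta> \<alpha> \<beta>
    by (rule p_lincomb[OF rep_compact[OF that(1)] rep_compact[OF that(2)] x t])
  fix K :: "real set" assume K: "compact K" "K \<subseteq> {0<..}"
  have zt: "x powr \<rho> > 0" "k * t > 0" using x t k by auto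
  obtain C where C: "\<forall>\<phi>\<in>compact_data_in m K. \<forall>M. (\<forall>j\<le>m. \<forall>y. \<bar>(deriv ^^ j) \<phi> y\<bar> <= M) --> \<bar>Pc \<phi> (x powr \<rho>) (k * t)\<bar> <= C * M"
    using Pc_bound[OF K zt] by blast
  show "\<exists>C. \<forall>\<phi>\<in>compact_data_in m K. \<forall>M. (\<forall>j\<le>m. \<forall>y. \<bar>(deriv ^^ j) \<phi> y\<bar> <= M) --> \<bar>p t x \<phi>\<bar> <= C * M"
  proof (rule exI[of _ "gfac x * C"], intro ballI allI impI)
    fix \<phi> M assume \<phi>: "\<phi> \<in> compact_data_in m K" and M: "\<forall>j\<le>m. \<forall>y. \<bar>(deriv ^^ j) \<phi> y\<bar> <= M"
    have cd: "\<phi> \<in> compact_data m" using \<phi> K unfolding compact_data_def by blast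
    have "gfac x * \<bar>Pc \<phi> (x powr \<rho>) (k * t)\<bar> <= gfac x * (C * M)" using C \<phi> M gfac_pos[OF x] by (intro mult_left_mono) auto
    then show "\<bar>p t x \<phi>\<bar> <= gfac x * C * M" unfolding p_compact[OF cd x t] using gfac_pos[OF x] by (simp add: abs_mult)
  qed
qed

lemma p_solves:
  assumes \<phi>: "\<phi> \<in> compact_data m"
  shows "solves_pde \<sigma> \<gamma> f g ({0<..} \<times> {0<..}) (%x t. p t x \<phi>)"
  by (rule solves_pde_cong[OF linear_pde_gfac[OF linear_pde_Pc[OF \<phi>]]]) (simp add: p_compact[OF \<phi>])

lemma p_initial:
  assumes \<phi>: "\<phi> \<in> compact_data m" and x: "x > 0"
  shows "((%(x', t). p t x' \<phi>) \<longlongrightarrow> \<phi> x) (at (x, 0) within {0<..} \<times> {0<..})"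
proof -
  let ?F = "at (x, 0::real) within {0<..} \<times> {0<..}"
  have f: "((%q. fst q) \<longlongrightarrow> x) ?F" and s: "((%q. snd q) \<longlongrightarrow> 0) ?F"
    using tendsto_fst[OF tendsto_ident_at, of "(x, 0)" "{0<..} \<times> {0<..}"] tendsto_snd[OF tendsto_ident_at, of "(x, 0)" "{0<..} \<times> {0<..}"] by simp_all
  have inq: "eventually (%q. q \<in> {0<..} \<times> {0<..}) ?F" by (simp add: eventually_at_filter)
  have "filterlim (%q. (fst q powr \<rho>, k * snd q)) (at (x powr \<rho>, 0) within {0<..} \<times> {0<..}) ?F"
    unfolding filterlim_at
  proof
    show "eventually (%q. (fst q powr \<rho>, k * snd q) \<in> {0<..} \<times> {0<..} \<and> (fst q powr \<rho>, k * snd q) \<noteq> (x powr \<rho>, 0)) ?F"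
      using inq by eventually_elim (use k in auto)
    have "((%q. (fst q powr \<rho>, k * snd q)) \<longlongrightarrow> (x powr \<rho>, k * 0)) ?F" using x by (intro tendsto_intros f s) auto
    then show "((%q. (fst q powr \<rho>, k * snd q)) \<longlongrightarrow> (x powr \<rho>, 0)) ?F" by simp
  qed
  from filterlim_compose[OF Pc_initial[OF \<phi>] this] x
  have 1: "((%q. Pc \<phi> (fst q powr \<rho>) (k * snd q)) \<longlongrightarrow> tlf \<phi> (x powr \<rho>)) ?F" by simp
  have 2: "((%q. gfac (fst q)) \<longlongrightarrow> gfac x) ?F" by (rule isCont_tendsto_compose[OF DERIV_isCont[OF gfac_deriv[OF x]] f])
  have "gfac x * tlf \<phi> (x powr \<rho>) = \<phi> x" using gfac_pos[OF x] x by (simp add: tlf_def xi)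
  with tendsto_mult[OF 2 1] have 3: "((%q. gfac (fst q) * Pc \<phi> (fst q powr \<rho>) (k * snd q)) \<longlongrightarrow> \<phi> x) ?F" by simp
  have "eventually (%q. gfac (fst q) * Pc \<phi> (fst q powr \<rho>) (k * snd q) = (case q of (x', t) => p t x' \<phi>)) ?F"
    using inq by eventually_elim (auto simp: p_compact[OF \<phi>])
  from Lim_transform_eventually[OF 3 this] show ?thesis .
qed

lemma p_fundamental: "fundamental_solution \<sigma> \<gamma> f g m p"
  unfolding fundamental_solution_def using p_distribution p_solves p_initial by blast

text \<open>The number of derivatives in the estimate is \<open>D\<close>, the number of
  integrations by parts that went into \<open>Pw\<close>.\<close>

lemma p_weight:
  assumes x: "x > 0" and t: "t > 0"
  shows "integrable_with_weight m \<rho> u0 (p t x)"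
  unfolding integrable_with_weight_def
proof (intro conjI)
  show "\<forall>\<phi> \<eta>. (\<forall>y>0. \<phi> y = \<eta> y) --> p t x \<phi> = p t x \<eta>"
  proof (intro allI impI)
    fix \<phi> \<eta> :: "real => real" assume "\<forall>y>0. \<phi> y = \<eta> y"
    then have "rep \<phi> = rep \<eta>" unfolding rep_def[abs_def] by (intro ext) simp
    then show "p t x \<phi> = p t x \<eta>" unfolding p_def by simp
  qed
  show "linear_functional_on {%y. \<phi> y + \<eta> y | \<phi> \<eta>. \<phi> \<in> compact_data m \<and> \<eta> \<in> weighted_data \<rho> u0} (p t x)"
    unfolding linear_functional_on_def
  proof (intro ballI allI)
    have r: "\<exists>\<phi> \<psi>. rep q \<phi> \<psi>" if "q \<in> {%y. \<phi> y + \<eta> y | \<phi> \<eta>. \<phi> \<in> compact_data m \<and> \<eta> \<in> weighted_data \<rho> u0}" for q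
      using that unfolding weighted_data_def rep_def by auto
    fix q q' \<alpha> \<beta>
    assume "q \<in> {%y. \<phi> y + \<eta> y | \<phi> \<eta>. \<phi> \<in> compact_data m \<and> \<eta> \<in> weighted_data \<rho> u0}"
      "q' \<in> {%y. \<phi> y + \<eta> y | \<phi> \<eta>. \<phi> \<in> compact_data m \<and> \<eta> \<in> weighted_data \<rho> u0}"
    then obtain \<phi> \<psi> \<phi>' \<psi>' where "rep q \<phi> \<psi>" "rep q' \<phi>' \<psi>'" using r by meson
    then show "p t x (%y. \<alpha> * q y + \<beta> * q' y) = \<alpha> * p t x q + \<beta> * p t x q'" by (rule p_lincomb[OF _ _ x t])
  qed
  have zt: "x powr \<rho> > 0" "k * t > 0" using x t k by auto
  obtain C where C: "\<forall>\<psi> M. smooth \<psi> \<and> (\<forall>j\<le>D. \<forall>y\<ge>0. \<bar>(deriv ^^ j) \<psi> y\<bar> <= M * (1 + y)) --> \<bar>Pw hh (A / k) D \<psi> (x powr \<rho>) (k * t)\<bar> <= C * M"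
    using Pw_bounded[OF rgV zt] by blast
  show "\<exists>N C. \<forall>\<psi>\<in>bounded_smooth. \<forall>M. (\<forall>j\<le>N. \<forall>z\<ge>0. \<bar>(deriv ^^ j) \<psi> z\<bar> <= M * (1 + z)) -->
        \<bar>p t x (%y. \<psi> (y powr \<rho>) * u0 y)\<bar> <= C * M"
  proof (rule exI[of _ D], rule exI[of _ "gfac x * C"], intro ballI allI impI)
    fix \<psi> M assume \<psi>: "\<psi> \<in> bounded_smooth" and M: "\<forall>j\<le>D. \<forall>z\<ge>0. \<bar>(deriv ^^ j) \<psi> z\<bar> <= M * (1 + z)"
    have "gfac x * \<bar>Pw hh (A / k) D \<psi> (x powr \<rho>) (k * t)\<bar> <= gfac x * (C * M)"
      using C bounded_smooth_imp_smooth[OF \<psi>] M gfac_pos[OF x] by (intro mult_left_mono) auto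
    then show "\<bar>p t x (%y. \<psi> (y powr \<rho>) * u0 y)\<bar> <= gfac x * C * M"
      unfolding p_weighted[OF \<psi> x t] using gfac_pos[OF x] by (simp add: abs_mult)
  qed
qed

text \<open>The choice \<epsilon> = \<sigma> (2 - \<gamma>)^2 l / 4 makes 1 + 4 \<epsilon> t equal
  to 1 + l k t, the Laplace variable of \<open>Pw_exp\<close> at time k t; the rest is undoing the
  gauge at x and at the image point Z.\<close>

lemma p_laplace:
  assumes x: "x > 0" and t: "t > 0" and l: "l >= 0"
  shows "p t x (%y. exp (- l * y powr \<rho>) * u0 y) = Ubar \<sigma> \<gamma> A F (1 / 4 * \<sigma> * (2 - \<gamma>)\<^sup>2 * l) (%x t. u0 x) x t"
proof -
  have zt: "x powr \<rho> > 0" "k * t > 0" using x t k by auto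
  define s where "s = 1 + l * (k * t)"
  have s: "s > 0" using l zt by (auto simp: s_def intro!: add_pos_nonneg)
  have e4: "4 * (1 / 4 * \<sigma> * (2 - \<gamma>)\<^sup>2 * l) = k * l" by (simp add: k_def \<rho>_def)
  have es: "1 + k * l * t = s" by (simp add: s_def)
  define Z where "Z = x / s powr (2 / \<rho>)"
  have Z: "Z > 0" using x s by (simp add: Z_def)
  have "(s powr (2 / \<rho>)) powr \<rho> = s\<^sup>2" using s \<rho> by (simp add: powr_powr powr_numeral)
  then have ZP: "Z powr \<rho> = x powr \<rho> / s\<^sup>2" using x s by (simp add: Z_def powr_divide)
  have sZ: "sqrt Z = sqrt x / s powr (1 / \<rho>)"
  proof -
    have "sqrt (s powr (2 / \<rho>)) = s powr (1 / \<rho>)" using s by (simp add: powr_half_sqrt[symmetric] powr_powr)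
    then show ?thesis by (simp add: Z_def real_sqrt_divide)
  qed
  \<comment> \<open>The power (1 - \<gamma>) / (2 - \<gamma>) in \<open>Ubar\<close> and the power 1
    / (2 - \<gamma>) from the root in \<open>gfac\<close> at Z combine to the single factor 1 / s of
    \<open>Pw_exp\<close>.\<close>
  have sp: "s powr ((1 - \<gamma>) / \<rho>) * s powr (1 / \<rho>) = s"
  proof -
    have "(1 - \<gamma>) / \<rho> + 1 / \<rho> = 1" using \<rho> by (simp add: \<rho>_def flip: add_divide_distrib)
    then show ?thesis using s by (simp flip: powr_add)
  qed
  have g: "1 / s powr ((1 - \<gamma>) / \<rho>) * exp (1 / (2 * \<sigma>) * (F Z - F x)) * gfac Z = gfac x / s"
  proof -
    have "exp (1 / (2 * \<sigma>) * (F Z - F x)) * exp (- (F Z / (2 * \<sigma>))) = exp (- (F x / (2 * \<sigma>)))"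
      by (simp add: diff_divide_distrib flip: exp_add)
    then have "1 / s powr ((1 - \<gamma>) / \<rho>) * exp (1 / (2 * \<sigma>) * (F Z - F x)) * gfac Z
        = sqrt x * exp (- (F x / (2 * \<sigma>))) / (s powr ((1 - \<gamma>) / \<rho>) * s powr (1 / \<rho>))"
      unfolding gfac_def sZ by (simp add: field_simps)
    then show ?thesis unfolding sp gfac_def .
  qed
  have ex: "- (k * l) * (x powr \<rho> + A * k * t\<^sup>2) / (k * s) = - l * (x powr \<rho> + A / k * (k * t)\<^sup>2) / s"
    using k s by (simp add: field_simps power2_eq_square)
  have "p t x (%y. exp (- l * y powr \<rho>) * u0 y) = gfac x * (exp (- l * (x powr \<rho> + A / k * (k * t)\<^sup>2) / s) / s * V0 (x powr \<rho> / s\<^sup>2))"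
    using p_weighted[OF exp_bounded_smooth[OF l] x t] Pw_exp[OF rgV zt l] unfolding s_def by simp
  also have "\<dots> = (gfac x / s) * exp (- l * (x powr \<rho> + A / k * (k * t)\<^sup>2) / s) * V0 (Z powr \<rho>)" unfolding ZP by simp
  also have "\<dots> = 1 / s powr ((1 - \<gamma>) / \<rho>) * exp (- (k * l) * (x powr \<rho> + A * k * t\<^sup>2) / (k * s)) * exp (1 / (2 * \<sigma>) * (F Z - F x)) * u0 Z"
    unfolding g[symmetric] ex u0_V0[OF Z] by (simp only: mult_ac)
  also have "\<dots> = Ubar \<sigma> \<gamma> A F (1 / 4 * \<sigma> * (2 - \<gamma>)\<^sup>2 * l) (%x t. u0 x) x t"
    unfolding Ubar_def \<rho>_def[symmetric] Z_def e4[unfolded \<rho>_def[symmetric]] es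
    by (simp add: k_def s_def mult_ac)
  finally show ?thesis .
qed

end

theorem theorem3p1:
  fixes \<sigma> \<gamma> A B :: real and f g h F :: "real \<Rightarrow> real"
  assumes "\<sigma> > 0" and "\<gamma> \<noteq> 2"
    and "\<And>x. x > 0 \<Longrightarrow> h x = x powr (1 - \<gamma>) * f x"
    and "riccati_solution \<sigma> \<gamma> A B g h"
    and "\<And>x. x > 0 \<Longrightarrow> (F has_real_derivative f x / x powr \<gamma>) (at x)"
  shows "(\<forall>u \<epsilon>. solves_pde \<sigma> \<gamma> f g ({0<..} \<times> {0<..}) u \<longrightarrow>
            solves_pde \<sigma> \<gamma> f g {(x, t). x > 0 \<and> t > 0 \<and> 1 + 4 * \<epsilon> * t > 0} (Ubar \<sigma> \<gamma> A F \<epsilon> u))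
       \<and> (\<forall>u\<^sub>0. stationary_solution \<sigma> \<gamma> f g u\<^sub>0 \<and> real_analytic_on u\<^sub>0 {0<..} \<longrightarrow>
            (\<exists>m p. fundamental_solution \<sigma> \<gamma> f g m p \<and>
               ((\<forall>y>0. u\<^sub>0 y \<noteq> 0) \<longrightarrow> m = 0) \<and>
               (\<forall>t>0. \<forall>x>0. integrable_with_weight m (2 - \<gamma>) u\<^sub>0 (p t x) \<and>
                  (\<forall>l\<ge>0. p t x (\<lambda>y. exp (- l * y powr (2 - \<gamma>)) * u\<^sub>0 y)
                     = Ubar \<sigma> \<gamma> A F (1/4 * \<sigma> * (2 - \<gamma>)\<^sup>2 * l) (\<lambda>x t. u\<^sub>0 x) x t))))"
proof -
  interpret riccati_pde \<sigma> \<gamma> A B f g h F by unfold_locales (fact assms)+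
  show ?thesis
  proof (intro conjI allI impI)
    show "solves_pde \<sigma> \<gamma> f g {(x, t). x > 0 \<and> t > 0 \<and> 1 + 4 * \<epsilon> * t > 0} (Ubar \<sigma> \<gamma> A F \<epsilon> u)"
      if "solves_pde \<sigma> \<gamma> f g ({0<..} \<times> {0<..}) u" for u \<epsilon> by (rule solves_pde_Ubar[OF that])
    fix u0 assume "stationary_solution \<sigma> \<gamma> f g u0 \<and> real_analytic_on u0 {0<..}"
    then have st: "stationary_solution \<sigma> \<gamma> f g u0" ..
    obtain V1 where V1: "sol N (A / k) (\<lambda>z. u0 (z powr (1 / \<rho>)) / gfac (z powr (1 / \<rho>))) V1"
      using stationary_imp_sol(1)[OF st] by blast
    obtain D e1 d1 e2 d2 c hh where C: "sol N 1 e1 d1" "sol N 1 e2 d2" "rasy e1 1" "rasy e2 0" "continuous_on {0<..} c"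
      "rgood (A / k) D (\<lambda>z. u0 (z powr (1 / \<rho>)) / gfac (z powr (1 / \<rho>)))
        (\<lambda>y x. u0 (y powr (1 / \<rho>)) / gfac (y powr (1 / \<rho>)) * e1 x + c y * e2 x) hh"
      "(\<forall>y>0. u0 (y powr (1 / \<rho>)) / gfac (y powr (1 / \<rho>)) = 0) \<longrightarrow> (\<forall>\<tau> b j y. hh \<tau> b j y = 0)"
      using core_data[OF V1] by blast
    interpret kernel_data \<sigma> \<gamma> A B f g h F u0 V1 e1 d1 e2 d2 c D hh
      by unfold_locales (use V1 C stationary_imp_sol(2)[OF st] in blast)+
    have "(\<forall>y>0. u0 y \<noteq> 0) \<longrightarrow> m = 0" by (simp add: m_def)
    then show "\<exists>m p. fundamental_solution \<sigma> \<gamma> f g m p \<and> ((\<forall>y>0. u0 y \<noteq> 0) \<longrightarrow> m = 0) \<and>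
               (\<forall>t>0. \<forall>x>0. integrable_with_weight m (2 - \<gamma>) u0 (p t x) \<and>
                  (\<forall>l\<ge>0. p t x (\<lambda>y. exp (- l * y powr (2 - \<gamma>)) * u0 y)
                     = Ubar \<sigma> \<gamma> A F (1/4 * \<sigma> * (2 - \<gamma>)\<^sup>2 * l) (\<lambda>x t. u0 x) x t))"
      using p_fundamental p_weight p_laplace unfolding \<rho>_def by blast
  qed
qed

end
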